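(* Let $\Lambda\subset V$ be a regular $\mathcal W$-orbit, identified with $\mathcal W$ by the choice of $v\in\Lambda$ and partially ordered by the Bruhat order. Then there is an equivalence of categories $\mathcal F_{\bigtriangledown}\cong\mathcal V(\Lambda)$.
   Context: Let $(\mathcal W,\mathcal S)$ be a Coxeter system (not necessarily finite), $l$ its length function, $\le$ the Bruhat order, and $\mathcal T\subset\mathcal W$ the set of reflections, i.e. of conjugates of elements of $\mathcal S$. Let $k$ be an infinite field of characteristic $\neq 2$ and $V$ a reflection faithful representation of $(\mathcal W,\mathcal S)$ over $k$, i.e. a faithful finite-dimensional representation such that for each $w\in\mathcal W$ the fixed space $V^w$ is a hyperplane in $V$ if and only if $w\in\mathcal T$. Let $S=S_k(V^* )$ be the symmetric algebra of $V^*$, graded by $\deg V^*=2$, identified with the algebra of regular (polynomial) functions on $V$. All modules are $\mathbb Z$-graded and morphisms are of degree $0$; $M_{\{n\}}$ is the degree $n$ component, and $M\{l\}$ is the shifted module with $M\{l\}_{\{n\}}=M_{\{n+l\}}$. A graded $S$-module is graded free if it is isomorphic to a finite direct sum $\bigoplus S\{k_i\}$. For $t\in\mathcal T$ let $\alpha_t\in V^*$ be a nonzero linear form vanishing on $V^t$. The category $\mathcal V(\Lambda)$. Let $\Lambda=\mathcal W.v\subset V$ be a regular orbit (all stabilizers trivial), identified with $\mathcal W$ via $w\mapsto w.v$ and ordered by the Bruhat order. Put $\mathcal Z=\{(z_w)\in\prod_{w\in\mathcal W}S\mid z_w\equiv z_{tw}\bmod\alpha_t\text{ for all }w\in\mathcal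 W,t\in\mathcal T\}$, a graded commutative $S$-algebra (an element is homogeneous of degree $n$ if all its entries are). For $\Omega\subset\mathcal W$ let $\mathcal Z^\Omega$ be the image of $\mathcal Z$ in $\prod_{w\in\Omega}S$. Let $\mathcal Z\text{-mod}^f$ be the category of graded $\mathcal Z$-modules that are finitely generated and torsion free over $S$ and on which $\mathcal Z$ acts through $\mathcal Z^\Omega$ for some finite $\Omega$. Let $Q$ be the quotient field of $S$ and $M_Q=M\otimes_SQ$. For finite $\Omega$ one has $\mathcal Z^\Omega\otimes_SQ=\bigoplus_{w\in\Omega}Q$, so for $M\in\mathcal Z\text{-mod}^f$ the idempotents give a canonical decomposition $M_Q=\bigoplus_{w\in\mathcal W}M_Q^w$, and $M\subset M_Q$. For $\Omega\subset\mathcal W$ let $M^\Omega$ be the image of $M$ in $\bigoplus_{w\in\Omega}M_Q^w$ under the projection. A subset $\Omega\subset\mathcal W$ is upwardly closed if $y\in\Omega$, $z\ge y$ imply $z\in\Omega$. $\mathcal V(\Lambda)$ is the full subcategory of $\mathcal Z\text{-mod}^f$ of all $M$ such that $M^\Omega$ is a graded free $S$-module for every upwardly closed $\Omega$. The category $\mathcal F_{\bigtriangledown}$ (Soergel). Graded $S$-bimodules (graded $S\otimes_kS$-modules) are viewed as quasi-coherent sheaves on $V\times V$. For $x\in\mathcal W$ let $\mathrm{Gr}(x)=\{(x^{-1}.v,v)\mid v\in V\}\subset V\times V$, let $S(x)$ be the $S$-bimodule of regular functions on $\mathrm{Gr}(x)$, and for $A\subset\mathcal W$ let $\mathrm{Gr}(A)=\bigcup_{x\in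 A}\mathrm{Gr}(x)$. For a bimodule $M$ let $M_{\le i}\subset M$ be the submodule of sections supported on $\mathrm{Gr}(\{x\mid l(x)\le i\})$ (with $M_{\le -1}=0$). $\mathcal F_{\bigtriangledown}$ is the full subcategory of graded $S$-bimodules $M$ that are supported on $\mathrm{Gr}(A)$ for some finite $A\subset\mathcal W$ and such that for each $i\ge0$ the quotient $M_{\le i}/M_{\le i-1}$ is isomorphic to a finite direct sum of graded bimodules $S(x)\{k\}$ with $l(x)=i$ and $k\in\mathbb Z$. *)

theory Defs
  imports Complex_Main "HOL-Algebra.Module" "HOL-Algebra.Ideal" "HOL-Algebra.Generated_Groups"
    "HOL-Algebra.Multiplicative_Group"
begin

section \<open>Categories\<close>

record ('o, 'a) cat =
  Obj :: "'o set"
  Arr :: "'o \<Rightarrow> 'o \<Rightarrow> 'a set"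
  Ide :: "'o \<Rightarrow> 'a"
  Cmp :: "'o \<Rightarrow> 'o \<Rightarrow> 'o \<Rightarrow> 'a \<Rightarrow> 'a \<Rightarrow> 'a"

text \<open>\<^term>\<open>Cmp C X Y Z g f\<close> is the composite of \<open>f : X \<rightarrow> Y\<close> and \<open>g : Y \<rightarrow> Z\<close>.\<close>

locale category =
  fixes C :: "('o, 'a) cat"
  assumes Ide_in: "X \<in> Obj C \<Longrightarrow> Ide C X \<in> Arr C X X"
    and Cmp_in: "\<lbrakk>X \<in> Obj C; Y \<in> Obj C; Z \<in> Obj C; f \<in> Arr C X Y; g \<in> Arr C Y Z\<rbrakk>
      \<Longrightarrow> Cmp C X Y Z g f \<in> Arr C X Z"
    and Cmp_Ide_right: "\<lbrakk>X \<in> Obj C; Y \<in> Obj C; f \<in> Arr C X Y\<rbrakk> \<Longrightarrow> Cmp C X X Y f (Ide C X) = f"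
    and Cmp_Ide_left: "\<lbrakk>X \<in> Obj C; Y \<in> Obj C; f \<in> Arr C X Y\<rbrakk> \<Longrightarrow> Cmp C X Y Y (Ide C Y) f = f"
    and Cmp_assoc: "\<lbrakk>X \<in> Obj C; Y \<in> Obj C; Z \<in> Obj C; U \<in> Obj C;
        f \<in> Arr C X Y; g \<in> Arr C Y Z; h \<in> Arr C Z U\<rbrakk>
      \<Longrightarrow> Cmp C X Y U (Cmp C Y Z U h g) f = Cmp C X Z U h (Cmp C X Y Z g f)"

locale cat_functor = C: category C + D: category D
  for C :: "('o, 'a) cat" and D :: "('p, 'b) cat" +
  fixes Fo :: "'o \<Rightarrow> 'p" and Fa :: "'o \<Rightarrow> 'o \<Rightarrow> 'a \<Rightarrow> 'b"
  assumes Fo_in: "X \<in> Obj C \<Longrightarrow> Fo X \<in> Obj D"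
    and Fa_in: "\<lbrakk>X \<in> Obj C; Y \<in> Obj C; f \<in> Arr C X Y\<rbrakk> \<Longrightarrow> Fa X Y f \<in> Arr D (Fo X) (Fo Y)"
    and Fa_Ide: "X \<in> Obj C \<Longrightarrow> Fa X X (Ide C X) = Ide D (Fo X)"
    and Fa_Cmp: "\<lbrakk>X \<in> Obj C; Y \<in> Obj C; Z \<in> Obj C; f \<in> Arr C X Y; g \<in> Arr C Y Z\<rbrakk>
      \<Longrightarrow> Fa X Z (Cmp C X Y Z g f) = Cmp D (Fo X) (Fo Y) (Fo Z) (Fa Y Z g) (Fa X Y f)"

definition iso_arr :: "('o, 'a) cat \<Rightarrow> 'o \<Rightarrow> 'o \<Rightarrow> 'a \<Rightarrow> bool" where
  "iso_arr C X Y f \<longleftrightarrow> f \<in> Arr C X Y \<and>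
     (\<exists>g \<in> Arr C Y X. Cmp C X Y X g f = Ide C X \<and> Cmp C Y X Y f g = Ide C Y)"

definition natural_iso ::
    "('o, 'a) cat \<Rightarrow> ('p, 'b) cat \<Rightarrow> ('o \<Rightarrow> 'p) \<Rightarrow> ('o \<Rightarrow> 'o \<Rightarrow> 'a \<Rightarrow> 'b) \<Rightarrow>
     ('o \<Rightarrow> 'p) \<Rightarrow> ('o \<Rightarrow> 'o \<Rightarrow> 'a \<Rightarrow> 'b) \<Rightarrow> ('o \<Rightarrow> 'b) \<Rightarrow> bool" where
  "natural_iso C D Fo Fa Go Ga \<tau> \<longleftrightarrow>
     (\<forall>X \<in> Obj C. iso_arr D (Fo X) (Go X) (\<tau> X)) \<and>
     (\<forall>X \<in> Obj C. \<forall>Y \<in> Obj C. \<forall>f \<in> Arr C X Y.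
        Cmp D (Fo X) (Fo Y) (Go Y) (\<tau> Y) (Fa X Y f) = Cmp D (Fo X) (Go X) (Go Y) (Ga X Y f) (\<tau> X))"

definition equivalent_categories :: "('o, 'a) cat \<Rightarrow> ('p, 'b) cat \<Rightarrow> bool" where
  "equivalent_categories C D \<longleftrightarrow>
     (\<exists>Fo Fa Go Ga \<eta> \<epsilon>.
        cat_functor C D Fo Fa \<and> cat_functor D C Go Ga \<and>
        natural_iso C C (\<lambda>X. X) (\<lambda>X Y f. f) (\<lambda>X. Go (Fo X)) (\<lambda>X Y f. Ga (Fo X) (Fo Y) (Fa X Y f)) \<eta> \<and>
        natural_iso D D (\<lambda>X. Fo (Go X)) (\<lambda>X Y f. Fa (Go X) (Go Y) (Ga X Y f)) (\<lambda>X. X) (\<lambda>X Y f. f) \<epsilon>)"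

section \<open>Coxeter systems\<close>

definition word_prod :: "('w, 'c) monoid_scheme \<Rightarrow> 'w list \<Rightarrow> 'w" where
  "word_prod W us = foldr (\<lambda>x y. x \<otimes>\<^bsub>W\<^esub> y) us \<one>\<^bsub>W\<^esub>"

text \<open>Insertion of a Coxeter relator \<open>(s t)\<^sup>m\<close>, \<open>m\<close> the order of \<open>s t\<close>.
  \<^term>\<open>group.ord W (s \<otimes>\<^bsub>W\<^esub> t)\<close> is \<open>0\<close> if \<open>s t\<close> has infinite order, and then nothing is inserted;
  for \<open>s = t\<close> it is \<open>1\<close>, and \<open>s s\<close> is inserted.\<close>

inductive relator_step :: "('w, 'c) monoid_scheme \<Rightarrow> 'w set \<Rightarrow> 'w list \<Rightarrow> 'w list \<Rightarrow> bool"
  for W I where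
  "\<lbrakk>us \<in> lists I; vs \<in> lists I; s \<in> I; t \<in> I\<rbrakk>
   \<Longrightarrow> relator_step W I (us @ vs)
        (us @ concat (replicate (group.ord W (s \<otimes>\<^bsub>W\<^esub> t)) [s, t]) @ vs)"

text \<open>\<open>I\<close> consists of involutions, generates \<open>W\<close>, and the relators above present \<open>W\<close>. As the
  generators are involutions, words need no formal inverses.\<close>

definition coxeter_system :: "('w, 'c) monoid_scheme \<Rightarrow> 'w set \<Rightarrow> bool" where
  "coxeter_system W I \<longleftrightarrow> group W \<and> I \<subseteq> carrier W \<and>
     (\<forall>s \<in> I. s \<noteq> \<one>\<^bsub>W\<^esub> \<and> s \<otimes>\<^bsub>W\<^esub> s = \<one>\<^bsub>W\<^esub>) \<and>
     generate W I = carrier W \<and>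
     (\<forall>us \<in> lists I. word_prod W us = \<one>\<^bsub>W\<^esub> \<longrightarrow> equivclp (relator_step W I) us [])"

definition cox_length :: "('w, 'c) monoid_scheme \<Rightarrow> 'w set \<Rightarrow> 'w \<Rightarrow> nat" where
  "cox_length W I w = (LEAST n. \<exists>us \<in> lists I. length us = n \<and> word_prod W us = w)"

definition reflections :: "('w, 'c) monoid_scheme \<Rightarrow> 'w set \<Rightarrow> 'w set" where
  "reflections W I = {w \<otimes>\<^bsub>W\<^esub> s \<otimes>\<^bsub>W\<^esub> inv\<^bsub>W\<^esub> w | w s. w \<in> carrier W \<and> s \<in> I}"

definition bruhat_step :: "('w, 'c) monoid_scheme \<Rightarrow> 'w set \<Rightarrow> 'w \<Rightarrow> 'w \<Rightarrow> bool" where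
  "bruhat_step W I x y \<longleftrightarrow> x \<in> carrier W \<and>
     (\<exists>t \<in> reflections W I. y = t \<otimes>\<^bsub>W\<^esub> x \<and> cox_length W I x < cox_length W I y)"

definition bruhat_le :: "('w, 'c) monoid_scheme \<Rightarrow> 'w set \<Rightarrow> 'w \<Rightarrow> 'w \<Rightarrow> bool" where
  "bruhat_le W I = (bruhat_step W I)\<^sup>*\<^sup>*"

definition upwardly_closed :: "('w, 'c) monoid_scheme \<Rightarrow> 'w set \<Rightarrow> 'w set \<Rightarrow> bool" where
  "upwardly_closed W I \<Omega> \<longleftrightarrow> \<Omega> \<subseteq> carrier W \<and>
     (\<forall>y \<in> \<Omega>. \<forall>z \<in> carrier W. bruhat_le W I y z \<longrightarrow> z \<in> \<Omega>)"

section \<open>Reflection faithful representations\<close>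

definition fixed_space :: "('w \<Rightarrow> 'v \<Rightarrow> 'v) \<Rightarrow> 'w \<Rightarrow> 'v set" where
  "fixed_space \<rho> w = {v. \<rho> w v = v}"

definition hyperplane :: "('k::field \<Rightarrow> 'v::ab_group_add \<Rightarrow> 'v) \<Rightarrow> 'v set \<Rightarrow> bool" where
  "hyperplane scale H \<longleftrightarrow> Modules.module.subspace scale H \<and>
     vector_space.dim scale H + 1 = vector_space.dim scale UNIV"

definition reflection_faithful_rep ::
    "('k::field \<Rightarrow> 'v::ab_group_add \<Rightarrow> 'v) \<Rightarrow> ('w, 'c) monoid_scheme \<Rightarrow> 'w set \<Rightarrow>
     ('w \<Rightarrow> 'v \<Rightarrow> 'v) \<Rightarrow> bool" where
  "reflection_faithful_rep scale W I \<rho> \<longleftrightarrow>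
     vector_space scale \<and> (\<exists>B. finite_dimensional_vector_space scale B) \<and>
     (\<forall>w \<in> carrier W. Vector_Spaces.linear scale scale (\<rho> w)) \<and>
     \<rho> \<one>\<^bsub>W\<^esub> = id \<and>
     (\<forall>x \<in> carrier W. \<forall>y \<in> carrier W. \<rho> (x \<otimes>\<^bsub>W\<^esub> y) = \<rho> x \<circ> \<rho> y) \<and>
     inj_on \<rho> (carrier W) \<and>
     (\<forall>w \<in> carrier W. hyperplane scale (fixed_space \<rho> w) \<longleftrightarrow> w \<in> reflections W I)"

section \<open>Graded rings and modules\<close>

record 'a gring = "'a ring" +
  rpart :: "int \<Rightarrow> 'a set"

record ('a, 'm) gmodule = "('a, 'm) module" +
  part :: "int \<Rightarrow> 'm set"

text \<open>\<open>M\<close> is the internal direct sum of its homogeneous parts, compatibly with those of \<open>R\<close>. It is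
  not required that \<open>R\<close> itself is the sum of its homogeneous parts; see \<open>Z_ring\<close> below.\<close>

definition graded_module :: "'a gring \<Rightarrow> ('a, 'm) gmodule \<Rightarrow> bool" where
  "graded_module R M \<longleftrightarrow> Module.module R M \<and>
     (\<forall>n. additive_subgroup (part M n) M) \<and>
     (\<forall>m \<in> carrier M. \<exists>!c. (\<forall>n. c n \<in> part M n) \<and> finite {n. c n \<noteq> \<zero>\<^bsub>M\<^esub>} \<and>
        finsum M c {n. c n \<noteq> \<zero>\<^bsub>M\<^esub>} = m) \<and>
     (\<forall>i j. \<forall>r \<in> rpart R i. \<forall>m \<in> part M j. r \<odot>\<^bsub>M\<^esub> m \<in> part M (i + j))"

definition gmod_hom :: "'a gring \<Rightarrow> ('a, 'm) gmodule \<Rightarrow> ('a, 'n) gmodule \<Rightarrow> ('m \<Rightarrow> 'n) set" where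
  "gmod_hom R M N = {f \<in> carrier M \<rightarrow>\<^sub>E carrier N.
     (\<forall>x \<in> carrier M. \<forall>y \<in> carrier M. f (x \<oplus>\<^bsub>M\<^esub> y) = f x \<oplus>\<^bsub>N\<^esub> f y) \<and>
     (\<forall>r \<in> carrier R. \<forall>x \<in> carrier M. f (r \<odot>\<^bsub>M\<^esub> x) = r \<odot>\<^bsub>N\<^esub> f x) \<and>
     (\<forall>n. f ` part M n \<subseteq> part N n)}"

definition gmod_iso :: "'a gring \<Rightarrow> ('a, 'm) gmodule \<Rightarrow> ('a, 'n) gmodule \<Rightarrow> bool" where
  "gmod_iso R M N \<longleftrightarrow> (\<exists>f \<in> gmod_hom R M N. \<exists>g \<in> gmod_hom R N M.
     (\<forall>x \<in> carrier M. g (f x) = x) \<and> (\<forall>y \<in> carrier N. f (g y) = y))"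

text \<open>The type \<open>'m\<close> plays the role of the universe: objects are the graded modules in \<open>Os\<close>, whose
  underlying sets are subsets of \<open>'m\<close>.\<close>

definition gmod_category :: "'a gring \<Rightarrow> ('a, 'm) gmodule set \<Rightarrow> (('a, 'm) gmodule, 'm \<Rightarrow> 'm) cat" where
  "gmod_category R Os = \<lparr>Obj = Os, Arr = gmod_hom R, Ide = (\<lambda>M. \<lambda>x \<in> carrier M. x),
     Cmp = (\<lambda>L M N g f. compose (carrier L) g f)\<rparr>"

definition gshift :: "('a, 'm) gmodule \<Rightarrow> int \<Rightarrow> ('a, 'm) gmodule" where
  "gshift M l = M\<lparr>part := (\<lambda>n. part M (n + l))\<rparr>"

definition ring_as_gmodule :: "'a gring \<Rightarrow> ('a, 'a) gmodule" where
  "ring_as_gmodule R = \<lparr>carrier = carrier R, mult = mult R, one = \<one>\<^bsub>R\<^esub>, zero = \<zero>\<^bsub>R\<^esub>,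
     add = add R, smult = mult R, part = rpart R\<rparr>"

definition gdirect_sum :: "'i set \<Rightarrow> ('i \<Rightarrow> ('a, 'm) gmodule) \<Rightarrow> ('a, 'i \<Rightarrow> 'm) gmodule" where
  "gdirect_sum J N = \<lparr>carrier = (\<Pi>\<^sub>E j \<in> J. carrier (N j)), mult = undefined, one = undefined,
     zero = (\<lambda>j \<in> J. \<zero>\<^bsub>N j\<^esub>), add = (\<lambda>f g. \<lambda>j \<in> J. f j \<oplus>\<^bsub>N j\<^esub> g j),
     smult = (\<lambda>r f. \<lambda>j \<in> J. r \<odot>\<^bsub>N j\<^esub> f j), part = (\<lambda>n. \<Pi>\<^sub>E j \<in> J. part (N j) n)\<rparr>"

text \<open>\<open>gdirect_sum\<close> is the direct product, and is only used for finite index sets.\<close>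

definition graded_free :: "'a gring \<Rightarrow> ('a, 'm) gmodule \<Rightarrow> bool" where
  "graded_free R M \<longleftrightarrow> (\<exists>(n::nat) ks.
     gmod_iso R M (gdirect_sum {..<n} (\<lambda>j. gshift (ring_as_gmodule R) (ks j))))"

definition gsub :: "('a, 'm) gmodule \<Rightarrow> 'm set \<Rightarrow> ('a, 'm) gmodule" where
  "gsub M A = M\<lparr>carrier := A, part := (\<lambda>n. part M n \<inter> A)\<rparr>"

definition gquot :: "('a, 'm) gmodule \<Rightarrow> 'm set \<Rightarrow> ('a, 'm set) gmodule" where
  "gquot M N = \<lparr>carrier = a_rcosets\<^bsub>M\<^esub> N, mult = undefined, one = undefined, zero = N,
     add = (\<lambda>X Y. X <+>\<^bsub>M\<^esub> Y), smult = (\<lambda>r X. \<Union>x \<in> X. N +>\<^bsub>M\<^esub> (r \<odot>\<^bsub>M\<^esub> x)),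
     part = (\<lambda>n. (\<lambda>x. N +>\<^bsub>M\<^esub> x) ` part M n)\<rparr>"

definition fin_gen :: "'a gring \<Rightarrow> ('a, 'm) gmodule \<Rightarrow> bool" where
  "fin_gen R M \<longleftrightarrow> (\<exists>B. finite B \<and> B \<subseteq> carrier M \<and>
     (\<forall>m \<in> carrier M. \<exists>c \<in> B \<rightarrow> carrier R. m = (\<Oplus>\<^bsub>M\<^esub>b \<in> B. c b \<odot>\<^bsub>M\<^esub> b)))"

definition torsion_free :: "'a gring \<Rightarrow> ('a, 'm) gmodule \<Rightarrow> bool" where
  "torsion_free R M \<longleftrightarrow>
     (\<forall>r \<in> carrier R. \<forall>m \<in> carrier M. r \<odot>\<^bsub>M\<^esub> m = \<zero>\<^bsub>M\<^esub> \<longrightarrow> r = \<zero>\<^bsub>R\<^esub> \<or> m = \<zero>\<^bsub>M\<^esub>)"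

section \<open>Localization of modules\<close>

text \<open>For a multiplicative subset \<open>D\<close> of \<open>R\<close>, the module \<open>D\<^sup>-\<^sup>1M\<close> of fractions \<open>m / s\<close> (as equivalence
  classes of pairs), and the action on it of a fraction \<open>r / u\<close> in \<open>D\<^sup>-\<^sup>1R\<close>.\<close>

definition frac_rel :: "('a, 'm) gmodule \<Rightarrow> 'a set \<Rightarrow> (('m \<times> 'a) \<times> ('m \<times> 'a)) set" where
  "frac_rel M D = {((m, s), (n, t)). m \<in> carrier M \<and> n \<in> carrier M \<and> s \<in> D \<and> t \<in> D \<and>
     (\<exists>u \<in> D. u \<odot>\<^bsub>M\<^esub> (t \<odot>\<^bsub>M\<^esub> m) = u \<odot>\<^bsub>M\<^esub> (s \<odot>\<^bsub>M\<^esub> n))}"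

definition frac :: "('a, 'm) gmodule \<Rightarrow> 'a set \<Rightarrow> 'm \<Rightarrow> 'a \<Rightarrow> ('m \<times> 'a) set" where
  "frac M D m s = frac_rel M D `` {(m, s)}"

definition frac_act :: "'a gring \<Rightarrow> ('a, 'm) gmodule \<Rightarrow> 'a set \<Rightarrow> 'a \<Rightarrow> 'a \<Rightarrow>
    ('m \<times> 'a) set \<Rightarrow> ('m \<times> 'a) set" where
  "frac_act R M D r u X = (\<Union>(m, s) \<in> X. frac M D (r \<odot>\<^bsub>M\<^esub> m) (u \<otimes>\<^bsub>R\<^esub> s))"

definition frac_module :: "'a gring \<Rightarrow> ('a, 'm) gmodule \<Rightarrow> 'a set \<Rightarrow> ('a, ('m \<times> 'a) set) module" where
  "frac_module R M D = \<lparr>carrier = (carrier M \<times> D) // frac_rel M D, mult = undefined, one = undefined,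
     zero = frac M D \<zero>\<^bsub>M\<^esub> \<one>\<^bsub>R\<^esub>,
     add = (\<lambda>X Y. \<Union>(m, s) \<in> X. \<Union>(n, t) \<in> Y. frac M D (t \<odot>\<^bsub>M\<^esub> m \<oplus>\<^bsub>M\<^esub> s \<odot>\<^bsub>M\<^esub> n) (s \<otimes>\<^bsub>R\<^esub> t)),
     smult = (\<lambda>r X. frac_act R M D r \<one>\<^bsub>R\<^esub> X)\<rparr>"

section \<open>Regular functions\<close>

inductive_set fun_span :: "('x \<Rightarrow> 'k::field) set \<Rightarrow> ('x \<Rightarrow> 'k) set" for X where
  "(\<lambda>_. 0) \<in> fun_span X"
| "\<lbrakk>f \<in> X; g \<in> fun_span X\<rbrakk> \<Longrightarrow> (\<lambda>x. f x + g x) \<in> fun_span X"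

definition dual_space :: "('k::field \<Rightarrow> 'v::ab_group_add \<Rightarrow> 'v) \<Rightarrow> ('v \<Rightarrow> 'k) set" where
  "dual_space scale = {\<alpha>. Vector_Spaces.linear scale (*) \<alpha>}"

text \<open>The \<open>d\<close>-th symmetric power of \<open>V\<^sup>*\<close> as a space of functions on \<open>V\<close>; over an infinite field
  the symmetric algebra of \<open>V\<^sup>*\<close> is the algebra of polynomial functions.\<close>

primrec sym_power :: "('k::field \<Rightarrow> 'v::ab_group_add \<Rightarrow> 'v) \<Rightarrow> nat \<Rightarrow> ('v \<Rightarrow> 'k) set" where
  "sym_power scale 0 = {(\<lambda>_. c) | c. True}"
| "sym_power scale (Suc d) =
     fun_span {(\<lambda>v. \<alpha> v * f v) | \<alpha> f. \<alpha> \<in> dual_space scale \<and> f \<in> sym_power scale d}"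

definition fun_gring :: "('x \<Rightarrow> 'k::field) set \<Rightarrow> (int \<Rightarrow> ('x \<Rightarrow> 'k) set) \<Rightarrow> ('x \<Rightarrow> 'k) gring" where
  "fun_gring A P = \<lparr>carrier = A, mult = (\<lambda>f g x. f x * g x), one = (\<lambda>_. 1), zero = (\<lambda>_. 0),
     add = (\<lambda>f g x. f x + g x), rpart = P\<rparr>"

text \<open>Linear forms have degree \<open>2\<close>.\<close>

definition S_ring :: "('k::field \<Rightarrow> 'v::ab_group_add \<Rightarrow> 'v) \<Rightarrow> ('v \<Rightarrow> 'k) gring" where
  "S_ring scale = fun_gring (fun_span (\<Union>d. sym_power scale d))
     (\<lambda>n. if 0 \<le> n \<and> even n then sym_power scale (nat (n div 2)) else {\<lambda>_. 0})"

text \<open>\<open>S \<otimes>\<^sub>k S\<close> as the ring of functions on \<open>V \<times> V\<close> spanned by the \<open>f \<otimes> g : (u, v) \<mapsto> f(u) g(v)\<close>. A module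
  over it is an \<open>S\<close>-bimodule with \<open>f m g = (f \<otimes> g) m\<close>.\<close>

definition SS_ring :: "('k::field \<Rightarrow> 'v::ab_group_add \<Rightarrow> 'v) \<Rightarrow> ('v \<times> 'v \<Rightarrow> 'k) gring" where
  "SS_ring scale = fun_gring
     (fun_span {(\<lambda>(u, v). f u * g v) | f g. f \<in> carrier (S_ring scale) \<and> g \<in> carrier (S_ring scale)})
     (\<lambda>n. fun_span {(\<lambda>(u, v). f u * g v) | f g.
        \<exists>i j. i + j = n \<and> f \<in> rpart (S_ring scale) i \<and> g \<in> rpart (S_ring scale) j})"

section \<open>The category \<open>\<F>\<^sub>\<nabla>\<close>\<close>

definition graph :: "('w, 'c) monoid_scheme \<Rightarrow> ('w \<Rightarrow> 'v \<Rightarrow> 'v) \<Rightarrow> 'w \<Rightarrow> ('v \<times> 'v) set" where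
  "graph W \<rho> x = {(\<rho> (inv\<^bsub>W\<^esub> x) v, v) | v. True}"

definition graph_bimodule ::
    "('k::field \<Rightarrow> 'v::ab_group_add \<Rightarrow> 'v) \<Rightarrow> ('w, 'c) monoid_scheme \<Rightarrow> ('w \<Rightarrow> 'v \<Rightarrow> 'v) \<Rightarrow> 'w \<Rightarrow>
     ('v \<times> 'v \<Rightarrow> 'k, 'v \<times> 'v \<Rightarrow> 'k) gmodule" where
  "graph_bimodule scale W \<rho> x =
     \<lparr>carrier = (\<lambda>F. restrict F (graph W \<rho> x)) ` carrier (SS_ring scale),
      mult = (\<lambda>F G. \<lambda>p \<in> graph W \<rho> x. F p * G p), one = (\<lambda>p \<in> graph W \<rho> x. 1),
      zero = (\<lambda>p \<in> graph W \<rho> x. 0), add = (\<lambda>F G. \<lambda>p \<in> graph W \<rho> x. F p + G p),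
      smult = (\<lambda>F G. \<lambda>p \<in> graph W \<rho> x. F p * G p),
      part = (\<lambda>n. (\<lambda>F. restrict F (graph W \<rho> x)) ` rpart (SS_ring scale) n)\<rparr>"

definition vanishing_ideal ::
    "('k::field \<Rightarrow> 'v::ab_group_add \<Rightarrow> 'v) \<Rightarrow> ('v \<times> 'v) set \<Rightarrow> ('v \<times> 'v \<Rightarrow> 'k) set" where
  "vanishing_ideal scale Y = {F \<in> carrier (SS_ring scale). \<forall>p \<in> Y. F p = 0}"

text \<open>Supports are taken in the prime spectrum of \<open>S \<otimes>\<^sub>k S\<close>. There, \<open>Gr(A)\<close> is the union of the closed
  subsets defined by the vanishing ideals of the linear subspaces \<open>Gr(x)\<close>, \<open>x \<in> A\<close>.\<close>

definition graph_primes ::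
    "('k::field \<Rightarrow> 'v::ab_group_add \<Rightarrow> 'v) \<Rightarrow> ('w, 'c) monoid_scheme \<Rightarrow> ('w \<Rightarrow> 'v \<Rightarrow> 'v) \<Rightarrow> 'w set \<Rightarrow>
     ('v \<times> 'v \<Rightarrow> 'k) set set" where
  "graph_primes scale W \<rho> A = {P. primeideal P (SS_ring scale) \<and>
     (\<exists>x \<in> A. vanishing_ideal scale (graph W \<rho> x) \<subseteq> P)}"

definition section_support :: "'a gring \<Rightarrow> ('a, 'm) gmodule \<Rightarrow> 'm \<Rightarrow> 'a set set" where
  "section_support R M m = {P. primeideal P R \<and> {r \<in> carrier R. r \<odot>\<^bsub>M\<^esub> m = \<zero>\<^bsub>M\<^esub>} \<subseteq> P}"

definition supported_sections ::
    "('k::field \<Rightarrow> 'v::ab_group_add \<Rightarrow> 'v) \<Rightarrow> ('w, 'c) monoid_scheme \<Rightarrow> ('w \<Rightarrow> 'v \<Rightarrow> 'v) \<Rightarrow>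
     ('v \<times> 'v \<Rightarrow> 'k, 'm) gmodule \<Rightarrow> 'w set \<Rightarrow> 'm set" where
  "supported_sections scale W \<rho> M A =
     {m \<in> carrier M. section_support (SS_ring scale) M m \<subseteq> graph_primes scale W \<rho> A}"

definition sections_le ::
    "('k::field \<Rightarrow> 'v::ab_group_add \<Rightarrow> 'v) \<Rightarrow> ('w, 'c) monoid_scheme \<Rightarrow> 'w set \<Rightarrow> ('w \<Rightarrow> 'v \<Rightarrow> 'v) \<Rightarrow>
     ('v \<times> 'v \<Rightarrow> 'k, 'm) gmodule \<Rightarrow> nat \<Rightarrow> 'm set" where
  "sections_le scale W I \<rho> M i =
     supported_sections scale W \<rho> M {x \<in> carrier W. cox_length W I x \<le> i}"

definition layer ::
    "('k::field \<Rightarrow> 'v::ab_group_add \<Rightarrow> 'v) \<Rightarrow> ('w, 'c) monoid_scheme \<Rightarrow> 'w set \<Rightarrow> ('w \<Rightarrow> 'v \<Rightarrow> 'v) \<Rightarrow>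
     ('v \<times> 'v \<Rightarrow> 'k, 'm) gmodule \<Rightarrow> nat \<Rightarrow> ('v \<times> 'v \<Rightarrow> 'k, 'm set) gmodule" where
  "layer scale W I \<rho> M i = gquot (gsub M (sections_le scale W I \<rho> M i))
     (case i of 0 \<Rightarrow> {\<zero>\<^bsub>M\<^esub>} | Suc j \<Rightarrow> sections_le scale W I \<rho> M j)"

definition F_nabla_objects ::
    "('k::field \<Rightarrow> 'v::ab_group_add \<Rightarrow> 'v) \<Rightarrow> ('w, 'c) monoid_scheme \<Rightarrow> 'w set \<Rightarrow> ('w \<Rightarrow> 'v \<Rightarrow> 'v) \<Rightarrow>
     ('v \<times> 'v \<Rightarrow> 'k, 'm) gmodule set" where
  "F_nabla_objects scale W I \<rho> = {M. graded_module (SS_ring scale) M \<and>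
     (\<exists>A. finite A \<and> A \<subseteq> carrier W \<and> supported_sections scale W \<rho> M A = carrier M) \<and>
     (\<forall>i. \<exists>(n::nat) xs ks. (\<forall>j < n. xs j \<in> carrier W \<and> cox_length W I (xs j) = i) \<and>
        gmod_iso (SS_ring scale) (layer scale W I \<rho> M i)
          (gdirect_sum {..<n} (\<lambda>j. gshift (graph_bimodule scale W \<rho> (xs j)) (ks j))))}"

definition F_nabla ::
    "('k::field \<Rightarrow> 'v::ab_group_add \<Rightarrow> 'v) \<Rightarrow> ('w, 'c) monoid_scheme \<Rightarrow> 'w set \<Rightarrow> ('w \<Rightarrow> 'v \<Rightarrow> 'v) \<Rightarrow>
     (('v \<times> 'v \<Rightarrow> 'k, 'm) gmodule, 'm \<Rightarrow> 'm) cat" where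
  "F_nabla scale W I \<rho> = gmod_category (SS_ring scale) (F_nabla_objects scale W I \<rho>)"

section \<open>The category \<open>\<V>(\<Lambda>)\<close>\<close>

text \<open>For infinite \<open>W\<close> the full product contains families of unbounded degree, so that \<open>Z\<close> need not
  be the sum of its homogeneous parts; its images in finite subproducts are.\<close>

definition Z_ring ::
    "('k::field \<Rightarrow> 'v::ab_group_add \<Rightarrow> 'v) \<Rightarrow> ('w, 'c) monoid_scheme \<Rightarrow> 'w set \<Rightarrow> ('w \<Rightarrow> 'v \<Rightarrow> 'k) \<Rightarrow>
     ('w \<Rightarrow> 'v \<Rightarrow> 'k) gring" where
  "Z_ring scale W I \<alpha> =
    (let Z = {z \<in> carrier W \<rightarrow>\<^sub>E carrier (S_ring scale).
       \<forall>w \<in> carrier W. \<forall>t \<in> reflections W I. \<exists>h \<in> carrier (S_ring scale).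
         z w = (\<lambda>v. z (t \<otimes>\<^bsub>W\<^esub> w) v + \<alpha> t v * h v)}
     in \<lparr>carrier = Z, mult = (\<lambda>y z. \<lambda>w \<in> carrier W. \<lambda>v. y w v * z w v),
         one = (\<lambda>w \<in> carrier W. \<lambda>_. 1), zero = (\<lambda>w \<in> carrier W. \<lambda>_. 0),
         add = (\<lambda>y z. \<lambda>w \<in> carrier W. \<lambda>v. y w v + z w v),
         rpart = (\<lambda>n. {z \<in> Z. \<forall>w \<in> carrier W. z w \<in> rpart (S_ring scale) n})\<rparr>)"

definition const_family :: "('w, 'c) monoid_scheme \<Rightarrow> ('v \<Rightarrow> 'k) \<Rightarrow> 'w \<Rightarrow> 'v \<Rightarrow> 'k" where
  "const_family W s = (\<lambda>w \<in> carrier W. s)"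

definition restrict_scalars :: "('w, 'c) monoid_scheme \<Rightarrow> ('w \<Rightarrow> 'v \<Rightarrow> 'k, 'm) gmodule \<Rightarrow>
    ('v \<Rightarrow> 'k, 'm) gmodule" where
  "restrict_scalars W M = \<lparr>carrier = carrier M, mult = mult M, one = \<one>\<^bsub>M\<^esub>, zero = \<zero>\<^bsub>M\<^esub>, add = add M,
     smult = (\<lambda>s m. const_family W s \<odot>\<^bsub>M\<^esub> m), part = part M\<rparr>"

text \<open>The action factors through the image \<open>Z\<^sup>\<Omega>\<close> of \<open>Z\<close> in the product over \<open>\<Omega>\<close>.\<close>

definition acts_through ::
    "('k::field \<Rightarrow> 'v::ab_group_add \<Rightarrow> 'v) \<Rightarrow> ('w, 'c) monoid_scheme \<Rightarrow> 'w set \<Rightarrow> ('w \<Rightarrow> 'v \<Rightarrow> 'k) \<Rightarrow>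
     ('w \<Rightarrow> 'v \<Rightarrow> 'k, 'm) gmodule \<Rightarrow> 'w set \<Rightarrow> bool" where
  "acts_through scale W I \<alpha> M \<Omega> \<longleftrightarrow>
     (\<forall>y \<in> carrier (Z_ring scale W I \<alpha>). \<forall>z \<in> carrier (Z_ring scale W I \<alpha>).
        restrict y \<Omega> = restrict z \<Omega> \<longrightarrow> (\<forall>m \<in> carrier M. y \<odot>\<^bsub>M\<^esub> m = z \<odot>\<^bsub>M\<^esub> m))"

definition Z_mod_f_objects ::
    "('k::field \<Rightarrow> 'v::ab_group_add \<Rightarrow> 'v) \<Rightarrow> ('w, 'c) monoid_scheme \<Rightarrow> 'w set \<Rightarrow> ('w \<Rightarrow> 'v \<Rightarrow> 'k) \<Rightarrow>
     ('w \<Rightarrow> 'v \<Rightarrow> 'k, 'm) gmodule set" where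
  "Z_mod_f_objects scale W I \<alpha> = {M. graded_module (Z_ring scale W I \<alpha>) M \<and>
     fin_gen (S_ring scale) (restrict_scalars W M) \<and>
     torsion_free (S_ring scale) (restrict_scalars W M) \<and>
     (\<exists>\<Omega>. finite \<Omega> \<and> \<Omega> \<subseteq> carrier W \<and> acts_through scale W I \<alpha> M \<Omega>)}"

text \<open>\<open>M\<^sub>Q = M \<otimes>\<^sub>S Q\<close> is the module of fractions with denominators in \<open>S - {0}\<close>.\<close>

definition denominators ::
    "('k::field \<Rightarrow> 'v::ab_group_add \<Rightarrow> 'v) \<Rightarrow> ('w, 'c) monoid_scheme \<Rightarrow> ('w \<Rightarrow> 'v \<Rightarrow> 'k) set" where
  "denominators scale W = const_family W ` (carrier (S_ring scale) - {\<zero>\<^bsub>S_ring scale\<^esub>})"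

definition M_Q ::
    "('k::field \<Rightarrow> 'v::ab_group_add \<Rightarrow> 'v) \<Rightarrow> ('w, 'c) monoid_scheme \<Rightarrow> 'w set \<Rightarrow> ('w \<Rightarrow> 'v \<Rightarrow> 'k) \<Rightarrow>
     ('w \<Rightarrow> 'v \<Rightarrow> 'k, 'm) gmodule \<Rightarrow>
     ('w \<Rightarrow> 'v \<Rightarrow> 'k, ('m \<times> ('w \<Rightarrow> 'v \<Rightarrow> 'k)) set) module" where
  "M_Q scale W I \<alpha> M = frac_module (Z_ring scale W I \<alpha>) M (denominators scale W)"

text \<open>The fraction \<open>z / s\<close> is the idempotent of \<open>w\<close> in \<open>Z\<^sup>\<Omega> \<otimes>\<^sub>S Q = \<Oplus>\<^bsub>\<Omega>\<^esub> Q\<close>.\<close>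

definition represents_idempotent ::
    "('k::field \<Rightarrow> 'v::ab_group_add \<Rightarrow> 'v) \<Rightarrow> ('w, 'c) monoid_scheme \<Rightarrow> 'w set \<Rightarrow> ('w \<Rightarrow> 'v \<Rightarrow> 'k) \<Rightarrow>
     'w set \<Rightarrow> 'w \<Rightarrow> ('w \<Rightarrow> 'v \<Rightarrow> 'k) \<Rightarrow> ('w \<Rightarrow> 'v \<Rightarrow> 'k) \<Rightarrow> bool" where
  "represents_idempotent scale W I \<alpha> \<Omega> w z s \<longleftrightarrow>
     z \<in> carrier (Z_ring scale W I \<alpha>) \<and> s \<in> denominators scale W \<and>
     z w = s w \<and> (\<forall>y \<in> \<Omega> - {w}. z y = \<zero>\<^bsub>S_ring scale\<^esub>)"

text \<open>The projection of \<open>M\<^sub>Q\<close> to its summand at \<open>w\<close>. It does not depend on the choice of \<open>\<Omega>\<close> and of the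
  fraction. As \<open>\<Omega>\<close> may be enlarged, \<open>w \<in> \<Omega>\<close> can be assumed; the summand vanishes if \<open>Z\<close> already
  acts through \<open>\<Omega> - {w}\<close>.\<close>

definition proj_Q ::
    "('k::field \<Rightarrow> 'v::ab_group_add \<Rightarrow> 'v) \<Rightarrow> ('w, 'c) monoid_scheme \<Rightarrow> 'w set \<Rightarrow> ('w \<Rightarrow> 'v \<Rightarrow> 'k) \<Rightarrow>
     ('w \<Rightarrow> 'v \<Rightarrow> 'k, 'm) gmodule \<Rightarrow> 'w \<Rightarrow>
     ('m \<times> ('w \<Rightarrow> 'v \<Rightarrow> 'k)) set \<Rightarrow> ('m \<times> ('w \<Rightarrow> 'v \<Rightarrow> 'k)) set" where
  "proj_Q scale W I \<alpha> M w X = (THE Y. \<exists>\<Omega> z s. finite \<Omega> \<and> \<Omega> \<subseteq> carrier W \<and> w \<in> \<Omega> \<and>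
     acts_through scale W I \<alpha> M \<Omega> \<and> represents_idempotent scale W I \<alpha> \<Omega> w z s \<and>
     Y = frac_act (Z_ring scale W I \<alpha>) M (denominators scale W) z s X)"

text \<open>\<open>m \<mapsto> (m\<^sub>w)\<^bsub>w \<in> \<Omega>\<^esub>\<close>; only finitely many components are nonzero.\<close>

definition proj_family ::
    "('k::field \<Rightarrow> 'v::ab_group_add \<Rightarrow> 'v) \<Rightarrow> ('w, 'c) monoid_scheme \<Rightarrow> 'w set \<Rightarrow> ('w \<Rightarrow> 'v \<Rightarrow> 'k) \<Rightarrow>
     ('w \<Rightarrow> 'v \<Rightarrow> 'k, 'm) gmodule \<Rightarrow> 'w set \<Rightarrow> 'm \<Rightarrow> 'w \<Rightarrow> ('m \<times> ('w \<Rightarrow> 'v \<Rightarrow> 'k)) set" where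
  "proj_family scale W I \<alpha> M \<Omega> m = (\<lambda>w \<in> \<Omega>. proj_Q scale W I \<alpha> M w
     (frac M (denominators scale W) m \<one>\<^bsub>Z_ring scale W I \<alpha>\<^esub>))"

text \<open>\<open>M\<^sup>\<Omega>\<close> as a graded \<open>S\<close>-module.\<close>

definition M_restr ::
    "('k::field \<Rightarrow> 'v::ab_group_add \<Rightarrow> 'v) \<Rightarrow> ('w, 'c) monoid_scheme \<Rightarrow> 'w set \<Rightarrow> ('w \<Rightarrow> 'v \<Rightarrow> 'k) \<Rightarrow>
     ('w \<Rightarrow> 'v \<Rightarrow> 'k, 'm) gmodule \<Rightarrow> 'w set \<Rightarrow>
     ('v \<Rightarrow> 'k, 'w \<Rightarrow> ('m \<times> ('w \<Rightarrow> 'v \<Rightarrow> 'k)) set) gmodule" where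
  "M_restr scale W I \<alpha> M \<Omega> =
     \<lparr>carrier = proj_family scale W I \<alpha> M \<Omega> ` carrier M, mult = undefined, one = undefined,
      zero = (\<lambda>w \<in> \<Omega>. \<zero>\<^bsub>M_Q scale W I \<alpha> M\<^esub>),
      add = (\<lambda>f g. \<lambda>w \<in> \<Omega>. f w \<oplus>\<^bsub>M_Q scale W I \<alpha> M\<^esub> g w),
      smult = (\<lambda>s f. \<lambda>w \<in> \<Omega>. const_family W s \<odot>\<^bsub>M_Q scale W I \<alpha> M\<^esub> f w),
      part = (\<lambda>n. proj_family scale W I \<alpha> M \<Omega> ` part M n)\<rparr>"

definition V_objects ::
    "('k::field \<Rightarrow> 'v::ab_group_add \<Rightarrow> 'v) \<Rightarrow> ('w, 'c) monoid_scheme \<Rightarrow> 'w set \<Rightarrow> ('w \<Rightarrow> 'v \<Rightarrow> 'k) \<Rightarrow>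
     ('w \<Rightarrow> 'v \<Rightarrow> 'k, 'm) gmodule set" where
  "V_objects scale W I \<alpha> = {M \<in> Z_mod_f_objects scale W I \<alpha>.
     \<forall>\<Omega>. upwardly_closed W I \<Omega> \<longrightarrow> graded_free (S_ring scale) (M_restr scale W I \<alpha> M \<Omega>)}"

text \<open>The regular orbit \<open>\<Lambda>\<close> enters only through its identification with \<open>W\<close>.\<close>

definition V_category ::
    "('k::field \<Rightarrow> 'v::ab_group_add \<Rightarrow> 'v) \<Rightarrow> ('w, 'c) monoid_scheme \<Rightarrow> 'w set \<Rightarrow> ('w \<Rightarrow> 'v \<Rightarrow> 'k) \<Rightarrow>
     (('w \<Rightarrow> 'v \<Rightarrow> 'k, 'm) gmodule, 'm \<Rightarrow> 'm) cat" where
  "V_category scale W I \<alpha> = gmod_category (Z_ring scale W I \<alpha>) (V_objects scale W I \<alpha>)"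

end

theory Submission
  imports Defs "HOL-Computational_Algebra.Polynomial"
begin

text \<open>Restricting functions on \<open>V \<times> V\<close> to the graphs gives a map \<open>S \<otimes> S \<rightarrow> Z\<close>, and the functor from
  \<open>\<V>(\<Lambda>)\<close> to \<open>\<F>\<^sub>\<nabla>\<close> is restriction of scalars. Its inverse extends the action: by Newton interpolation
  every \<open>z \<in> Z\<close> becomes, on finitely many graphs, the restriction of some \<open>F \<in> S \<otimes> S\<close> after multiplication
  by a product \<open>s\<close> of linear forms, and for each hyperplane \<open>s\<close> can be chosen not to vanish on it. Hence
  \<open>F m\<close> is divisible by \<open>s\<close> whenever \<open>m\<close> lies in a module that is free over the right copy of \<open>S\<close>.
  Both extension and restriction are the identity on morphisms.

  To match the objects, both conditions are reduced to the existence of a homogeneous basis over \<open>S\<close> in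
  which every element is supported on one graph \<open>Gr(x)\<close> and graphs of smaller length. For \<open>\<V>(\<Lambda>)\<close> the
  upwardly closed sets only filter \<open>W\<close> by a linear extension of the length function; an element
  labelled \<open>x\<close> is moved off the points preceding \<open>x\<close> that are not shorter, none of which is a reflection
  of \<open>x\<close> because \<open>l(t x) \<noteq> l(x)\<close> for parity reasons. Conversely, a basis adapted to the length is moved so
  as to be adapted to any given upwardly closed set.\<close>

section \<open>Polynomial functions\<close>

text \<open>Why denominators cancel: a linear form generates a prime ideal of S, and over its
  hyperplane two graphs Gr(x) and Gr(y) coincide only if y x^-1 is a reflection fixing it, by
  reflection faithfulness; a product of two reflections has even length, so there is at most one
  such reflection. Locally at a hyperplane only pairs x, t x stay glued, and coordinates over S
  collect the local statements into divisibility by a product of linear forms, one factor at a time.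
  Why subquotients are free: a homogeneous polynomial with nonzero constant term is a constant, so
  kernels of surjections between graded free modules are found by Gaussian elimination, with
  representatives modulo a submodule in place of quotients. Support in F_nabla is a condition on
  primes; that the module is torsion free and killed by the functions vanishing on its graphs, not
  just acted on nilpotently, is derived from the layers. V(Lambda) sees only quotients M^Omega;
  layers are recovered as kernels between them, for a rank refining length and injective on the
  finite support.\<close>

lemma fun_span_add:
  "f \<in> fun_span X \<Longrightarrow> g \<in> fun_span X \<Longrightarrow> (\<lambda>x. f x + g x) \<in> fun_span X"
proof (induction rule: fun_span.induct)
  case 1
  then show ?case by simp
next
  case (2 f h)
  have "(\<lambda>x. f x + (h x + g x)) \<in> fun_span X"
    by (rule fun_span.intros(2)[OF 2(1) 2(3)[OF 2(4)]])
  then show ?case by (simp add: add.assoc)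
qed

lemma fun_span_base: "f \<in> X \<Longrightarrow> f \<in> fun_span X"
  using fun_span.intros(2)[of f X "\<lambda>_. 0"] fun_span.intros(1)[of X] by simp

text \<open>\<open>fun_span\<close> closes only under addition; it is a k-linear span because the
  generating sets it is applied to are stable under scalars. Hence an additive T is enough.\<close>

lemma fun_span_map:
  assumes "f \<in> fun_span X" "\<And>g. g \<in> X \<Longrightarrow> T g \<in> fun_span Y"
    and "T (\<lambda>_. 0) = (\<lambda>_. 0)" "\<And>f g. T (\<lambda>x. f x + g x) = (\<lambda>y. T f y + T g y)"
  shows "T f \<in> fun_span Y"
  using assms(1)
proof (induction rule: fun_span.induct)
  case 1
  then show ?case by (simp add: assms(3) fun_span.intros(1))
next
  case (2 f g)
  then show ?case using assms(2,4) fun_span_add by metis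
qed

lemma fun_span_subset:
  assumes "f \<in> fun_span X" "(\<lambda>_. 0) \<in> Y" "\<And>g. g \<in> X \<Longrightarrow> g \<in> Y"
    "\<And>f g. f \<in> Y \<Longrightarrow> g \<in> Y \<Longrightarrow> (\<lambda>x. f x + g x) \<in> Y"
  shows "f \<in> Y"
  using assms(1) by (induction rule: fun_span.induct) (auto intro: assms)

locale polynomial_functions = vector_space scale
  for scale :: "'k::field \<Rightarrow> 'v::ab_group_add \<Rightarrow> 'v" +
  assumes infinite_field: "infinite (UNIV :: 'k set)"
begin

abbreviation S where "S \<equiv> carrier (S_ring scale)"
abbreviation SS where "SS \<equiv> carrier (SS_ring scale)"
abbreviation dual where "dual \<equiv> dual_space scale"
abbreviation sym where "sym \<equiv> sym_power scale"
abbreviation Sp where "Sp \<equiv> rpart (S_ring scale)"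
abbreviation SSp where "SSp \<equiv> rpart (SS_ring scale)"

section \<open>The algebra S, its symmetric powers and its grading\<close>

lemma S_ring_simps [simp]:
  "monoid.mult (S_ring scale) = (\<lambda>f g x. f x * g x)" "monoid.one (S_ring scale) = (\<lambda>_. 1)"
  "ring.zero (S_ring scale) = (\<lambda>_. 0)" "ring.add (S_ring scale) = (\<lambda>f g x. f x + g x)"
  "monoid.mult (SS_ring scale) = (\<lambda>f g x. f x * g x)" "monoid.one (SS_ring scale) = (\<lambda>_. 1)"
  "ring.zero (SS_ring scale) = (\<lambda>_. 0)" "ring.add (SS_ring scale) = (\<lambda>f g x. f x + g x)"
  by (simp_all add: S_ring_def SS_ring_def fun_gring_def)

lemma S_carrier: "S = fun_span (\<Union>d. sym d)"
  by (simp add: S_ring_def fun_gring_def)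

lemma SS_carrier: "SS = fun_span {(\<lambda>(u, v). f u * g v) | f g. f \<in> S \<and> g \<in> S}"
  by (simp add: SS_ring_def fun_gring_def)

lemma Sp_def: "Sp n = (if 0 \<le> n \<and> even n then sym (nat (n div 2)) else {\<lambda>_. 0})"
  by (simp add: S_ring_def fun_gring_def)

lemma SSp_def: "SSp n = fun_span {(\<lambda>(u, v). f u * g v) | f g. \<exists>i j. i + j = n \<and> f \<in> Sp i \<and> g \<in> Sp j}"
  by (simp add: SS_ring_def fun_gring_def)

lemma dual_iff: "f \<in> dual \<longleftrightarrow> (\<forall>x y. f (x + y) = f x + f y) \<and> (\<forall>c x. f (scale c x) = c * f x)"
proof -
  have "vector_space ((*) :: 'k \<Rightarrow> 'k \<Rightarrow> 'k)"
    by (unfold_locales) (auto simp: algebra_simps)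
  then show ?thesis
    unfolding dual_space_def mem_Collect_eq Vector_Spaces.linear_iff using vector_space_axioms by auto
qed

lemma linear_endo_iff: "Vector_Spaces.linear scale scale L \<longleftrightarrow>
    (\<forall>x y. L (x + y) = L x + L y) \<and> (\<forall>c x. L (scale c x) = scale c (L x))"
  unfolding Vector_Spaces.linear_iff using vector_space_axioms by auto

lemma dual_zero: "f \<in> dual \<Longrightarrow> f 0 = 0"
  by (metis dual_iff add_cancel_right_right)

lemma dual_minus: "f \<in> dual \<Longrightarrow> f (- x) = - f x"
  by (metis dual_iff dual_zero add.right_inverse add_eq_0_iff)

lemma dual_diff: "f \<in> dual \<Longrightarrow> f (x - y) = f x - f y"
  by (metis dual_iff dual_minus diff_conv_add_uminus)

lemma dual_compose: "f \<in> dual \<Longrightarrow> Vector_Spaces.linear scale scale L \<Longrightarrow> (\<lambda>v. f (L v)) \<in> dual"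
  by (auto simp: dual_iff linear_endo_iff)

lemma dual_sub: "f \<in> dual \<Longrightarrow> g \<in> dual \<Longrightarrow> (\<lambda>v. f v - g v) \<in> dual"
  by (auto simp: dual_iff algebra_simps)

lemma dual_separates: "u \<noteq> 0 \<Longrightarrow> \<exists>f \<in> dual. f u \<noteq> 0"
proof -
  assume u: "u \<noteq> 0"
  have vs: "vector_space ((*) :: 'k \<Rightarrow> 'k \<Rightarrow> 'k)"
    by (unfold_locales) (auto simp: algebra_simps)
  interpret P: vector_space_pair scale "(*) :: 'k \<Rightarrow> 'k \<Rightarrow> 'k"
    using vs vector_space_axioms by (simp add: vector_space_pair_def)
  have "independent {u}" using u by simp
  from P.linear_independent_extend[OF this, of "\<lambda>_. 1"] obtain g
    where "Vector_Spaces.linear scale (*) g" "g u = 1" by auto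
  then show ?thesis by (intro bexI[of _ g]) (auto simp: dual_space_def)
qed

lemma zero_sym: "(\<lambda>_. 0) \<in> sym d"
  by (cases d) (auto intro: fun_span.intros)

lemma add_sym: "f \<in> sym d \<Longrightarrow> g \<in> sym d \<Longrightarrow> (\<lambda>v. f v + g v) \<in> sym d"
  by (cases d) (auto intro: fun_span_add)

lemma dual_mult_sym: "a \<in> dual \<Longrightarrow> f \<in> sym d \<Longrightarrow> h = (\<lambda>v. a v * f v) \<Longrightarrow> 
    h \<in> fun_span {(\<lambda>v. \<alpha> v * f v) | \<alpha> f. \<alpha> \<in> dual \<and> f \<in> sym d}"
  by (intro fun_span_base CollectI exI[of _ a] exI[of _ f]) auto

lemma mult_sym: "f \<in> sym m \<Longrightarrow> g \<in> sym n \<Longrightarrow> (\<lambda>v. f v * g v) \<in> sym (m + n)"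
proof (induction m arbitrary: f)
  case 0
  then obtain c where f: "f = (\<lambda>_. c)" by auto
  have "g \<in> sym n \<Longrightarrow> (\<lambda>v. c * g v) \<in> sym n"
  proof (induction n arbitrary: g)
    case (Suc n)
    have "(\<lambda>g v. c * g v) g \<in> fun_span {(\<lambda>v. \<alpha> v * f v) | \<alpha> f. \<alpha> \<in> dual \<and> f \<in> sym n}"
    proof (rule fun_span_map[OF Suc.prems[unfolded sym_power.simps(2)]])
      fix h assume "h \<in> {(\<lambda>v. \<alpha> v * f v) | \<alpha> f. \<alpha> \<in> dual \<and> f \<in> sym n}"
      then obtain a f where h: "h = (\<lambda>v. a v * f v)" "a \<in> dual" "f \<in> sym n" by auto
      show "(\<lambda>v. c * h v) \<in> fun_span {(\<lambda>v. \<alpha> v * f v) | \<alpha> f. \<alpha> \<in> dual \<and> f \<in> sym n}"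
        by (rule dual_mult_sym[OF h(2) Suc.IH[OF h(3)]]) (simp add: h(1) algebra_simps)
    qed (auto simp: algebra_simps)
    then show ?case by simp
  qed auto
  then show ?case using 0 f by simp
next
  case (Suc m)
  have "(\<lambda>f v. f v * g v) f \<in> fun_span {(\<lambda>v. \<alpha> v * f v) | \<alpha> f. \<alpha> \<in> dual \<and> f \<in> sym (m + n)}"
  proof (rule fun_span_map[OF Suc.prems(1)[unfolded sym_power.simps(2)]])
    fix h assume "h \<in> {(\<lambda>v. \<alpha> v * f v) | \<alpha> f. \<alpha> \<in> dual \<and> f \<in> sym m}"
    then obtain a f where h: "h = (\<lambda>v. a v * f v)" "a \<in> dual" "f \<in> sym m" by auto
    show "(\<lambda>v. h v * g v) \<in> fun_span {(\<lambda>v. \<alpha> v * f v) | \<alpha> f. \<alpha> \<in> dual \<and> f \<in> sym (m + n)}"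
      by (rule dual_mult_sym[OF h(2) Suc.IH[OF h(3) Suc.prems(2)]]) (simp add: h(1) algebra_simps)
  qed (auto simp: algebra_simps)
  then show ?case by simp
qed

lemma dual_in_sym: "f \<in> dual \<Longrightarrow> f \<in> sym 1"
proof -
  assume f: "f \<in> dual"
  have "(\<lambda>v. f v * (\<lambda>_. 1) v) \<in> fun_span {(\<lambda>v. \<alpha> v * f v) | \<alpha> f. \<alpha> \<in> dual \<and> f \<in> sym 0}"
    by (rule dual_mult_sym[OF f, of "\<lambda>_. 1"]) auto
  then show ?thesis by simp
qed

lemma sym_compose: "f \<in> sym d \<Longrightarrow> Vector_Spaces.linear scale scale L \<Longrightarrow> (\<lambda>v. f (L v)) \<in> sym d"
proof (induction d arbitrary: f)
  case (Suc d)
  have "(\<lambda>f v. f (L v)) f \<in> fun_span {(\<lambda>v. \<alpha> v * f v) | \<alpha> f. \<alpha> \<in> dual \<and> f \<in> sym d}"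
  proof (rule fun_span_map[OF Suc.prems(1)[unfolded sym_power.simps(2)]])
    fix h assume "h \<in> {(\<lambda>v. \<alpha> v * f v) | \<alpha> f. \<alpha> \<in> dual \<and> f \<in> sym d}"
    then obtain a f where h: "h = (\<lambda>v. a v * f v)" "a \<in> dual" "f \<in> sym d" by auto
    have "(\<lambda>v. a (L v)) \<in> dual" using dual_compose h(2) Suc.prems(2) .
    from dual_mult_sym[OF this Suc.IH[OF h(3) Suc.prems(2)] refl]
    show "(\<lambda>v. h (L v)) \<in> fun_span {(\<lambda>v. \<alpha> v * f v) | \<alpha> f. \<alpha> \<in> dual \<and> f \<in> sym d}"
      unfolding h(1) .
  qed auto
  then show ?case by simp
qed auto

text \<open>What matters later is the scaling by 0: it makes homogeneous functions of positive
  degree vanish at the origin.\<close>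

lemma sym_homogeneous: "f \<in> sym d \<Longrightarrow> f (scale c v) = c ^ d * f v"
proof (induction d arbitrary: f)
  case (Suc d)
  show ?case
    by (rule fun_span_subset[OF Suc.prems[unfolded sym_power.simps(2)], where Y = "{f. f (scale c v) = c ^ Suc d * f v}", THEN CollectD])
      (auto simp: Suc.IH dual_iff algebra_simps)
qed auto

lemma sym_S: "f \<in> sym d \<Longrightarrow> f \<in> S"
  unfolding S_carrier by (intro fun_span_base) auto

lemma const_S [simp, intro]: "(\<lambda>_. c) \<in> S"
  by (rule sym_S[of _ 0]) auto

lemma dual_S: "f \<in> dual \<Longrightarrow> f \<in> S"
  using sym_S dual_in_sym by blast

lemma add_S [simp, intro]: "f \<in> S \<Longrightarrow> g \<in> S \<Longrightarrow> (\<lambda>v. f v + g v) \<in> S"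
  unfolding S_carrier by (rule fun_span_add)

lemma mult_S [simp, intro]: "f \<in> S \<Longrightarrow> g \<in> S \<Longrightarrow> (\<lambda>v. f v * g v) \<in> S"
proof -
  assume f: "f \<in> S" and g: "g \<in> S"
  have *: "(\<lambda>v. f v * g v) \<in> S" if f: "f \<in> sym d" for f d
  proof -
    have "(\<lambda>g v. f v * g v) g \<in> fun_span (\<Union>d. sym d)"
      by (rule fun_span_map[OF g[unfolded S_carrier]])
        (use mult_sym[OF f] in \<open>auto simp: algebra_simps intro!: fun_span_base\<close>)
    then show ?thesis unfolding S_carrier .
  qed
  have "(\<lambda>f v. f v * g v) f \<in> fun_span (\<Union>d. sym d)"
    by (rule fun_span_map[OF f[unfolded S_carrier]])
      (use * S_carrier in \<open>auto simp: algebra_simps\<close>)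
  then show ?thesis unfolding S_carrier .
qed

text \<open>Each symmetric power is spanned by products of linear forms, so constants and linear
  forms generate S as an algebra. Statements stable under sums and products are checked on
  these.\<close>

lemma S_induct [consumes 1, case_names const dual add mult]:
  assumes "f \<in> S" and const: "\<And>c. P (\<lambda>_. c)" and dual: "\<And>f. f \<in> dual \<Longrightarrow> P f"
    and add: "\<And>f g. f \<in> S \<Longrightarrow> g \<in> S \<Longrightarrow> P f \<Longrightarrow> P g \<Longrightarrow> P (\<lambda>v. f v + g v)"
    and mult: "\<And>f g. f \<in> S \<Longrightarrow> g \<in> S \<Longrightarrow> P f \<Longrightarrow> P g \<Longrightarrow> P (\<lambda>v. f v * g v)"
  shows "P f"
proof -
  have sym: "f \<in> sym d \<Longrightarrow> P f" for d f
  proof (induction d arbitrary: f)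
    case (Suc d)
    have "f \<in> {f \<in> S. P f}"
    proof (rule fun_span_subset[OF Suc.prems[unfolded sym_power.simps(2)]])
      fix h assume "h \<in> {(\<lambda>v. \<alpha> v * f v) | \<alpha> f. \<alpha> \<in> dual \<and> f \<in> sym d}"
      then show "h \<in> {f \<in> S. P f}" using mult dual dual_S sym_S Suc.IH by auto
    qed (auto intro: const add)
    then show ?case by simp
  qed (auto intro: const)
  have "f \<in> {f \<in> S. P f}"
    by (rule fun_span_subset[OF assms(1)[unfolded S_carrier]]) (auto intro: const add sym sym_S)
  then show ?thesis by simp
qed

lemma uminus_S [simp, intro]: "f \<in> S \<Longrightarrow> (\<lambda>v. - f v) \<in> S"
  using mult_S[of "\<lambda>_. - 1" f] by simp

lemma diff_S [simp, intro]: "f \<in> S \<Longrightarrow> g \<in> S \<Longrightarrow> (\<lambda>v. f v - g v) \<in> S"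
  using add_S[of f "\<lambda>v. - g v"] by simp

lemma compose_S: "f \<in> S \<Longrightarrow> Vector_Spaces.linear scale scale L \<Longrightarrow> (\<lambda>v. f (L v)) \<in> S"
  by (induction rule: S_induct) (auto intro: dual_S dual_compose)

lemma Sp_S: "f \<in> Sp n \<Longrightarrow> f \<in> S"
  by (auto simp: Sp_def sym_S split: if_splits)

lemma zero_Sp [simp, intro]: "(\<lambda>_. 0) \<in> Sp n"
  by (simp add: Sp_def zero_sym)

lemma add_Sp: "f \<in> Sp n \<Longrightarrow> g \<in> Sp n \<Longrightarrow> (\<lambda>v. f v + g v) \<in> Sp n"
  by (auto simp: Sp_def add_sym split: if_splits)

lemma mult_Sp: "f \<in> Sp m \<Longrightarrow> g \<in> Sp n \<Longrightarrow> (\<lambda>v. f v * g v) \<in> Sp (m + n)"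
proof (cases "f = (\<lambda>_. 0) \<or> g = (\<lambda>_. 0)")
  case True
  then have "(\<lambda>v. f v * g v) = (\<lambda>_. 0)" by auto
  then show ?thesis by simp
next
  case False
  assume fg: "f \<in> Sp m" "g \<in> Sp n"
  have mn: "0 \<le> m" "even m" "0 \<le> n" "even n" 
    using False fg by (auto simp: Sp_def split: if_splits)
  have "nat ((m + n) div 2) = nat (m div 2) + nat (n div 2)"
    using mn by (auto elim!: evenE)
  then show ?thesis using fg mn mult_sym by (simp add: Sp_def)
qed

lemma const_Sp: "(\<lambda>_. c) \<in> Sp 0"
  by (auto simp: Sp_def)

lemma dual_Sp: "f \<in> dual \<Longrightarrow> f \<in> Sp 2"
  using dual_in_sym by (simp add: Sp_def)

lemma uminus_Sp: "f \<in> Sp n \<Longrightarrow> (\<lambda>v. - f v) \<in> Sp n"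
  using mult_Sp[OF const_Sp[of "-1"], of f n] by simp

lemma diff_Sp: "f \<in> Sp n \<Longrightarrow> g \<in> Sp n \<Longrightarrow> (\<lambda>v. f v - g v) \<in> Sp n"
  using add_Sp[of f n "\<lambda>v. - g v"] uminus_Sp by simp

lemma compose_Sp: "f \<in> Sp n \<Longrightarrow> Vector_Spaces.linear scale scale L \<Longrightarrow> (\<lambda>v. f (L v)) \<in> Sp n"
  by (auto simp: Sp_def sym_compose split: if_splits)

text \<open>The graded analogue of S being a local ring: homogeneous elements outside the
  augmentation ideal are nonzero constants. It supplies the invertible pivot in
  \<open>eliminate_one\<close>.\<close>

lemma Sp_nonzero_at_origin: "f \<in> Sp n \<Longrightarrow> f 0 \<noteq> 0 \<Longrightarrow> n = 0 \<and> f = (\<lambda>_. f 0)"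
proof -
  assume f: "f \<in> Sp n" and f0: "f 0 \<noteq> 0"
  then have n: "0 \<le> n" "even n" and fs: "f \<in> sym (nat (n div 2))" by (auto simp: Sp_def split: if_splits)
  have "f 0 = 0 ^ (nat (n div 2)) * f 0" using sym_homogeneous[OF fs, of 0 0] by simp
  then have "nat (n div 2) = 0" using f0 by (cases "nat (n div 2)") auto
  then show ?thesis using n fs by (auto elim!: evenE)
qed

section \<open>S is a domain and linear forms are prime\<close>

lemma S_on_line: "f \<in> S \<Longrightarrow> \<exists>P. \<forall>c. f (p + scale c u) = poly P c"
proof (induction rule: S_induct)
  case (const c)
  show ?case by (rule exI[of _ "[:c:]"]) simp
next
  case (dual f)
  then show ?case by (intro exI[of _ "[:f p, f u:]"]) (auto simp: dual_iff)
next
  case (add f g)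
  then show ?case by (metis poly_add)
next
  case (mult f g)
  then show ?case by (metis poly_mult)
qed

text \<open>Restrict to the line through a point where \<open>f\<close> does not vanish and one where \<open>g\<close> does not.\<close>

lemma S_domain_on:
  assumes "f \<in> S" "g \<in> S" "\<And>p q c. p \<in> H \<Longrightarrow> q \<in> H \<Longrightarrow> p + scale c (q - p) \<in> H"
    and fg: "\<And>v. v \<in> H \<Longrightarrow> f v * g v = 0"
  shows "(\<forall>v\<in>H. f v = 0) \<or> (\<forall>v\<in>H. g v = 0)"
proof (rule ccontr)
  assume "\<not> ?thesis"
  then obtain p q where p: "p \<in> H" "f p \<noteq> 0" and q: "q \<in> H" "g q \<noteq> 0" by auto
  obtain P where P: "\<And>c. f (p + scale c (q - p)) = poly P c" using S_on_line[OF assms(1)] by blast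
  obtain Q where Q: "\<And>c. g (p + scale c (q - p)) = poly Q c" using S_on_line[OF assms(2)] by blast
  \<comment> \<open>The two points sit at the parameters 0 and 1 of the line, so neither
    one-variable polynomial is zero. Their product vanishes at every parameter, which an infinite
    field forbids.\<close>
  have "poly P 0 \<noteq> 0" using P[of 0] p by simp
  moreover have "poly Q 1 \<noteq> 0" using Q[of 1] q by simp
  ultimately have "P * Q \<noteq> 0" by auto
  moreover have "poly (P * Q) c = 0" for c
    using fg[OF assms(3)[OF p(1) q(1)], of c] by (simp add: P Q)
  ultimately show False using poly_roots_finite[of "P * Q"] infinite_field by simp
qed

lemma S_domain:
  "f \<in> S \<Longrightarrow> g \<in> S \<Longrightarrow> (\<lambda>v. f v * g v) = (\<lambda>_. 0) \<Longrightarrow> f = (\<lambda>_. 0) \<or> g = (\<lambda>_. 0)"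
  using S_domain_on[of f g UNIV] by (auto simp: fun_eq_iff)

lemma S_mult_nonzero:
  "f \<in> S \<Longrightarrow> g \<in> S \<Longrightarrow> f \<noteq> (\<lambda>_. 0) \<Longrightarrow> g \<noteq> (\<lambda>_. 0) \<Longrightarrow> (\<lambda>v. f v * g v) \<noteq> (\<lambda>_. 0)"
  using S_domain by blast

lemma S_cancel:
  assumes "f \<in> S" "g \<in> S" "h \<in> S" "f \<noteq> (\<lambda>_. 0)" "(\<lambda>v. f v * g v) = (\<lambda>v. f v * h v)"
  shows "g = h"
proof -
  have "(\<lambda>v. f v * (g v - h v)) = (\<lambda>_. 0)"
    using fun_cong[OF assms(5)] by (auto simp: algebra_simps)
  then have "(\<lambda>v. g v - h v) = (\<lambda>_. 0)" using S_domain[OF assms(1) diff_S[OF assms(2,3)]] assms(4) by auto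
  then show ?thesis by (auto simp: fun_eq_iff)
qed

definition Sdvd :: "('v \<Rightarrow> 'k) \<Rightarrow> ('v \<Rightarrow> 'k) \<Rightarrow> bool" where
  "Sdvd f g \<longleftrightarrow> (\<exists>h \<in> S. g = (\<lambda>v. f v * h v))"

lemma Sdvd_zero: "Sdvd f (\<lambda>_. 0)"
  unfolding Sdvd_def by (intro bexI[of _ "\<lambda>_. 0"]) auto

lemma Sdvd_one: "f \<in> S \<Longrightarrow> Sdvd (\<lambda>_. 1) f"
  unfolding Sdvd_def by (intro bexI[of _ f]) auto

text \<open>Factor theorem for a linear form. With \<open>p\<close> the projection to its kernel,
  f(v) - f(p v) is a multiple of \<open>lam\<close>: this holds for linear forms and passes to sums
  and products.\<close>

lemma Sdvd_linear_iff:
  assumes lam: "lam \<in> dual" "lam \<noteq> (\<lambda>_. 0)" and f: "f \<in> S"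
  shows "Sdvd lam f \<longleftrightarrow> (\<forall>v. lam v = 0 \<longrightarrow> f v = 0)"
proof
  assume "\<forall>v. lam v = 0 \<longrightarrow> f v = 0"
  obtain b where b: "lam b \<noteq> 0" using lam(2) by auto
  \<comment> \<open>Scaled so that \<open>lam a\<close> is 1, which makes \<open>p\<close> below the
    projection onto the kernel along \<open>a\<close>.\<close>
  define a where "a = scale (1 / lam b) b"
  have a: "lam a = 1" using b lam(1) by (simp add: a_def dual_iff)
  define p where "p v = v - scale (lam v) a" for v
  have lin: "Vector_Spaces.linear scale scale p"
    using lam(1) by (auto simp: linear_endo_iff p_def dual_iff algebra_simps)
  have lp: "lam (p v) = 0" for v
    using lam(1) a by (simp add: p_def dual_diff) (simp add: dual_iff)
  have "\<exists>h \<in> S. \<forall>v. f v - f (p v) = lam v * h v"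
    using f
  proof (induction rule: S_induct)
    case (const c)
    show ?case by (rule bexI[of _ "\<lambda>_. 0"]) auto
  next
    case (dual g)
    then show ?case 
      by (intro bexI[of _ "\<lambda>_. g a"]) (auto simp: p_def dual_diff, auto simp: dual_iff)
  next
    case (add f g)
    then obtain h h' where h: "h \<in> S" "h' \<in> S" "\<And>v. f v - f (p v) = lam v * h v"
       "\<And>v. g v - g (p v) = lam v * h' v" by blast
    have "f v + g v - (f (p v) + g (p v)) = lam v * (h v + h' v)" for v
      by (simp only: distrib_left h(3,4)[symmetric]) simp
    then show ?case using h by (intro bexI[of _ "\<lambda>v. h v + h' v"]) auto
  next
    case (mult f g)
    then obtain h h' where h: "h \<in> S" "h' \<in> S" "\<And>v. f v - f (p v) = lam v * h v"
       "\<And>v. g v - g (p v) = lam v * h' v" by blast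
    have "f v * g v - f (p v) * g (p v) = lam v * (h v * g v + f (p v) * h' v)" for v
    proof -
      \<comment> \<open>Leibniz rule for the difference between a function and its composite with
        \<open>p\<close>.\<close>
      have "f v * g v - f (p v) * g (p v) = (f v - f (p v)) * g v + f (p v) * (g v - g (p v))"
        by (simp add: algebra_simps)
      then show ?thesis unfolding h(3,4) by (simp add: algebra_simps)
    qed
    moreover have "(\<lambda>v. h v * g v + f (p v) * h' v) \<in> S"
      using h mult compose_S[OF mult(1) lin] by auto
    ultimately show ?case by (intro bexI[of _ "\<lambda>v. h v * g v + f (p v) * h' v"]) auto
  qed
  then obtain h where h: "h \<in> S" "\<And>v. f v = lam v * h v"
    using \<open>\<forall>v. lam v = 0 \<longrightarrow> f v = 0\<close> lp by auto
  then have "f = (\<lambda>v. lam v * h v)" by (simp add: fun_eq_iff)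
  with h(1) show "Sdvd lam f" by (auto simp: Sdvd_def)
qed (auto simp: Sdvd_def)

text \<open>A hyperplane contains the line through any two of its points, so the argument for S
  being a domain applies to functions on it; divisibility by \<open>lam\<close> means vanishing
  there.\<close>

lemma linear_form_prime:
  assumes lam: "lam \<in> dual" "lam \<noteq> (\<lambda>_. 0)" and fg: "f \<in> S" "g \<in> S"
    and dvd: "Sdvd lam (\<lambda>v. f v * g v)"
  shows "Sdvd lam f \<or> Sdvd lam g"
proof -
  have "\<forall>v. lam v = 0 \<longrightarrow> f v * g v = 0"
    using dvd Sdvd_linear_iff[OF lam] fg by simp
  moreover have "p + scale c (q - p) \<in> {v. lam v = 0}" if "p \<in> {v. lam v = 0}" "q \<in> {v. lam v = 0}" for p q c
  proof -
    have "lam (p + scale c (q - p)) = lam p + c * lam (q - p)" using lam(1) by (simp add: dual_iff)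
    then show ?thesis using that dual_diff[OF lam(1)] by simp
  qed
  ultimately have "(\<forall>v\<in>{v. lam v = 0}. f v = 0) \<or> (\<forall>v\<in>{v. lam v = 0}. g v = 0)"
    using S_domain_on[OF fg, of "{v. lam v = 0}"] by blast
  then show ?thesis using Sdvd_linear_iff[OF lam] fg by auto
qed

text \<open>The denominators that interpolation produces. Their factors are known primes, so
  divisibility by such a product can be tested one hyperplane at a time.\<close>

inductive linprod :: "('v \<Rightarrow> 'k) \<Rightarrow> bool" where
  linprod_one: "linprod (\<lambda>_. 1)"
| linprod_mult: "lam \<in> dual \<Longrightarrow> lam \<noteq> (\<lambda>_. 0) \<Longrightarrow> linprod D \<Longrightarrow> linprod (\<lambda>v. lam v * D v)"

lemma linprod_S: "linprod D \<Longrightarrow> D \<in> S"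
  by (induction rule: linprod.induct) (auto simp: dual_S)

lemma linprod_nonzero: "linprod D \<Longrightarrow> D \<noteq> (\<lambda>_. 0)"
proof (induction rule: linprod.induct)
  case (linprod_mult lam D)
  then show ?case by (intro S_mult_nonzero) (auto simp: dual_S linprod_S)
qed (auto simp: fun_eq_iff)

lemma linprod_prod: "linprod D \<Longrightarrow> linprod D' \<Longrightarrow> linprod (\<lambda>v. D v * D' v)"
  by (induction rule: linprod.induct) (auto simp: mult.assoc intro: linprod.intros)

text \<open>Strip one linear factor: the multiplier chosen for \<open>lam\<close> itself is not
  divisible by it, so the prime \<open>lam\<close> divides \<open>c\<close>. After cancelling it the
  hypothesis persists for the remaining product, with the same multipliers.\<close>

lemma linprod_dvd:
  assumes "linprod D" "c \<in> S"
    and "\<And>lam. lam \<in> dual \<Longrightarrow> lam \<noteq> (\<lambda>_. 0) \<Longrightarrow> \<exists>s \<in> S. \<not> Sdvd lam s \<and> Sdvd D (\<lambda>v. s v * c v)"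
  shows "Sdvd D c"
  using assms
proof (induction arbitrary: c rule: linprod.induct)
  case linprod_one
  then show ?case by (simp add: Sdvd_one)
next
  case (linprod_mult lam D)
  note lam = linprod_mult(1,2)
  from linprod_mult.prems(2)[OF lam] obtain s where s: "s \<in> S" "\<not> Sdvd lam s"
    "Sdvd (\<lambda>v. lam v * D v) (\<lambda>v. s v * c v)" by auto
  then obtain h where h: "h \<in> S" "(\<lambda>v. s v * c v) = (\<lambda>v. lam v * D v * h v)" by (auto simp: Sdvd_def)
  then have "Sdvd lam (\<lambda>v. s v * c v)" unfolding Sdvd_def
    using linprod_S[OF linprod_mult(3)] by (intro bexI[of _ "\<lambda>v. D v * h v"]) (auto simp: mult.assoc)
  then have "Sdvd lam c" using linear_form_prime[OF lam s(1) linprod_mult.prems(1)] s(2) by simp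
  then obtain c' where c': "c' \<in> S" "c = (\<lambda>v. lam v * c' v)" by (auto simp: Sdvd_def)
  have "Sdvd D c'"
  proof (rule linprod_mult.IH[OF c'(1)])
    fix mu assume mu: "mu \<in> dual" "mu \<noteq> (\<lambda>_. 0)"
    from linprod_mult.prems(2)[OF mu] obtain s where s: "s \<in> S" "\<not> Sdvd mu s"
      "Sdvd (\<lambda>v. lam v * D v) (\<lambda>v. s v * c v)" by auto
    then obtain h where h: "h \<in> S" "(\<lambda>v. s v * c v) = (\<lambda>v. lam v * D v * h v)" by (auto simp: Sdvd_def)
    have "(\<lambda>v. lam v * (s v * c' v)) = (\<lambda>v. lam v * (D v * h v))"
      using fun_cong[OF h(2)] by (auto simp: c'(2) algebra_simps)
    then have "(\<lambda>v. s v * c' v) = (\<lambda>v. D v * h v)"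
      using S_cancel[of lam "\<lambda>v. s v * c' v" "\<lambda>v. D v * h v"] lam dual_S[OF lam(1)] s(1) c'(1) h(1)
         linprod_S[OF linprod_mult(3)] by auto
    then show "\<exists>s \<in> S. \<not> Sdvd mu s \<and> Sdvd D (\<lambda>v. s v * c' v)"
      using s h(1) by (auto simp: Sdvd_def)
  qed
  then show ?case by (auto simp: Sdvd_def c'(2) mult.assoc)
qed

section \<open>The rings S and S tensor S\<close>

lemma S_cring: "cring (S_ring scale)"
proof (rule cringI)
  show "abelian_group (S_ring scale)"
  proof (rule abelian_groupI)
    fix x assume "x \<in> S"
    then show "\<exists>y\<in>S. y \<oplus>\<^bsub>S_ring scale\<^esub> x = \<zero>\<^bsub>S_ring scale\<^esub>"
      by (intro bexI[of _ "\<lambda>v. - x v"]) auto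
  qed (auto simp: algebra_simps)
  show "Group.comm_monoid (S_ring scale)"
    by (rule comm_monoidI) (auto simp: algebra_simps)
qed (auto simp: algebra_simps)

text \<open>The right copy of S. Every graph Gr(x) is parametrized by its second coordinate, so
  \<open>rt s\<close> restricts to \<open>s\<close> on all graphs at once and S acts through it like
  a ring of scalars.\<close>

definition rt :: "('v \<Rightarrow> 'k) \<Rightarrow> 'v \<times> 'v \<Rightarrow> 'k" where
  "rt s = (\<lambda>(u, v). s v)"

lemma tensor_SS: "f \<in> S \<Longrightarrow> g \<in> S \<Longrightarrow> (\<lambda>(u, v). f u * g v) \<in> SS"
  unfolding SS_carrier by (intro fun_span_base) blast

lemma const_SS [simp, intro]: "(\<lambda>_. c) \<in> SS"
  using tensor_SS[of "\<lambda>_. c" "\<lambda>_. 1"] by (simp add: case_prod_unfold)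

lemma rt_SS [simp, intro]: "s \<in> S \<Longrightarrow> rt s \<in> SS"
  using tensor_SS[of "\<lambda>_. 1" s] by (simp add: rt_def)

lemma add_SS [simp, intro]: "F \<in> SS \<Longrightarrow> G \<in> SS \<Longrightarrow> (\<lambda>p. F p + G p) \<in> SS"
  unfolding SS_carrier by (rule fun_span_add)

lemma mult_SS [simp, intro]: "F \<in> SS \<Longrightarrow> G \<in> SS \<Longrightarrow> (\<lambda>p. F p * G p) \<in> SS"
proof -
  assume F: "F \<in> SS" and G: "G \<in> SS"
  have *: "(\<lambda>p. (case p of (u, v) \<Rightarrow> f u * g v) * G p) \<in> SS" if fg: "f \<in> S" "g \<in> S" for f g
  proof -
    have "(\<lambda>G p. (case p of (u, v) \<Rightarrow> f u * g v) * G p) G \<in> fun_span {(\<lambda>(u, v). f u * g v) | f g. f \<in> S \<and> g \<in> S}"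
    proof (rule fun_span_map[OF G[unfolded SS_carrier]])
      fix H assume "H \<in> {(\<lambda>(u, v). f u * g v) | f g. f \<in> S \<and> g \<in> S}"
      then obtain f' g' where H: "f' \<in> S" "g' \<in> S" "H = (\<lambda>(u, v). f' u * g' v)" by auto
      have "(\<lambda>p. (case p of (u, v) \<Rightarrow> f u * g v) * H p) = (\<lambda>(u, v). (f u * f' u) * (g v * g' v))"
        by (auto simp: H(3))
      then show "(\<lambda>p. (case p of (u, v) \<Rightarrow> f u * g v) * H p) \<in> fun_span {(\<lambda>(u, v). f u * g v) | f g. f \<in> S \<and> g \<in> S}"
        using tensor_SS[OF mult_S[OF fg(1) H(1)] mult_S[OF fg(2) H(2)]] SS_carrier by simp
    qed (auto simp: algebra_simps)
    then show ?thesis unfolding SS_carrier .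
  qed
  have "(\<lambda>F p. F p * G p) F \<in> fun_span {(\<lambda>(u, v). f u * g v) | f g. f \<in> S \<and> g \<in> S}"
    by (rule fun_span_map[OF F[unfolded SS_carrier]]) (use * SS_carrier in \<open>auto simp: algebra_simps\<close>)
  then show ?thesis unfolding SS_carrier .
qed

lemma uminus_SS [simp, intro]: "F \<in> SS \<Longrightarrow> (\<lambda>p. - F p) \<in> SS"
  using mult_SS[of "\<lambda>_. - 1" F] by simp

lemma diff_SS [simp, intro]: "F \<in> SS \<Longrightarrow> G \<in> SS \<Longrightarrow> (\<lambda>p. F p - G p) \<in> SS"
  using add_SS[of F "\<lambda>v. - G v"] by simp

lemma SS_cring: "cring (SS_ring scale)"
proof (rule cringI)
  show "abelian_group (SS_ring scale)"
  proof (rule abelian_groupI)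
    fix x assume "x \<in> SS"
    then show "\<exists>y\<in>SS. y \<oplus>\<^bsub>SS_ring scale\<^esub> x = \<zero>\<^bsub>SS_ring scale\<^esub>"
      by (intro bexI[of _ "\<lambda>v. - x v"]) auto
  qed (auto simp: algebra_simps)
  show "Group.comm_monoid (SS_ring scale)"
    by (rule comm_monoidI) (auto simp: algebra_simps)
qed (auto simp: algebra_simps)

lemma tensor_SSp: "f \<in> Sp i \<Longrightarrow> g \<in> Sp j \<Longrightarrow> (\<lambda>(u, v). f u * g v) \<in> SSp (i + j)"
  unfolding SSp_def by (intro fun_span_base) blast

lemma rt_SSp: "s \<in> Sp n \<Longrightarrow> rt s \<in> SSp n"
  using tensor_SSp[OF const_Sp[of 1], of s n] by (simp add: rt_def)

lemma SSp_SS: "F \<in> SSp n \<Longrightarrow> F \<in> SS"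
  unfolding SSp_def
  by (erule fun_span_subset) (auto intro!: tensor_SS dest: Sp_S)

lemma zero_SSp [simp, intro]: "(\<lambda>_. 0) \<in> SSp n"
  by (simp add: SSp_def fun_span.intros)

lemma one_SSp: "(\<lambda>_. 1) \<in> SSp 0"
  using rt_SSp[OF const_Sp[of 1]] by (simp add: rt_def case_prod_unfold)

lemma add_SSp: "F \<in> SSp n \<Longrightarrow> G \<in> SSp n \<Longrightarrow> (\<lambda>p. F p + G p) \<in> SSp n"
  unfolding SSp_def by (rule fun_span_add)

lemma mult_SSp: "F \<in> SSp m \<Longrightarrow> G \<in> SSp n \<Longrightarrow> (\<lambda>p. F p * G p) \<in> SSp (m + n)"
proof -
  assume F: "F \<in> SSp m" and G: "G \<in> SSp n"
  have *: "(\<lambda>p. (case p of (u, v) \<Rightarrow> f u * g v) * G p) \<in> SSp (m + n)"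
    if fg: "f \<in> Sp i" "g \<in> Sp j" "i + j = m" for f g i j
  proof -
    have "(\<lambda>G p. (case p of (u, v) \<Rightarrow> f u * g v) * G p) G \<in> 
      fun_span {(\<lambda>(u, v). f u * g v) | f g. \<exists>i j. i + j = m + n \<and> f \<in> Sp i \<and> g \<in> Sp j}"
    proof (rule fun_span_map[OF G[unfolded SSp_def]])
      fix H assume "H \<in> {(\<lambda>(u, v). f u * g v) | f g. \<exists>i j. i + j = n \<and> f \<in> Sp i \<and> g \<in> Sp j}"
      then obtain f' g' i' j' where H: "f' \<in> Sp i'" "g' \<in> Sp j'" "i' + j' = n" "H = (\<lambda>(u, v). f' u * g' v)" by auto
      have "(\<lambda>p. (case p of (u, v) \<Rightarrow> f u * g v) * H p) = (\<lambda>(u, v). (f u * f' u) * (g v * g' v))"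
        by (auto simp: H(4))
      moreover have "i + i' + (j + j') = m + n" using fg(3) H(3) by simp
      ultimately show "(\<lambda>p. (case p of (u, v) \<Rightarrow> f u * g v) * H p) \<in> 
         fun_span {(\<lambda>(u, v). f u * g v) | f g. \<exists>i j. i + j = m + n \<and> f \<in> Sp i \<and> g \<in> Sp j}"
        using tensor_SSp[OF mult_Sp[OF fg(1) H(1)] mult_Sp[OF fg(2) H(2)]] SSp_def by simp
    qed (auto simp: algebra_simps)
    then show ?thesis unfolding SSp_def .
  qed
  have "(\<lambda>F p. F p * G p) F \<in> fun_span {(\<lambda>(u, v). f u * g v) | f g. \<exists>i j. i + j = m + n \<and> f \<in> Sp i \<and> g \<in> Sp j}"
    by (rule fun_span_map[OF F[unfolded SSp_def]]) (use * SSp_def in \<open>auto simp: algebra_simps\<close>)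
  then show ?thesis unfolding SSp_def .
qed

lemma uminus_SSp: "F \<in> SSp n \<Longrightarrow> (\<lambda>p. - F p) \<in> SSp n"
  using mult_SSp[OF rt_SSp[OF const_Sp[of "-1"]], of F n] by (simp add: rt_def case_prod_unfold)

lemma diff_SSp: "F \<in> SSp n \<Longrightarrow> G \<in> SSp n \<Longrightarrow> (\<lambda>p. F p - G p) \<in> SSp n"
  using add_SSp[of F n "\<lambda>p. - G p"] uminus_SSp by simp

end

section \<open>Reflections and interpolation on graphs\<close>

locale coxeter_representation = polynomial_functions scale
  for scale :: "'k::field \<Rightarrow> 'v::ab_group_add \<Rightarrow> 'v" +
  fixes W :: "'w monoid" and I :: "'w set" and \<rho> :: "'w \<Rightarrow> 'v \<Rightarrow> 'v" and \<alpha> :: "'w \<Rightarrow> 'v \<Rightarrow> 'k"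
  assumes coxeter: "coxeter_system W I"
    and rep: "reflection_faithful_rep scale W I \<rho>"
    and alpha: "\<forall>t \<in> reflections W I. \<alpha> t \<in> dual_space scale \<and> \<alpha> t \<noteq> (\<lambda>_. 0) \<and>
           (\<forall>u \<in> fixed_space \<rho> t. \<alpha> t u = 0)"
begin

abbreviation T where "T \<equiv> reflections W I"
abbreviation len where "len \<equiv> cox_length W I"

sublocale W: group W
  using coxeter by (simp add: coxeter_system_def)

lemma I_carrier: "I \<subseteq> carrier W" and I_square: "s \<in> I \<Longrightarrow> s \<otimes>\<^bsub>W\<^esub> s = \<one>\<^bsub>W\<^esub>"
  and I_generate: "generate W I = carrier W"
  and I_relations: "us \<in> lists I \<Longrightarrow> word_prod W us = \<one>\<^bsub>W\<^esub> \<Longrightarrow> equivclp (relator_step W I) us []"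
  and I_not_one: "s \<in> I \<Longrightarrow> s \<noteq> \<one>\<^bsub>W\<^esub>"
  using coxeter by (auto simp: coxeter_system_def)

section \<open>Words, parity of lengths and reflections\<close>

lemma word_prod_Nil [simp]: "word_prod W [] = \<one>\<^bsub>W\<^esub>"
  by (simp add: word_prod_def)

lemma word_prod_Cons [simp]: "word_prod W (s # us) = s \<otimes>\<^bsub>W\<^esub> word_prod W us"
  by (simp add: word_prod_def)

lemma word_prod_closed: "us \<in> lists I \<Longrightarrow> word_prod W us \<in> carrier W"
  by (induction us) (use I_carrier in auto)

lemma word_prod_append: "us \<in> lists I \<Longrightarrow> vs \<in> lists I \<Longrightarrow> word_prod W (us @ vs) = word_prod W us \<otimes>\<^bsub>W\<^esub> word_prod W vs"
proof (induction us)
  case Nil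
  then show ?case using word_prod_closed by simp
next
  case (Cons a us)
  have "a \<in> carrier W" using Cons.prems(1) I_carrier by auto
  then show ?case using Cons word_prod_closed by (simp add: W.m_assoc)
qed

lemma rev_lists [simp]: "rev us \<in> lists A \<longleftrightarrow> us \<in> lists A"
  by (simp add: in_lists_conv_set)

lemma word_prod_rev: "us \<in> lists I \<Longrightarrow> word_prod W (rev us) = inv\<^bsub>W\<^esub> word_prod W us"
proof (induction us)
  case (Cons a us)
  have a: "a \<in> I" "a \<in> carrier W" "us \<in> lists I" using Cons.prems I_carrier by auto
  have ia: "inv\<^bsub>W\<^esub> a = a" using I_square[OF a(1)] a(2) W.inv_equality by blast
  show ?case using a word_prod_closed[OF a(3)]
    by (simp add: word_prod_append[of "rev us" "[a]"] Cons.IH[OF a(3)] W.inv_mult_group ia)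
qed simp

lemma word_exists: "w \<in> carrier W \<Longrightarrow> \<exists>us \<in> lists I. word_prod W us = w"
proof -
  assume "w \<in> carrier W"
  then have "w \<in> generate W I" using I_generate by simp
  then show ?thesis
  proof (induction rule: generate.induct)
    case one
    show ?case by (rule bexI[of _ "[]"]) auto
  next
    case (incl h)
    then show ?case using I_carrier by (intro bexI[of _ "[h]"]) auto
  next
    case (inv h)
    then have "inv\<^bsub>W\<^esub> h = word_prod W (rev [h])" using I_carrier by (subst word_prod_rev) auto
    then show ?case using inv by (intro bexI[of _ "[h]"]) auto
  next
    case (eng h1 h2)
    then show ?case by (metis append_in_lists_conv word_prod_append)
  qed
qed

text \<open>Coxeter relators have even length.\<close>

lemma word_parity:
  assumes us: "us \<in> lists I" and "vs \<in> lists I" and eq: "word_prod W us = word_prod W vs"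
  shows "even (length us) = even (length vs)"
proof -
  have step: "even (length us) = even (length vs)" if "relator_step W I us vs" for us vs
    using that
  proof cases
    case (1 us' vs' s t)
    have "even (length (concat (replicate n [s, t])))" for n
      by (induction n) auto
    then show ?thesis unfolding 1(1,2) by simp
  qed
  \<comment> \<open>The generators are involutions, so reversing a word inverts its value; two words
    of equal value thus yield a relation.\<close>
  have "word_prod W (us @ rev vs) = \<one>\<^bsub>W\<^esub>"
    using assms word_prod_closed[OF assms(2)] by (simp add: word_prod_append word_prod_rev)
  then have "equivclp (relator_step W I) (us @ rev vs) []"
    using assms I_relations[of "us @ rev vs"] by simp
  then have "even (length (us @ rev vs)) = even (length ([] :: 'w list))"
    by (induction rule: equivclp_induct) (use step in blast)+
  then show ?thesis by simp
qed

lemma len_word: "w \<in> carrier W \<Longrightarrow> \<exists>us \<in> lists I. length us = len w \<and> word_prod W us = w"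
  unfolding cox_length_def using word_exists[of w]
    LeastI_ex[of "\<lambda>n. \<exists>us \<in> lists I. length us = n \<and> word_prod W us = w"] by blast

text \<open>The sign character of W. Reduced words may be compared with their concatenation because
  the parity depends only on the value of a word.\<close>

lemma even_len_mult:
  assumes "x \<in> carrier W" "y \<in> carrier W"
  shows "even (len (x \<otimes>\<^bsub>W\<^esub> y)) = (even (len x) = even (len y))"
proof -
  obtain us vs ws where u: "us \<in> lists I" "length us = len x" "word_prod W us = x"
    and v: "vs \<in> lists I" "length vs = len y" "word_prod W vs = y"
    and w: "ws \<in> lists I" "length ws = len (x \<otimes>\<^bsub>W\<^esub> y)" "word_prod W ws = x \<otimes>\<^bsub>W\<^esub> y"
    using len_word assms by (metis W.m_closed)
  have "even (length ws) = even (length (us @ vs))"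
    using u v w by (intro word_parity) (auto simp: word_prod_append)
  then show ?thesis using u v w by simp
qed

lemma T_carrier: "t \<in> T \<Longrightarrow> t \<in> carrier W"
  using I_carrier by (auto simp: reflections_def)

lemma T_square: "t \<in> T \<Longrightarrow> t \<otimes>\<^bsub>W\<^esub> t = \<one>\<^bsub>W\<^esub>"
proof -
  assume "t \<in> T"
  then obtain w s where t: "w \<in> carrier W" "s \<in> I" "t = w \<otimes>\<^bsub>W\<^esub> s \<otimes>\<^bsub>W\<^esub> inv\<^bsub>W\<^esub> w"
    by (auto simp: reflections_def)
  have s: "s \<in> carrier W" using t I_carrier by auto
  have "t \<otimes>\<^bsub>W\<^esub> t = w \<otimes>\<^bsub>W\<^esub> (s \<otimes>\<^bsub>W\<^esub> ((inv\<^bsub>W\<^esub> w \<otimes>\<^bsub>W\<^esub> w) \<otimes>\<^bsub>W\<^esub> (s \<otimes>\<^bsub>W\<^esub> inv\<^bsub>W\<^esub> w)))"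
    unfolding t(3) using t(1) s by (simp only: W.m_assoc W.m_closed W.inv_closed)
  also have "\<dots> = w \<otimes>\<^bsub>W\<^esub> ((s \<otimes>\<^bsub>W\<^esub> s) \<otimes>\<^bsub>W\<^esub> inv\<^bsub>W\<^esub> w)"
    using t(1) s by (simp add: W.m_assoc)
  finally show ?thesis using t s I_square by simp
qed

text \<open>A reflection is the value of a palindromic word \<open>us @ [s] @ rev us\<close>, which
  has odd length.\<close>

lemma T_odd: "t \<in> T \<Longrightarrow> odd (len t)"
proof -
  assume "t \<in> T"
  then obtain w s where t: "w \<in> carrier W" "s \<in> I" "t = w \<otimes>\<^bsub>W\<^esub> s \<otimes>\<^bsub>W\<^esub> inv\<^bsub>W\<^esub> w"
    by (auto simp: reflections_def)
  obtain us where us: "us \<in> lists I" "word_prod W us = w" using word_exists t by blast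
  obtain vs where vs: "vs \<in> lists I" "length vs = len t" "word_prod W vs = t" 
    using len_word T_carrier \<open>t \<in> T\<close> by blast
  have s: "s \<in> carrier W" using t I_carrier by auto
  have "word_prod W (us @ [s] @ rev us) = t"
    using us t(1,2) s word_prod_append[of us "[s] @ rev us"] by (simp add: word_prod_rev t(3) W.m_assoc)
  then have "even (length (us @ [s] @ rev us)) = even (length vs)"
    using us vs t(2) by (intro word_parity) simp_all
  then show ?thesis using vs by simp
qed

text \<open>Used to see that a reflection never relates two elements of the same length: graphs of
  equal length are not glued along a hyperplane.\<close>

lemma even_len_reflect: "t \<in> T \<Longrightarrow> x \<in> carrier W \<Longrightarrow> even (len (t \<otimes>\<^bsub>W\<^esub> x)) \<longleftrightarrow> odd (len x)"
  using even_len_mult T_odd T_carrier by auto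

lemma T_mult_self: "t \<in> T \<Longrightarrow> x \<in> carrier W \<Longrightarrow> t \<otimes>\<^bsub>W\<^esub> (t \<otimes>\<^bsub>W\<^esub> x) = x"
  using T_square T_carrier by (simp add: W.m_assoc[symmetric])

lemma T_not_one: "t \<in> T \<Longrightarrow> t \<noteq> \<one>\<^bsub>W\<^esub>"
proof
  assume t: "t \<in> T" "t = \<one>\<^bsub>W\<^esub>"
  have "even (len \<one>\<^bsub>W\<^esub>)" using even_len_mult[of "\<one>\<^bsub>W\<^esub>" "\<one>\<^bsub>W\<^esub>"] by auto
  then show False using T_odd t by simp
qed

section \<open>Fixed hyperplanes of the representation\<close>

lemma rho_linear: "w \<in> carrier W \<Longrightarrow> Vector_Spaces.linear scale scale (\<rho> w)"
  and rho_one: "\<rho> \<one>\<^bsub>W\<^esub> = id"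
  and rho_mult: "x \<in> carrier W \<Longrightarrow> y \<in> carrier W \<Longrightarrow> \<rho> (x \<otimes>\<^bsub>W\<^esub> y) v = \<rho> x (\<rho> y v)"
  and rho_inj: "inj_on \<rho> (carrier W)"
  and rho_hyperplane: "w \<in> carrier W \<Longrightarrow> hyperplane scale (fixed_space \<rho> w) \<longleftrightarrow> w \<in> T"
  and finite_dim: "\<exists>B. finite_dimensional_vector_space scale B"
  using rep by (auto simp: reflection_faithful_rep_def)

lemma rho_inv: "x \<in> carrier W \<Longrightarrow> \<rho> x (\<rho> (inv\<^bsub>W\<^esub> x) v) = v"
  and rho_inv': "x \<in> carrier W \<Longrightarrow> \<rho> (inv\<^bsub>W\<^esub> x) (\<rho> x v) = v"
  by (metis W.inv_closed W.r_inv W.l_inv rho_mult rho_one id_apply)+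

lemma kernel_hyperplane:
  assumes "lam \<in> dual" "lam \<noteq> (\<lambda>_. 0)"
  shows "hyperplane scale {v. lam v = 0}"
proof -
  obtain B where "finite_dimensional_vector_space scale B" using finite_dim by blast
  then interpret F: finite_dimensional_vector_space scale B .
  have sub: "subspace {v. lam v = 0}"
    using assms(1) dual_zero by (auto simp: subspace_def dual_iff)
  obtain b where b: "lam b \<noteq> 0" using assms(2) by auto
  have sp: "span {v. lam v = 0} = {v. lam v = 0}" using sub by (simp add: span_eq_iff)
  have "v \<in> span (insert b {v. lam v = 0})" for v
  proof -
    define c where "c = lam v / lam b"
    have "lam (v - scale c b) = lam v - c * lam b"
      using assms(1) by (simp add: dual_diff) (simp add: dual_iff)
    then have "v - scale c b \<in> span {v. lam v = 0}" using b by (simp add: c_def sp)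
    then show ?thesis by (simp add: span_insert) blast
  qed
  then have "span (insert b {v. lam v = 0}) = UNIV" by auto
  then have "dim UNIV = dim (insert b {v. lam v = 0})" by (metis dim_span)
  also have "\<dots> = dim {v. lam v = 0} + 1" using F.dim_insert[of b "{v. lam v = 0}"] b unfolding sp by simp
  finally show ?thesis using sub by (simp add: hyperplane_def)
qed

lemma fixed_subspace: "w \<in> carrier W \<Longrightarrow> subspace (fixed_space \<rho> w)"
proof -
  assume "w \<in> carrier W"
  then have L: "\<rho> w (x + y) = \<rho> w x + \<rho> w y" "\<rho> w (scale c x) = scale c (\<rho> w x)" for x y c
    using rho_linear[unfolded linear_endo_iff] by auto
  have "\<rho> w 0 = 0" using L(2)[of 0 0] by simp
  then show ?thesis by (auto simp: subspace_def fixed_space_def L)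
qed

text \<open>The fixed space contains the hyperplane of \<open>lam\<close>. If it were larger it
  would be all of V, which faithfulness excludes; so it is that hyperplane, and reflection
  faithfulness makes \<open>w\<close> a reflection.\<close>

lemma fixes_kernel_imp_reflection:
  assumes w: "w \<in> carrier W" "w \<noteq> \<one>\<^bsub>W\<^esub>" and lam: "lam \<in> dual" "lam \<noteq> (\<lambda>_. 0)"
    and fx: "\<And>v. lam v = 0 \<Longrightarrow> \<rho> w v = v"
  shows "w \<in> T"
proof -
  have "fixed_space \<rho> w = {v. lam v = 0}"
  proof (rule ccontr)
    assume "fixed_space \<rho> w \<noteq> {v. lam v = 0}"
    then obtain b where b: "\<rho> w b = b" "lam b \<noteq> 0" using fx by (auto simp: fixed_space_def)
    have sub: "subspace (fixed_space \<rho> w)" using fixed_subspace w(1) .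
    have "v \<in> fixed_space \<rho> w" for v
    proof -
      define c where "c = lam v / lam b"
      have "lam (v - scale c b) = lam v - c * lam b"
        using lam(1) by (simp add: dual_diff) (simp add: dual_iff)
      then have "v - scale c b \<in> fixed_space \<rho> w" using b fx by (simp add: c_def fixed_space_def)
      moreover have "scale c b \<in> fixed_space \<rho> w" using sub b(1) by (auto simp: subspace_def fixed_space_def)
      ultimately have "(v - scale c b) + scale c b \<in> fixed_space \<rho> w" using sub by (auto simp only: subspace_def)
      then show ?thesis by simp
    qed
    then have "\<rho> w = \<rho> \<one>\<^bsub>W\<^esub>" by (auto simp: fixed_space_def rho_one)
    then show False using rho_inj w by (auto simp: inj_on_def)
  qed
  then show ?thesis using kernel_hyperplane[OF lam] rho_hyperplane[OF w(1)] by simp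
qed

text \<open>Otherwise t t' would be a nontrivial element fixing the hyperplane, hence a reflection,
  although its length is even. Thus over a given hyperplane each x is glued to at most one other
  element.\<close>

lemma kernel_reflection_unique:
  assumes t: "t \<in> T" "t' \<in> T" and lam: "lam \<in> dual" "lam \<noteq> (\<lambda>_. 0)"
    and fx: "\<And>v. lam v = 0 \<Longrightarrow> \<rho> t v = v" "\<And>v. lam v = 0 \<Longrightarrow> \<rho> t' v = v"
  shows "t = t'"
proof (rule ccontr)
  assume "t \<noteq> t'"
  have c: "t \<in> carrier W" "t' \<in> carrier W" using t T_carrier by auto
  have "t \<otimes>\<^bsub>W\<^esub> t' \<noteq> \<one>\<^bsub>W\<^esub>"
  proof
    assume "t \<otimes>\<^bsub>W\<^esub> t' = \<one>\<^bsub>W\<^esub>"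
    then have "t \<otimes>\<^bsub>W\<^esub> t' = t \<otimes>\<^bsub>W\<^esub> t" using T_square[OF t(1)] by simp
    then show False using c \<open>t \<noteq> t'\<close> by simp
  qed
  then have "t \<otimes>\<^bsub>W\<^esub> t' \<in> T"
    using c fx by (intro fixes_kernel_imp_reflection[OF _ _ lam]) (auto simp: rho_mult)
  then show False using T_odd[of "t \<otimes>\<^bsub>W\<^esub> t'"] even_len_mult[OF c] T_odd[OF t(1)] T_odd[OF t(2)] by simp
qed

lemma alpha_dual: "t \<in> T \<Longrightarrow> \<alpha> t \<in> dual" "t \<in> T \<Longrightarrow> \<alpha> t \<noteq> (\<lambda>_. 0)"
  using alpha by auto

text \<open>The hyperplane fixed by t lies in the kernel of \<open>\<alpha> t\<close>, and both have
  codimension one.\<close>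

lemma alpha_zero_iff: "t \<in> T \<Longrightarrow> \<alpha> t v = 0 \<longleftrightarrow> \<rho> t v = v"
proof -
  assume t: "t \<in> T"
  obtain B where "finite_dimensional_vector_space scale B" using finite_dim by blast
  then interpret F: finite_dimensional_vector_space scale B .
  have "fixed_space \<rho> t = {v. \<alpha> t v = 0}"
  proof (rule F.subspace_dim_equal)
    show "subspace (fixed_space \<rho> t)" using fixed_subspace T_carrier t by blast
    have h: "hyperplane scale {v. \<alpha> t v = 0}" using kernel_hyperplane alpha_dual t by blast
    then show "subspace {v. \<alpha> t v = 0}" by (simp add: hyperplane_def)
    show "fixed_space \<rho> t \<subseteq> {v. \<alpha> t v = 0}" using alpha t by auto
    have "hyperplane scale (fixed_space \<rho> t)" using rho_hyperplane T_carrier t by blast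
    then show "dim {v. \<alpha> t v = 0} \<le> dim (fixed_space \<rho> t)" using h by (simp add: hyperplane_def)
  qed
  then show ?thesis by (auto simp: fixed_space_def)
qed

text \<open>Over the hyperplane fixed by t the graphs of x and t x coincide; this is the origin of
  the congruences that define Z.\<close>

lemma rho_inv_reflect: "t \<in> T \<Longrightarrow> x \<in> carrier W \<Longrightarrow> \<rho> (inv\<^bsub>W\<^esub> (t \<otimes>\<^bsub>W\<^esub> x)) v = \<rho> (inv\<^bsub>W\<^esub> x) (\<rho> t v)"
proof -
  assume t: "t \<in> T" and x: "x \<in> carrier W"
  have "inv\<^bsub>W\<^esub> t = t" using T_square[OF t] T_carrier[OF t] W.inv_equality by blast
  then show ?thesis using x T_carrier[OF t] by (simp add: W.inv_mult_group rho_mult)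
qed

text \<open>A function on Gr(x) written in the second coordinate. This identifies the regular
  functions on Gr(x) with S, the left factor being twisted by x.\<close>

definition res :: "'w \<Rightarrow> ('v \<times> 'v \<Rightarrow> 'k) \<Rightarrow> 'v \<Rightarrow> 'k" where
  "res x F = (\<lambda>v. F (\<rho> (inv\<^bsub>W\<^esub> x) v, v))"

section \<open>Restriction to graphs and equations of graphs\<close>

lemma res_rt [simp]: "res x (rt s) = s"
  by (simp add: res_def rt_def)

lemma res_simps [simp]:
  "res x (\<lambda>p. F p + G p) = (\<lambda>v. res x F v + res x G v)"
  "res x (\<lambda>p. F p - G p) = (\<lambda>v. res x F v - res x G v)"
  "res x (\<lambda>p. F p * G p) = (\<lambda>v. res x F v * res x G v)"
  "res x (\<lambda>p. - F p) = (\<lambda>v. - res x F v)"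
  "res x (\<lambda>p. c) = (\<lambda>v. c)"
  by (auto simp: res_def)

lemma res_S: "F \<in> SS \<Longrightarrow> x \<in> carrier W \<Longrightarrow> res x F \<in> S"
  unfolding SS_carrier
  by (erule fun_span_subset[where Y = "{F. res x F \<in> S}", THEN CollectD])
    (auto simp: res_def intro!: mult_S compose_S[OF _ rho_linear])

lemma res_Sp: "F \<in> SSp n \<Longrightarrow> x \<in> carrier W \<Longrightarrow> res x F \<in> Sp n"
  unfolding SSp_def
  by (erule fun_span_subset[where Y = "{F. res x F \<in> Sp n}", THEN CollectD])
    (auto simp: res_def intro!: mult_Sp compose_Sp[OF _ rho_linear] add_Sp)

text \<open>Wherever \<open>\<alpha> t\<close> vanishes, both values are taken at the same point of
  V x V. So the restrictions of one function to all graphs form an element of Z.\<close>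

lemma res_reflect_dvd: "F \<in> SS \<Longrightarrow> x \<in> carrier W \<Longrightarrow> t \<in> T \<Longrightarrow>
    Sdvd (\<alpha> t) (\<lambda>v. res x F v - res (t \<otimes>\<^bsub>W\<^esub> x) F v)"
  using alpha_dual alpha_zero_iff rho_inv_reflect T_carrier
  by (subst Sdvd_linear_iff) (auto intro!: diff_S res_S, auto simp: res_def)

text \<open>For linear f, one of the linear equations of Gr(y). On every graph it restricts to a
  linear form, which is why the denominators below are products of linear forms.\<close>

definition sep :: "'w \<Rightarrow> ('v \<Rightarrow> 'k) \<Rightarrow> 'v \<times> 'v \<Rightarrow> 'k" where
  "sep y f = (\<lambda>(u, v). f u - f (\<rho> (inv\<^bsub>W\<^esub> y) v))"

lemma sep_SSp: "f \<in> dual \<Longrightarrow> y \<in> carrier W \<Longrightarrow> sep y f \<in> SSp 2"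
proof -
  assume f: "f \<in> dual" and y: "y \<in> carrier W"
  have 1: "(\<lambda>(u, v). f u * 1) \<in> SSp 2" using tensor_SSp[OF dual_Sp[OF f] const_Sp[of 1]] by simp
  have 2: "rt (\<lambda>v. f (\<rho> (inv\<^bsub>W\<^esub> y) v)) \<in> SSp 2"
    using f y by (intro rt_SSp dual_Sp dual_compose[OF _ rho_linear]) auto
  show ?thesis using diff_SSp[OF 1 2] by (simp add: sep_def rt_def case_prod_unfold)
qed

lemma res_sep: "res x (sep y f) = (\<lambda>v. f (\<rho> (inv\<^bsub>W\<^esub> x) v) - f (\<rho> (inv\<^bsub>W\<^esub> y) v))"
  by (simp add: res_def sep_def)

lemma res_sep_self [simp]: "res y (sep y f) = (\<lambda>v. 0)"
  by (simp add: res_sep)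

lemma res_sep_dual: "f \<in> dual \<Longrightarrow> x \<in> carrier W \<Longrightarrow> y \<in> carrier W \<Longrightarrow> res x (sep y f) \<in> dual"
  unfolding res_sep
  by (rule dual_sub[OF dual_compose[OF _ rho_linear] dual_compose[OF _ rho_linear]]) auto

lemma sep_nonzero:
  assumes "x \<in> carrier W" "y \<in> carrier W" "x \<noteq> y"
  shows "\<exists>f \<in> dual. res x (sep y f) \<noteq> (\<lambda>_. 0)"
proof -
  have "\<rho> (inv\<^bsub>W\<^esub> x) \<noteq> \<rho> (inv\<^bsub>W\<^esub> y)"
    using assms rho_inj unfolding inj_on_def by (metis W.inv_closed W.inv_inv)
  then obtain v where "\<rho> (inv\<^bsub>W\<^esub> x) v - \<rho> (inv\<^bsub>W\<^esub> y) v \<noteq> 0" by auto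
  then obtain f where f: "f \<in> dual" "f (\<rho> (inv\<^bsub>W\<^esub> x) v - \<rho> (inv\<^bsub>W\<^esub> y) v) \<noteq> 0" using dual_separates by blast
  then have "res x (sep y f) v \<noteq> 0" by (simp add: res_sep dual_diff)
  then show ?thesis using f(1) by (intro bexI[of _ f]) (auto simp: fun_eq_iff)
qed

text \<open>If every equation of Gr(y) vanishes on the part of Gr(x) over the hyperplane of
  \<open>lam\<close>, then x^-1 and y^-1 agree on that hyperplane, and y x^-1 fixes it
  pointwise.\<close>

lemma sep_dvd_imp_reflection:
  assumes xy: "x \<in> carrier W" "y \<in> carrier W" "x \<noteq> y" and lam: "lam \<in> dual" "lam \<noteq> (\<lambda>_. 0)"
    and dvd: "\<And>f. f \<in> dual \<Longrightarrow> Sdvd lam (res x (sep y f))"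
  shows "\<exists>t \<in> T. y = t \<otimes>\<^bsub>W\<^esub> x \<and> (\<forall>v. lam v = 0 \<longrightarrow> \<rho> t v = v)"
proof -
  define t where "t = y \<otimes>\<^bsub>W\<^esub> inv\<^bsub>W\<^esub> x"
  have t: "t \<in> carrier W" "y = t \<otimes>\<^bsub>W\<^esub> x" using xy by (auto simp: t_def W.m_assoc)
  have "t \<noteq> \<one>\<^bsub>W\<^esub>" using t xy by auto
  have fx: "\<rho> t v = v" if v: "lam v = 0" for v
  proof -
    have "f (\<rho> (inv\<^bsub>W\<^esub> x) v - \<rho> (inv\<^bsub>W\<^esub> y) v) = 0" if f: "f \<in> dual" for f
    proof -
      have "res x (sep y f) v = 0"
        using dvd[OF f] Sdvd_linear_iff[OF lam dual_S[OF res_sep_dual[OF f xy(1,2)]]] v by blast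
      then show ?thesis using f by (simp add: res_sep dual_diff)
    qed
    then have "\<rho> (inv\<^bsub>W\<^esub> x) v - \<rho> (inv\<^bsub>W\<^esub> y) v = 0" using dual_separates by blast
    then have "\<rho> (inv\<^bsub>W\<^esub> x) v = \<rho> (inv\<^bsub>W\<^esub> y) v" by simp
    then show ?thesis using xy by (simp add: t_def rho_mult rho_inv)
  qed
  then have "t \<in> T" using fixes_kernel_imp_reflection[OF t(1) \<open>t \<noteq> \<one>\<^bsub>W\<^esub>\<close> lam] by blast
  then show ?thesis using t fx by blast
qed

text \<open>The equations of Gr(t x) restrict on Gr(x) to linear forms that vanish on the hyperplane
  of t, hence to multiples of \<open>\<alpha> t\<close>. One of them is nonzero because the graphs
  differ.\<close>

lemma res_sep_reflect:
  assumes t: "t \<in> T" and x: "x \<in> carrier W"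
  shows "\<exists>f \<in> dual. \<exists>c. c \<noteq> 0 \<and> res x (sep (t \<otimes>\<^bsub>W\<^esub> x) f) = (\<lambda>v. c * \<alpha> t v)"
proof -
  have tx: "t \<otimes>\<^bsub>W\<^esub> x \<in> carrier W" "x \<noteq> t \<otimes>\<^bsub>W\<^esub> x"
    using t x T_carrier T_not_one by auto
  obtain f where f: "f \<in> dual" "res x (sep (t \<otimes>\<^bsub>W\<^esub> x) f) \<noteq> (\<lambda>_. 0)" using sep_nonzero[OF x tx] by blast
  define g where "g = res x (sep (t \<otimes>\<^bsub>W\<^esub> x) f)"
  have g: "g \<in> dual" unfolding g_def using res_sep_dual f x tx by blast
  have g0: "g v = 0" if "\<alpha> t v = 0" for v
    using that alpha_zero_iff[OF t] by (simp add: g_def res_sep rho_inv_reflect t x)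
  obtain b where b: "\<alpha> t b \<noteq> 0" using alpha_dual[OF t] by auto
  have "g v = g b / \<alpha> t b * \<alpha> t v" for v
  proof -
    have "\<alpha> t (v - scale (\<alpha> t v / \<alpha> t b) b) = 0"
      using alpha_dual(1)[OF t] b by (simp add: dual_diff) (simp add: dual_iff)
    from g0[OF this] show ?thesis using g by (simp add: dual_diff) (simp add: dual_iff)
  qed
  then obtain c where ge: "g = (\<lambda>v. c * \<alpha> t v)" by blast
  moreover have "c \<noteq> 0"
  proof
    assume "c = 0"
    then have "g = (\<lambda>_. 0)" by (subst ge) simp
    then show False using f(2) unfolding g_def by blast
  qed
  ultimately have "c \<noteq> 0 \<and> res x (sep (t \<otimes>\<^bsub>W\<^esub> x) f) = (\<lambda>v. c * \<alpha> t v)" by (simp add: g_def)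
  then show ?thesis using f(1) by (intro bexI[of _ f] exI[of _ c])
qed

text \<open>Multiply one equation for each graph over \<open>B\<close>, chosen not to vanish
  identically on Gr(x).\<close>

lemma separate_all:
  assumes "finite B" "B \<subseteq> carrier W" "x \<in> carrier W" "x \<notin> B"
  shows "\<exists>H e. H \<in> SSp e \<and> linprod (res x H) \<and> (\<forall>y \<in> B. res y H = (\<lambda>_. 0))"
  using assms
proof (induction rule: finite_induct)
  case empty
  then show ?case by (intro exI[of _ "\<lambda>_. 1"] exI[of _ 0]) (auto intro: one_SSp linprod_one)
next
  case (insert y B)
  then obtain H e where H: "H \<in> SSp e" "linprod (res x H)" "\<And>y. y \<in> B \<Longrightarrow> res y H = (\<lambda>_. 0)" by auto
  obtain f where f: "f \<in> dual" "res x (sep y f) \<noteq> (\<lambda>_. 0)" using sep_nonzero[of x y] insert.prems by auto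
  have yW: "y \<in> carrier W" using insert.prems by auto
  have "(\<lambda>p. sep y f p * H p) \<in> SSp (2 + e)" using mult_SSp sep_SSp[OF f(1) yW] H(1) by blast
  moreover have "linprod (\<lambda>v. res x (sep y f) v * res x H v)"
    using linprod_mult[OF res_sep_dual[OF f(1) insert.prems(2) yW] f(2) H(2)] .
  ultimately show ?case using H(3) by (intro exI[of _ "\<lambda>p. sep y f p * H p"] exI[of _ "2 + e"]) auto
qed

text \<open>The same product as in \<open>separate_all\<close>, with each factor not divisible by
  \<open>lam\<close> on Gr(x); as \<open>lam\<close> is prime, neither is the product.\<close>

lemma separate_mod:
  assumes "finite B" "B \<subseteq> carrier W" "x \<in> carrier W" and lam: "lam \<in> dual" "lam \<noteq> (\<lambda>_. 0)"
    and "\<And>y. y \<in> B \<Longrightarrow> \<exists>f \<in> dual. \<not> Sdvd lam (res x (sep y f))"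
  shows "\<exists>H \<in> SS. \<not> Sdvd lam (res x H) \<and> (\<forall>y \<in> B. res y H = (\<lambda>_. 0))"
  using assms
proof (induction rule: finite_induct)
  case empty
  have "\<not> Sdvd lam (\<lambda>_. 1)" using Sdvd_linear_iff[OF lam const_S[of 1]] dual_zero[OF lam(1)] by auto
  then show ?case by (intro bexI[of _ "\<lambda>_. 1"]) auto
next
  case (insert y B)
  then obtain H where H: "H \<in> SS" "\<not> Sdvd lam (res x H)" "\<And>y. y \<in> B \<Longrightarrow> res y H = (\<lambda>_. 0)" by auto
  obtain f where f: "f \<in> dual" "\<not> Sdvd lam (res x (sep y f))" using insert.prems(5) by auto
  have yW: "y \<in> carrier W" using insert.prems by auto
  have s: "sep y f \<in> SS" using sep_SSp[OF f(1) yW] SSp_SS by blast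
  have "\<not> Sdvd lam (\<lambda>v. res x (sep y f) v * res x H v)"
    using linear_form_prime[OF lam res_S[OF s] res_S[OF H(1)]] insert.prems f H by blast
  then show ?case using H s by (intro bexI[of _ "\<lambda>p. sep y f p * H p"]) auto
qed

text \<open>Newton interpolation on the graphs \<open>Gr(x)\<close>: values are corrected one point at a time.\<close>

lemma interpolation:
  assumes "finite B" "B \<subseteq> carrier W" "\<And>x. x \<in> B \<Longrightarrow> z x \<in> S"
  shows "\<exists>D e G. linprod D \<and> D \<in> Sp e \<and> G \<in> SS \<and> (\<forall>x \<in> B. res x G = (\<lambda>v. D v * z x v)) \<and>
    (\<forall>d. (\<forall>x \<in> B. z x \<in> Sp d) \<longrightarrow> G \<in> SSp (d + e))"
  using assms
proof (induction rule: finite_induct)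
  case empty
  show ?case by (intro exI[of _ "\<lambda>_. 1"] exI[of _ 0] exI[of _ "\<lambda>_. 0"]) (auto intro: linprod_one const_Sp)
next
  case (insert x B)
  then obtain D e G where G: "linprod D" "D \<in> Sp e" "G \<in> SS" "\<And>x. x \<in> B \<Longrightarrow> res x G = (\<lambda>v. D v * z x v)"
    "\<And>d. (\<forall>x \<in> B. z x \<in> Sp d) \<longrightarrow> G \<in> SSp (d + e)" by auto
  have xW: "x \<in> carrier W" "B \<subseteq> carrier W" using insert.prems by auto
  obtain H eH where H: "H \<in> SSp eH" "linprod (res x H)" "\<And>y. y \<in> B \<Longrightarrow> res y H = (\<lambda>_. 0)"
    using separate_all[OF insert.hyps(1) xW(2) xW(1) insert.hyps(2)] by auto
  define u where "u = res x H"
  \<comment> \<open>The error of G at the new point. It is put back with the factor H, which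
    vanishes at all old points; the common denominator grows from D to u D.\<close>
  define \<delta> where "\<delta> = (\<lambda>v. D v * z x v - res x G v)"
  define G' where "G' = (\<lambda>p. rt u p * G p + rt \<delta> p * H p)"
  have uS: "u \<in> S" "u \<in> Sp eH" unfolding u_def using H xW SSp_SS res_S res_Sp by auto
  have dS: "\<delta> \<in> S" unfolding \<delta>_def using G xW res_S linprod_S insert.prems by auto
  have "G' \<in> SS" unfolding G'_def using uS dS G H SSp_SS by auto
  moreover have "linprod (\<lambda>v. u v * D v)" using linprod_prod H(2) G(1) u_def by simp
  moreover have "(\<lambda>v. u v * D v) \<in> Sp (eH + e)" using mult_Sp uS G by blast
  moreover have "res y G' = (\<lambda>v. u v * D v * z y v)" if "y \<in> insert x B" for y
    using that G(4) H(3) by (auto simp: G'_def \<delta>_def u_def algebra_simps)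
  moreover have "G' \<in> SSp (d + (eH + e))" if z: "\<And>y. y \<in> insert x B \<Longrightarrow> z y \<in> Sp d" for d
  proof -
    have Gd: "G \<in> SSp (d + e)" using G(5) z by blast
    have "(\<lambda>v. D v * z x v) \<in> Sp (d + e)" using mult_Sp[OF G(2) z[of x]] by (simp add: add.commute)
    then have "\<delta> \<in> Sp (d + e)" unfolding \<delta>_def using res_Sp[OF Gd xW(1)] diff_Sp by blast
    then have 1: "(\<lambda>p. rt \<delta> p * H p) \<in> SSp (d + e + eH)" using mult_SSp rt_SSp H(1) by blast
    have "(\<lambda>p. rt u p * G p) \<in> SSp (eH + (d + e))" using mult_SSp rt_SSp uS(2) Gd by blast
    then have 2: "(\<lambda>p. rt u p * G p) \<in> SSp (d + e + eH)" by (simp add: algebra_simps)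
    show ?thesis using add_SSp[OF 2 1] by (simp add: G'_def algebra_simps)
  qed
  ultimately show ?case
    by (intro exI[of _ "\<lambda>v. u v * D v"] exI[of _ "eH + e"] exI[of _ G'] conjI) auto
qed

text \<open>Away from a hyperplane only pairs \<open>x, t x\<close> with \<open>t\<close> the reflection in it remain to be glued,
  and the congruences defining \<open>Z\<close> allow for this.\<close>

lemma interpolation_mod:
  assumes "finite B" "B \<subseteq> carrier W" "\<And>x. x \<in> B \<Longrightarrow> z x \<in> S"
    and lam: "lam \<in> dual" "lam \<noteq> (\<lambda>_. 0)"
    and "\<And>x t. x \<in> B \<Longrightarrow> t \<in> T \<Longrightarrow> t \<otimes>\<^bsub>W\<^esub> x \<in> B \<Longrightarrow> Sdvd (\<alpha> t) (\<lambda>v. z x v - z (t \<otimes>\<^bsub>W\<^esub> x) v)"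
  shows "\<exists>s \<in> S. \<not> Sdvd lam s \<and> (\<exists>G \<in> SS. \<forall>x \<in> B. res x G = (\<lambda>v. s v * z x v))"
  using assms
proof (induction rule: finite_induct)
  case empty
  have "\<not> Sdvd lam (\<lambda>_. 1)" using Sdvd_linear_iff[OF lam const_S[of 1]] dual_zero[OF lam(1)] by auto
  then show ?case by (intro bexI[of _ "\<lambda>_. 1"]) auto
next
  case (insert x B)
  have "\<exists>s \<in> S. \<not> Sdvd lam s \<and> (\<exists>G \<in> SS. \<forall>x \<in> B. res x G = (\<lambda>v. s v * z x v))"
    using insert.prems by (intro insert.IH) auto
  then obtain s G where G: "s \<in> S" "\<not> Sdvd lam s" "G \<in> SS" "\<And>x. x \<in> B \<Longrightarrow> res x G = (\<lambda>v. s v * z x v)" by blast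
  have xW: "x \<in> carrier W" "B \<subseteq> carrier W" and zx: "z x \<in> S" using insert.prems by auto
  define \<delta> where "\<delta> = (\<lambda>v. s v * z x v - res x G v)"
  have dS: "\<delta> \<in> S" unfolding \<delta>_def using G xW res_S zx by auto
  show ?case
  \<comment> \<open>If every earlier graph has an equation that is not divisible by
    \<open>lam\<close> on Gr(x), the correction runs as in \<open>interpolation\<close>. Otherwise
    some y is glued to x over the hyperplane of \<open>lam\<close>.\<close>
  proof (cases "\<exists>y \<in> B. \<forall>f \<in> dual. Sdvd lam (res x (sep y f))")
    case False
    then obtain H where H: "H \<in> SS" "\<not> Sdvd lam (res x H)" "\<And>y. y \<in> B \<Longrightarrow> res y H = (\<lambda>_. 0)"
      using separate_mod[OF insert.hyps(1) xW(2,1) lam] by blast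
    define u where "u = res x H"
    have uS: "u \<in> S" unfolding u_def using H xW res_S by auto
    have "(\<lambda>p. rt u p * G p + rt \<delta> p * H p) \<in> SS" using uS dS G H by auto
    moreover have "res y (\<lambda>p. rt u p * G p + rt \<delta> p * H p) = (\<lambda>v. u v * s v * z y v)" if "y \<in> insert x B" for y
      using that G(4) H(3) by (auto simp: \<delta>_def u_def algebra_simps)
    moreover have "\<not> Sdvd lam (\<lambda>v. u v * s v)" using linear_form_prime[OF lam uS G(1)] H(2) G(2) u_def by blast
    moreover have "(\<lambda>v. u v * s v) \<in> S" using uS G by auto
    ultimately show ?thesis by blast
  next
    case True
    then obtain y where y: "y \<in> B" "\<And>f. f \<in> dual \<Longrightarrow> Sdvd lam (res x (sep y f))" by blast
    have yW: "y \<in> carrier W" "x \<noteq> y" using y xW insert.hyps by auto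
    obtain t where t: "t \<in> T" "y = t \<otimes>\<^bsub>W\<^esub> x" "\<And>v. lam v = 0 \<Longrightarrow> \<rho> t v = v"
      using sep_dvd_imp_reflection[OF xW(1) yW lam y(2)] by blast
    \<comment> \<open>All other points of \<open>B\<close> can still be separated modulo
      \<open>lam\<close>: a second obstruction y' would give a second reflection fixing the same
      hyperplane.\<close>
    have "\<exists>H \<in> SS. \<not> Sdvd lam (res x H) \<and> (\<forall>y \<in> B - {y}. res y H = (\<lambda>_. 0))"
    proof (rule separate_mod[OF _ _ xW(1) lam])
      fix y' assume y': "y' \<in> B - {y}"
      show "\<exists>f \<in> dual. \<not> Sdvd lam (res x (sep y' f))"
      proof (rule ccontr)
        assume "\<not> ?thesis"
        then obtain t' where "t' \<in> T" "y' = t' \<otimes>\<^bsub>W\<^esub> x" "\<And>v. lam v = 0 \<Longrightarrow> \<rho> t' v = v"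
          using sep_dvd_imp_reflection[OF xW(1) _ _ lam, of y'] y' xW(2) insert.hyps(2) by blast
        then show False using kernel_reflection_unique[OF t(1) _ lam t(3), of t'] t(2) y' by auto
      qed
    qed (use insert.hyps xW in auto)
    then obtain H where H: "H \<in> SS" "\<not> Sdvd lam (res x H)" "\<And>y'. y' \<in> B \<Longrightarrow> y' \<noteq> y \<Longrightarrow> res y' H = (\<lambda>_. 0)" by auto
    obtain f c where f: "f \<in> dual" "c \<noteq> 0" "res x (sep y f) = (\<lambda>v. c * \<alpha> t v)"
      using res_sep_reflect[OF t(1) xW(1)] t(2) by blast
    \<comment> \<open>On the hyperplane of t the required values at x and y = t x agree by the
      congruence, and so do the restrictions of G. As G is correct at y, its error at x vanishes
      there.\<close>
    have "Sdvd (\<alpha> t) \<delta>"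
    proof -
      have "z x v = z y v" "res x G v = res y G v" if "\<alpha> t v = 0" for v
        using insert.prems(5)[of x t] t y(1) res_reflect_dvd[OF G(3) xW(1) t(1)] that
        by (auto simp: Sdvd_def fun_eq_iff) (metis eq_iff_diff_eq_0 mult_zero_left)+
      then show ?thesis using Sdvd_linear_iff[OF alpha_dual[OF t(1)] dS] G(4)[OF y(1)] by (simp add: \<delta>_def)
    qed
    then obtain k where k: "k \<in> S" "\<delta> = (\<lambda>v. \<alpha> t v * k v)" by (auto simp: Sdvd_def)
    define u where "u = (\<lambda>v. c * res x H v)"
    have uS: "u \<in> S" unfolding u_def using mult_S[OF const_S res_S[OF H(1) xW(1)]] .
    have sepS: "sep y f \<in> SS" using sep_SSp[OF f(1) yW(1)] SSp_SS by blast
    \<comment> \<open>The equation \<open>sep y f\<close> vanishes on Gr(y) and restricts to c times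
      \<open>\<alpha> t\<close> on Gr(x). The error is already divisible by
      \<open>\<alpha> t\<close>, so its cofactor \<open>k\<close> is inserted; the constant c is
      absorbed in \<open>u\<close>.\<close>
    define G' where "G' = (\<lambda>p. rt u p * G p + rt k p * (H p * sep y f p))"
    have "G' \<in> SS" unfolding G'_def using uS k G H sepS by auto
    moreover have "res y' G' = (\<lambda>v. u v * s v * z y' v)" if y': "y' \<in> insert x B" for y'
    proof (cases "y' = x")
      case True
      have "u v * res x G v + k v * (res x H v * (c * \<alpha> t v)) = u v * (res x G v + \<alpha> t v * k v)" for v
        by (simp add: u_def algebra_simps)
      moreover have "res x G v + \<alpha> t v * k v = s v * z x v" for v
        using fun_cong[OF k(2), of v] by (simp add: \<delta>_def algebra_simps)
      ultimately have "u v * res x G v + k v * (res x H v * (c * \<alpha> t v)) = u v * s v * z x v" for v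
        by (simp add: mult.assoc)
      then show ?thesis by (simp add: True G'_def f(3))
    next
      case False
      then show ?thesis using that G(4) H(3) by (cases "y' = y") (auto simp: G'_def algebra_simps)
    qed
    moreover have "\<not> Sdvd lam u"
    proof
      assume "Sdvd lam u"
      then obtain h where h: "h \<in> S" "u = (\<lambda>v. lam v * h v)" by (auto simp: Sdvd_def)
      have "res x H = (\<lambda>v. lam v * ((1 / c) * h v))"
        using fun_cong[OF h(2)] f(2) by (auto simp: u_def field_simps)
      moreover have "(\<lambda>v. (1 / c) * h v) \<in> S" using mult_S[OF const_S h(1)] .
      ultimately have "Sdvd lam (res x H)" unfolding Sdvd_def
        by (intro bexI[of _ "\<lambda>v. (1 / c) * h v"])
      then show False using H(2) by simp
    qed
    then have "\<not> Sdvd lam (\<lambda>v. u v * s v)" using linear_form_prime[OF lam uS G(1)] G(2) by blast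
    moreover have "(\<lambda>v. u v * s v) \<in> S" using uS G by auto
    ultimately show ?thesis by blast
  qed
qed

end

section \<open>Relative homogeneous bases\<close>

locale graded_mod =
  fixes R :: "'a gring" and M :: "('a, 'm) gmodule"
  assumes graded: "graded_module R M" and rpart_carrier: "rpart R i \<subseteq> carrier R"
begin

sublocale Module.module R M
  using graded by (simp add: graded_module_def)

section \<open>Homogeneous components\<close>

lemma part_subgroup: "additive_subgroup (part M n) M"
  and part_smult: "r \<in> rpart R i \<Longrightarrow> m \<in> part M j \<Longrightarrow> r \<odot>\<^bsub>M\<^esub> m \<in> part M (i + j)"
  and part_unique: "m \<in> carrier M \<Longrightarrow> \<exists>!c. (\<forall>n. c n \<in> part M n) \<and> finite {n. c n \<noteq> \<zero>\<^bsub>M\<^esub>} \<and>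
        finsum M c {n. c n \<noteq> \<zero>\<^bsub>M\<^esub>} = m"
  using graded by (auto simp: graded_module_def)

lemma part_carrier: "m \<in> part M n \<Longrightarrow> m \<in> carrier M"
  using additive_subgroup.a_subset[OF part_subgroup] by blast

lemma part_zero [simp]: "\<zero>\<^bsub>M\<^esub> \<in> part M n"
  and part_add: "x \<in> part M n \<Longrightarrow> y \<in> part M n \<Longrightarrow> x \<oplus>\<^bsub>M\<^esub> y \<in> part M n"
  and part_minus: "x \<in> part M n \<Longrightarrow> \<ominus>\<^bsub>M\<^esub> x \<in> part M n"
  using additive_subgroup.zero_closed[OF part_subgroup] additive_subgroup.a_closed[OF part_subgroup]
    additive_subgroup.a_inv_closed[OF part_subgroup] by auto

lemma finsum_part:
  assumes "finite J" "\<And>j. j \<in> J \<Longrightarrow> f j \<in> part M n"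
  shows "(\<Oplus>\<^bsub>M\<^esub>j \<in> J. f j) \<in> part M n"
  using assms
proof (induction rule: finite_induct)
  case (insert x F)
  then show ?case by (subst finsum_insert) (auto intro: part_add part_carrier)
qed simp

definition hc :: "int \<Rightarrow> 'm \<Rightarrow> 'm" where
  "hc n m = (THE c. (\<forall>n. c n \<in> part M n) \<and> finite {n. c n \<noteq> \<zero>\<^bsub>M\<^esub>} \<and>
        finsum M c {n. c n \<noteq> \<zero>\<^bsub>M\<^esub>} = m) n"

lemma hc_props:
  assumes "m \<in> carrier M"
  shows "hc n m \<in> part M n" "finite {n. hc n m \<noteq> \<zero>\<^bsub>M\<^esub>}"
    "finsum M (\<lambda>n. hc n m) {n. hc n m \<noteq> \<zero>\<^bsub>M\<^esub>} = m"
  using theI'[OF part_unique[OF assms]] unfolding hc_def by auto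

lemma hc_closed [simp, intro]: "m \<in> carrier M \<Longrightarrow> hc n m \<in> carrier M"
  using hc_props(1) part_carrier by blast

lemma hc_unique:
  assumes K: "finite K" "\<And>n. n \<in> K \<Longrightarrow> c n \<in> part M n" and m: "m = finsum M c K"
  shows "hc n m = (if n \<in> K then c n else \<zero>\<^bsub>M\<^esub>)"
proof -
  define c' where "c' n = (if n \<in> K then c n else \<zero>\<^bsub>M\<^esub>)" for n
  have cc: "c \<in> K \<rightarrow> carrier M" using K(2) part_carrier by auto
  have sub: "{n. c' n \<noteq> \<zero>\<^bsub>M\<^esub>} \<subseteq> K" by (auto simp: c'_def)
  have "finsum M c' {n. c' n \<noteq> \<zero>\<^bsub>M\<^esub>} = finsum M c K"
    by (rule add.finprod_mono_neutral_cong_left[OF K(1) sub]) (use cc in \<open>auto simp: c'_def split: if_splits\<close>)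
  then have "(\<forall>n. c' n \<in> part M n) \<and> finite {n. c' n \<noteq> \<zero>\<^bsub>M\<^esub>} \<and> finsum M c' {n. c' n \<noteq> \<zero>\<^bsub>M\<^esub>} = m"
    using finite_subset[OF sub K(1)] K(2) m by (auto simp: c'_def)
  moreover have "m \<in> carrier M" using m cc by auto
  ultimately have "(THE c. (\<forall>n. c n \<in> part M n) \<and> finite {n. c n \<noteq> \<zero>\<^bsub>M\<^esub>} \<and>
        finsum M c {n. c n \<noteq> \<zero>\<^bsub>M\<^esub>} = m) = c'"
    by (intro the1_equality part_unique) auto
  then show ?thesis by (simp add: hc_def c'_def)
qed

lemma hc_sum:
  assumes "m \<in> carrier M" "finite K" "{n. hc n m \<noteq> \<zero>\<^bsub>M\<^esub>} \<subseteq> K"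
  shows "m = finsum M (\<lambda>n. hc n m) K"
proof -
  have "finsum M (\<lambda>n. hc n m) {n. hc n m \<noteq> \<zero>\<^bsub>M\<^esub>} = finsum M (\<lambda>n. hc n m) K"
    by (rule add.finprod_mono_neutral_cong_left[OF assms(2,3)]) (use assms(1) in auto)
  then show ?thesis using hc_props(3)[OF assms(1)] by simp
qed

lemma hc_part: "m \<in> part M j \<Longrightarrow> hc n m = (if n = j then m else \<zero>\<^bsub>M\<^esub>)"
  using hc_unique[of "{j}" "\<lambda>_. m" m n] part_carrier by auto

lemma hc_zero [simp]: "hc n \<zero>\<^bsub>M\<^esub> = \<zero>\<^bsub>M\<^esub>"
  using hc_part[of "\<zero>\<^bsub>M\<^esub>" n n] by simp

lemma hc_add:
  assumes "m \<in> carrier M" "m' \<in> carrier M"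
  shows "hc n (m \<oplus>\<^bsub>M\<^esub> m') = hc n m \<oplus>\<^bsub>M\<^esub> hc n m'"
proof -
  define K where "K = {n. hc n m \<noteq> \<zero>\<^bsub>M\<^esub>} \<union> {n. hc n m' \<noteq> \<zero>\<^bsub>M\<^esub>}"
  have K: "finite K" using hc_props(2) assms by (auto simp: K_def)
  have "m \<oplus>\<^bsub>M\<^esub> m' = finsum M (\<lambda>n. hc n m) K \<oplus>\<^bsub>M\<^esub> finsum M (\<lambda>n. hc n m') K"
    using hc_sum[OF assms(1) K] hc_sum[OF assms(2) K] by (auto simp: K_def)
  also have "\<dots> = finsum M (\<lambda>n. hc n m \<oplus>\<^bsub>M\<^esub> hc n m') K"
    by (rule finsum_addf[symmetric]) (use assms in auto)
  finally have "hc n (m \<oplus>\<^bsub>M\<^esub> m') = (if n \<in> K then hc n m \<oplus>\<^bsub>M\<^esub> hc n m' else \<zero>\<^bsub>M\<^esub>)"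
    by (rule hc_unique[OF K, rotated]) (use assms hc_props(1) part_add in auto)
  then show ?thesis by (auto simp: K_def)
qed

lemma hc_minus: "m \<in> carrier M \<Longrightarrow> hc n (\<ominus>\<^bsub>M\<^esub> m) = \<ominus>\<^bsub>M\<^esub> hc n m"
  using hc_add[of "\<ominus>\<^bsub>M\<^esub> m" m n] by (simp add: M.l_neg M.minus_equality)

lemma hc_diff: "m \<in> carrier M \<Longrightarrow> m' \<in> carrier M \<Longrightarrow> hc n (m \<ominus>\<^bsub>M\<^esub> m') = hc n m \<ominus>\<^bsub>M\<^esub> hc n m'"
  by (simp add: a_minus_def hc_add hc_minus)

lemma hc_finsum: "finite J \<Longrightarrow> f \<in> J \<rightarrow> carrier M \<Longrightarrow> hc n (finsum M f J) = finsum M (\<lambda>j. hc n (f j)) J"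
proof (induction rule: finite_induct)
  case (insert x F)
  then have "f \<in> F \<rightarrow> carrier M" "f x \<in> carrier M" by auto
  then show ?case using insert by (subst (1 2) finsum_insert) (auto simp: hc_add)
qed simp

lemma hc_smult:
  assumes r: "r \<in> rpart R i" and m: "m \<in> carrier M"
  shows "hc (i + n) (r \<odot>\<^bsub>M\<^esub> m) = r \<odot>\<^bsub>M\<^esub> hc n m"
proof -
  define K where "K = {n. hc n m \<noteq> \<zero>\<^bsub>M\<^esub>}"
  have K: "finite K" using hc_props(2) m by (auto simp: K_def)
  have rR: "r \<in> carrier R" using r rpart_carrier by blast
  have "r \<odot>\<^bsub>M\<^esub> m = r \<odot>\<^bsub>M\<^esub> finsum M (\<lambda>n. hc n m) K"
    using hc_sum[OF m K] by (simp add: K_def)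
  also have "\<dots> = finsum M (\<lambda>n. r \<odot>\<^bsub>M\<^esub> hc n m) K"
    by (rule finsum_smult_ldistr[OF K rR]) (use m in auto)
  also have "\<dots> = finsum M (\<lambda>n. r \<odot>\<^bsub>M\<^esub> hc (n - i) m) ((\<lambda>n. i + n) ` K)"
    by (subst finsum_reindex) (use m rR in \<open>auto simp: inj_on_def\<close>)
  finally have "hc (i + n) (r \<odot>\<^bsub>M\<^esub> m) = (if i + n \<in> (\<lambda>n. i + n) ` K then r \<odot>\<^bsub>M\<^esub> hc (i + n - i) m else \<zero>\<^bsub>M\<^esub>)"
    by (rule hc_unique[rotated 2]) (use K part_smult[OF r] hc_props(1)[OF m] in \<open>auto simp: algebra_simps\<close>)
  then show ?thesis using rR by (auto simp: K_def)
qed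

lemma part_iff_hc: "m \<in> carrier M \<Longrightarrow> m \<in> part M j \<longleftrightarrow> (\<forall>n. n \<noteq> j \<longrightarrow> hc n m = \<zero>\<^bsub>M\<^esub>)"
proof
  assume m: "m \<in> carrier M" and z: "\<forall>n. n \<noteq> j \<longrightarrow> hc n m = \<zero>\<^bsub>M\<^esub>"
  then have "{n. hc n m \<noteq> \<zero>\<^bsub>M\<^esub>} \<subseteq> {j}" by auto
  then have "m = finsum M (\<lambda>n. hc n m) {j}" using m by (intro hc_sum) auto
  then have "m = hc j m" using m by simp
  then show "m \<in> part M j" using hc_props(1)[OF m] by metis
qed (auto simp: hc_part)

definition gsubmodule :: "'m set \<Rightarrow> bool" where
  "gsubmodule N \<longleftrightarrow> submodule N R M \<and> (\<forall>m \<in> N. \<forall>n. hc n m \<in> N)"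

text \<open>A homogeneous basis of N1/N0 given by representatives, so that chains of submodules can
  be handled inside one module without iterated quotients.\<close>

definition rel_basis :: "'m set \<Rightarrow> 'm set \<Rightarrow> 'j set \<Rightarrow> ('j \<Rightarrow> 'm) \<Rightarrow> ('j \<Rightarrow> int) \<Rightarrow> bool" where
  "rel_basis N0 N1 J b d \<longleftrightarrow> finite J \<and> (\<forall>j \<in> J. b j \<in> N1 \<and> b j \<in> part M (d j)) \<and>
    (\<forall>m \<in> N1. \<exists>c \<in> J \<rightarrow> carrier R. m \<ominus>\<^bsub>M\<^esub> (\<Oplus>\<^bsub>M\<^esub>j \<in> J. c j \<odot>\<^bsub>M\<^esub> b j) \<in> N0) \<and>
    (\<forall>c \<in> J \<rightarrow> carrier R. (\<Oplus>\<^bsub>M\<^esub>j \<in> J. c j \<odot>\<^bsub>M\<^esub> b j) \<in> N0 \<longrightarrow> (\<forall>j \<in> J. c j = \<zero>\<^bsub>R\<^esub>))"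

section \<open>Linear combinations modulo a submodule\<close>

lemma submodule_facts:
  assumes "submodule N R M"
  shows "N \<subseteq> carrier M" "\<zero>\<^bsub>M\<^esub> \<in> N" "\<And>a. a \<in> N \<Longrightarrow> \<ominus>\<^bsub>M\<^esub> a \<in> N"
    "\<And>a b. a \<in> N \<Longrightarrow> b \<in> N \<Longrightarrow> a \<oplus>\<^bsub>M\<^esub> b \<in> N"
    "\<And>a b. a \<in> N \<Longrightarrow> b \<in> N \<Longrightarrow> a \<ominus>\<^bsub>M\<^esub> b \<in> N"
    "\<And>r a. r \<in> carrier R \<Longrightarrow> a \<in> N \<Longrightarrow> r \<odot>\<^bsub>M\<^esub> a \<in> N"
proof -
  note E = submoduleE[OF assms]
  show "N \<subseteq> carrier M" "\<And>a. a \<in> N \<Longrightarrow> \<ominus>\<^bsub>M\<^esub> a \<in> N" "\<And>a b. a \<in> N \<Longrightarrow> b \<in> N \<Longrightarrow> a \<oplus>\<^bsub>M\<^esub> b \<in> N"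
    "\<And>r a. r \<in> carrier R \<Longrightarrow> a \<in> N \<Longrightarrow> r \<odot>\<^bsub>M\<^esub> a \<in> N"
    "\<And>a b. a \<in> N \<Longrightarrow> b \<in> N \<Longrightarrow> a \<ominus>\<^bsub>M\<^esub> b \<in> N"
    using E by (auto simp: a_minus_def)
  obtain a where "a \<in> N" using E(2) by blast
  then have "a \<oplus>\<^bsub>M\<^esub> \<ominus>\<^bsub>M\<^esub> a \<in> N" using E by blast
  then show "\<zero>\<^bsub>M\<^esub> \<in> N" using \<open>a \<in> N\<close> E(1) by (auto simp: r_neg)
qed

lemma finsum_submodule:
  assumes N: "submodule N R M" and "finite J" "\<And>j. j \<in> J \<Longrightarrow> f j \<in> N"
  shows "(\<Oplus>\<^bsub>M\<^esub>j \<in> J. f j) \<in> N"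
  using assms(2,3)
proof (induction rule: finite_induct)
  case (insert x F)
  then show ?case using submodule_facts[OF N] by (subst finsum_insert) auto
qed (use submodule_facts(2)[OF N] in simp)

lemma lc_submodule:
  assumes N: "submodule N R M" and J: "finite J" and c: "c \<in> J \<rightarrow> carrier R" and b: "\<And>j. j \<in> J \<Longrightarrow> b j \<in> N"
  shows "(\<Oplus>\<^bsub>M\<^esub>j \<in> J. c j \<odot>\<^bsub>M\<^esub> b j) \<in> N"
  by (rule finsum_submodule[OF N J]) (use submodule_facts(6)[OF N] b c in blast)

lemma diff_zero: "x \<in> carrier M \<Longrightarrow> x \<ominus>\<^bsub>M\<^esub> \<zero>\<^bsub>M\<^esub> = x"
  by (simp add: a_minus_def)

lemma diff_add_cancel: "x \<in> carrier M \<Longrightarrow> y \<in> carrier M \<Longrightarrow> (x \<ominus>\<^bsub>M\<^esub> y) \<oplus>\<^bsub>M\<^esub> y = x"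
  by (simp add: a_minus_def M.add.m_assoc M.l_neg)

lemma diff_diff:
  assumes "x \<in> carrier M" "y \<in> carrier M" "z \<in> carrier M"
  shows "(x \<ominus>\<^bsub>M\<^esub> y) \<ominus>\<^bsub>M\<^esub> (x \<ominus>\<^bsub>M\<^esub> z) = z \<ominus>\<^bsub>M\<^esub> y"
proof -
  have "(x \<ominus>\<^bsub>M\<^esub> y) \<ominus>\<^bsub>M\<^esub> (x \<ominus>\<^bsub>M\<^esub> z) = (x \<oplus>\<^bsub>M\<^esub> \<ominus>\<^bsub>M\<^esub> y) \<oplus>\<^bsub>M\<^esub> (\<ominus>\<^bsub>M\<^esub> x \<oplus>\<^bsub>M\<^esub> z)"
    using assms by (simp add: a_minus_def M.minus_add)
  also have "\<dots> = (x \<oplus>\<^bsub>M\<^esub> \<ominus>\<^bsub>M\<^esub> x) \<oplus>\<^bsub>M\<^esub> (z \<oplus>\<^bsub>M\<^esub> \<ominus>\<^bsub>M\<^esub> y)"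
    using assms by (simp only: M.a_ac M.a_closed M.a_inv_closed)
  finally show ?thesis using assms by (simp add: M.r_neg a_minus_def)
qed

lemma add_diff_add:
  assumes "a \<in> carrier M" "b \<in> carrier M" "c \<in> carrier M" "d \<in> carrier M"
  shows "(a \<oplus>\<^bsub>M\<^esub> b) \<ominus>\<^bsub>M\<^esub> (c \<oplus>\<^bsub>M\<^esub> d) = (a \<ominus>\<^bsub>M\<^esub> c) \<oplus>\<^bsub>M\<^esub> (b \<ominus>\<^bsub>M\<^esub> d)"
proof -
  have "(a \<oplus>\<^bsub>M\<^esub> b) \<ominus>\<^bsub>M\<^esub> (c \<oplus>\<^bsub>M\<^esub> d) = (a \<oplus>\<^bsub>M\<^esub> b) \<oplus>\<^bsub>M\<^esub> (\<ominus>\<^bsub>M\<^esub> c \<oplus>\<^bsub>M\<^esub> \<ominus>\<^bsub>M\<^esub> d)"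
    using assms by (simp add: a_minus_def M.minus_add)
  also have "\<dots> = (a \<oplus>\<^bsub>M\<^esub> \<ominus>\<^bsub>M\<^esub> c) \<oplus>\<^bsub>M\<^esub> (b \<oplus>\<^bsub>M\<^esub> \<ominus>\<^bsub>M\<^esub> d)"
    using assms by (simp only: M.a_ac M.a_closed M.a_inv_closed)
  finally show ?thesis by (simp add: a_minus_def)
qed

lemma smult_diff:
  "r \<in> carrier R \<Longrightarrow> x \<in> carrier M \<Longrightarrow> y \<in> carrier M \<Longrightarrow> r \<odot>\<^bsub>M\<^esub> (x \<ominus>\<^bsub>M\<^esub> y) = r \<odot>\<^bsub>M\<^esub> x \<ominus>\<^bsub>M\<^esub> r \<odot>\<^bsub>M\<^esub> y"
  by (simp add: a_minus_def smult_r_distr smult_r_minus)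

lemma mem_cancel:
  assumes N: "submodule N R M" and "x \<in> carrier M" "y \<in> carrier M" "x \<ominus>\<^bsub>M\<^esub> y \<in> N"
  shows "x \<in> N \<longleftrightarrow> y \<in> N"
proof -
  have "x = (x \<ominus>\<^bsub>M\<^esub> y) \<oplus>\<^bsub>M\<^esub> y"
    using assms(2,3) by (simp add: a_minus_def M.add.m_assoc M.l_neg)
  moreover from this have "y = \<ominus>\<^bsub>M\<^esub> (x \<ominus>\<^bsub>M\<^esub> y) \<oplus>\<^bsub>M\<^esub> x"
    using assms(2,3) M.r_neg1[of "x \<ominus>\<^bsub>M\<^esub> y" y] by simp
  ultimately show ?thesis using submodule_facts[OF N] assms(4) by metis
qed

lemma lc_add:
  assumes "finite J" "c \<in> J \<rightarrow> carrier R" "c' \<in> J \<rightarrow> carrier R" "b \<in> J \<rightarrow> carrier M"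
  shows "(\<Oplus>\<^bsub>M\<^esub>j \<in> J. (c j \<oplus>\<^bsub>R\<^esub> c' j) \<odot>\<^bsub>M\<^esub> b j) = (\<Oplus>\<^bsub>M\<^esub>j \<in> J. c j \<odot>\<^bsub>M\<^esub> b j) \<oplus>\<^bsub>M\<^esub> (\<Oplus>\<^bsub>M\<^esub>j \<in> J. c' j \<odot>\<^bsub>M\<^esub> b j)"
proof -
  have "(\<Oplus>\<^bsub>M\<^esub>j \<in> J. (c j \<oplus>\<^bsub>R\<^esub> c' j) \<odot>\<^bsub>M\<^esub> b j) = (\<Oplus>\<^bsub>M\<^esub>j \<in> J. c j \<odot>\<^bsub>M\<^esub> b j \<oplus>\<^bsub>M\<^esub> c' j \<odot>\<^bsub>M\<^esub> b j)"
    using assms by (intro finsum_cong') (auto intro!: smult_l_distr simp: Pi_iff)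
  also have "\<dots> = (\<Oplus>\<^bsub>M\<^esub>j \<in> J. c j \<odot>\<^bsub>M\<^esub> b j) \<oplus>\<^bsub>M\<^esub> (\<Oplus>\<^bsub>M\<^esub>j \<in> J. c' j \<odot>\<^bsub>M\<^esub> b j)"
    using assms by (intro finsum_addf) (auto simp: Pi_iff)
  finally show ?thesis .
qed

lemma lc_smult:
  assumes "finite J" "c \<in> J \<rightarrow> carrier R" "r \<in> carrier R" "b \<in> J \<rightarrow> carrier M"
  shows "(\<Oplus>\<^bsub>M\<^esub>j \<in> J. (r \<otimes>\<^bsub>R\<^esub> c j) \<odot>\<^bsub>M\<^esub> b j) = r \<odot>\<^bsub>M\<^esub> (\<Oplus>\<^bsub>M\<^esub>j \<in> J. c j \<odot>\<^bsub>M\<^esub> b j)"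
proof -
  have "(\<Oplus>\<^bsub>M\<^esub>j \<in> J. (r \<otimes>\<^bsub>R\<^esub> c j) \<odot>\<^bsub>M\<^esub> b j) = (\<Oplus>\<^bsub>M\<^esub>j \<in> J. r \<odot>\<^bsub>M\<^esub> (c j \<odot>\<^bsub>M\<^esub> b j))"
    using assms by (intro finsum_cong') (auto intro!: smult_assoc1 simp: Pi_iff)
  also have "\<dots> = r \<odot>\<^bsub>M\<^esub> (\<Oplus>\<^bsub>M\<^esub>j \<in> J. c j \<odot>\<^bsub>M\<^esub> b j)"
    using assms by (intro finsum_smult_ldistr[symmetric]) (auto simp: Pi_iff)
  finally show ?thesis .
qed

lemma lc_minus:
  assumes "finite J" "c \<in> J \<rightarrow> carrier R" "b \<in> J \<rightarrow> carrier M"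
  shows "(\<Oplus>\<^bsub>M\<^esub>j \<in> J. (\<ominus>\<^bsub>R\<^esub> c j) \<odot>\<^bsub>M\<^esub> b j) = \<ominus>\<^bsub>M\<^esub> (\<Oplus>\<^bsub>M\<^esub>j \<in> J. c j \<odot>\<^bsub>M\<^esub> b j)"
proof -
  have "(\<Oplus>\<^bsub>M\<^esub>j \<in> J. (\<ominus>\<^bsub>R\<^esub> c j) \<odot>\<^bsub>M\<^esub> b j) = (\<Oplus>\<^bsub>M\<^esub>j \<in> J. ((\<ominus>\<^bsub>R\<^esub> \<one>\<^bsub>R\<^esub>) \<otimes>\<^bsub>R\<^esub> c j) \<odot>\<^bsub>M\<^esub> b j)"
    using assms by (intro finsum_cong') (auto simp: Pi_iff R.l_minus)
  also have "\<dots> = (\<ominus>\<^bsub>R\<^esub> \<one>\<^bsub>R\<^esub>) \<odot>\<^bsub>M\<^esub> (\<Oplus>\<^bsub>M\<^esub>j \<in> J. c j \<odot>\<^bsub>M\<^esub> b j)"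
    using assms by (intro lc_smult) auto
  finally show ?thesis using assms by (simp add: smult_l_minus Pi_iff)
qed

lemma lc_diff:
  assumes "finite J" "c \<in> J \<rightarrow> carrier R" "c' \<in> J \<rightarrow> carrier R" "b \<in> J \<rightarrow> carrier M"
  shows "(\<Oplus>\<^bsub>M\<^esub>j \<in> J. (c j \<ominus>\<^bsub>R\<^esub> c' j) \<odot>\<^bsub>M\<^esub> b j) = (\<Oplus>\<^bsub>M\<^esub>j \<in> J. c j \<odot>\<^bsub>M\<^esub> b j) \<ominus>\<^bsub>M\<^esub> (\<Oplus>\<^bsub>M\<^esub>j \<in> J. c' j \<odot>\<^bsub>M\<^esub> b j)"
  using lc_add[of J c "\<lambda>j. \<ominus>\<^bsub>R\<^esub> c' j" b] lc_minus[of J c' b] assms by (simp add: a_minus_def Pi_iff)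

lemma lc_closed: "finite J \<Longrightarrow> c \<in> J \<rightarrow> carrier R \<Longrightarrow> b \<in> J \<rightarrow> carrier M \<Longrightarrow>
    (\<Oplus>\<^bsub>M\<^esub>j \<in> J. c j \<odot>\<^bsub>M\<^esub> b j) \<in> carrier M"
  by (intro finsum_closed) (auto simp: Pi_iff)

lemma lc_single: "finite J \<Longrightarrow> i \<in> J \<Longrightarrow> b \<in> J \<rightarrow> carrier M \<Longrightarrow> r \<in> carrier R \<Longrightarrow>
    (\<Oplus>\<^bsub>M\<^esub>j \<in> J. (if j = i then r else \<zero>\<^bsub>R\<^esub>) \<odot>\<^bsub>M\<^esub> b j) = r \<odot>\<^bsub>M\<^esub> b i"
proof -
  assume a: "finite J" "i \<in> J" "b \<in> J \<rightarrow> carrier M" "r \<in> carrier R"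
  have "(\<Oplus>\<^bsub>M\<^esub>j \<in> J. (if j = i then r else \<zero>\<^bsub>R\<^esub>) \<odot>\<^bsub>M\<^esub> b j) = (\<Oplus>\<^bsub>M\<^esub>j \<in> J. (if i = j then r \<odot>\<^bsub>M\<^esub> b j else \<zero>\<^bsub>M\<^esub>))"
    using a by (intro finsum_cong') (auto simp: Pi_iff)
  also have "\<dots> = r \<odot>\<^bsub>M\<^esub> b i"
    by (rule finsum_singleton) (use a in \<open>auto simp: Pi_iff\<close>)
  finally show ?thesis .
qed

text \<open>The relations of \<open>M1 / N0\<close> are diagonal, and the annihilator of the \<open>j\<close>-th generator is the
  fibre of \<open>q j\<close> through \<open>0\<close>.\<close>

definition presentation :: "'m set \<Rightarrow> 'm set \<Rightarrow> nat \<Rightarrow> (nat \<Rightarrow> 'm) \<Rightarrow> (nat \<Rightarrow> int) \<Rightarrow> (nat \<Rightarrow> 'a \<Rightarrow> 'q) \<Rightarrow> bool" where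
  "presentation N0 M1 n b k q \<longleftrightarrow> (\<forall>j < n. b j \<in> M1 \<and> b j \<in> part M (- k j)) \<and>
    (\<forall>m \<in> M1. \<exists>F \<in> {..<n} \<rightarrow> carrier R. m \<ominus>\<^bsub>M\<^esub> (\<Oplus>\<^bsub>M\<^esub>j \<in> {..<n}. F j \<odot>\<^bsub>M\<^esub> b j) \<in> N0) \<and>
    (\<forall>F \<in> {..<n} \<rightarrow> carrier R. (\<Oplus>\<^bsub>M\<^esub>j \<in> {..<n}. F j \<odot>\<^bsub>M\<^esub> b j) \<in> N0 \<longleftrightarrow> (\<forall>j < n. q j (F j) = q j \<zero>\<^bsub>R\<^esub>)) \<and>
    (\<forall>i. \<forall>m \<in> M1. m \<in> part M i \<longrightarrow>
      (\<exists>F. (\<forall>j < n. F j \<in> rpart R (i + k j)) \<and> m \<ominus>\<^bsub>M\<^esub> (\<Oplus>\<^bsub>M\<^esub>j \<in> {..<n}. F j \<odot>\<^bsub>M\<^esub> b j) \<in> N0))"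

text \<open>\<open>\<pi>\<close> stands for the quotient map to M1/N0 and \<open>q j\<close> for a
  graded surjection from R onto the j-th cyclic summand. Two kinds of target are meant:
  \<open>q j\<close> is the identity for free modules, and restriction to a graph for sums of
  S(x).\<close>

lemma gmod_iso_cyclic:
  fixes Np :: "('a, 'p) gmodule" and C :: "nat \<Rightarrow> ('a, 'q) gmodule"
  assumes N0: "submodule N0 R M" and M1: "submodule M1 R M" and sub: "N0 \<subseteq> M1"
    and one: "\<one>\<^bsub>R\<^esub> \<in> rpart R 0" and zero: "\<And>i. \<zero>\<^bsub>R\<^esub> \<in> rpart R i"
    and Np: "carrier Np = \<pi> ` M1" "\<And>m m'. m \<in> M1 \<Longrightarrow> m' \<in> M1 \<Longrightarrow> \<pi> m = \<pi> m' \<longleftrightarrow> m \<ominus>\<^bsub>M\<^esub> m' \<in> N0"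
      "\<And>m m'. m \<in> M1 \<Longrightarrow> m' \<in> M1 \<Longrightarrow> \<pi> m \<oplus>\<^bsub>Np\<^esub> \<pi> m' = \<pi> (m \<oplus>\<^bsub>M\<^esub> m')"
      "\<And>r m. r \<in> carrier R \<Longrightarrow> m \<in> M1 \<Longrightarrow> r \<odot>\<^bsub>Np\<^esub> \<pi> m = \<pi> (r \<odot>\<^bsub>M\<^esub> m)"
      "\<And>i. part Np i = \<pi> ` (part M i \<inter> M1)"
    and C: "\<And>j. j < n \<Longrightarrow> carrier (C j) = q j ` carrier R"
      "\<And>j r s. j < n \<Longrightarrow> r \<in> carrier R \<Longrightarrow> s \<in> carrier R \<Longrightarrow> q j r \<oplus>\<^bsub>C j\<^esub> q j s = q j (r \<oplus>\<^bsub>R\<^esub> s)"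
      "\<And>j r s. j < n \<Longrightarrow> r \<in> carrier R \<Longrightarrow> s \<in> carrier R \<Longrightarrow> r \<odot>\<^bsub>C j\<^esub> q j s = q j (r \<otimes>\<^bsub>R\<^esub> s)"
      "\<And>j i. j < n \<Longrightarrow> part (C j) i = q j ` rpart R i"
  shows "gmod_iso R Np (gdirect_sum {..<n} (\<lambda>j. gshift (C j) (k j))) \<longleftrightarrow> (\<exists>b. presentation N0 M1 n b k q)"
    (is "gmod_iso R Np ?D \<longleftrightarrow> _")
proof -
  note M1f = submodule_facts[OF M1] and N0f = submodule_facts[OF N0]
  define Q where "Q F = (\<lambda>j \<in> {..<n}. q j (F j))" for F :: "nat \<Rightarrow> 'a"
  have Q_eq: "Q F = Q F' \<longleftrightarrow> (\<forall>j < n. q j (F j) = q j (F' j))" for F F'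
    by (auto simp: Q_def restrict_def fun_eq_iff)
  have D_car: "carrier ?D = Q ` ({..<n} \<rightarrow> carrier R)"
  proof
    show "carrier ?D \<subseteq> Q ` ({..<n} \<rightarrow> carrier R)"
    proof
      fix X assume X: "X \<in> carrier ?D"
      then have "\<forall>j \<in> {..<n}. \<exists>r \<in> carrier R. X j = q j r"
        using C(1) by (auto simp: gdirect_sum_def gshift_def PiE_def Pi_def)
      then obtain F where F: "\<forall>j \<in> {..<n}. F j \<in> carrier R \<and> X j = q j (F j)" by metis
      have "X = Q F" using X F by (auto simp: gdirect_sum_def Q_def PiE_def extensional_def restrict_def fun_eq_iff)
      then show "X \<in> Q ` ({..<n} \<rightarrow> carrier R)" using F by auto
    qed
  qed (auto simp: Q_def gdirect_sum_def gshift_def C(1) Pi_iff PiE_iff extensional_def split: if_splits)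
  have D_part: "part ?D i = Q ` {F. \<forall>j < n. F j \<in> rpart R (i + k j)}" for i
  proof
    show "part ?D i \<subseteq> Q ` {F. \<forall>j < n. F j \<in> rpart R (i + k j)}"
    proof
      fix X assume X: "X \<in> part ?D i"
      then have "\<forall>j \<in> {..<n}. \<exists>r \<in> rpart R (i + k j). X j = q j r"
        using C(4) by (auto simp: gdirect_sum_def gshift_def PiE_def Pi_def)
      then obtain F where F: "\<forall>j \<in> {..<n}. F j \<in> rpart R (i + k j) \<and> X j = q j (F j)" by metis
      have "X = Q F" using X F by (auto simp: gdirect_sum_def Q_def PiE_def extensional_def restrict_def fun_eq_iff)
      then show "X \<in> Q ` {F. \<forall>j < n. F j \<in> rpart R (i + k j)}" using F by auto
    qed
  qed (auto simp: Q_def gdirect_sum_def gshift_def C(4) Pi_iff PiE_iff extensional_def split: if_splits)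
  have D_add: "Q F \<oplus>\<^bsub>?D\<^esub> Q F' = Q (\<lambda>j. F j \<oplus>\<^bsub>R\<^esub> F' j)"
    if "F \<in> {..<n} \<rightarrow> carrier R" "F' \<in> {..<n} \<rightarrow> carrier R" for F F'
    using that C(2) by (auto simp: gdirect_sum_def gshift_def Q_def restrict_def Pi_iff fun_eq_iff)
  have D_smult: "r \<odot>\<^bsub>?D\<^esub> Q F = Q (\<lambda>j. r \<otimes>\<^bsub>R\<^esub> F j)" if "r \<in> carrier R" "F \<in> {..<n} \<rightarrow> carrier R" for r F
    using that C(3) by (auto simp: gdirect_sum_def gshift_def Q_def restrict_def Pi_iff fun_eq_iff)
  define lc where "lc b F = (\<Oplus>\<^bsub>M\<^esub>j \<in> {..<n}. F j \<odot>\<^bsub>M\<^esub> b j)" for b F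
  show ?thesis
  proof
    assume "gmod_iso R Np ?D"
    then obtain f g where f: "f \<in> gmod_hom R Np ?D" and g: "g \<in> gmod_hom R ?D Np"
      and gf: "\<And>x. x \<in> carrier Np \<Longrightarrow> g (f x) = x" and fg: "\<And>y. y \<in> carrier ?D \<Longrightarrow> f (g y) = y"
      unfolding gmod_iso_def by blast
    have g_add: "g (X \<oplus>\<^bsub>?D\<^esub> Y) = g X \<oplus>\<^bsub>Np\<^esub> g Y" if "X \<in> carrier ?D" "Y \<in> carrier ?D" for X Y
      using g that unfolding gmod_hom_def by blast
    have g_smult: "g (r \<odot>\<^bsub>?D\<^esub> X) = r \<odot>\<^bsub>Np\<^esub> g X" if "r \<in> carrier R" "X \<in> carrier ?D" for r X
      using g that unfolding gmod_hom_def by blast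
    have g_closed: "g X \<in> carrier Np" if "X \<in> carrier ?D" for X
      using g that by (auto simp: gmod_hom_def PiE_def)
    define e where "e j = (\<lambda>i. if i = j then \<one>\<^bsub>R\<^esub> else \<zero>\<^bsub>R\<^esub>)" for j :: nat
    have "\<exists>m. m \<in> M1 \<and> m \<in> part M (- k j) \<and> g (Q (e j)) = \<pi> m" if "j < n" for j
    proof -
      \<comment> \<open>Shifting by \<open>k j\<close> moves the unit of \<open>C j\<close> from
        degree 0 to degree \<open>- k j\<close>; this is the source of the sign in
        \<open>presentation\<close>.\<close>
      have "Q (e j) \<in> part ?D (- k j)" unfolding D_part using one zero by (auto simp: e_def)
      then have "g (Q (e j)) \<in> part Np (- k j)" using g unfolding gmod_hom_def by blast
      then show ?thesis using Np(5) by auto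
    qed
    then obtain b where b: "\<And>j. j < n \<Longrightarrow> b j \<in> M1" "\<And>j. j < n \<Longrightarrow> b j \<in> part M (- k j)"
      "\<And>j. j < n \<Longrightarrow> g (Q (e j)) = \<pi> (b j)" by metis
    have bc: "b \<in> {..<n} \<rightarrow> carrier M" using b(1) M1f(1) by auto
    have lcM1: "lc b F \<in> M1" if "F \<in> {..<n} \<rightarrow> carrier R" for F
      unfolding lc_def by (rule lc_submodule[OF M1]) (use that b(1) in auto)
    \<comment> \<open>Induction on the support: a coefficient family is a sum of multiples of the
      unit vectors \<open>e i\<close>, whose images under g are known.\<close>
    have gpart: "g (Q (\<lambda>j. if j \<in> J then F j else \<zero>\<^bsub>R\<^esub>)) = \<pi> (\<Oplus>\<^bsub>M\<^esub>j \<in> J. F j \<odot>\<^bsub>M\<^esub> b j)"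
      if F: "F \<in> {..<n} \<rightarrow> carrier R" and J: "J \<subseteq> {..<n}" for F J
      using finite_subset[OF J finite_lessThan] J
    proof (induction J rule: finite_induct)
      case empty
      let ?Z = "Q (\<lambda>j. \<zero>\<^bsub>R\<^esub>)"
      have Z: "?Z \<in> carrier ?D" unfolding D_car by auto
      obtain m where m: "m \<in> M1" "g ?Z = \<pi> m" using g_closed[OF Z] Np(1) by auto
      have "g (\<zero>\<^bsub>R\<^esub> \<odot>\<^bsub>?D\<^esub> ?Z) = \<pi> (\<zero>\<^bsub>R\<^esub> \<odot>\<^bsub>M\<^esub> m)" using g_smult[OF _ Z] m Np(4) by simp
      moreover have "\<zero>\<^bsub>R\<^esub> \<odot>\<^bsub>?D\<^esub> ?Z = ?Z" by (subst D_smult) auto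
      ultimately show ?case using m M1f(1) by auto
    next
      case (insert i J)
      have i: "i < n" "F i \<in> carrier R" using insert F by auto
      let ?G = "\<lambda>j. if j \<in> J then F j else \<zero>\<^bsub>R\<^esub>"
      have G: "?G \<in> {..<n} \<rightarrow> carrier R" using F by auto
      have e: "e i \<in> {..<n} \<rightarrow> carrier R" by (auto simp: e_def)
      have re: "(\<lambda>j. F i \<otimes>\<^bsub>R\<^esub> e i j) \<in> {..<n} \<rightarrow> carrier R" using i by (auto simp: e_def)
      have "Q (\<lambda>j. if j \<in> insert i J then F j else \<zero>\<^bsub>R\<^esub>) = Q (\<lambda>j. F i \<otimes>\<^bsub>R\<^esub> e i j \<oplus>\<^bsub>R\<^esub> ?G j)"
        unfolding Q_eq using F insert.hyps insert.prems i by (auto simp: e_def Pi_iff)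
      also have "\<dots> = F i \<odot>\<^bsub>?D\<^esub> Q (e i) \<oplus>\<^bsub>?D\<^esub> Q ?G"
        using D_add[OF re G] D_smult[OF i(2) e] by simp
      finally have Qs: "Q (\<lambda>j. if j \<in> insert i J then F j else \<zero>\<^bsub>R\<^esub>) = F i \<odot>\<^bsub>?D\<^esub> Q (e i) \<oplus>\<^bsub>?D\<^esub> Q ?G" .
      have Dc: "Q (e i) \<in> carrier ?D" "Q ?G \<in> carrier ?D" "F i \<odot>\<^bsub>?D\<^esub> Q (e i) \<in> carrier ?D"
        unfolding D_smult[OF i(2) e] unfolding D_car using e G re by blast+
      have IH: "g (Q ?G) = \<pi> (\<Oplus>\<^bsub>M\<^esub>j \<in> J. F j \<odot>\<^bsub>M\<^esub> b j)" using insert by simp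
      have "g (Q (\<lambda>j. if j \<in> insert i J then F j else \<zero>\<^bsub>R\<^esub>)) = F i \<odot>\<^bsub>Np\<^esub> \<pi> (b i) \<oplus>\<^bsub>Np\<^esub> \<pi> (\<Oplus>\<^bsub>M\<^esub>j \<in> J. F j \<odot>\<^bsub>M\<^esub> b j)"
        unfolding Qs g_add[OF Dc(3,2)] g_smult[OF i(2) Dc(1)] b(3)[OF i(1)] IH ..
      also have "\<dots> = \<pi> (F i \<odot>\<^bsub>M\<^esub> b i \<oplus>\<^bsub>M\<^esub> (\<Oplus>\<^bsub>M\<^esub>j \<in> J. F j \<odot>\<^bsub>M\<^esub> b j))"
      proof -
        have "(\<Oplus>\<^bsub>M\<^esub>j \<in> J. F j \<odot>\<^bsub>M\<^esub> b j) \<in> M1"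
          by (rule lc_submodule[OF M1]) (use insert F b(1) in auto)
        then show ?thesis using Np(3,4) i b(1) M1f by simp
      qed
      also have "F i \<odot>\<^bsub>M\<^esub> b i \<oplus>\<^bsub>M\<^esub> (\<Oplus>\<^bsub>M\<^esub>j \<in> J. F j \<odot>\<^bsub>M\<^esub> b j) = (\<Oplus>\<^bsub>M\<^esub>j \<in> insert i J. F j \<odot>\<^bsub>M\<^esub> b j)"
      proof (rule finsum_insert[symmetric, OF insert.hyps])
        have "\<And>j. j \<in> insert i J \<Longrightarrow> F j \<in> carrier R \<and> b j \<in> carrier M" using F bc insert.prems by blast
        then show "(\<lambda>j. F j \<odot>\<^bsub>M\<^esub> b j) \<in> J \<rightarrow> carrier M" "F i \<odot>\<^bsub>M\<^esub> b i \<in> carrier M" by auto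
      qed
      finally show ?case .
    qed
    have gQ: "g (Q F) = \<pi> (lc b F)" if F: "F \<in> {..<n} \<rightarrow> carrier R" for F
    proof -
      have "Q F = Q (\<lambda>j. if j \<in> {..<n} then F j else \<zero>\<^bsub>R\<^esub>)" unfolding Q_eq by auto
      then show ?thesis using gpart[OF F, of "{..<n}"] by (simp add: lc_def)
    qed
    have "presentation N0 M1 n b k q"
      unfolding presentation_def lc_def[symmetric]
    proof (intro conjI allI ballI impI)
      fix m assume m: "m \<in> M1"
      then have "f (\<pi> m) \<in> carrier ?D" using f Np(1) by (auto simp: gmod_hom_def PiE_def)
      then obtain F where F: "F \<in> {..<n} \<rightarrow> carrier R" "f (\<pi> m) = Q F" using D_car by auto
      then have "\<pi> m = \<pi> (lc b F)" using gf[of "\<pi> m"] gQ[OF F(1)] m Np(1) by auto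
      then show "\<exists>F \<in> {..<n} \<rightarrow> carrier R. m \<ominus>\<^bsub>M\<^esub> lc b F \<in> N0" using Np(2)[OF m lcM1[OF F(1)]] F by blast
    next
      fix F assume F: "F \<in> {..<n} \<rightarrow> carrier R"
      have Z: "(\<lambda>j. \<zero>\<^bsub>R\<^esub>) \<in> {..<n} \<rightarrow> carrier R" by simp
      have z: "lc b (\<lambda>j. \<zero>\<^bsub>R\<^esub>) = \<zero>\<^bsub>M\<^esub>" unfolding lc_def using bc by (intro add.finprod_one_eqI) (auto simp: Pi_iff)
      have "lc b F \<in> N0 \<longleftrightarrow> \<pi> (lc b F) = \<pi> (lc b (\<lambda>j. \<zero>\<^bsub>R\<^esub>))"
        using Np(2)[OF lcM1[OF F] lcM1[OF Z]] z M1f(1) lcM1[OF F] diff_zero by auto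
      also have "\<dots> \<longleftrightarrow> g (Q F) = g (Q (\<lambda>j. \<zero>\<^bsub>R\<^esub>))" using gQ F Z by simp
      also have "\<dots> \<longleftrightarrow> Q F = Q (\<lambda>j. \<zero>\<^bsub>R\<^esub>)" 
      proof -
        have "Q F \<in> carrier ?D" "Q (\<lambda>j. \<zero>\<^bsub>R\<^esub>) \<in> carrier ?D" using F Z by (auto simp only: D_car)
        then show ?thesis using fg by metis
      qed
      finally show "lc b F \<in> N0 \<longleftrightarrow> (\<forall>j < n. q j (F j) = q j \<zero>\<^bsub>R\<^esub>)" by (simp add: Q_eq)
    next
      fix i m assume m: "m \<in> M1" "m \<in> part M i"
      then have "\<pi> m \<in> part Np i" using Np(5) by auto
      then have "f (\<pi> m) \<in> part ?D i" using f unfolding gmod_hom_def by blast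
      then obtain F where F: "\<forall>j < n. F j \<in> rpart R (i + k j)" "f (\<pi> m) = Q F" using D_part by auto
      have FR: "F \<in> {..<n} \<rightarrow> carrier R" using F(1) rpart_carrier by blast
      have "\<pi> m = \<pi> (lc b F)" using gf[of "\<pi> m"] gQ[OF FR] m Np(1) F by auto
      then show "\<exists>F. (\<forall>j < n. F j \<in> rpart R (i + k j)) \<and> m \<ominus>\<^bsub>M\<^esub> lc b F \<in> N0"
        using Np(2)[OF m(1) lcM1[OF FR]] F by blast
    qed (use b in auto)
    then show "\<exists>b. presentation N0 M1 n b k q" by blast
  next
    assume "\<exists>b. presentation N0 M1 n b k q"
    then obtain b where pr: "presentation N0 M1 n b k q" by blast
    then have b: "\<And>j. j < n \<Longrightarrow> b j \<in> M1" "\<And>j. j < n \<Longrightarrow> b j \<in> part M (- k j)"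
      and span: "\<And>m. m \<in> M1 \<Longrightarrow> \<exists>F \<in> {..<n} \<rightarrow> carrier R. m \<ominus>\<^bsub>M\<^esub> lc b F \<in> N0"
      and indep: "\<And>F. F \<in> {..<n} \<rightarrow> carrier R \<Longrightarrow> lc b F \<in> N0 \<longleftrightarrow> (\<forall>j < n. q j (F j) = q j \<zero>\<^bsub>R\<^esub>)"
      and hom: "\<And>i m. m \<in> M1 \<Longrightarrow> m \<in> part M i \<Longrightarrow> \<exists>F. (\<forall>j < n. F j \<in> rpart R (i + k j)) \<and> m \<ominus>\<^bsub>M\<^esub> lc b F \<in> N0"
      unfolding presentation_def lc_def by blast+
    have bc: "b \<in> {..<n} \<rightarrow> carrier M" using b(1) M1f(1) by auto
    have lcM1: "lc b F \<in> M1" if "F \<in> {..<n} \<rightarrow> carrier R" for F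
      unfolding lc_def by (rule lc_submodule[OF M1]) (use that b(1) in auto)
    have qminus: "q j r = q j s \<longleftrightarrow> q j (r \<ominus>\<^bsub>R\<^esub> s) = q j \<zero>\<^bsub>R\<^esub>" if "j < n" "r \<in> carrier R" "s \<in> carrier R" for j r s
    proof
      assume eq: "q j r = q j s"
      have "q j (r \<ominus>\<^bsub>R\<^esub> s) = q j r \<oplus>\<^bsub>C j\<^esub> q j (\<ominus>\<^bsub>R\<^esub> s)" using C(2) that by (simp add: a_minus_def)
      also have "\<dots> = q j (s \<ominus>\<^bsub>R\<^esub> s)" using C(2) that by (simp add: a_minus_def eq)
      finally show "q j (r \<ominus>\<^bsub>R\<^esub> s) = q j \<zero>\<^bsub>R\<^esub>" using that by (simp add: a_minus_def R.r_neg)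
    next
      assume eq: "q j (r \<ominus>\<^bsub>R\<^esub> s) = q j \<zero>\<^bsub>R\<^esub>"
      have "q j r = q j ((r \<ominus>\<^bsub>R\<^esub> s) \<oplus>\<^bsub>R\<^esub> s)" using that by (simp add: a_minus_def R.add.m_assoc R.l_neg)
      also have "\<dots> = q j \<zero>\<^bsub>R\<^esub> \<oplus>\<^bsub>C j\<^esub> q j s" using C(2) that by (simp add: eq[symmetric])
      finally show "q j r = q j s" using C(2) that by simp
    qed
    \<comment> \<open>Sending F to \<open>\<pi> (lc b F)\<close> and to \<open>Q F\<close>
      identifies the same families, so each map factors through the other. Hence the coefficients
      picked by choice in \<open>co\<close> and \<open>cr\<close> do not influence the values of f
      and g.\<close>
    have key: "\<pi> (lc b F) = \<pi> (lc b F') \<longleftrightarrow> Q F = Q F'" if F: "F \<in> {..<n} \<rightarrow> carrier R" "F' \<in> {..<n} \<rightarrow> carrier R" for F F'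
    proof -
      have "\<pi> (lc b F) = \<pi> (lc b F') \<longleftrightarrow> lc b F \<ominus>\<^bsub>M\<^esub> lc b F' \<in> N0" using Np(2) lcM1 F by blast
      also have "lc b F \<ominus>\<^bsub>M\<^esub> lc b F' = lc b (\<lambda>j. F j \<ominus>\<^bsub>R\<^esub> F' j)" unfolding lc_def using F bc by (subst lc_diff) auto
      also have "lc b (\<lambda>j. F j \<ominus>\<^bsub>R\<^esub> F' j) \<in> N0 \<longleftrightarrow> (\<forall>j < n. q j (F j \<ominus>\<^bsub>R\<^esub> F' j) = q j \<zero>\<^bsub>R\<^esub>)"
        by (rule indep) (use F in auto)
      also have "\<dots> \<longleftrightarrow> Q F = Q F'" unfolding Q_eq using qminus F by (auto simp: Pi_iff)
      finally show ?thesis .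
    qed
    define inF where "inF F \<longleftrightarrow> F \<in> {..<n} \<rightarrow> carrier R" for F :: "nat \<Rightarrow> 'a"
    have Np_ex: "\<exists>F. inF F \<and> X = \<pi> (lc b F)" if "X \<in> carrier Np" for X
    proof -
      obtain m where m: "m \<in> M1" "X = \<pi> m" using \<open>X \<in> carrier Np\<close> Np(1) by auto
      obtain F where F: "F \<in> {..<n} \<rightarrow> carrier R" "m \<ominus>\<^bsub>M\<^esub> lc b F \<in> N0" using span[OF m(1)] by blast
      then show ?thesis using Np(2)[OF m(1) lcM1[OF F(1)]] m by (auto simp: inF_def)
    qed
    define co where "co X = (SOME F. inF F \<and> X = \<pi> (lc b F))" for X
    have co: "inF (co X)" "X = \<pi> (lc b (co X))" if "X \<in> carrier Np" for X
      using someI_ex[OF Np_ex[OF that]] by (auto simp: co_def)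
    define f where "f = (\<lambda>X \<in> carrier Np. Q (co X))"
    define cr where "cr Y = (SOME F. inF F \<and> Y = Q F)" for Y
    have cr: "inF (cr Y)" "Y = Q (cr Y)" if "Y \<in> carrier ?D" for Y
    proof -
      have "\<exists>F. inF F \<and> Y = Q F" using that D_car by (auto simp: inF_def)
      from someI_ex[OF this] show "inF (cr Y)" "Y = Q (cr Y)" by (auto simp: cr_def)
    qed
    define g where "g = (\<lambda>Y \<in> carrier ?D. \<pi> (lc b (cr Y)))"
    have piN: "\<pi> (lc b F) \<in> carrier Np" if "inF F" for F using that lcM1 Np(1) by (auto simp: inF_def)
    have QD: "Q F \<in> carrier ?D" if "inF F" for F using that D_car by (auto simp: inF_def)
    have f_eq: "f (\<pi> (lc b F)) = Q F" if "inF F" for F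
      using co[OF piN[OF that]] key[of F "co (\<pi> (lc b F))"] that piN[OF that] by (auto simp: f_def inF_def)
    have g_eq: "g (Q F) = \<pi> (lc b F)" if "inF F" for F
      using cr[OF QD[OF that]] key[of F "cr (Q F)"] that QD[OF that] by (auto simp: g_def inF_def)
    have add_in: "inF (\<lambda>j. F j \<oplus>\<^bsub>R\<^esub> F' j)" if "inF F" "inF F'" for F F' using that by (auto simp: inF_def)
    have smult_in: "inF (\<lambda>j. r \<otimes>\<^bsub>R\<^esub> F j)" if "r \<in> carrier R" "inF F" for r F using that by (auto simp: inF_def)
    have pi_add: "\<pi> (lc b F) \<oplus>\<^bsub>Np\<^esub> \<pi> (lc b F') = \<pi> (lc b (\<lambda>j. F j \<oplus>\<^bsub>R\<^esub> F' j))" if "inF F" "inF F'" for F F'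
      using that lcM1 Np(3) lc_add[of "{..<n}" F F' b] bc by (auto simp: inF_def lc_def)
    have pi_smult: "r \<odot>\<^bsub>Np\<^esub> \<pi> (lc b F) = \<pi> (lc b (\<lambda>j. r \<otimes>\<^bsub>R\<^esub> F j))" if "r \<in> carrier R" "inF F" for r F
      using that lcM1 Np(4) lc_smult[of "{..<n}" F r b] bc by (auto simp: inF_def lc_def)
    have "f \<in> gmod_hom R Np ?D"
      unfolding gmod_hom_def
    proof (intro CollectI conjI ballI allI)
      show "f \<in> carrier Np \<rightarrow>\<^sub>E carrier ?D" unfolding f_def using co QD by auto
      fix X assume X: "X \<in> carrier Np"
      then obtain F where F: "inF F" "X = \<pi> (lc b F)" using Np_ex by blast
      { fix Y assume Y: "Y \<in> carrier Np"
        then obtain F' where F': "inF F'" "Y = \<pi> (lc b F')" using Np_ex by blast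
        show "f (X \<oplus>\<^bsub>Np\<^esub> Y) = f X \<oplus>\<^bsub>?D\<^esub> f Y"
          using F F' by (simp add: pi_add f_eq add_in D_add inF_def[symmetric]) }
      { fix r assume r: "r \<in> carrier R"
        show "f (r \<odot>\<^bsub>Np\<^esub> X) = r \<odot>\<^bsub>?D\<^esub> f X"
          using F r by (simp add: pi_smult f_eq smult_in) (simp add: inF_def D_smult) }
    next
      fix i
      show "f ` part Np i \<subseteq> part ?D i"
      proof
        fix Y assume "Y \<in> f ` part Np i"
        then obtain m where m: "m \<in> M1" "m \<in> part M i" "Y = f (\<pi> m)" using Np(5) by auto
        obtain F where F: "\<forall>j < n. F j \<in> rpart R (i + k j)" "m \<ominus>\<^bsub>M\<^esub> lc b F \<in> N0" using hom[OF m(1,2)] by blast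
        have FR: "inF F" using F(1) rpart_carrier unfolding inF_def by blast
        have "\<pi> m = \<pi> (lc b F)" using Np(2)[OF m(1) lcM1] F(2) FR by (auto simp: inF_def)
        then have "Y = Q F" using m(3) f_eq[OF FR] by simp
        then show "Y \<in> part ?D i" using F(1) D_part by auto
      qed
    qed
    moreover have "g \<in> gmod_hom R ?D Np"
      unfolding gmod_hom_def
    proof (intro CollectI conjI ballI allI)
      show "g \<in> carrier ?D \<rightarrow>\<^sub>E carrier Np" unfolding g_def using cr piN by auto
      fix X assume X: "X \<in> carrier ?D"
      then obtain F where F: "inF F" "X = Q F" using cr by blast
      { fix Y assume Y: "Y \<in> carrier ?D"
        then obtain F' where F': "inF F'" "Y = Q F'" using cr by blast
        have "X \<oplus>\<^bsub>?D\<^esub> Y = Q (\<lambda>j. F j \<oplus>\<^bsub>R\<^esub> F' j)" using F F' D_add by (auto simp: inF_def)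
        then show "g (X \<oplus>\<^bsub>?D\<^esub> Y) = g X \<oplus>\<^bsub>Np\<^esub> g Y"
          using F F' by (simp add: g_eq pi_add add_in) }
      { fix r assume r: "r \<in> carrier R"
        have "r \<odot>\<^bsub>?D\<^esub> X = Q (\<lambda>j. r \<otimes>\<^bsub>R\<^esub> F j)" using F r D_smult by (auto simp: inF_def)
        then show "g (r \<odot>\<^bsub>?D\<^esub> X) = r \<odot>\<^bsub>Np\<^esub> g X"
          using F r by (simp add: g_eq pi_smult smult_in) }
    next
      fix i
      show "g ` part ?D i \<subseteq> part Np i"
      proof
        fix Y assume "Y \<in> g ` part ?D i"
        then obtain F where F: "\<forall>j < n. F j \<in> rpart R (i + k j)" "Y = g (Q F)" using D_part by auto
        have FR: "inF F" using F(1) rpart_carrier unfolding inF_def by blast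
        have "lc b F \<in> part M i" unfolding lc_def
        proof (rule finsum_part)
          fix j assume "j \<in> {..<n}"
          then have "F j \<odot>\<^bsub>M\<^esub> b j \<in> part M (i + k j + - k j)" using part_smult F(1) b(2) by blast
          then show "F j \<odot>\<^bsub>M\<^esub> b j \<in> part M i" by simp
        qed auto
        then show "Y \<in> part Np i" using F(2) g_eq[OF FR] Np(5) lcM1 FR by (auto simp: inF_def)
      qed
    qed
    moreover have "\<forall>x \<in> carrier Np. g (f x) = x"
      using Np_ex f_eq g_eq by metis
    moreover have "\<forall>y \<in> carrier ?D. f (g y) = y"
      using cr f_eq g_eq by metis
    ultimately show "gmod_iso R Np ?D" unfolding gmod_iso_def by blast
  qed
qed

end

locale S_module = polynomial_functions scale
  for scale :: "'k::field \<Rightarrow> 'v::ab_group_add \<Rightarrow> 'v" +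
  fixes M :: "('v \<Rightarrow> 'k, 'm) gmodule"
  assumes S_graded: "graded_module (S_ring scale) M"
begin

sublocale graded_mod "S_ring scale" M
  using S_graded Sp_S by unfold_locales auto

section \<open>Homogeneous bases over S\<close>

lemma rel_basisD:
  assumes "rel_basis N0 N1 J b d"
  shows "finite J" "\<And>j. j \<in> J \<Longrightarrow> b j \<in> N1" "\<And>j. j \<in> J \<Longrightarrow> b j \<in> part M (d j)"
    "b \<in> J \<rightarrow> carrier M"
    "\<And>m. m \<in> N1 \<Longrightarrow> \<exists>c \<in> J \<rightarrow> S. m \<ominus>\<^bsub>M\<^esub> (\<Oplus>\<^bsub>M\<^esub>j \<in> J. c j \<odot>\<^bsub>M\<^esub> b j) \<in> N0"
    "\<And>c j. c \<in> J \<rightarrow> S \<Longrightarrow> (\<Oplus>\<^bsub>M\<^esub>j \<in> J. c j \<odot>\<^bsub>M\<^esub> b j) \<in> N0 \<Longrightarrow> j \<in> J \<Longrightarrow> c j = (\<lambda>_. 0)"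
  using assms part_carrier unfolding rel_basis_def by auto

lemma sym_Sp: "f \<in> sym d \<Longrightarrow> f \<in> Sp (2 * int d)"
  by (simp add: Sp_def)

text \<open>Plays the part of a homogeneous component of c. As S is given as a span of symmetric
  powers, the coefficient of degree n - g is assembled summand by summand.\<close>

lemma hc_smult_part:
  assumes "c \<in> S" and p: "p \<in> part M g"
  shows "\<exists>c' \<in> Sp (n - g). hc n (c \<odot>\<^bsub>M\<^esub> p) = c' \<odot>\<^bsub>M\<^esub> p"
  using assms(1)[unfolded S_carrier]
proof (induction rule: fun_span.induct)
  case 1
  have "(\<lambda>_. 0) \<odot>\<^bsub>M\<^esub> p = \<zero>\<^bsub>M\<^esub>" using smult_l_null[OF part_carrier[OF p]] by simp
  then show ?case by (intro bexI[of _ "\<lambda>_. 0"]) auto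
next
  case (2 f h)
  obtain d where d: "f \<in> sym d" using 2(1) by auto
  obtain c' where c': "c' \<in> Sp (n - g)" "hc n (h \<odot>\<^bsub>M\<^esub> p) = c' \<odot>\<^bsub>M\<^esub> p" using 2(3) by blast
  have pc: "p \<in> carrier M" using p part_carrier by blast
  have hS: "h \<in> S" using 2(2) S_carrier by simp
  have fp: "f \<odot>\<^bsub>M\<^esub> p \<in> part M (2 * int d + g)" using part_smult[OF sym_Sp[OF d] p] .
  define f' where "f' = (if n = 2 * int d + g then f else (\<lambda>_. 0))"
  have f': "f' \<in> Sp (n - g)" using sym_Sp[OF d] by (auto simp: f'_def)
  have "hc n (f \<odot>\<^bsub>M\<^esub> p) = f' \<odot>\<^bsub>M\<^esub> p"
    using hc_part[OF fp, of n] smult_l_null[OF pc] by (simp add: f'_def)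
  moreover have "(\<lambda>x. f x + h x) \<odot>\<^bsub>M\<^esub> p = f \<odot>\<^bsub>M\<^esub> p \<oplus>\<^bsub>M\<^esub> h \<odot>\<^bsub>M\<^esub> p"
    using smult_l_distr[of f h p] sym_S[OF d] hS pc by simp
  ultimately have "hc n ((\<lambda>x. f x + h x) \<odot>\<^bsub>M\<^esub> p) = f' \<odot>\<^bsub>M\<^esub> p \<oplus>\<^bsub>M\<^esub> c' \<odot>\<^bsub>M\<^esub> p"
    using hc_add[of "f \<odot>\<^bsub>M\<^esub> p" "h \<odot>\<^bsub>M\<^esub> p" n] sym_S[OF d] hS pc c'(2) by simp
  also have "\<dots> = (\<lambda>x. f' x + c' x) \<odot>\<^bsub>M\<^esub> p"
    using smult_l_distr[of f' c' p] Sp_S[OF f'] Sp_S[OF c'(1)] pc by simp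
  finally show ?case using add_Sp[OF f' c'(1)] by (intro bexI[of _ "\<lambda>x. f' x + c' x"]) auto
qed

text \<open>Take the component of degree n of the relation; since N0 is graded, the result is again
  a relation modulo N0.\<close>

lemma homogeneous_coefficients:
  assumes N0: "gsubmodule N0" and J: "finite J" "\<And>j. j \<in> J \<Longrightarrow> b j \<in> part M (d j)"
    and c: "c \<in> J \<rightarrow> S" and m: "m \<in> part M n" "m \<ominus>\<^bsub>M\<^esub> (\<Oplus>\<^bsub>M\<^esub>j \<in> J. c j \<odot>\<^bsub>M\<^esub> b j) \<in> N0"
  shows "\<exists>c'. (\<forall>j \<in> J. c' j \<in> Sp (n - d j)) \<and> m \<ominus>\<^bsub>M\<^esub> (\<Oplus>\<^bsub>M\<^esub>j \<in> J. c' j \<odot>\<^bsub>M\<^esub> b j) \<in> N0"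
proof -
  have bc: "b \<in> J \<rightarrow> carrier M" using J(2) part_carrier by blast
  have "\<forall>j \<in> J. \<exists>c'. c' \<in> Sp (n - d j) \<and> hc n (c j \<odot>\<^bsub>M\<^esub> b j) = c' \<odot>\<^bsub>M\<^esub> b j"
    using hc_smult_part J(2) c by blast
  then obtain c' where c': "\<And>j. j \<in> J \<Longrightarrow> c' j \<in> Sp (n - d j)" "\<And>j. j \<in> J \<Longrightarrow> hc n (c j \<odot>\<^bsub>M\<^esub> b j) = c' j \<odot>\<^bsub>M\<^esub> b j"
    by metis
  have "hc n (m \<ominus>\<^bsub>M\<^esub> (\<Oplus>\<^bsub>M\<^esub>j \<in> J. c j \<odot>\<^bsub>M\<^esub> b j)) = hc n m \<ominus>\<^bsub>M\<^esub> hc n (\<Oplus>\<^bsub>M\<^esub>j \<in> J. c j \<odot>\<^bsub>M\<^esub> b j)"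
    using part_carrier[OF m(1)] lc_closed[OF J(1) c bc] by (rule hc_diff)
  also have "hc n m = m" using hc_part[OF m(1)] by simp
  also have "hc n (\<Oplus>\<^bsub>M\<^esub>j \<in> J. c j \<odot>\<^bsub>M\<^esub> b j) = (\<Oplus>\<^bsub>M\<^esub>j \<in> J. hc n (c j \<odot>\<^bsub>M\<^esub> b j))"
    using c bc by (intro hc_finsum[OF J(1)]) auto
  also have "\<dots> = (\<Oplus>\<^bsub>M\<^esub>j \<in> J. c' j \<odot>\<^bsub>M\<^esub> b j)"
  proof (rule finsum_cong')
    have "c' j \<in> S" if "j \<in> J" for j using c'(1)[OF that] Sp_S by blast
    then show "(\<lambda>j. c' j \<odot>\<^bsub>M\<^esub> b j) \<in> J \<rightarrow> carrier M" using bc by (auto simp: Pi_iff)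
  qed (use c' in auto)
  finally have eq: "hc n (m \<ominus>\<^bsub>M\<^esub> (\<Oplus>\<^bsub>M\<^esub>j \<in> J. c j \<odot>\<^bsub>M\<^esub> b j)) = m \<ominus>\<^bsub>M\<^esub> (\<Oplus>\<^bsub>M\<^esub>j \<in> J. c' j \<odot>\<^bsub>M\<^esub> b j)" .
  have "m \<ominus>\<^bsub>M\<^esub> (\<Oplus>\<^bsub>M\<^esub>j \<in> J. c' j \<odot>\<^bsub>M\<^esub> b j) \<in> N0"
    unfolding eq[symmetric] using N0 m(2) unfolding gsubmodule_def by simp
  then show ?thesis using c'(1) by (intro exI[of _ c']) simp
qed

text \<open>Spanning provides coefficients by choice; uniqueness modulo N0 then forces them to be
  additive, S-linear and compatible with degrees.\<close>

lemma rel_basis_coordinates: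
  assumes B: "rel_basis N0 N1 J b d" and N0: "gsubmodule N0" and N1: "submodule N1 (S_ring scale) M"
  obtains \<phi> where "\<And>m. m \<in> N1 \<Longrightarrow> \<phi> m \<in> J \<rightarrow> S"
    "\<And>m. m \<in> N1 \<Longrightarrow> m \<ominus>\<^bsub>M\<^esub> (\<Oplus>\<^bsub>M\<^esub>j \<in> J. \<phi> m j \<odot>\<^bsub>M\<^esub> b j) \<in> N0"
    "\<And>m c. m \<in> N1 \<Longrightarrow> c \<in> J \<rightarrow> S \<Longrightarrow> m \<ominus>\<^bsub>M\<^esub> (\<Oplus>\<^bsub>M\<^esub>j \<in> J. c j \<odot>\<^bsub>M\<^esub> b j) \<in> N0 \<Longrightarrow> \<forall>j \<in> J. c j = \<phi> m j"
    "\<And>m m' j. m \<in> N1 \<Longrightarrow> m' \<in> N1 \<Longrightarrow> j \<in> J \<Longrightarrow> \<phi> (m \<oplus>\<^bsub>M\<^esub> m') j = (\<lambda>v. \<phi> m j v + \<phi> m' j v)"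
    "\<And>m s j. m \<in> N1 \<Longrightarrow> s \<in> S \<Longrightarrow> j \<in> J \<Longrightarrow> \<phi> (s \<odot>\<^bsub>M\<^esub> m) j = (\<lambda>v. s v * \<phi> m j v)"
    "\<And>m j n. m \<in> N1 \<Longrightarrow> m \<in> part M n \<Longrightarrow> j \<in> J \<Longrightarrow> \<phi> m j \<in> Sp (n - d j)"
proof -
  define lc where "lc c = (\<Oplus>\<^bsub>M\<^esub>j \<in> J. c j \<odot>\<^bsub>M\<^esub> b j)" for c
  have J: "finite J" and b: "\<And>j. j \<in> J \<Longrightarrow> b j \<in> N1" "\<And>j. j \<in> J \<Longrightarrow> b j \<in> part M (d j)"
    and span: "\<And>m. m \<in> N1 \<Longrightarrow> \<exists>c \<in> J \<rightarrow> S. m \<ominus>\<^bsub>M\<^esub> lc c \<in> N0"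
    and indep: "\<And>c j. c \<in> J \<rightarrow> S \<Longrightarrow> lc c \<in> N0 \<Longrightarrow> j \<in> J \<Longrightarrow> c j = (\<lambda>_. 0)"
    using B unfolding rel_basis_def lc_def by auto
  have bc: "b \<in> J \<rightarrow> carrier M" using b(2) part_carrier by blast
  have N0s: "submodule N0 (S_ring scale) M" using N0 by (simp add: gsubmodule_def)
  note f0 = submodule_facts[OF N0s] and f1 = submodule_facts[OF N1]
  obtain \<phi> where phi: "\<And>m. m \<in> N1 \<Longrightarrow> \<phi> m \<in> J \<rightarrow> S" "\<And>m. m \<in> N1 \<Longrightarrow> m \<ominus>\<^bsub>M\<^esub> lc (\<phi> m) \<in> N0"
    using span by metis
  have uniq: "\<forall>j \<in> J. c j = \<phi> m j" if m: "m \<in> N1" and c: "c \<in> J \<rightarrow> S" "m \<ominus>\<^bsub>M\<^esub> lc c \<in> N0" for m c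
  proof
    fix j assume j: "j \<in> J"
    have mc: "m \<in> carrier M" using m f1(1) by blast
    have lcc: "lc c \<in> carrier M" "lc (\<phi> m) \<in> carrier M" 
      using lc_closed[OF J _ bc] c(1) phi(1)[OF m] by (auto simp: lc_def)
    have "(\<lambda>j. c j \<ominus>\<^bsub>S_ring scale\<^esub> \<phi> m j) \<in> J \<rightarrow> S" using c(1) phi(1)[OF m] by (simp add: Pi_iff)
    moreover have "lc (\<lambda>j. c j \<ominus>\<^bsub>S_ring scale\<^esub> \<phi> m j) = lc c \<ominus>\<^bsub>M\<^esub> lc (\<phi> m)"
      unfolding lc_def using lc_diff[OF J c(1) phi(1)[OF m] bc] .
    moreover have "lc c \<ominus>\<^bsub>M\<^esub> lc (\<phi> m) = (m \<ominus>\<^bsub>M\<^esub> lc (\<phi> m)) \<ominus>\<^bsub>M\<^esub> (m \<ominus>\<^bsub>M\<^esub> lc c)"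
      using diff_diff[OF mc lcc(2,1)] by simp
    ultimately have "c j \<ominus>\<^bsub>S_ring scale\<^esub> \<phi> m j = \<zero>\<^bsub>S_ring scale\<^esub>"
      using indep[of "\<lambda>j. c j \<ominus>\<^bsub>S_ring scale\<^esub> \<phi> m j" j] j f0(5) c(2) phi(2)[OF m] by simp
    then show "c j = \<phi> m j" using c(1) phi(1)[OF m] j by (simp add: Pi_iff del: S_ring_simps)
  qed
  show ?thesis
  proof (rule that[of \<phi>])
    fix m m' j assume m: "m \<in> N1" "m' \<in> N1" and j: "j \<in> J"
    have mc: "m \<in> carrier M" "m' \<in> carrier M" using m f1(1) by auto
    have lcc: "lc (\<phi> m') \<in> carrier M" "lc (\<phi> m) \<in> carrier M" 
      using lc_closed[OF J _ bc] phi(1)[OF m(1)] phi(1)[OF m(2)] by (auto simp: lc_def)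
    have 1: "(\<lambda>j. \<phi> m j \<oplus>\<^bsub>S_ring scale\<^esub> \<phi> m' j) \<in> J \<rightarrow> S" using phi(1)[OF m(1)] phi(1)[OF m(2)] by (simp add: Pi_iff)
    have 2: "lc (\<lambda>j. \<phi> m j \<oplus>\<^bsub>S_ring scale\<^esub> \<phi> m' j) = lc (\<phi> m) \<oplus>\<^bsub>M\<^esub> lc (\<phi> m')"
      unfolding lc_def using lc_add[OF J phi(1)[OF m(1)] phi(1)[OF m(2)] bc] .
    have 3: "(m \<oplus>\<^bsub>M\<^esub> m') \<ominus>\<^bsub>M\<^esub> (lc (\<phi> m) \<oplus>\<^bsub>M\<^esub> lc (\<phi> m')) = (m \<ominus>\<^bsub>M\<^esub> lc (\<phi> m)) \<oplus>\<^bsub>M\<^esub> (m' \<ominus>\<^bsub>M\<^esub> lc (\<phi> m'))"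
      using add_diff_add mc lcc by blast
    have "(m \<oplus>\<^bsub>M\<^esub> m') \<ominus>\<^bsub>M\<^esub> lc (\<lambda>j. \<phi> m j \<oplus>\<^bsub>S_ring scale\<^esub> \<phi> m' j) \<in> N0"
      unfolding 2 3 by (rule f0(4)[OF phi(2)[OF m(1)] phi(2)[OF m(2)]])
    from uniq[OF f1(4)[OF m] 1 this]
    show "\<phi> (m \<oplus>\<^bsub>M\<^esub> m') j = (\<lambda>v. \<phi> m j v + \<phi> m' j v)" using j by simp
  next
    fix m s j assume m: "m \<in> N1" and s: "s \<in> S" and j: "j \<in> J"
    have mc: "m \<in> carrier M" using m f1(1) by auto
    have lcc: "lc (\<phi> m) \<in> carrier M" 
      using lc_closed[OF J _ bc] phi(1)[OF m(1)] by (auto simp: lc_def)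
    have 1: "(\<lambda>j. s \<otimes>\<^bsub>S_ring scale\<^esub> \<phi> m j) \<in> J \<rightarrow> S" using phi(1)[OF m] s by (simp add: Pi_iff)
    have 2: "lc (\<lambda>j. s \<otimes>\<^bsub>S_ring scale\<^esub> \<phi> m j) = s \<odot>\<^bsub>M\<^esub> lc (\<phi> m)"
      unfolding lc_def using lc_smult[OF J phi(1)[OF m(1)] s bc] .
    have 3: "s \<odot>\<^bsub>M\<^esub> m \<ominus>\<^bsub>M\<^esub> s \<odot>\<^bsub>M\<^esub> lc (\<phi> m) = s \<odot>\<^bsub>M\<^esub> (m \<ominus>\<^bsub>M\<^esub> lc (\<phi> m))"
      using smult_diff[OF s mc lcc] by simp
    have "s \<odot>\<^bsub>M\<^esub> m \<ominus>\<^bsub>M\<^esub> lc (\<lambda>j. s \<otimes>\<^bsub>S_ring scale\<^esub> \<phi> m j) \<in> N0"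
      unfolding 2 3 by (rule f0(6)[OF s phi(2)[OF m]])
    from uniq[OF f1(6)[OF s m] 1 this]
    show "\<phi> (s \<odot>\<^bsub>M\<^esub> m) j = (\<lambda>v. s v * \<phi> m j v)" using j by simp
  next
    fix m j n assume m: "m \<in> N1" "m \<in> part M n" and j: "j \<in> J"
    obtain c' where c': "\<forall>j \<in> J. c' j \<in> Sp (n - d j)" "m \<ominus>\<^bsub>M\<^esub> lc c' \<in> N0"
      using homogeneous_coefficients[where b = b and d = d, OF N0 J b(2) phi(1)[OF m(1)] m(2)] phi(2)[OF m(1)] unfolding lc_def by blast
    then have "\<forall>j \<in> J. c' j = \<phi> m j" using Sp_S by (intro uniq[OF m(1)]) auto
    then show "\<phi> m j \<in> Sp (n - d j)" using c'(1) j by auto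
  qed (fact phi(1) phi(2)[unfolded lc_def] uniq[unfolded lc_def])+
qed

lemma smult_sum:
  "finite J \<Longrightarrow> s \<in> J \<rightarrow> S \<Longrightarrow> x \<in> carrier M \<Longrightarrow>
    (\<lambda>v. \<Sum>j \<in> J. s j v) \<in> S \<and> (\<Oplus>\<^bsub>M\<^esub>j \<in> J. s j \<odot>\<^bsub>M\<^esub> x) = (\<lambda>v. \<Sum>j \<in> J. s j v) \<odot>\<^bsub>M\<^esub> x"
proof (induction rule: finite_induct)
  case empty
  then show ?case using smult_l_null by simp
next
  case (insert i J)
  then have IH: "(\<lambda>v. \<Sum>j \<in> J. s j v) \<in> S" "(\<Oplus>\<^bsub>M\<^esub>j \<in> J. s j \<odot>\<^bsub>M\<^esub> x) = (\<lambda>v. \<Sum>j \<in> J. s j v) \<odot>\<^bsub>M\<^esub> x" by auto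
  have "s i \<in> S" using insert by auto
  then show ?case
    using insert IH smult_l_distr[of "s i" "\<lambda>v. \<Sum>j \<in> J. s j v" x]
    by (subst finsum_insert) auto
qed

text \<open>One step of Gaussian elimination: a linear form \<open>\<psi>\<close> with kernel \<open>M1\<close> taking the value \<open>1\<close> on \<open>M0\<close> takes an
  invertible value on some basis element, by comparing constant terms.\<close>

lemma eliminate_one:
  assumes B: "rel_basis N0 M0 J b d" and N0: "gsubmodule N0" and M0: "submodule M0 (S_ring scale) M"
    and sub: "N0 \<subseteq> M0" and psi_S: "\<And>m. m \<in> M0 \<Longrightarrow> \<psi> m \<in> S"
    and psi_add: "\<And>m m'. m \<in> M0 \<Longrightarrow> m' \<in> M0 \<Longrightarrow> \<psi> (m \<oplus>\<^bsub>M\<^esub> m') = (\<lambda>v. \<psi> m v + \<psi> m' v)"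
    and psi_smult: "\<And>m s. m \<in> M0 \<Longrightarrow> s \<in> S \<Longrightarrow> \<psi> (s \<odot>\<^bsub>M\<^esub> m) = (\<lambda>v. s v * \<psi> m v)"
    and psi_part: "\<And>m n. m \<in> M0 \<Longrightarrow> m \<in> part M n \<Longrightarrow> \<psi> m \<in> Sp (n - e)"
    and psi_N0: "\<And>m. m \<in> N0 \<Longrightarrow> \<psi> m = (\<lambda>_. 0)"
    and p: "p \<in> M0" "\<psi> p = (\<lambda>_. 1)"
  shows "\<exists>J' b'. J' \<subseteq> J \<and> rel_basis N0 {m \<in> M0. \<psi> m = (\<lambda>_. 0)} J' b' d"
proof -
  have J: "finite J" and b: "\<And>j. j \<in> J \<Longrightarrow> b j \<in> M0" "\<And>j. j \<in> J \<Longrightarrow> b j \<in> part M (d j)"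
    and span: "\<And>m. m \<in> M0 \<Longrightarrow> \<exists>c \<in> J \<rightarrow> S. m \<ominus>\<^bsub>M\<^esub> (\<Oplus>\<^bsub>M\<^esub>j \<in> J. c j \<odot>\<^bsub>M\<^esub> b j) \<in> N0"
    and indep: "\<And>c j. c \<in> J \<rightarrow> S \<Longrightarrow> (\<Oplus>\<^bsub>M\<^esub>j \<in> J. c j \<odot>\<^bsub>M\<^esub> b j) \<in> N0 \<Longrightarrow> j \<in> J \<Longrightarrow> c j = (\<lambda>_. 0)"
    using B unfolding rel_basis_def by auto
  note M0f = submodule_facts[OF M0]
  have bc: "b \<in> J \<rightarrow> carrier M" using b(2) part_carrier by blast
  have psi_lc: "\<psi> (\<Oplus>\<^bsub>M\<^esub>j \<in> K. c j \<odot>\<^bsub>M\<^esub> b j) = (\<lambda>v. \<Sum>j \<in> K. c j v * \<psi> (b j) v)"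
    if "K \<subseteq> J" "c \<in> J \<rightarrow> S" for K c
    using finite_subset[OF that(1) J] that(1)
  proof (induction K rule: finite_induct)
    case empty
    have "\<psi> (\<zero>\<^bsub>M\<^esub>) = \<psi> ((\<lambda>_. 0) \<odot>\<^bsub>M\<^esub> \<zero>\<^bsub>M\<^esub>)" using smult_l_null[of "\<zero>\<^bsub>M\<^esub>"] by simp
    then show ?case using psi_smult[OF M0f(2), of "\<lambda>_. 0"] by simp
  next
    case (insert i K)
    have i: "c i \<in> S" "b i \<in> M0" using insert that b by auto
    have K: "(\<Oplus>\<^bsub>M\<^esub>j \<in> K. c j \<odot>\<^bsub>M\<^esub> b j) \<in> M0"
      by (rule lc_submodule[OF M0]) (use insert that b in auto)
    have "(\<Oplus>\<^bsub>M\<^esub>j \<in> insert i K. c j \<odot>\<^bsub>M\<^esub> b j) = c i \<odot>\<^bsub>M\<^esub> b i \<oplus>\<^bsub>M\<^esub> (\<Oplus>\<^bsub>M\<^esub>j \<in> K. c j \<odot>\<^bsub>M\<^esub> b j)"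
      using insert that bc by (subst finsum_insert) (auto simp: Pi_iff)
    then show ?case using insert i K M0f(6) by (simp add: psi_add psi_smult)
  qed
  have psi_cong: "\<psi> m = \<psi> m'" if "m \<in> M0" "m' \<in> M0" "m \<ominus>\<^bsub>M\<^esub> m' \<in> N0" for m m'
  proof -
    have "m \<in> carrier M" "m' \<in> carrier M" using that M0f(1) by blast+
    then have "m = (m \<ominus>\<^bsub>M\<^esub> m') \<oplus>\<^bsub>M\<^esub> m'" by (rule diff_add_cancel[symmetric])
    then have "\<psi> m = (\<lambda>v. \<psi> (m \<ominus>\<^bsub>M\<^esub> m') v + \<psi> m' v)" using psi_add[of "m \<ominus>\<^bsub>M\<^esub> m'" m'] that sub by auto
    then show ?thesis using psi_N0[OF that(3)] by simp
  qed
  have lcM0: "(\<Oplus>\<^bsub>M\<^esub>j \<in> J. c j \<odot>\<^bsub>M\<^esub> b j) \<in> M0" if "c \<in> J \<rightarrow> S" for c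
    by (rule lc_submodule[OF M0 J that b(1)])
  obtain c where c: "c \<in> J \<rightarrow> S" "p \<ominus>\<^bsub>M\<^esub> (\<Oplus>\<^bsub>M\<^esub>j \<in> J. c j \<odot>\<^bsub>M\<^esub> b j) \<in> N0" using span[OF p(1)] by blast
  have "(\<lambda>_. 1) = (\<lambda>v. \<Sum>j \<in> J. c j v * \<psi> (b j) v)"
    using psi_cong[OF p(1) lcM0[OF c(1)] c(2)] psi_lc[OF subset_refl c(1)] p(2) by simp
  \<comment> \<open>Evaluation at the origin: some summand is nonzero there, so some
    \<open>\<psi> (b i)\<close> has nonzero constant term. Being homogeneous it is a constant, and
    it becomes the pivot u.\<close>
  from fun_cong[OF this, of 0] obtain i where i: "i \<in> J" "\<psi> (b i) 0 \<noteq> 0"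
    using sum.not_neutral_contains_not_neutral[of "\<lambda>j. c j 0 * \<psi> (b j) 0" J] by force
  define u where "u = \<psi> (b i) 0"
  note z = Sp_nonzero_at_origin[OF psi_part[OF b(1)[OF i(1)] b(2)[OF i(1)]] i(2)]
  have u: "u \<noteq> 0" "\<psi> (b i) = (\<lambda>_. u)" "d i = e"
    unfolding u_def by (fact i(2), fact z[THEN conjunct2]) (use z[THEN conjunct1] in simp)
  \<comment> \<open>The multiplier that clears the value at \<open>b j\<close> against the pivot.
    Its degree is d j - e, and d i = e, so \<open>b' j\<close> is again homogeneous of degree d
    j.\<close>
  define a where "a j = (\<lambda>v. - (\<psi> (b j) v / u))" for j
  have a_S: "a j \<in> Sp (d j - e)" if j: "j \<in> J" for j
  proof -
    have "(\<lambda>v. (- (1 / u)) * \<psi> (b j) v) \<in> Sp (0 + (d j - e))"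
      using mult_Sp[OF const_Sp psi_part[OF b(1)[OF j] b(2)[OF j]]] .
    moreover have "(\<lambda>v. (- (1 / u)) * \<psi> (b j) v) = a j" by (auto simp: a_def)
    ultimately show ?thesis by (metis add_0)
  qed
  define J' where "J' = J - {i}"
  have J': "finite J'" "J' \<subseteq> J" "i \<notin> J'" "J = insert i J'" using J i by (auto simp: J'_def)
  define b' where "b' j = b j \<oplus>\<^bsub>M\<^esub> a j \<odot>\<^bsub>M\<^esub> b i" for j
  have aS: "a \<in> J \<rightarrow> S" using a_S Sp_S by blast
  have b': "b' j \<in> M0" "\<psi> (b' j) = (\<lambda>_. 0)" "b' j \<in> part M (d j)" if "j \<in> J'" for j
  proof -
    have j: "j \<in> J" "a j \<in> S" using that J' aS by auto
    have m: "a j \<odot>\<^bsub>M\<^esub> b i \<in> M0" using M0f(6) j(2) b(1)[OF i(1)] by simp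
    show "b' j \<in> M0" unfolding b'_def using M0f(4) b(1)[OF j(1)] m by blast
    show "\<psi> (b' j) = (\<lambda>_. 0)"
      unfolding b'_def psi_add[OF b(1)[OF j(1)] m] psi_smult[OF b(1)[OF i(1)] j(2)] using u by (auto simp: a_def)
    have "a j \<odot>\<^bsub>M\<^esub> b i \<in> part M (d j - e + d i)" using part_smult[OF a_S[OF j(1)] b(2)[OF i(1)]] .
    then show "b' j \<in> part M (d j)" unfolding b'_def using part_add[OF b(2)[OF j(1)]] u(3) by simp
  qed
  \<comment> \<open>Coefficients, with respect to the old family, of a combination of the new one:
    the pivot element collects all corrections.\<close>
  define ext where "ext c j = (if j = i then (\<lambda>v. \<Sum>l \<in> J'. c l v * a l v) else c j)" for c j
  have ext_S: "ext c \<in> J \<rightarrow> S" if c: "c \<in> J' \<rightarrow> S" for c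
  proof
    fix j assume "j \<in> J"
    have "(\<lambda>v. \<Sum>l \<in> J'. (\<lambda>l v. c l v * a l v) l v) \<in> S"
      using smult_sum[OF J'(1), of "\<lambda>l v. c l v * a l v" "\<zero>\<^bsub>M\<^esub>"] c aS J'(2) by blast
    then show "ext c j \<in> S" using \<open>j \<in> J\<close> c J' by (auto simp: ext_def)
  qed
  have lc': "(\<Oplus>\<^bsub>M\<^esub>j \<in> J'. c j \<odot>\<^bsub>M\<^esub> b' j) = (\<Oplus>\<^bsub>M\<^esub>j \<in> J. ext c j \<odot>\<^bsub>M\<^esub> b j)" if c: "c \<in> J' \<rightarrow> S" for c
  proof -
    have ca: "(\<lambda>l v. c l v * a l v) \<in> J' \<rightarrow> S" using c aS J'(2) by blast
    have bi: "b i \<in> carrier M" using bc i by auto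
    have "(\<Oplus>\<^bsub>M\<^esub>j \<in> J'. c j \<odot>\<^bsub>M\<^esub> b' j) = (\<Oplus>\<^bsub>M\<^esub>j \<in> J'. c j \<odot>\<^bsub>M\<^esub> b j \<oplus>\<^bsub>M\<^esub> (\<lambda>v. c j v * a j v) \<odot>\<^bsub>M\<^esub> b i)"
    proof (rule finsum_cong')
      fix j assume "j \<in> J'"
      then have "c j \<in> S" "a j \<in> S" "b j \<in> carrier M" using c aS bc J'(2) by auto
      then show "c j \<odot>\<^bsub>M\<^esub> b' j = c j \<odot>\<^bsub>M\<^esub> b j \<oplus>\<^bsub>M\<^esub> (\<lambda>v. c j v * a j v) \<odot>\<^bsub>M\<^esub> b i"
        using bi smult_assoc1[of "c j" "a j" "b i"] by (simp add: b'_def smult_r_distr)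
    qed (use c ca bc bi J'(2) in \<open>auto simp: Pi_iff subset_iff\<close>)
    also have "\<dots> = (\<Oplus>\<^bsub>M\<^esub>j \<in> J'. c j \<odot>\<^bsub>M\<^esub> b j) \<oplus>\<^bsub>M\<^esub> (\<Oplus>\<^bsub>M\<^esub>j \<in> J'. (\<lambda>v. c j v * a j v) \<odot>\<^bsub>M\<^esub> b i)"
      using c ca bc bi J'(2) by (intro finsum_addf) (auto simp: Pi_iff subset_iff)
    also have "(\<Oplus>\<^bsub>M\<^esub>j \<in> J'. (\<lambda>v. c j v * a j v) \<odot>\<^bsub>M\<^esub> b i) = (\<lambda>v. \<Sum>l \<in> J'. c l v * a l v) \<odot>\<^bsub>M\<^esub> b i"
      using smult_sum[OF J'(1) ca bi] by simp
    also have "(\<Oplus>\<^bsub>M\<^esub>j \<in> J'. c j \<odot>\<^bsub>M\<^esub> b j) = (\<Oplus>\<^bsub>M\<^esub>j \<in> J'. ext c j \<odot>\<^bsub>M\<^esub> b j)"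
      using c bc J' by (intro finsum_cong') (auto simp: Pi_iff subset_iff ext_def)
    also have "\<dots> \<oplus>\<^bsub>M\<^esub> (\<lambda>v. \<Sum>l \<in> J'. c l v * a l v) \<odot>\<^bsub>M\<^esub> b i = (\<Oplus>\<^bsub>M\<^esub>j \<in> insert i J'. ext c j \<odot>\<^bsub>M\<^esub> b j)"
    proof -
      have e: "ext c \<in> insert i J' \<rightarrow> S" using ext_S[OF c] J'(4) by simp
      have bb: "b \<in> insert i J' \<rightarrow> carrier M" using bc J'(4) by simp
      have "(\<lambda>j. ext c j \<odot>\<^bsub>M\<^esub> b j) \<in> J' \<rightarrow> carrier M" "ext c i \<odot>\<^bsub>M\<^esub> b i \<in> carrier M" using e bb by auto
      moreover have "ext c i = (\<lambda>v. \<Sum>l \<in> J'. c l v * a l v)" by (simp add: ext_def)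
      ultimately show ?thesis using J' by (subst finsum_insert) (auto simp: M.add.m_comm)
    qed
    finally show ?thesis using J'(4) by simp
  qed
  have "rel_basis N0 {m \<in> M0. \<psi> m = (\<lambda>_. 0)} J' b' d"
    unfolding rel_basis_def
  proof (intro conjI ballI impI)
    show "finite J'" by fact
  next
    fix m assume "m \<in> {m \<in> M0. \<psi> m = (\<lambda>_. 0)}"
    then have m: "m \<in> M0" "\<psi> m = (\<lambda>_. 0)" by auto
    obtain c where c: "c \<in> J \<rightarrow> S" "m \<ominus>\<^bsub>M\<^esub> (\<Oplus>\<^bsub>M\<^esub>j \<in> J. c j \<odot>\<^bsub>M\<^esub> b j) \<in> N0" using span[OF m(1)] by blast
    have eq: "(\<lambda>_. 0) = (\<lambda>v. \<Sum>j \<in> J. c j v * \<psi> (b j) v)"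
      using psi_cong[OF m(1) lcM0[OF c(1)] c(2)] psi_lc[OF subset_refl c(1)] m(2) by simp
    \<comment> \<open>Applying \<open>\<psi>\<close> to the expansion of m determines the
      coefficient at the pivot, so \<open>c\<close> is already of the form
      \<open>ext c\<close>.\<close>
    have "c i v * u + (\<Sum>j \<in> J'. c j v * \<psi> (b j) v) = 0" for v
    proof -
      have "0 = (\<Sum>j \<in> insert i J'. c j v * \<psi> (b j) v)" using eq J'(4) by (metis (no_types))
      then show ?thesis using J' u(2) by simp
    qed
    then have "c i v = (\<Sum>j \<in> J'. c j v * a j v)" for v
      using u(1) by (simp add: a_def sum_negf sum_divide_distrib[symmetric] field_simps eq_neg_iff_add_eq_0)
    then have "ext c j = c j" for j by (simp add: ext_def fun_eq_iff)
    then have "ext c = c" by blast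
    moreover have c': "c \<in> J' \<rightarrow> S" using c J' by auto
    ultimately have "(\<Oplus>\<^bsub>M\<^esub>j \<in> J'. c j \<odot>\<^bsub>M\<^esub> b' j) = (\<Oplus>\<^bsub>M\<^esub>j \<in> J. c j \<odot>\<^bsub>M\<^esub> b j)" using lc'[OF c'] by metis
    then have "m \<ominus>\<^bsub>M\<^esub> (\<Oplus>\<^bsub>M\<^esub>j \<in> J'. c j \<odot>\<^bsub>M\<^esub> b' j) \<in> N0" using c(2) by metis
    then show "\<exists>c \<in> J' \<rightarrow> S. m \<ominus>\<^bsub>M\<^esub> (\<Oplus>\<^bsub>M\<^esub>j \<in> J'. c j \<odot>\<^bsub>M\<^esub> b' j) \<in> N0" using c' by (rule bexI)
  next
    fix c j assume c: "c \<in> J' \<rightarrow> S" "(\<Oplus>\<^bsub>M\<^esub>j \<in> J'. c j \<odot>\<^bsub>M\<^esub> b' j) \<in> N0" and j: "j \<in> J'"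
    have "(\<Oplus>\<^bsub>M\<^esub>j \<in> J. ext c j \<odot>\<^bsub>M\<^esub> b j) \<in> N0" using c(2) lc'[OF c(1)] by metis
    then have "ext c j = (\<lambda>_. 0)" using indep[OF ext_S[OF c(1)]] j J'(2) by blast
    moreover have "j \<noteq> i" using j J'(3) by blast
    ultimately show "c j = \<zero>\<^bsub>S_ring scale\<^esub>" by (simp add: ext_def)
  qed (use b' in auto)
  then show ?thesis using J' by blast
qed

text \<open>N1/N0 is the kernel of a surjection between graded free modules. Induct on the basis of
  M0/N1: each step passes to the kernel of one coordinate function by
  \<open>eliminate_one\<close>.\<close>

lemma rel_basis_kernel:
  assumes "rel_basis N0 M0 J b d" "rel_basis N1 M0 L p e"
    and "gsubmodule N0" "gsubmodule N1" "submodule M0 (S_ring scale) M" "N0 \<subseteq> N1" "N1 \<subseteq> M0"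
  shows "\<exists>J' b'. J' \<subseteq> J \<and> rel_basis N0 N1 J' b' d"
proof -
  have "finite L" using assms(2) by (simp add: rel_basis_def)
  then show ?thesis using assms
  proof (induction L arbitrary: M0 J b rule: finite_induct)
    case empty
    have "m \<in> N1" if "m \<in> M0" for m
    proof -
      have "m \<in> carrier M" using that submodule_facts(1)[OF empty.prems(5)] by blast
      then have "m \<ominus>\<^bsub>M\<^esub> \<zero>\<^bsub>M\<^esub> = m" by (rule diff_zero)
      moreover have "m \<ominus>\<^bsub>M\<^esub> \<zero>\<^bsub>M\<^esub> \<in> N1" using empty.prems(2) that unfolding rel_basis_def by simp
      ultimately show ?thesis by simp
    qed
    then have "M0 = N1" using empty.prems by auto
    then show ?case using empty.prems by blast
  next
    case (insert l L)
    note N1 = insert.prems(4) and M0 = insert.prems(5)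
    note M0f = submodule_facts[OF M0]
    have N1s: "submodule N1 (S_ring scale) M" using N1 by (simp add: gsubmodule_def)
    obtain \<phi> where phi: "\<And>m. m \<in> M0 \<Longrightarrow> \<phi> m \<in> insert l L \<rightarrow> S"
      "\<And>m. m \<in> M0 \<Longrightarrow> m \<ominus>\<^bsub>M\<^esub> (\<Oplus>\<^bsub>M\<^esub>j \<in> insert l L. \<phi> m j \<odot>\<^bsub>M\<^esub> p j) \<in> N1"
      "\<And>m c. m \<in> M0 \<Longrightarrow> c \<in> insert l L \<rightarrow> S \<Longrightarrow> m \<ominus>\<^bsub>M\<^esub> (\<Oplus>\<^bsub>M\<^esub>j \<in> insert l L. c j \<odot>\<^bsub>M\<^esub> p j) \<in> N1 \<Longrightarrow> \<forall>j \<in> insert l L. c j = \<phi> m j"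
      "\<And>m m' j. m \<in> M0 \<Longrightarrow> m' \<in> M0 \<Longrightarrow> j \<in> insert l L \<Longrightarrow> \<phi> (m \<oplus>\<^bsub>M\<^esub> m') j = (\<lambda>v. \<phi> m j v + \<phi> m' j v)"
      "\<And>m s j. m \<in> M0 \<Longrightarrow> s \<in> S \<Longrightarrow> j \<in> insert l L \<Longrightarrow> \<phi> (s \<odot>\<^bsub>M\<^esub> m) j = (\<lambda>v. s v * \<phi> m j v)"
      "\<And>m j n. m \<in> M0 \<Longrightarrow> m \<in> part M n \<Longrightarrow> j \<in> insert l L \<Longrightarrow> \<phi> m j \<in> Sp (n - e j)"
      by (fact rel_basis_coordinates[OF insert.prems(2) N1 M0])
    have pM0: "\<And>j. j \<in> insert l L \<Longrightarrow> p j \<in> M0" and pp: "\<And>j. j \<in> insert l L \<Longrightarrow> p j \<in> part M (e j)"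
      and pind: "\<And>c j. c \<in> insert l L \<rightarrow> S \<Longrightarrow> (\<Oplus>\<^bsub>M\<^esub>j \<in> insert l L. c j \<odot>\<^bsub>M\<^esub> p j) \<in> N1 \<Longrightarrow> j \<in> insert l L \<Longrightarrow> c j = (\<lambda>_. 0)"
      and pc: "p \<in> insert l L \<rightarrow> carrier M"
      by (fact rel_basisD[OF insert.prems(2)])+
    have phi_N1: "\<phi> m j = (\<lambda>_. 0)" if "m \<in> N1" "j \<in> insert l L" for m j
    proof -
      have "(\<Oplus>\<^bsub>M\<^esub>j \<in> insert l L. (\<lambda>_. (\<lambda>_. 0)) j \<odot>\<^bsub>M\<^esub> p j) = \<zero>\<^bsub>M\<^esub>"
        using pc smult_l_null by (intro M.add.finprod_one_eqI) auto
      then have "m \<ominus>\<^bsub>M\<^esub> (\<Oplus>\<^bsub>M\<^esub>j \<in> insert l L. (\<lambda>_. (\<lambda>_. 0)) j \<odot>\<^bsub>M\<^esub> p j) \<in> N1"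
        using that diff_zero[OF subsetD[OF submodule_facts(1)[OF N1s] that(1)]] by simp
      moreover have "m \<in> M0" using that insert.prems(7) by blast
      ultimately show ?thesis using phi(3)[of m "\<lambda>_ _. 0"] that(2) by fastforce
    qed
    \<comment> \<open>The kernel of the coordinate at l. Modulo N1 the remaining members of p form a
      basis of it, so the induction continues with M1 in place of M0.\<close>
    define M1 where "M1 = {m \<in> M0. \<phi> m l = (\<lambda>_. 0)}"
    have "\<exists>J' b'. J' \<subseteq> J \<and> rel_basis N0 {m \<in> M0. \<phi> m l = (\<lambda>_. 0)} J' b' d"
    proof (rule eliminate_one[OF insert.prems(1,3,5)])
      show "N0 \<subseteq> M0" using insert.prems by auto
      show "p l \<in> M0" using pM0 by auto
      have "(\<Oplus>\<^bsub>M\<^esub>j \<in> insert l L. (if j = l then \<one>\<^bsub>S_ring scale\<^esub> else \<zero>\<^bsub>S_ring scale\<^esub>) \<odot>\<^bsub>M\<^esub> p j) = \<one>\<^bsub>S_ring scale\<^esub> \<odot>\<^bsub>M\<^esub> p l"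
        by (rule lc_single) (use insert.hyps pc in auto)
      also have "\<dots> = p l" using pc smult_one by (auto simp del: S_ring_simps)
      finally have "p l \<ominus>\<^bsub>M\<^esub> (\<Oplus>\<^bsub>M\<^esub>j \<in> insert l L. (if j = l then \<one>\<^bsub>S_ring scale\<^esub> else \<zero>\<^bsub>S_ring scale\<^esub>) \<odot>\<^bsub>M\<^esub> p j) \<in> N1"
        using pc submodule_facts(2)[OF N1s] by (simp add: a_minus_def M.r_neg)
      from phi(3)[OF pM0 _ this] show "\<phi> (p l) l = (\<lambda>_. 1)" by auto
      show "\<And>m n. m \<in> M0 \<Longrightarrow> m \<in> part M n \<Longrightarrow> \<phi> m l \<in> Sp (n - e l)" by (rule phi(6)) simp_all
      show "\<phi> m l \<in> S" if "m \<in> M0" for m using funcset_mem[OF phi(1)[OF that], of l] by simp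
      show "\<phi> (m \<oplus>\<^bsub>M\<^esub> m') l = (\<lambda>v. \<phi> m l v + \<phi> m' l v)" if "m \<in> M0" "m' \<in> M0" for m m'
        by (rule phi(4)[OF that]) simp
      show "\<phi> (s \<odot>\<^bsub>M\<^esub> m) l = (\<lambda>v. s v * \<phi> m l v)" if "m \<in> M0" "s \<in> S" for m s
        by (rule phi(5)[OF that]) simp
      show "\<phi> m l = (\<lambda>_. 0)" if "m \<in> N0" for m
        using phi_N1[of m l] that insert.prems(6) by blast
    qed
    then obtain J' b' where J': "J' \<subseteq> J" "rel_basis N0 M1 J' b' d" unfolding M1_def by blast
    have M1: "submodule M1 (S_ring scale) M"
    proof (rule submoduleI)
      show "M1 \<subseteq> carrier M" using M0f(1) by (auto simp: M1_def)
      show "\<zero>\<^bsub>M\<^esub> \<in> M1" using M0f(2) phi_N1[OF submodule_facts(2)[OF N1s]] by (auto simp: M1_def)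
      show smult: "s \<odot>\<^bsub>M\<^esub> m \<in> M1" if "s \<in> S" "m \<in> M1" for s m
        using that M0f(6) phi(5) by (auto simp: M1_def)
      show "\<And>a b. a \<in> M1 \<Longrightarrow> b \<in> M1 \<Longrightarrow> a \<oplus>\<^bsub>M\<^esub> b \<in> M1" using M0f(4) phi(4) by (auto simp: M1_def)
      fix a assume a: "a \<in> M1"
      then have ac: "a \<in> carrier M" using M0f(1) by (auto simp: M1_def)
      have "\<ominus>\<^bsub>M\<^esub> a = (\<ominus>\<^bsub>S_ring scale\<^esub> \<one>\<^bsub>S_ring scale\<^esub>) \<odot>\<^bsub>M\<^esub> a"
        using smult_l_minus[of "\<one>\<^bsub>S_ring scale\<^esub>" a] ac by (simp del: S_ring_simps)
      then show "\<ominus>\<^bsub>M\<^esub> a \<in> M1" using smult[OF _ a, of "\<ominus>\<^bsub>S_ring scale\<^esub> \<one>\<^bsub>S_ring scale\<^esub>"] by (simp del: S_ring_simps)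
    qed
    have lcL: "(\<Oplus>\<^bsub>M\<^esub>j \<in> insert l L. c j \<odot>\<^bsub>M\<^esub> p j) = (\<Oplus>\<^bsub>M\<^esub>j \<in> L. c j \<odot>\<^bsub>M\<^esub> p j)"
      if "c \<in> L \<rightarrow> S" "c l = (\<lambda>_. 0)" for c
      using insert.hyps that pc smult_l_null[of "p l"] by (subst finsum_insert) (auto simp: Pi_iff)
    have "rel_basis N1 M1 L p e"
      unfolding rel_basis_def
    proof (intro conjI ballI impI)
      fix j assume j: "j \<in> L"
      have "(\<Oplus>\<^bsub>M\<^esub>i \<in> insert l L. (if i = j then \<one>\<^bsub>S_ring scale\<^esub> else \<zero>\<^bsub>S_ring scale\<^esub>) \<odot>\<^bsub>M\<^esub> p i) = \<one>\<^bsub>S_ring scale\<^esub> \<odot>\<^bsub>M\<^esub> p j"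
        by (rule lc_single) (use insert.hyps pc j in auto)
      also have "\<dots> = p j" by (rule smult_one) (use pc j in blast)
      finally have "p j \<ominus>\<^bsub>M\<^esub> (\<Oplus>\<^bsub>M\<^esub>i \<in> insert l L. (if i = j then \<one>\<^bsub>S_ring scale\<^esub> else \<zero>\<^bsub>S_ring scale\<^esub>) \<odot>\<^bsub>M\<^esub> p i) \<in> N1"
        using pc j submodule_facts(2)[OF N1s] by (auto simp add: a_minus_def M.r_neg Pi_iff)
      from phi(3)[OF pM0 _ this] j have "\<phi> (p j) l = (\<lambda>_. 0)" using insert.hyps by auto
      then show "p j \<in> M1" using pM0 j by (auto simp: M1_def)
      show "p j \<in> part M (e j)" using pp j by auto
    next
      fix m assume "m \<in> M1"
      then have m: "m \<in> M0" "\<phi> m l = (\<lambda>_. 0)" by (auto simp: M1_def)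
      show "\<exists>c \<in> L \<rightarrow> S. m \<ominus>\<^bsub>M\<^esub> (\<Oplus>\<^bsub>M\<^esub>j \<in> L. c j \<odot>\<^bsub>M\<^esub> p j) \<in> N1"
        using phi(1,2)[OF m(1)] lcL[of "\<phi> m"] m(2) by (intro bexI[of _ "\<phi> m"]) auto
    next
      fix c j assume c: "c \<in> L \<rightarrow> S" "(\<Oplus>\<^bsub>M\<^esub>j \<in> L. c j \<odot>\<^bsub>M\<^esub> p j) \<in> N1" and j: "j \<in> L"
      define c' where "c' j = (if j = l then (\<lambda>_. 0) else c j)" for j
      have "(\<Oplus>\<^bsub>M\<^esub>j \<in> L. c' j \<odot>\<^bsub>M\<^esub> p j) = (\<Oplus>\<^bsub>M\<^esub>j \<in> L. c j \<odot>\<^bsub>M\<^esub> p j)"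
        using c(1) pc insert.hyps by (intro finsum_cong') (auto simp: Pi_iff c'_def)
      moreover have "c' \<in> L \<rightarrow> S" "c' l = (\<lambda>_. 0)" "c' \<in> insert l L \<rightarrow> S"
        using c(1) by (auto simp: c'_def Pi_iff)
      ultimately have "\<forall>j \<in> insert l L. c' j = (\<lambda>_. 0)"
        using pind[of c'] lcL[of c'] c(2) by metis
      then have "c' j = (\<lambda>_. 0)" using j by blast
      moreover have "j \<noteq> l" using j insert.hyps by blast
      ultimately show "c j = \<zero>\<^bsub>S_ring scale\<^esub>" by (simp add: c'_def)
    qed (use insert.hyps in auto)
    moreover have "N1 \<subseteq> M1" using phi_N1 insert.prems(7) by (auto simp: M1_def)
    ultimately obtain J'' b'' where "J'' \<subseteq> J'" "rel_basis N0 N1 J'' b'' d"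
      using insert.IH[OF J'(2) _ insert.prems(3,4) M1 insert.prems(6)] by blast
    then show ?case using J' by blast
  qed
qed

lemma rel_basis_reindex:
  assumes "rel_basis N0 N1 J b d" "bij_betw h K J"
  shows "rel_basis N0 N1 K (\<lambda>k. b (h k)) (\<lambda>k. d (h k))"
proof -
  have h: "inj_on h K" "h ` K = J" using assms(2) by (auto simp: bij_betw_def)
  have B: "finite J" "\<And>j. j \<in> J \<Longrightarrow> b j \<in> N1" "\<And>j. j \<in> J \<Longrightarrow> b j \<in> part M (d j)"
    "\<And>m. m \<in> N1 \<Longrightarrow> \<exists>c \<in> J \<rightarrow> S. m \<ominus>\<^bsub>M\<^esub> (\<Oplus>\<^bsub>M\<^esub>j \<in> J. c j \<odot>\<^bsub>M\<^esub> b j) \<in> N0"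
    "\<And>c j. c \<in> J \<rightarrow> S \<Longrightarrow> (\<Oplus>\<^bsub>M\<^esub>j \<in> J. c j \<odot>\<^bsub>M\<^esub> b j) \<in> N0 \<Longrightarrow> j \<in> J \<Longrightarrow> c j = (\<lambda>_. 0)"
    using assms(1) unfolding rel_basis_def by auto
  have bc: "b \<in> J \<rightarrow> carrier M" using B(3) part_carrier by blast
  have lc: "(\<Oplus>\<^bsub>M\<^esub>k \<in> K. c (h k) \<odot>\<^bsub>M\<^esub> b (h k)) = (\<Oplus>\<^bsub>M\<^esub>j \<in> J. c j \<odot>\<^bsub>M\<^esub> b j)" if "c \<in> J \<rightarrow> S" for c
    using M.finsum_reindex[of "\<lambda>j. c j \<odot>\<^bsub>M\<^esub> b j" h K] h that bc by (auto simp: Pi_iff)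
  show ?thesis
    unfolding rel_basis_def
  proof (intro conjI ballI impI)
    show "finite K" using B(1) h finite_imageD by blast
  next
    fix m assume "m \<in> N1"
    then obtain c where "c \<in> J \<rightarrow> S" "m \<ominus>\<^bsub>M\<^esub> (\<Oplus>\<^bsub>M\<^esub>j \<in> J. c j \<odot>\<^bsub>M\<^esub> b j) \<in> N0" using B(4) by blast
    then show "\<exists>c \<in> K \<rightarrow> S. m \<ominus>\<^bsub>M\<^esub> (\<Oplus>\<^bsub>M\<^esub>k \<in> K. c k \<odot>\<^bsub>M\<^esub> b (h k)) \<in> N0"
      using lc h by (intro bexI[of _ "\<lambda>k. c (h k)"]) auto
  next
    fix c k assume c: "c \<in> K \<rightarrow> S" "(\<Oplus>\<^bsub>M\<^esub>k \<in> K. c k \<odot>\<^bsub>M\<^esub> b (h k)) \<in> N0" and k: "k \<in> K"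
    define c' where "c' j = c (the_inv_into K h j)" for j
    have c'h: "c' (h k) = c k" if "k \<in> K" for k using the_inv_into_f_f[OF h(1) that] by (simp add: c'_def)
    have c'S: "c' \<in> J \<rightarrow> S" using c(1) c'h h(2) by auto
    have "(\<Oplus>\<^bsub>M\<^esub>k \<in> K. c k \<odot>\<^bsub>M\<^esub> b (h k)) = (\<Oplus>\<^bsub>M\<^esub>k \<in> K. c' (h k) \<odot>\<^bsub>M\<^esub> b (h k))"
      using c'h c(1) bc h(2) by (intro finsum_cong') (auto simp: Pi_iff)
    then have "c' (h k) = (\<lambda>_. 0)" using B(5)[OF c'S] lc[OF c'S] c(2) k h(2) by auto
    then show "c k = \<zero>\<^bsub>S_ring scale\<^esub>" using c'h k by simp
  qed (use B h in auto)
qed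

text \<open>The free case: the fibre of the identity over 0 is trivial. The homogeneous coefficients
  that a presentation contains come from \<open>homogeneous_coefficients\<close>.\<close>

lemma rel_basis_iff_presentation:
  assumes N0: "gsubmodule N0"
  shows "rel_basis N0 N1 {..<n} b d \<longleftrightarrow> presentation N0 N1 n b (\<lambda>j. - d j) (\<lambda>j r. r)"
proof
  assume B: "rel_basis N0 N1 {..<n} b d"
  show "presentation N0 N1 n b (\<lambda>j. - d j) (\<lambda>j r. r)"
    unfolding presentation_def
  proof (intro conjI allI ballI impI iffI)
    fix F j assume "F \<in> {..<n} \<rightarrow> S" "(\<Oplus>\<^bsub>M\<^esub>j \<in> {..<n}. F j \<odot>\<^bsub>M\<^esub> b j) \<in> N0" "j < n"
    then show "F j = \<zero>\<^bsub>S_ring scale\<^esub>" using B unfolding rel_basis_def by blast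
  next
    fix F assume F: "\<forall>j<n. F j = \<zero>\<^bsub>S_ring scale\<^esub>"
    have "b \<in> {..<n} \<rightarrow> carrier M" using B part_carrier unfolding rel_basis_def by blast
    then have "(\<Oplus>\<^bsub>M\<^esub>j \<in> {..<n}. F j \<odot>\<^bsub>M\<^esub> b j) = \<zero>\<^bsub>M\<^esub>"
      using F smult_l_null by (intro M.add.finprod_one_eqI) (auto simp: Pi_iff)
    then show "(\<Oplus>\<^bsub>M\<^esub>j \<in> {..<n}. F j \<odot>\<^bsub>M\<^esub> b j) \<in> N0"
      using submodule_facts(2) N0 by (simp add: gsubmodule_def)
  next
    fix i m assume m: "m \<in> N1" "m \<in> part M i"
    obtain c where "c \<in> {..<n} \<rightarrow> S" "m \<ominus>\<^bsub>M\<^esub> (\<Oplus>\<^bsub>M\<^esub>j \<in> {..<n}. c j \<odot>\<^bsub>M\<^esub> b j) \<in> N0"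
      using B m(1) unfolding rel_basis_def by blast
    from homogeneous_coefficients[OF N0 _ _ this(1) m(2) this(2), of d]
    show "\<exists>F. (\<forall>j<n. F j \<in> Sp (i + - d j)) \<and> m \<ominus>\<^bsub>M\<^esub> (\<Oplus>\<^bsub>M\<^esub>j \<in> {..<n}. F j \<odot>\<^bsub>M\<^esub> b j) \<in> N0"
      using B unfolding rel_basis_def by auto
  qed (use B in \<open>auto simp: rel_basis_def\<close>)
next
  assume "presentation N0 N1 n b (\<lambda>j. - d j) (\<lambda>j r. r)"
  then show "rel_basis N0 N1 {..<n} b d"
    unfolding presentation_def rel_basis_def by auto
qed

text \<open>In the application Np is M^Omega, and \<open>\<pi>\<close> is the projection of M onto
  it with kernel N0 the sections over the complement of Omega.\<close>

lemma graded_free_iff_rel_basis: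
  fixes Np :: "('v \<Rightarrow> 'k, 'p) gmodule"
  assumes N0: "gsubmodule N0"
    and Np: "carrier Np = \<pi> ` carrier M"
      "\<And>m m'. m \<in> carrier M \<Longrightarrow> m' \<in> carrier M \<Longrightarrow> \<pi> m = \<pi> m' \<longleftrightarrow> m \<ominus>\<^bsub>M\<^esub> m' \<in> N0"
      "\<And>m m'. m \<in> carrier M \<Longrightarrow> m' \<in> carrier M \<Longrightarrow> \<pi> m \<oplus>\<^bsub>Np\<^esub> \<pi> m' = \<pi> (m \<oplus>\<^bsub>M\<^esub> m')"
      "\<And>r m. r \<in> S \<Longrightarrow> m \<in> carrier M \<Longrightarrow> r \<odot>\<^bsub>Np\<^esub> \<pi> m = \<pi> (r \<odot>\<^bsub>M\<^esub> m)"
      "\<And>i. part Np i = \<pi> ` part M i"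
  shows "graded_free (S_ring scale) Np \<longleftrightarrow> (\<exists>(n::nat) b d. rel_basis N0 (carrier M) {..<n} b d)"
proof -
  have N0s: "submodule N0 (S_ring scale) M" using N0 by (simp add: gsubmodule_def)
  have pc: "part M i \<inter> carrier M = part M i" for i using part_carrier by auto
  have *: "gmod_iso (S_ring scale) Np (gdirect_sum {..<n} (\<lambda>j. gshift (ring_as_gmodule (S_ring scale)) (k j))) \<longleftrightarrow>
    (\<exists>b. presentation N0 (carrier M) n b k (\<lambda>j r. r))" for n :: nat and k
    by (rule gmod_iso_cyclic[where \<pi> = \<pi>])
      (use Np N0s carrier_is_submodule submodule_facts(1)[OF N0s] const_Sp zero_Sp pc in \<open>auto simp: ring_as_gmodule_def\<close>)
  have "graded_free (S_ring scale) Np \<longleftrightarrow> (\<exists>(n::nat) k b. presentation N0 (carrier M) n b k (\<lambda>j r. r))"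
    unfolding graded_free_def * ..
  also have "\<dots> \<longleftrightarrow> (\<exists>(n::nat) b d. rel_basis N0 (carrier M) {..<n} b d)"
    unfolding rel_basis_iff_presentation[OF N0]
  proof safe
    fix n :: nat and k b assume "presentation N0 (carrier M) n b k (\<lambda>j r. r)"
    then show "\<exists>(n::nat) b d. presentation N0 (carrier M) n b (\<lambda>j. - d j) (\<lambda>j r. r)"
      by (intro exI[of _ n] exI[of _ b] exI[of _ "\<lambda>j. - k j"]) simp
  qed blast
  finally show ?thesis .
qed

end

section \<open>Triangular bases\<close>

lemma finsum_transfer:
  assumes "carrier N = carrier M" "ring.add N = ring.add M" "ring.zero N = ring.zero M"
  shows "finsum N = finsum M" "a_inv N = a_inv M" "a_minus N = a_minus M"
  by (simp_all add: fun_eq_iff finsum_def a_inv_def a_minus_def assms finprod_def m_inv_def Units_def)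

lemma abelian_group_transfer:
  assumes "abelian_group M" "carrier N = carrier M" "ring.add N = ring.add M" "ring.zero N = ring.zero M"
  shows "abelian_group N"
proof -
  interpret M: abelian_group M by fact
  show ?thesis
  proof (rule abelian_groupI)
    fix x assume "x \<in> carrier N"
    then show "\<exists>y\<in>carrier N. y \<oplus>\<^bsub>N\<^esub> x = \<zero>\<^bsub>N\<^esub>"
      using assms M.l_neg M.a_inv_closed by auto
  qed (auto simp: assms M.a_ac)
qed

text \<open>All changes of scalars below keep the underlying graded group: to the right copy of S,
  from Z to S tensor S, and back. Only the laws of the new action remain to be checked.\<close>

lemma graded_module_transfer:
  fixes M :: "('a, 'm) gmodule" and N :: "('b, 'm) gmodule"
  assumes M: "graded_module R M" and R': "cring R'"
    and eq: "carrier N = carrier M" "ring.add N = ring.add M" "ring.zero N = ring.zero M" "part N = part M"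
    and smult: "\<And>a x. a \<in> carrier R' \<Longrightarrow> x \<in> carrier M \<Longrightarrow> a \<odot>\<^bsub>N\<^esub> x \<in> carrier M"
      "\<And>a b x. a \<in> carrier R' \<Longrightarrow> b \<in> carrier R' \<Longrightarrow> x \<in> carrier M \<Longrightarrow> (a \<oplus>\<^bsub>R'\<^esub> b) \<odot>\<^bsub>N\<^esub> x = a \<odot>\<^bsub>N\<^esub> x \<oplus>\<^bsub>M\<^esub> b \<odot>\<^bsub>N\<^esub> x"
      "\<And>a x y. a \<in> carrier R' \<Longrightarrow> x \<in> carrier M \<Longrightarrow> y \<in> carrier M \<Longrightarrow> a \<odot>\<^bsub>N\<^esub> (x \<oplus>\<^bsub>M\<^esub> y) = a \<odot>\<^bsub>N\<^esub> x \<oplus>\<^bsub>M\<^esub> a \<odot>\<^bsub>N\<^esub> y"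
      "\<And>a b x. a \<in> carrier R' \<Longrightarrow> b \<in> carrier R' \<Longrightarrow> x \<in> carrier M \<Longrightarrow> (a \<otimes>\<^bsub>R'\<^esub> b) \<odot>\<^bsub>N\<^esub> x = a \<odot>\<^bsub>N\<^esub> (b \<odot>\<^bsub>N\<^esub> x)"
      "\<And>x. x \<in> carrier M \<Longrightarrow> \<one>\<^bsub>R'\<^esub> \<odot>\<^bsub>N\<^esub> x = x"
    and part: "\<And>i j r m. r \<in> rpart R' i \<Longrightarrow> m \<in> part M j \<Longrightarrow> r \<odot>\<^bsub>N\<^esub> m \<in> part M (i + j)"
  shows "graded_module R' N"
proof -
  interpret M: Module.module R M using M by (simp add: graded_module_def)
  have ag: "abelian_group N" by (rule abelian_group_transfer[OF M.abelian_group_axioms eq(1-3)])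
  have m: "Module.module R' N"
    by (rule moduleI[OF R' ag]) (simp_all add: eq smult)
  have fs: "finsum N = finsum M" by (rule finsum_transfer[OF eq(1-3)])
  have as: "additive_subgroup (part N n) N" for n
  proof -
    have "additive_subgroup (part M n) M" using M by (simp add: graded_module_def)
    then show ?thesis
      by (simp add: additive_subgroup_def subgroup_def eq m_inv_def Units_def)
  qed
  show ?thesis
    unfolding graded_module_def eq fs using m as M part by (simp add: graded_module_def eq)
qed

context coxeter_representation
begin

definition right_module :: "('v \<times> 'v \<Rightarrow> 'k, 'm) gmodule \<Rightarrow> ('v \<Rightarrow> 'k, 'm) gmodule" where
  "right_module M = \<lparr>carrier = carrier M, monoid.mult = monoid.mult M, one = monoid.one M, zero = ring.zero M,
     add = ring.add M, module.smult = (\<lambda>s m. rt s \<odot>\<^bsub>M\<^esub> m), part = part M\<rparr>"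

lemma right_module_simps [simp]:
  "carrier (right_module M) = carrier M" "ring.add (right_module M) = ring.add M" "ring.zero (right_module M) = ring.zero M"
  "part (right_module M) = part M" "Module.module.smult (right_module M) s m = rt s \<odot>\<^bsub>M\<^esub> m"
  by (simp_all add: right_module_def)

lemma rt_simps: "rt (\<lambda>v. s v + t v) = (\<lambda>p. rt s p + rt t p)" "rt (\<lambda>v. s v * t v) = (\<lambda>p. rt s p * rt t p)"
  "rt (\<lambda>v. s v - t v) = (\<lambda>p. rt s p - rt t p)" "rt (\<lambda>v. c) = (\<lambda>p. c)"
  by (auto simp: rt_def)

lemma right_module_graded:
  assumes "graded_module (SS_ring scale) M"
  shows "graded_module (S_ring scale) (right_module M)"
proof -
  interpret M: Module.module "SS_ring scale" M using assms by (simp add: graded_module_def)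
  show ?thesis
  proof (rule graded_module_transfer[OF assms S_cring])
    fix a b x assume a: "a \<in> S" and b: "b \<in> S" and x: "x \<in> carrier M"
    show "(a \<oplus>\<^bsub>S_ring scale\<^esub> b) \<odot>\<^bsub>right_module M\<^esub> x = a \<odot>\<^bsub>right_module M\<^esub> x \<oplus>\<^bsub>M\<^esub> b \<odot>\<^bsub>right_module M\<^esub> x"
      using M.smult_l_distr[OF rt_SS[OF a] rt_SS[OF b] x] by (simp add: rt_simps)
    show "(a \<otimes>\<^bsub>S_ring scale\<^esub> b) \<odot>\<^bsub>right_module M\<^esub> x = a \<odot>\<^bsub>right_module M\<^esub> (b \<odot>\<^bsub>right_module M\<^esub> x)"
      using M.smult_assoc1[OF rt_SS[OF a] rt_SS[OF b] x] by (simp add: rt_simps)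
  next
    fix x assume "x \<in> carrier M"
    then show "\<one>\<^bsub>S_ring scale\<^esub> \<odot>\<^bsub>right_module M\<^esub> x = x" using M.smult_one[of x] by (simp add: rt_simps)
  next
    fix i j r m assume "r \<in> Sp i" "m \<in> part M j"
    then show "r \<odot>\<^bsub>right_module M\<^esub> m \<in> part M (i + j)" using assms rt_SSp by (simp add: graded_module_def)
  qed (simp_all add: M.smult_r_distr)
qed

end

text \<open>The common ground of both categories: torsion free over the right copy of S, and
  annihilated by every function that vanishes on the graphs over the finite set A. After inverting
  the nonzero elements of S such a module splits into components indexed by A.\<close>

locale supported_module = coxeter_representation scale W I \<rho> \<alpha>
  for scale :: "'k::field \<Rightarrow> 'v::ab_group_add \<Rightarrow> 'v" and W :: "'w monoid" and I \<rho> \<alpha> +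
  fixes M :: "('v \<times> 'v \<Rightarrow> 'k, 'm) gmodule" and A :: "'w set"
  assumes SS_graded: "graded_module (SS_ring scale) M"
    and A: "finite A" "A \<subseteq> carrier W"
    and torsion_free: "\<And>s m. s \<in> carrier (S_ring scale) \<Longrightarrow> m \<in> carrier M \<Longrightarrow> rt s \<odot>\<^bsub>M\<^esub> m = \<zero>\<^bsub>M\<^esub> \<Longrightarrow> s = (\<lambda>_. 0) \<or> m = \<zero>\<^bsub>M\<^esub>"
    and vanishing_kills: "\<And>F m. F \<in> carrier (SS_ring scale) \<Longrightarrow> (\<And>x. x \<in> A \<Longrightarrow> res x F = (\<lambda>_. 0)) \<Longrightarrow> m \<in> carrier M \<Longrightarrow> F \<odot>\<^bsub>M\<^esub> m = \<zero>\<^bsub>M\<^esub>"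
begin

abbreviation N where "N \<equiv> right_module M"

sublocale SSM: graded_mod "SS_ring scale" M
  using SS_graded SSp_SS by unfold_locales auto

sublocale N: S_module scale N
  using right_module_graded[OF SS_graded] by unfold_locales

definition act :: "('v \<times> 'v \<Rightarrow> 'k) \<Rightarrow> 'm \<Rightarrow> 'm" where "act F m = F \<odot>\<^bsub>M\<^esub> m"

section \<open>Action of functions and sections supported on graphs\<close>

lemma smult_N: "s \<odot>\<^bsub>N\<^esub> m = act (rt s) m"
  by (simp add: act_def)

lemma minus_N: "a_minus N = a_minus M" "a_inv N = a_inv M" "finsum N = finsum M"
  by (simp_all add: finsum_transfer[of N M])

lemma hc_N: "N.hc = SSM.hc"
  unfolding N.hc_def SSM.hc_def fun_eq_iff by (simp add: minus_N)

lemma act_closed [simp, intro]: "F \<in> SS \<Longrightarrow> m \<in> carrier M \<Longrightarrow> act F m \<in> carrier M"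
  by (simp add: act_def)

lemma act_add: "F \<in> SS \<Longrightarrow> G \<in> SS \<Longrightarrow> m \<in> carrier M \<Longrightarrow> act (\<lambda>p. F p + G p) m = act F m \<oplus>\<^bsub>M\<^esub> act G m"
  using SSM.smult_l_distr[of F G m] by (simp add: act_def)

lemma act_mult: "F \<in> SS \<Longrightarrow> G \<in> SS \<Longrightarrow> m \<in> carrier M \<Longrightarrow> act (\<lambda>p. F p * G p) m = act F (act G m)"
  using SSM.smult_assoc1[of F G m] by (simp add: act_def)

lemma act_comm: "F \<in> SS \<Longrightarrow> G \<in> SS \<Longrightarrow> m \<in> carrier M \<Longrightarrow> act F (act G m) = act G (act F m)"
  using act_mult[of F G m] act_mult[of G F m] by (simp add: mult.commute)

lemma act_plus: "F \<in> SS \<Longrightarrow> m \<in> carrier M \<Longrightarrow> m' \<in> carrier M \<Longrightarrow> act F (m \<oplus>\<^bsub>M\<^esub> m') = act F m \<oplus>\<^bsub>M\<^esub> act F m'"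
  by (simp add: act_def SSM.smult_r_distr)

lemma act_minus: "F \<in> SS \<Longrightarrow> m \<in> carrier M \<Longrightarrow> m' \<in> carrier M \<Longrightarrow> act F (m \<ominus>\<^bsub>M\<^esub> m') = act F m \<ominus>\<^bsub>M\<^esub> act F m'"
  by (simp add: act_def SSM.smult_diff)

lemma act_uminus: "F \<in> SS \<Longrightarrow> m \<in> carrier M \<Longrightarrow> act F (\<ominus>\<^bsub>M\<^esub> m) = \<ominus>\<^bsub>M\<^esub> act F m"
  by (simp add: act_def SSM.smult_r_minus)

lemma act_zero [simp]: "F \<in> SS \<Longrightarrow> act F \<zero>\<^bsub>M\<^esub> = \<zero>\<^bsub>M\<^esub>"
  by (simp add: act_def)

lemma act_one [simp]: "m \<in> carrier M \<Longrightarrow> act (\<lambda>_. 1) m = m"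
  using SSM.smult_one[of m] by (simp add: act_def)

lemma act_diff:
  assumes "F \<in> SS" "G \<in> SS" "m \<in> carrier M"
  shows "act (\<lambda>p. F p - G p) m = act F m \<ominus>\<^bsub>M\<^esub> act G m"
proof -
  have "act F m = act (\<lambda>p. (F p - G p) + G p) m" by simp
  also have "\<dots> = act (\<lambda>p. F p - G p) m \<oplus>\<^bsub>M\<^esub> act G m" using assms by (intro act_add) auto
  finally have "act F m \<ominus>\<^bsub>M\<^esub> act G m = (act (\<lambda>p. F p - G p) m \<oplus>\<^bsub>M\<^esub> act G m) \<ominus>\<^bsub>M\<^esub> act G m" by simp
  also have "\<dots> = act (\<lambda>p. F p - G p) m"
    using assms act_closed[OF diff_SS[OF assms(1,2)] assms(3)]
    by (simp add: a_minus_def SSM.M.add.m_assoc SSM.M.r_neg)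
  finally show ?thesis by simp
qed

lemma minus_zero_iff: "x \<in> carrier M \<Longrightarrow> y \<in> carrier M \<Longrightarrow> x \<ominus>\<^bsub>M\<^esub> y = \<zero>\<^bsub>M\<^esub> \<longleftrightarrow> x = y"
proof
  assume xy: "x \<in> carrier M" "y \<in> carrier M"
  { assume "x \<ominus>\<^bsub>M\<^esub> y = \<zero>\<^bsub>M\<^esub>"
    then show "x = y" using SSM.diff_add_cancel[OF xy] xy by simp }
  { assume "x = y"
    then show "x \<ominus>\<^bsub>M\<^esub> y = \<zero>\<^bsub>M\<^esub>" using xy by (simp add: a_minus_def SSM.M.r_neg) }
qed

lemma add_diff_cancel:
  assumes "x \<in> carrier M" "y \<in> carrier M"
  shows "(x \<oplus>\<^bsub>M\<^esub> y) \<ominus>\<^bsub>M\<^esub> x = y"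
proof -
  have "(x \<oplus>\<^bsub>M\<^esub> y) \<ominus>\<^bsub>M\<^esub> x = \<ominus>\<^bsub>M\<^esub> x \<oplus>\<^bsub>M\<^esub> (x \<oplus>\<^bsub>M\<^esub> y)"
    unfolding a_minus_def using assms by (intro SSM.M.a_comm) auto
  then show ?thesis using SSM.M.r_neg1[OF assms] by simp
qed

lemma act_cong:
  assumes "F \<in> SS" "G \<in> SS" "m \<in> carrier M" "\<And>x. x \<in> A \<Longrightarrow> res x F = res x G"
  shows "act F m = act G m"
proof -
  have "act (\<lambda>p. F p - G p) m = \<zero>\<^bsub>M\<^esub>"
    unfolding act_def using assms by (intro vanishing_kills) auto
  then show ?thesis using act_diff[OF assms(1-3)] minus_zero_iff assms(1-3) by simp
qed

lemma act_vanish: "F \<in> SS \<Longrightarrow> m \<in> carrier M \<Longrightarrow> (\<And>x. x \<in> A \<Longrightarrow> res x F = (\<lambda>_. 0)) \<Longrightarrow> act F m = \<zero>\<^bsub>M\<^esub>"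
  unfolding act_def by (rule vanishing_kills)

lemma act_rt_zero: "s \<in> S \<Longrightarrow> s \<noteq> (\<lambda>_. 0) \<Longrightarrow> m \<in> carrier M \<Longrightarrow> act (rt s) m = \<zero>\<^bsub>M\<^esub> \<Longrightarrow> m = \<zero>\<^bsub>M\<^esub>"
  unfolding act_def using torsion_free by blast

lemma act_rt_cancel:
  assumes "s \<in> S" "s \<noteq> (\<lambda>_. 0)" "m \<in> carrier M" "m' \<in> carrier M" "act (rt s) m = act (rt s) m'"
  shows "m = m'"
proof -
  have "act (rt s) (m \<ominus>\<^bsub>M\<^esub> m') = \<zero>\<^bsub>M\<^esub>"
    using assms minus_zero_iff[of "act (rt s) m" "act (rt s) m'"] by (simp add: act_minus)
  then have "m \<ominus>\<^bsub>M\<^esub> m' = \<zero>\<^bsub>M\<^esub>" using act_rt_zero[OF assms(1,2)] assms(3,4) by simp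
  then show ?thesis using minus_zero_iff assms(3,4) by blast
qed

text \<open>Interpolating the indicator function of x on A gives a numerator of the idempotent at x;
  its denominator is its own restriction to Gr(x).\<close>

lemma delta_exists:
  assumes "x \<in> A"
  shows "\<exists>E. (\<exists>e. E \<in> SSp e) \<and> res x E \<noteq> (\<lambda>_. 0) \<and> (\<forall>y \<in> A. y \<noteq> x \<longrightarrow> res y E = (\<lambda>_. 0))"
proof -
  define z where "z y = (if y = x then (\<lambda>_. 1) else (\<lambda>_. 0) :: 'v \<Rightarrow> 'k)" for y :: 'w
  have zS: "z y \<in> S" "z y \<in> Sp 0" for y by (auto simp: z_def const_Sp)
  obtain D e E where E: "linprod D" "\<forall>y \<in> A. res y E = (\<lambda>v. D v * z y v)"
    "\<forall>d. (\<forall>x \<in> A. z x \<in> Sp d) \<longrightarrow> E \<in> SSp (d + e)"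
    using interpolation[OF A, of z] zS(1) by blast
  then have "E \<in> SSp (0 + e)" using zS(2) by blast
  moreover have "res x E \<noteq> (\<lambda>_. 0)" using E(1,2) assms linprod_nonzero by (auto simp: z_def)
  ultimately show ?thesis using E(2) by (auto simp: z_def)
qed

definition E where
  "E x = (SOME E. (\<exists>e. E \<in> SSp e) \<and> res x E \<noteq> (\<lambda>_. 0) \<and> (\<forall>y \<in> A. y \<noteq> x \<longrightarrow> res y E = (\<lambda>_. 0)))"

lemma E_props:
  assumes "x \<in> A"
  shows "\<exists>e. E x \<in> SSp e" "res x (E x) \<noteq> (\<lambda>_. 0)" "\<And>y. y \<in> A \<Longrightarrow> y \<noteq> x \<Longrightarrow> res y (E x) = (\<lambda>_. 0)" "E x \<in> SS"
    "res x (E x) \<in> S"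
  using someI_ex[OF delta_exists[OF assms]] SSp_SS assms A res_S unfolding E_def[symmetric] by blast+

text \<open>Elements whose components at all points of A outside B vanish, tested by the idempotent
  numerators \<open>E x\<close>. By torsion freeness the result does not depend on how
  \<open>E\<close> was chosen, see \<open>sec_iff\<close>.\<close>

definition sec :: "'w set \<Rightarrow> 'm set" where
  "sec B = {m \<in> carrier M. \<forall>x \<in> A - B. act (E x) m = \<zero>\<^bsub>M\<^esub>}"

lemma sec_carrier: "m \<in> sec B \<Longrightarrow> m \<in> carrier M"
  by (simp add: sec_def)

lemma sec_vanish:
  assumes m: "m \<in> sec B" and F: "F \<in> SS" "\<And>x. x \<in> A \<Longrightarrow> x \<in> B \<Longrightarrow> res x F = (\<lambda>_. 0)"
  shows "act F m = \<zero>\<^bsub>M\<^esub>"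
proof -
  have mc: "m \<in> carrier M" using m sec_carrier by blast
  have *: "finite C \<Longrightarrow> C \<subseteq> A - B \<Longrightarrow> F \<in> SS \<Longrightarrow> (\<And>x. x \<in> A - C \<Longrightarrow> res x F = (\<lambda>_. 0)) \<Longrightarrow> act F m = \<zero>\<^bsub>M\<^esub>" for C F
  proof (induction C arbitrary: F rule: finite_induct)
    case empty
    then show ?case using mc by (intro act_vanish) auto
  next
    case (insert x C)
    have x: "x \<in> A" "act (E x) m = \<zero>\<^bsub>M\<^esub>" "x \<in> carrier W" using insert.prems(1) m A by (auto simp: sec_def)
    note Ex = E_props[OF x(1)]
    define d where "d = res x (E x)"
    have FS: "res x F \<in> S" using res_S insert.prems(2) x by blast
    \<comment> \<open>Both terms agree on Gr(x), and \<open>E x\<close> vanishes on the other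
      graphs, so the difference vanishes at x as well and the exceptional set shrinks. As
      \<open>E x\<close> kills m, this yields d F m = 0, and torsion freeness removes d.\<close>
    define F' where "F' = (\<lambda>p. rt d p * F p - rt (res x F) p * E x p)"
    have F'S: "(\<lambda>p. rt d p * F p) \<in> SS" "(\<lambda>p. rt (res x F) p * E x p) \<in> SS"
      using insert.prems(2) Ex FS by (auto simp: d_def)
    have "act F' m = \<zero>\<^bsub>M\<^esub>"
    proof (rule insert.IH)
      show "F' \<in> SS" unfolding F'_def using diff_SS[OF F'S] .
      fix y assume y: "y \<in> A - C"
      show "res y F' = (\<lambda>_. 0)"
        using insert.prems(3)[of y] Ex(3)[of y] y by (cases "y = x") (auto simp: F'_def d_def)
    qed (use insert.prems in auto)
    moreover have "act F' m = act (rt d) (act F m) \<ominus>\<^bsub>M\<^esub> act (rt (res x F)) (act (E x) m)"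
      unfolding F'_def act_diff[OF F'S mc] using insert.prems(2) Ex FS mc by (simp add: act_mult d_def)
    ultimately have "act (rt d) (act F m) = \<zero>\<^bsub>M\<^esub>"
      using x(2) FS Ex(5) insert.prems(2) mc by (simp add: SSM.diff_zero d_def)
    then show ?case using Ex(2,5) insert.prems(2) mc by (auto simp: d_def intro: act_rt_zero)
  qed
  show ?thesis by (rule *[of "A - B"]) (use A F in auto)
qed

lemma sec_iff: "m \<in> sec B \<longleftrightarrow> m \<in> carrier M \<and> (\<forall>F \<in> SS. (\<forall>x \<in> A \<inter> B. res x F = (\<lambda>_. 0)) \<longrightarrow> act F m = \<zero>\<^bsub>M\<^esub>)"
proof
  assume "m \<in> sec B"
  then show "m \<in> carrier M \<and> (\<forall>F \<in> SS. (\<forall>x \<in> A \<inter> B. res x F = (\<lambda>_. 0)) \<longrightarrow> act F m = \<zero>\<^bsub>M\<^esub>)"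
    using sec_vanish sec_carrier by blast
next
  assume a: "m \<in> carrier M \<and> (\<forall>F \<in> SS. (\<forall>x \<in> A \<inter> B. res x F = (\<lambda>_. 0)) \<longrightarrow> act F m = \<zero>\<^bsub>M\<^esub>)"
  have "act (E x) m = \<zero>\<^bsub>M\<^esub>" if x: "x \<in> A - B" for x
  proof -
    have "E x \<in> SS" "\<forall>y \<in> A \<inter> B. res y (E x) = (\<lambda>_. 0)" using E_props[of x] x by auto
    then show ?thesis using a by blast
  qed
  then show "m \<in> sec B" using a by (simp add: sec_def)
qed

lemma sec_act: "F \<in> SS \<Longrightarrow> m \<in> sec B \<Longrightarrow> act F m \<in> sec B"
proof -
  assume F: "F \<in> SS" and m: "m \<in> sec B"
  have "act (E x) (act F m) = \<zero>\<^bsub>M\<^esub>" if "x \<in> A - B" for x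
    using act_comm[OF _ F sec_carrier[OF m], of "E x"] E_props(4)[of x] that m F by (simp add: sec_def)
  then show ?thesis using F m by (auto simp: sec_def)
qed

lemma sec_add: "m \<in> sec B \<Longrightarrow> m' \<in> sec B \<Longrightarrow> m \<oplus>\<^bsub>M\<^esub> m' \<in> sec B"
  using E_props(4) by (auto simp: sec_def act_plus)

lemma sec_uminus: "m \<in> sec B \<Longrightarrow> \<ominus>\<^bsub>M\<^esub> m \<in> sec B"
  using E_props(4) by (auto simp: sec_def act_uminus)

lemma sec_minus: "m \<in> sec B \<Longrightarrow> m' \<in> sec B \<Longrightarrow> m \<ominus>\<^bsub>M\<^esub> m' \<in> sec B"
  by (simp add: a_minus_def sec_add sec_uminus)

lemma sec_zero [simp]: "\<zero>\<^bsub>M\<^esub> \<in> sec B"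
  using E_props(4) by (auto simp: sec_def)

lemma sec_submodule_SS: "submodule (sec B) (SS_ring scale) M"
  by (rule SSM.submoduleI) (use sec_carrier sec_uminus sec_add sec_act act_def in auto)

text \<open>\<open>E x\<close> was chosen homogeneous for this purpose: it carries the components of
  m to components of \<open>act (E x) m\<close>.\<close>

lemma sec_gsubmodule: "N.gsubmodule (sec B)"
  unfolding N.gsubmodule_def
proof (intro conjI ballI allI)
  show "submodule (sec B) (S_ring scale) N"
    by (rule N.submoduleI) (use sec_carrier sec_uminus sec_add sec_act[OF rt_SS] act_def minus_N in auto)
  fix m n assume m: "m \<in> sec B"
  show "N.hc n m \<in> sec B"
    unfolding sec_def
  proof (intro CollectI conjI ballI)
    show "N.hc n m \<in> carrier M" using sec_carrier[OF m] by (simp add: hc_N)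
    fix x assume x: "x \<in> A - B"
    obtain e where e: "E x \<in> SSp e" using E_props x by blast
    have "act (E x) (N.hc n m) = SSM.hc (e + n) (act (E x) m)"
      unfolding hc_N act_def using SSM.hc_smult[OF e sec_carrier[OF m]] by simp
    then show "act (E x) (N.hc n m) = \<zero>\<^bsub>M\<^esub>" using m x by (simp add: sec_def)
  qed
qed

lemma sec_submodule: "submodule (sec B) (S_ring scale) N"
  using sec_gsubmodule by (simp add: N.gsubmodule_def)

lemma sec_mono: "A \<inter> B \<subseteq> C \<Longrightarrow> m \<in> sec B \<Longrightarrow> m \<in> sec C"
  by (auto simp: sec_def)

lemma sec_all: "A \<subseteq> B \<Longrightarrow> sec B = carrier M"
  by (auto simp: sec_def)

lemma sec_none: "A \<inter> B = {} \<Longrightarrow> sec B = {\<zero>\<^bsub>M\<^esub>}"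
proof -
  assume AB: "A \<inter> B = {}"
  have "m = \<zero>\<^bsub>M\<^esub>" if "m \<in> sec B" for m
    using sec_vanish[OF that, of "\<lambda>_. 1"] AB that sec_carrier by auto
  then show ?thesis by auto
qed

lemma sec_insertD: "m \<in> sec (insert x B) \<Longrightarrow> (x \<in> A \<Longrightarrow> act (E x) m = \<zero>\<^bsub>M\<^esub>) \<Longrightarrow> m \<in> sec B"
  by (auto simp: sec_def)

text \<open>For dropping denominators: the quotient of M by \<open>sec B\<close> is again torsion
  free.\<close>

lemma sec_rt_cancel: "s \<in> S \<Longrightarrow> s \<noteq> (\<lambda>_. 0) \<Longrightarrow> m \<in> carrier M \<Longrightarrow> act (rt s) m \<in> sec B \<Longrightarrow> m \<in> sec B"
proof -
  assume s: "s \<in> S" "s \<noteq> (\<lambda>_. 0)" and m: "m \<in> carrier M" and sm: "act (rt s) m \<in> sec B"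
  have "act (E x) m = \<zero>\<^bsub>M\<^esub>" if x: "x \<in> A - B" for x
  proof -
    have Ex: "E x \<in> SS" using E_props(4) x by blast
    have "act (rt s) (act (E x) m) = \<zero>\<^bsub>M\<^esub>"
      using act_comm[OF rt_SS[OF s(1)] Ex m] sm x by (simp add: sec_def)
    then show ?thesis using act_rt_zero[OF s] Ex m by simp
  qed
  then show ?thesis using m by (simp add: sec_def)
qed

abbreviation lc where "lc K c b \<equiv> (\<Oplus>\<^bsub>N\<^esub>j \<in> K. c j \<odot>\<^bsub>N\<^esub> b j)"

section \<open>Bases triangular with respect to a rank\<close>

lemma lc_closed': "finite K \<Longrightarrow> c \<in> K \<rightarrow> S \<Longrightarrow> (\<And>j. j \<in> K \<Longrightarrow> b j \<in> carrier M) \<Longrightarrow> lc K c b \<in> carrier M"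
  using N.lc_closed[of K c b] by (simp add: Pi_iff)

lemma lc_sec: "finite K \<Longrightarrow> c \<in> K \<rightarrow> S \<Longrightarrow> (\<And>j. j \<in> K \<Longrightarrow> b j \<in> sec B) \<Longrightarrow> lc K c b \<in> sec B"
  by (rule N.lc_submodule[OF sec_submodule])

lemma lc_split:
  assumes "finite K" "c \<in> K \<rightarrow> S" "\<And>j. j \<in> K \<Longrightarrow> b j \<in> carrier M"
  shows "lc K c b = lc {j \<in> K. P j} c b \<oplus>\<^bsub>M\<^esub> lc {j \<in> K. \<not> P j} c b"
proof -
  have f: "(\<lambda>j. c j \<odot>\<^bsub>N\<^esub> b j) \<in> K \<rightarrow> carrier N" using assms(2,3) N.smult_closed by (simp add: Pi_iff)
  have "K = {j \<in> K. P j} \<union> {j \<in> K. \<not> P j}" by auto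
  then have "lc K c b = lc ({j \<in> K. P j} \<union> {j \<in> K. \<not> P j}) c b" by simp
  also have "\<dots> = lc {j \<in> K. P j} c b \<oplus>\<^bsub>N\<^esub> lc {j \<in> K. \<not> P j} c b"
    by (rule N.finsum_Un_disjoint) (use assms(1) f in \<open>auto simp: Pi_iff\<close>)
  finally show ?thesis by simp
qed

lemma lc_zero: "(\<And>j. j \<in> K \<Longrightarrow> c j = (\<lambda>_. 0)) \<Longrightarrow> (\<And>j. j \<in> K \<Longrightarrow> b j \<in> carrier M) \<Longrightarrow> lc K c b = \<zero>\<^bsub>M\<^esub>"
  using N.smult_l_null by (subst N.add.finprod_one_eqI) auto

text \<open>The rank r is kept arbitrary, as it will be the length and also a refinement of it that
  separates the points of A. Distinct labels may share a rank; their basis elements then avoid each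
  other's graphs. The last clause compares only elements with a common label, modulo smaller
  rank.\<close>

definition tri :: "('w \<Rightarrow> nat) \<Rightarrow> 'j set \<Rightarrow> ('j \<Rightarrow> 'm) \<Rightarrow> ('j \<Rightarrow> int) \<Rightarrow> ('j \<Rightarrow> 'w) \<Rightarrow> bool" where
  "tri r J b d lab \<longleftrightarrow> finite J \<and>
    (\<forall>j \<in> J. lab j \<in> A \<and> b j \<in> part M (d j) \<and> b j \<in> sec (insert (lab j) {y. r y < r (lab j)})) \<and>
    (\<forall>m \<in> carrier M. \<exists>c \<in> J \<rightarrow> S. m = lc J c b) \<and>
    (\<forall>x \<in> A. \<forall>c \<in> J \<rightarrow> S. lc {j \<in> J. lab j = x} c b \<in> sec {y. r y < r x} \<longrightarrow> (\<forall>j \<in> J. lab j = x \<longrightarrow> c j = (\<lambda>_. 0)))"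

lemma triD:
  assumes "tri r J b d lab"
  shows "finite J" "\<And>j. j \<in> J \<Longrightarrow> lab j \<in> A" "\<And>j. j \<in> J \<Longrightarrow> b j \<in> part M (d j)"
    "\<And>j. j \<in> J \<Longrightarrow> b j \<in> sec (insert (lab j) {y. r y < r (lab j)})"
    "\<And>j. j \<in> J \<Longrightarrow> b j \<in> carrier M"
    "\<And>m. m \<in> carrier M \<Longrightarrow> \<exists>c \<in> J \<rightarrow> S. m = lc J c b"
    "\<And>x c j. x \<in> A \<Longrightarrow> c \<in> J \<rightarrow> S \<Longrightarrow> lc {j \<in> J. lab j = x} c b \<in> sec {y. r y < r x} \<Longrightarrow> j \<in> J \<Longrightarrow> lab j = x \<Longrightarrow> c j = (\<lambda>_. 0)"
  using assms sec_carrier unfolding tri_def by blast+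

text \<open>Among the nonzero coefficients take a label x of maximal rank. The terms with other
  labels have no component at x, so the terms labelled x combine to an element of smaller rank,
  against the last clause of \<open>tri\<close>.\<close>

lemma tri_independent:
  assumes t: "tri r J b d lab" and c: "c \<in> J \<rightarrow> S" and Om: "\<Omega> \<subseteq> A"
    and m: "lc {j \<in> J. lab j \<in> \<Omega>} c b \<in> sec (- \<Omega>)" and j: "j \<in> J" "lab j \<in> \<Omega>"
  shows "c j = (\<lambda>_. 0)"
proof (rule ccontr)
  assume cj: "c j \<noteq> (\<lambda>_. 0)"
  note tD = triD[OF t]
  define K where "K = {j \<in> J. lab j \<in> \<Omega>}"
  define K' where "K' = {j \<in> K. c j \<noteq> (\<lambda>_. 0)}"
  have K: "finite K" "K \<subseteq> J" "finite K'" "K' \<subseteq> J" "K' \<noteq> {}"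
    using tD(1) j cj by (auto simp: K_def K'_def)
  have cK: "c \<in> K \<rightarrow> S" "c \<in> K' \<rightarrow> S" using c K by auto
  have bK: "\<And>j. j \<in> K \<Longrightarrow> b j \<in> carrier M" "\<And>j. j \<in> K' \<Longrightarrow> b j \<in> carrier M" using tD(5) K by auto
  obtain k where k: "k \<in> K'" "\<And>i. i \<in> K' \<Longrightarrow> r (lab i) \<le> r (lab k)"
  proof -
    have "Max ((\<lambda>i. r (lab i)) ` K') \<in> (\<lambda>i. r (lab i)) ` K'" using K by (intro Max_in) auto
    then obtain k where "k \<in> K'" "r (lab k) = Max ((\<lambda>i. r (lab i)) ` K')" by auto
    then show ?thesis using K(3) by (intro that[of k]) auto
  qed
  define x where "x = lab k"
  have x: "x \<in> A" "x \<in> \<Omega>" using k(1) K tD(2) by (auto simp: x_def K'_def K_def)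
  note Ex = E_props[OF x(1)]
  have "lc {i \<in> K. \<not> (c i \<noteq> (\<lambda>_. 0))} c b = \<zero>\<^bsub>M\<^esub>" by (rule lc_zero) (use bK in auto)
  then have KK': "lc K c b = lc K' c b"
    using lc_split[OF K(1) cK(1) bK(1), where P = "\<lambda>i. c i \<noteq> (\<lambda>_. 0)"] lc_closed'[OF K(3) cK(2) bK(2)]
    unfolding K'_def by simp
  define K1 where "K1 = {i \<in> K'. lab i = x}"
  define K2 where "K2 = {i \<in> K'. lab i \<noteq> x}"
  have K12: "finite K1" "finite K2" "c \<in> K1 \<rightarrow> S" "c \<in> K2 \<rightarrow> S" "\<And>j. j \<in> K1 \<Longrightarrow> b j \<in> carrier M" "\<And>j. j \<in> K2 \<Longrightarrow> b j \<in> carrier M"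
    using K cK bK by (auto simp: K1_def K2_def)
  have "lc K2 c b \<in> sec (- {x})"
  proof (rule lc_sec[OF K12(2,4)])
    fix i assume i: "i \<in> K2"
    then have "i \<in> J" "lab i \<noteq> x" "\<not> r x < r (lab i)" using K k(2) by (auto simp: K2_def x_def not_less)
    then show "b i \<in> sec (- {x})" by (intro sec_mono[OF _ tD(4)]) auto
  qed
  then have 2: "act (E x) (lc K2 c b) = \<zero>\<^bsub>M\<^esub>" using x by (auto simp: sec_def)
  have "lc K c b = lc K1 c b \<oplus>\<^bsub>M\<^esub> lc K2 c b"
    unfolding KK' K1_def K2_def by (rule lc_split[OF K(3) cK(2) bK(2)])
  moreover have "act (E x) (lc K c b) = \<zero>\<^bsub>M\<^esub>" using m x unfolding K_def[symmetric] by (auto simp: sec_def)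
  ultimately have 1: "act (E x) (lc K1 c b) = \<zero>\<^bsub>M\<^esub>"
    using 2 lc_closed'[OF K12(1,3,5)] lc_closed'[OF K12(2,4,6)] Ex(4) by (simp add: act_plus)
  have "lc K1 c b \<in> sec (insert x {y. r y < r x})"
  proof (rule lc_sec[OF K12(1,3)])
    fix i assume "i \<in> K1"
    then have "i \<in> J" "lab i = x" using K by (auto simp: K1_def)
    then show "b i \<in> sec (insert x {y. r y < r x})" using tD(4)[of i] by simp
  qed
  then have s1: "lc K1 c b \<in> sec {y. r y < r x}" using sec_insertD 1 by blast
  have J1: "finite {j \<in> J. lab j = x}" "c \<in> {j \<in> J. lab j = x} \<rightarrow> S" "\<And>j. j \<in> {j \<in> J. lab j = x} \<Longrightarrow> b j \<in> carrier M"
    using tD(1,5) c by auto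
  have z: "lc {j \<in> {j \<in> J. lab j = x}. \<not> j \<in> K1} c b = \<zero>\<^bsub>M\<^esub>"
    by (rule lc_zero) (use J1(3) x in \<open>auto simp: K1_def K'_def K_def\<close>)
  have e: "{j \<in> {j \<in> J. lab j = x}. j \<in> K1} = K1" using K(4) unfolding K1_def by blast
  have "lc {j \<in> J. lab j = x} c b =
      lc {j \<in> {j \<in> J. lab j = x}. j \<in> K1} c b \<oplus>\<^bsub>M\<^esub> lc {j \<in> {j \<in> J. lab j = x}. \<not> j \<in> K1} c b"
    by (rule lc_split[OF J1])
  then have "lc {j \<in> J. lab j = x} c b = lc K1 c b \<oplus>\<^bsub>M\<^esub> \<zero>\<^bsub>M\<^esub>"
    unfolding z e .
  then have "lc {j \<in> J. lab j = x} c b = lc K1 c b" using lc_closed'[OF K12(1,3,5)] by simp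
  then have "lc {j \<in> J. lab j = x} c b \<in> sec {y. r y < r x}" by (simp only: s1)
  moreover have "k \<in> J" using k(1) K(4) by blast
  ultimately have "c k = (\<lambda>_. 0)" using tD(7)[OF x(1) c, of k] x_def by blast
  then show False using k(1) by (simp add: K'_def)
qed

text \<open>Terms with label in B lie in \<open>sec B\<close> because B is closed under passing to
  smaller rank in A. The remaining terms then sum to an element of \<open>sec B\<close> as well, and
  vanish by independence over A - B.\<close>

lemma tri_span_sec:
  assumes t: "tri r J b d lab" and B: "\<And>x y. x \<in> A \<Longrightarrow> y \<in> A \<Longrightarrow> x \<in> B \<Longrightarrow> r y < r x \<Longrightarrow> y \<in> B"
    and m: "m \<in> sec B"
  shows "\<exists>c \<in> J \<rightarrow> S. m = lc {j \<in> J. lab j \<in> B} c b"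
proof -
  note tD = triD[OF t]
  obtain c where c: "c \<in> J \<rightarrow> S" "m = lc J c b" using tD(6) m sec_carrier by blast
  define K1 where "K1 = {j \<in> J. lab j \<in> B}"
  define K2 where "K2 = {j \<in> J. lab j \<notin> B}"
  have K12: "finite K1" "finite K2" "c \<in> K1 \<rightarrow> S" "c \<in> K2 \<rightarrow> S" "\<And>j. j \<in> K1 \<Longrightarrow> b j \<in> carrier M" "\<And>j. j \<in> K2 \<Longrightarrow> b j \<in> carrier M"
    using tD(1,5) c by (auto simp: K1_def K2_def)
  have l1: "lc K1 c b \<in> sec B"
  proof (rule lc_sec[OF K12(1,3)])
    fix j assume "j \<in> K1"
    then have j: "j \<in> J" "lab j \<in> B" "lab j \<in> A" using tD(2) by (auto simp: K1_def)
    show "b j \<in> sec B" by (rule sec_mono[OF _ tD(4)[OF j(1)]]) (use B j in blast)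
  qed
  have cl: "lc K1 c b \<in> carrier M" "lc K2 c b \<in> carrier M" using lc_closed' K12 by blast+
  have ms: "m = lc K1 c b \<oplus>\<^bsub>M\<^esub> lc K2 c b"
    unfolding c(2) K1_def K2_def by (rule lc_split[OF tD(1) c(1) tD(5)])
  then have "lc K2 c b = m \<ominus>\<^bsub>M\<^esub> lc K1 c b"
    using add_diff_cancel[OF cl] by simp
  then have l2: "lc K2 c b \<in> sec B" using sec_minus[OF m l1] by simp
  have K2e: "K2 = {j \<in> J. lab j \<in> A - B}" using tD(2) by (auto simp: K2_def)
  have "c j = (\<lambda>_. 0)" if "j \<in> K2" for j
  proof (rule tri_independent[OF t c(1), of "A - B"])
    show "lc {j \<in> J. lab j \<in> A - B} c b \<in> sec (- (A - B))"
      unfolding K2e[symmetric] by (rule sec_mono[OF _ l2]) auto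
  qed (use that K2e in auto)
  then have "lc K2 c b = \<zero>\<^bsub>M\<^esub>" using K12(6) by (intro lc_zero) auto
  then have "m = lc K1 c b" using ms cl by simp
  then show ?thesis using c(1) unfolding K1_def by blast
qed

text \<open>A unitriangular change of basis: corrections have smaller rank than the label, so
  independence within one label is untouched, and spanning follows by induction on the rank.\<close>

lemma tri_change:
  assumes t: "tri r J b d lab" and b': "\<And>j. j \<in> J \<Longrightarrow> b' j \<in> part M (d j)"
    "\<And>j. j \<in> J \<Longrightarrow> b' j \<ominus>\<^bsub>M\<^esub> b j \<in> sec {y. r y < r (lab j)}"
  shows "tri r J b' d lab"
proof -
  note tD = triD[OF t]
  have b'c: "\<And>j. j \<in> J \<Longrightarrow> b' j \<in> carrier M" using b'(1) SSM.part_carrier by blast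
  have diff: "lc K c b \<ominus>\<^bsub>M\<^esub> lc K c b' \<in> sec B"
    if K: "K \<subseteq> J" "c \<in> J \<rightarrow> S" "\<And>j y. j \<in> K \<Longrightarrow> r y < r (lab j) \<Longrightarrow> y \<in> B" for K c B
  proof -
    have fK: "finite K" using K(1) tD(1) finite_subset by blast
    have "lc K c (\<lambda>j. b j \<ominus>\<^bsub>M\<^esub> b' j) \<in> sec B"
    proof (rule lc_sec[OF fK])
      fix j assume j: "j \<in> K"
      then have jJ: "j \<in> J" using K by blast
      have "b j \<ominus>\<^bsub>M\<^esub> b' j = \<ominus>\<^bsub>M\<^esub> (b' j \<ominus>\<^bsub>M\<^esub> b j)"
        using tD(5)[OF jJ] b'c[OF jJ] by (simp add: a_minus_def SSM.M.minus_add SSM.M.a_comm)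
      then show "b j \<ominus>\<^bsub>M\<^esub> b' j \<in> sec B"
        using sec_uminus[OF b'(2)[OF jJ]] K(3)[OF j] sec_mono[of "{y. r y < r (lab j)}" B] by auto
    qed (use K in auto)
    moreover have "lc K c (\<lambda>j. b j \<ominus>\<^bsub>M\<^esub> b' j) = lc K c b \<ominus>\<^bsub>M\<^esub> lc K c b'"
    proof -
      have cb: "c j \<in> S" "b j \<in> carrier N" "b' j \<in> carrier N" if "j \<in> K" for j
        using that K(1,2) tD(5) b'c by auto
      have cc: "(\<lambda>j. c j \<odot>\<^bsub>N\<^esub> b j) \<in> K \<rightarrow> carrier N" "(\<lambda>j. c j \<odot>\<^bsub>N\<^esub> b' j) \<in> K \<rightarrow> carrier N"
        using N.smult_closed cb by (auto simp del: right_module_simps)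
      have "lc K c b = (\<Oplus>\<^bsub>N\<^esub>j \<in> K. c j \<odot>\<^bsub>N\<^esub> (b j \<ominus>\<^bsub>M\<^esub> b' j) \<oplus>\<^bsub>N\<^esub> c j \<odot>\<^bsub>N\<^esub> b' j)"
      proof (rule N.finsum_cong'[OF refl])
        show "(\<lambda>j. c j \<odot>\<^bsub>N\<^esub> (b j \<ominus>\<^bsub>M\<^esub> b' j) \<oplus>\<^bsub>N\<^esub> c j \<odot>\<^bsub>N\<^esub> b' j) \<in> K \<rightarrow> carrier N"
          using cb by auto
        fix j assume j: "j \<in> K"
        have "b j = (b j \<ominus>\<^bsub>M\<^esub> b' j) \<oplus>\<^bsub>M\<^esub> b' j" using SSM.diff_add_cancel[of "b j" "b' j"] cb[OF j] by simp
        then have "c j \<odot>\<^bsub>N\<^esub> b j = c j \<odot>\<^bsub>N\<^esub> ((b j \<ominus>\<^bsub>M\<^esub> b' j) \<oplus>\<^bsub>N\<^esub> b' j)" by simp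
        also have "\<dots> = c j \<odot>\<^bsub>N\<^esub> (b j \<ominus>\<^bsub>M\<^esub> b' j) \<oplus>\<^bsub>N\<^esub> c j \<odot>\<^bsub>N\<^esub> b' j"
          by (rule N.smult_r_distr) (use cb[OF j] in auto)
        finally show "c j \<odot>\<^bsub>N\<^esub> b j = c j \<odot>\<^bsub>N\<^esub> (b j \<ominus>\<^bsub>M\<^esub> b' j) \<oplus>\<^bsub>N\<^esub> c j \<odot>\<^bsub>N\<^esub> b' j" .
      qed
      also have "\<dots> = lc K c (\<lambda>j. b j \<ominus>\<^bsub>M\<^esub> b' j) \<oplus>\<^bsub>N\<^esub> lc K c b'"
        by (rule N.finsum_addf) (use cb in auto)
      finally have eq: "lc K c b = lc K c (\<lambda>j. b j \<ominus>\<^bsub>M\<^esub> b' j) \<oplus>\<^bsub>M\<^esub> lc K c b'" by simp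
      have "lc K c (\<lambda>j. b j \<ominus>\<^bsub>M\<^esub> b' j) \<in> carrier M" "lc K c b' \<in> carrier M"
        by (rule lc_closed'[OF fK]; use cb in auto)+
      then show ?thesis unfolding eq by (simp add: a_minus_def SSM.M.add.m_assoc SSM.M.r_neg)
    qed
    ultimately show ?thesis by simp
  qed
  have span: "\<exists>c \<in> J \<rightarrow> S. m = lc J c b'" if "m \<in> sec {y. r y < n}" for m n
    using that
  proof (induction n arbitrary: m)
    case 0
    then have "m = \<zero>\<^bsub>M\<^esub>" using sec_none[of "{y. r y < 0}"] by auto
    then show ?case using lc_zero[of J "\<lambda>_ _. 0" b'] b'c by (intro bexI[of _ "\<lambda>_ _. 0"]) auto
  next
    case (Suc n)
    obtain c where c: "c \<in> J \<rightarrow> S" "m = lc {j \<in> J. lab j \<in> {y. r y < Suc n}} c b"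
      using tri_span_sec[OF t _ Suc.prems] by auto
    define K where "K = {j \<in> J. lab j \<in> {y. r y < Suc n}}"
    define c' where "c' j = (if j \<in> K then c j else (\<lambda>_. 0))" for j
    have K: "K \<subseteq> J" "finite K" using tD(1) by (auto simp: K_def)
    have c': "c' \<in> J \<rightarrow> S" "c' \<in> K \<rightarrow> S" using c(1) by (auto simp: c'_def K_def)
    have z: "lc {j \<in> J. \<not> j \<in> K} c' b' = \<zero>\<^bsub>M\<^esub>" by (rule lc_zero) (use b'c in \<open>auto simp: c'_def\<close>)
    have e: "{j \<in> J. j \<in> K} = K" using K by auto
    have ec: "lc K c' b' = lc K c b'" by (rule N.finsum_cong') (use c b'c K in \<open>auto simp: c'_def Pi_iff subset_iff\<close>)
    have cl: "lc K c' b' \<in> carrier M" by (rule lc_closed'[OF K(2) c'(2)]) (use b'c K(1) in blast)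
    have "lc J c' b' = lc {j \<in> J. j \<in> K} c' b' \<oplus>\<^bsub>M\<^esub> lc {j \<in> J. \<not> j \<in> K} c' b'"
      by (rule lc_split[OF tD(1) c'(1) b'c])
    then have "lc J c' b' = lc K c b'" unfolding z e using cl ec by simp
    moreover have "lc K c b \<ominus>\<^bsub>M\<^esub> lc K c b' \<in> sec {y. r y < n}"
      by (rule diff[OF K(1) c(1)]) (auto simp: K_def)
    ultimately have "m \<ominus>\<^bsub>M\<^esub> lc J c' b' \<in> sec {y. r y < n}" using c(2) K_def by simp
    from Suc.IH[OF this] obtain c2 where c2: "c2 \<in> J \<rightarrow> S" "m \<ominus>\<^bsub>M\<^esub> lc J c' b' = lc J c2 b'" by blast
    have mc: "m \<in> carrier M" "lc J c' b' \<in> carrier M" using Suc.prems sec_carrier lc_closed'[OF tD(1) c'(1) b'c] by auto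
    have "m = lc J c2 b' \<oplus>\<^bsub>N\<^esub> lc J c' b'" using SSM.diff_add_cancel[OF mc] c2(2) by simp
    also have "\<dots> = (\<Oplus>\<^bsub>N\<^esub>j \<in> J. (c2 j \<oplus>\<^bsub>S_ring scale\<^esub> c' j) \<odot>\<^bsub>N\<^esub> b' j)"
      by (rule N.lc_add[symmetric, OF tD(1) c2(1) c'(1)]) (use b'c in auto)
    finally show ?case using c2(1) c'(1) by (intro bexI[of _ "\<lambda>j. c2 j \<oplus>\<^bsub>S_ring scale\<^esub> c' j"]) auto
  qed
  show ?thesis
    unfolding tri_def
  proof (intro conjI ballI impI)
    show "finite J" by (rule tD(1))
    fix j assume j: "j \<in> J"
    show "lab j \<in> A" using tD(2)[OF j] .
    show "b' j \<in> part M (d j)" using b'(1)[OF j] .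
    have "b' j = (b' j \<ominus>\<^bsub>M\<^esub> b j) \<oplus>\<^bsub>M\<^esub> b j" using SSM.diff_add_cancel tD(5)[OF j] b'c[OF j] by simp
    moreover have "b' j \<ominus>\<^bsub>M\<^esub> b j \<in> sec (insert (lab j) {y. r y < r (lab j)})"
      by (rule sec_mono[OF _ b'(2)[OF j]]) auto
    ultimately show "b' j \<in> sec (insert (lab j) {y. r y < r (lab j)})"
      using sec_add[OF _ tD(4)[OF j]] by metis
  next
    fix m assume m: "m \<in> carrier M"
    obtain n where "\<And>x. x \<in> A \<Longrightarrow> r x < n"
    proof -
      have "\<forall>x \<in> A. r x < Suc (Max (r ` A))" using A(1) by (auto simp: less_Suc_eq_le)
      then show ?thesis using that by blast
    qed
    then have "sec {y. r y < n} = carrier M" by (intro sec_all) auto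
    then show "\<exists>c \<in> J \<rightarrow> S. m = lc J c b'" using span m by blast
  next
    fix x c j assume x: "x \<in> A" and c: "c \<in> J \<rightarrow> S" and s: "lc {j \<in> J. lab j = x} c b' \<in> sec {y. r y < r x}"
      and j: "j \<in> J" "lab j = x"
    have d: "lc {j \<in> J. lab j = x} c b \<ominus>\<^bsub>M\<^esub> lc {j \<in> J. lab j = x} c b' \<in> sec {y. r y < r x}"
      by (rule diff[OF _ c]) auto
    have cl: "lc {j \<in> J. lab j = x} c b \<in> carrier M" "lc {j \<in> J. lab j = x} c b' \<in> carrier M"
      by (rule lc_closed'; use tD(1,5) c b'c in auto)+
    have "lc {j \<in> J. lab j = x} c b \<in> sec {y. r y < r x}"
      using sec_add[OF d s] SSM.diff_add_cancel[OF cl] by simp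
    then show "c j = (\<lambda>_. 0)" using tD(7)[OF x c _ j] by blast
  qed
qed

end

context supported_module
begin

section \<open>Moving a triangular basis off a set of graphs\<close>

lemma act_lc:
  assumes "finite K" "c \<in> K \<rightarrow> S" "\<And>j. j \<in> K \<Longrightarrow> b j \<in> carrier M" "s \<in> S"
  shows "lc K (\<lambda>j v. s v * c j v) b = act (rt s) (lc K c b)"
  using N.lc_smult[OF assms(1,2,4), of b] assms(3) by (simp add: smult_N[symmetric] Pi_iff)

lemma lc_minus':
  assumes "finite K" "c \<in> K \<rightarrow> S" "c' \<in> K \<rightarrow> S" "\<And>j. j \<in> K \<Longrightarrow> b j \<in> carrier M"
  shows "lc K (\<lambda>j v. c j v - c' j v) b = lc K c b \<ominus>\<^bsub>M\<^esub> lc K c' b"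
proof -
  have "lc K (\<lambda>j. c j \<ominus>\<^bsub>S_ring scale\<^esub> c' j) b = lc K c b \<ominus>\<^bsub>N\<^esub> lc K c' b"
    by (rule N.lc_diff[OF assms(1-3)]) (use assms(4) in auto)
  moreover have "lc K (\<lambda>j. c j \<ominus>\<^bsub>S_ring scale\<^esub> c' j) b = lc K (\<lambda>j v. c j v - c' j v) b"
  proof (rule N.finsum_cong'[OF refl])
    have cj: "c j \<in> S" "c' j \<in> S" "b j \<in> carrier M" if "j \<in> K" for j using that assms by auto
    show "(\<lambda>j. (\<lambda>v. c j v - c' j v) \<odot>\<^bsub>N\<^esub> b j) \<in> K \<rightarrow> carrier N"
      using cj N.smult_closed[OF diff_S] by (simp add: Pi_iff)
    fix j assume j: "j \<in> K"
    have "c j \<ominus>\<^bsub>S_ring scale\<^esub> c' j = (\<lambda>v. c j v - c' j v)"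
    proof -
      have "(\<lambda>v. c j v - c' j v) \<oplus>\<^bsub>S_ring scale\<^esub> c' j = c j" by simp
      then show ?thesis using N.R.add.inv_solve_right[of "\<lambda>v. c j v - c' j v" "c j" "c' j"] cj[OF j]
        by (simp add: a_minus_def[of "S_ring scale"] a_inv_def del: S_ring_simps)
    qed
    then show "(c j \<ominus>\<^bsub>S_ring scale\<^esub> c' j) \<odot>\<^bsub>N\<^esub> b j = (\<lambda>v. c j v - c' j v) \<odot>\<^bsub>N\<^esub> b j" by simp
  qed
  ultimately show ?thesis by (simp add: minus_N)
qed

text \<open>In the absence of reflections of \<open>x\<close> in \<open>B\<close> the idempotent of \<open>x\<close> exists locally at every hyperplane.\<close>

lemma local_idempotent:
  assumes B: "B \<subseteq> A" "x \<in> A" "x \<notin> B" "\<And>t. t \<in> T \<Longrightarrow> t \<otimes>\<^bsub>W\<^esub> x \<notin> B"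
  shows "\<exists>D G. linprod D \<and> G \<in> SS \<and> res x G = D \<and> (\<forall>y \<in> B. res y G = (\<lambda>_. 0))"
    and "lam \<in> dual \<Longrightarrow> lam \<noteq> (\<lambda>_. 0) \<Longrightarrow>
      \<exists>s \<in> S. \<not> Sdvd lam s \<and> (\<exists>G \<in> SS. res x G = s \<and> (\<forall>y \<in> B. res y G = (\<lambda>_. 0)))"
proof -
  define z where "z y = (if y = x then (\<lambda>_. 1) else (\<lambda>_. 0) :: 'v \<Rightarrow> 'k)" for y :: 'w
  have zS: "z y \<in> S" for y by (simp add: z_def)
  have fin: "finite (insert x B)" "insert x B \<subseteq> carrier W" using B A finite_subset by auto
  have xW: "x \<in> carrier W" using B(2) A by blast
  obtain D e G where G: "linprod D" "G \<in> SS" "\<forall>y \<in> insert x B. res y G = (\<lambda>v. D v * z y v)"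
    using interpolation[OF fin, of z] zS by blast
  have "res x G = D" "\<forall>y \<in> B. res y G = (\<lambda>_. 0)" using G(3) B(3) by (auto simp: z_def)
  then show "\<exists>D G. linprod D \<and> G \<in> SS \<and> res x G = D \<and> (\<forall>y \<in> B. res y G = (\<lambda>_. 0))" using G by blast
  assume lam: "lam \<in> dual" "lam \<noteq> (\<lambda>_. 0)"
  have "\<exists>s \<in> S. \<not> Sdvd lam s \<and> (\<exists>G \<in> SS. \<forall>y \<in> insert x B. res y G = (\<lambda>v. s v * z y v))"
  proof (rule interpolation_mod[OF fin zS lam])
    fix y t assume y: "y \<in> insert x B" "t \<in> T" "t \<otimes>\<^bsub>W\<^esub> y \<in> insert x B"
    have "z y = z (t \<otimes>\<^bsub>W\<^esub> y)"
    proof (cases "y = x")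
      case True
      then show ?thesis using y B(4) by (auto simp: z_def)
    next
      case False
      have "t \<otimes>\<^bsub>W\<^esub> y \<noteq> x"
      proof
        assume "t \<otimes>\<^bsub>W\<^esub> y = x"
        moreover have "y \<in> carrier W" using y fin by blast
        ultimately have "t \<otimes>\<^bsub>W\<^esub> x = y" using T_mult_self y(2) by blast
        then show False using B(4)[OF y(2)] y(1) False by simp
      qed
      then show ?thesis using False by (simp add: z_def)
    qed
    then show "Sdvd (\<alpha> t) (\<lambda>v. z y v - z (t \<otimes>\<^bsub>W\<^esub> y) v)" by (simp add: Sdvd_zero)
  qed
  then obtain s G where s: "s \<in> S" "\<not> Sdvd lam s" "G \<in> SS" "\<forall>y \<in> insert x B. res y G = (\<lambda>v. s v * z y v)" by blast
  have "res x G = s" "\<forall>y \<in> B. res y G = (\<lambda>_. 0)" using s(4) B(3) by (auto simp: z_def)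
  then show "\<exists>s \<in> S. \<not> Sdvd lam s \<and> (\<exists>G \<in> SS. res x G = s \<and> (\<forall>y \<in> B. res y G = (\<lambda>_. 0)))" using s by blast
qed

text \<open>Let G/Dn be the idempotent of x relative to the points to be avoided. G maps b i into
  \<open>sec D\<close>, and G b i - Dn b i has smaller rank, so it expands in the lower basis. Its
  coefficients at the avoided labels measure what has to be added to b i, and they turn out to be
  divisible by Dn.\<close>

lemma tri_move_one:
  assumes t: "tri r J b d lab"
    and D: "\<And>x t. x \<in> D \<Longrightarrow> x \<in> A \<Longrightarrow> t \<in> T \<Longrightarrow> t \<otimes>\<^bsub>W\<^esub> x \<in> A \<Longrightarrow> r (t \<otimes>\<^bsub>W\<^esub> x) < r x \<Longrightarrow> t \<otimes>\<^bsub>W\<^esub> x \<in> D"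
    and lower: "\<And>j. j \<in> J \<Longrightarrow> lab j \<in> D \<Longrightarrow> r (lab j) < n \<Longrightarrow> b j \<in> sec D"
    and i: "i \<in> J" "lab i \<in> D" "r (lab i) = n"
  shows "\<exists>\<beta>. \<beta> \<in> part M (d i) \<and> \<beta> \<ominus>\<^bsub>M\<^esub> b i \<in> sec {y. r y < n} \<and> \<beta> \<in> sec D"
proof -
  note tD = triD[OF t]
  define x where "x = lab i"
  have x: "x \<in> A" "x \<in> D" "r x = n" using tD(2) i by (auto simp: x_def)
  \<comment> \<open>The points of smaller rank that are to be avoided. By the closure property of D
    none of them is a reflection of x, which is the condition in
    \<open>local_idempotent\<close>.\<close>
  define B where "B = {y \<in> A. y \<notin> D \<and> r y < n}"
  have B: "B \<subseteq> A" "x \<notin> B" "\<And>t. t \<in> T \<Longrightarrow> t \<otimes>\<^bsub>W\<^esub> x \<notin> B"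
    using D[OF x(2,1)] x by (auto simp: B_def)
  have bi: "b i \<in> carrier M" "b i \<in> sec (insert x {y. r y < n})"
    using tD(5)[OF i(1)] tD(4)[OF i(1)] i(3) by (auto simp: x_def)
  define J1 where "J1 = {j \<in> J. lab j \<in> {y. r y < n}}"
  define JD where "JD = {j \<in> J1. lab j \<in> D}"
  define JB where "JB = {j \<in> J1. \<not> lab j \<in> D}"
  have fin: "finite J1" "finite JD" "finite JB" using tD(1) by (auto simp: J1_def JD_def JB_def)
  have bc: "\<And>j. j \<in> J1 \<Longrightarrow> b j \<in> carrier M" "\<And>j. j \<in> JD \<Longrightarrow> b j \<in> carrier M" "\<And>j. j \<in> JB \<Longrightarrow> b j \<in> carrier M"
    using tD(5) by (auto simp: J1_def JD_def JB_def)
  have JB: "JB = {j \<in> J. lab j \<in> B}" using tD(2) by (auto simp: JB_def J1_def B_def)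
  \<comment> \<open>At a point of smaller rank outside D the function G vanishes; at a point of rank
    at least n other than x already b i has no component.\<close>
  have GD: "act G (b i) \<in> sec D" if G: "G \<in> SS" "\<forall>y \<in> B. res y G = (\<lambda>_. 0)" for G
  proof -
    have "act (E y) (act G (b i)) = \<zero>\<^bsub>M\<^esub>" if y: "y \<in> A - D" for y
    proof (cases "r y < n")
      case True
      have Ey: "E y \<in> SS" using E_props(4) y by blast
      have "act (\<lambda>p. E y p * G p) (b i) = \<zero>\<^bsub>M\<^esub>"
      proof (rule act_vanish)
        fix w assume w: "w \<in> A"
        show "res w (\<lambda>p. E y p * G p) = (\<lambda>_. 0)"
          using E_props(3)[of y w] G(2) y True w by (cases "w = y") (auto simp: B_def)
      qed (use Ey G bi in auto)
      then show ?thesis using act_mult[OF Ey G(1) bi(1)] by simp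
    next
      case False
      have Ey: "E y \<in> SS" using E_props(4) y by blast
      have "y \<noteq> x" using y x by auto
      then have "act (E y) (b i) = \<zero>\<^bsub>M\<^esub>" using bi(2) y False by (auto simp: sec_def)
      then show ?thesis using act_comm[OF Ey G(1) bi(1)] G(1) by simp
    qed
    then show ?thesis using G bi by (simp add: sec_def)
  qed
  \<comment> \<open>G and \<open>rt s\<close> agree on Gr(x), so their difference sends b i to
    smaller rank.\<close>
  have lowpart: "\<exists>c \<in> J \<rightarrow> S. act G (b i) \<ominus>\<^bsub>M\<^esub> act (rt s) (b i) = lc J1 c b"
    if G: "G \<in> SS" "res x G = s" "s \<in> S" for G s
  proof -
    have "act (\<lambda>p. G p - rt s p) (b i) \<in> sec {y. r y < n}"
      unfolding sec_iff
    proof (intro conjI ballI impI)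
      show "act (\<lambda>p. G p - rt s p) (b i) \<in> carrier M" using G bi by auto
      fix F assume F: "F \<in> SS" "\<forall>y \<in> A \<inter> {y. r y < n}. res y F = (\<lambda>_. 0)"
      have "act (\<lambda>p. F p * (G p - rt s p)) (b i) = \<zero>\<^bsub>M\<^esub>"
        by (rule sec_vanish[OF bi(2)]) (use F G in auto)
      then show "act F (act (\<lambda>p. G p - rt s p) (b i)) = \<zero>\<^bsub>M\<^esub>"
        using act_mult[of F "\<lambda>p. G p - rt s p" "b i"] F G bi by auto
    qed
    moreover have "act (\<lambda>p. G p - rt s p) (b i) = act G (b i) \<ominus>\<^bsub>M\<^esub> act (rt s) (b i)"
      by (rule act_diff) (use G bi in auto)
    ultimately have "act G (b i) \<ominus>\<^bsub>M\<^esub> act (rt s) (b i) \<in> sec {y. r y < n}" by simp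
    from tri_span_sec[OF t _ this] show ?thesis unfolding J1_def by auto
  qed
  have split: "lc J1 c b = lc JD c b \<oplus>\<^bsub>M\<^esub> lc JB c b" if "c \<in> J \<rightarrow> S" for c
    unfolding JD_def JB_def by (rule lc_split[OF fin(1) _ bc(1)]) (use that in \<open>auto simp: J1_def\<close>)
  have lcD: "lc JD c b \<in> sec D" if "c \<in> J \<rightarrow> S" for c
    by (rule lc_sec[OF fin(2)]) (use that lower in \<open>auto simp: JD_def J1_def\<close>)
  have cl: "lc JD c b \<in> carrier M" "lc JB c b \<in> carrier M" "lc J1 c b \<in> carrier M" if "c \<in> J \<rightarrow> S" for c
    by (rule lc_closed'; use that fin bc in \<open>auto simp: JD_def JB_def J1_def\<close>)+
  obtain Dn G where G: "linprod Dn" "G \<in> SS" "res x G = Dn" "\<forall>y \<in> B. res y G = (\<lambda>_. 0)"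
    using local_idempotent(1)[OF B(1) x(1) B(2,3)] by blast
  have DnS: "Dn \<in> S" "Dn \<noteq> (\<lambda>_. 0)" using linprod_S linprod_nonzero G(1) by auto
  obtain c where c: "c \<in> J \<rightarrow> S" "act G (b i) \<ominus>\<^bsub>M\<^esub> act (rt Dn) (b i) = lc J1 c b"
    using lowpart[OF G(2,3) DnS(1)] by blast
  have "Sdvd Dn (c k)" if k: "k \<in> JB" for k
  proof (rule linprod_dvd[OF G(1)])
    have kJ: "k \<in> J" "lab k \<in> B" using k JB by auto
    then show "c k \<in> S" using c(1) by auto
    fix lam assume lam: "lam \<in> dual" "lam \<noteq> (\<lambda>_. 0)"
    obtain s G' where s: "s \<in> S" "\<not> Sdvd lam s" "G' \<in> SS" "res x G' = s" "\<forall>y \<in> B. res y G' = (\<lambda>_. 0)"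
      using local_idempotent(2)[OF B(1) x(1) B(2,3) lam] by blast
    obtain c' where c': "c' \<in> J \<rightarrow> S" "act G' (b i) \<ominus>\<^bsub>M\<^esub> act (rt s) (b i) = lc J1 c' b"
      using lowpart[OF s(3,4,1)] by blast
    \<comment> \<open>Compares the global idempotent with one that is good at \<open>lam\<close>. In
      s (G b i - Dn b i) - Dn (G' b i - s b i) the terms s Dn b i cancel and the rest lies in
      \<open>sec D\<close>; independence at labels in B gives s c = Dn c'.\<close>
    define e where "e j = (\<lambda>v. s v * c j v - Dn v * c' j v)" for j
    have cs: "(\<lambda>j v. s v * c j v) \<in> J \<rightarrow> S" "(\<lambda>j v. Dn v * c' j v) \<in> J \<rightarrow> S" "e \<in> J \<rightarrow> S"
      using c(1) c'(1) s(1) DnS(1) by (auto simp: Pi_iff e_def)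
    have J1J: "J1 \<subseteq> J" by (auto simp: J1_def)
    have inJ1: "f \<in> J1 \<rightarrow> S" if "f \<in> J \<rightarrow> S" for f using that J1J by auto
    have "lc J1 e b = lc J1 (\<lambda>j v. s v * c j v) b \<ominus>\<^bsub>M\<^esub> lc J1 (\<lambda>j v. Dn v * c' j v) b"
      unfolding e_def by (rule lc_minus'[OF fin(1) inJ1[OF cs(1)] inJ1[OF cs(2)] bc(1)])
    also have "lc J1 (\<lambda>j v. s v * c j v) b = act (rt s) (act G (b i) \<ominus>\<^bsub>M\<^esub> act (rt Dn) (b i))"
      unfolding c(2) by (rule act_lc[OF fin(1) inJ1[OF c(1)] bc(1) s(1)])
    also have "\<dots> = act (rt s) (act G (b i)) \<ominus>\<^bsub>M\<^esub> act (rt s) (act (rt Dn) (b i))"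
      by (rule act_minus) (use s G bi DnS in auto)
    also have "lc J1 (\<lambda>j v. Dn v * c' j v) b = act (rt Dn) (act G' (b i) \<ominus>\<^bsub>M\<^esub> act (rt s) (b i))"
      unfolding c'(2) by (rule act_lc[OF fin(1) inJ1[OF c'(1)] bc(1) DnS(1)])
    also have "\<dots> = act (rt Dn) (act G' (b i)) \<ominus>\<^bsub>M\<^esub> act (rt Dn) (act (rt s) (b i))"
      by (rule act_minus) (use s G bi DnS in auto)
    also have "act (rt Dn) (act (rt s) (b i)) = act (rt s) (act (rt Dn) (b i))"
      by (rule act_comm) (use s bi DnS in auto)
    also have "(act (rt s) (act G (b i)) \<ominus>\<^bsub>M\<^esub> act (rt s) (act (rt Dn) (b i))) \<ominus>\<^bsub>M\<^esub>
       (act (rt Dn) (act G' (b i)) \<ominus>\<^bsub>M\<^esub> act (rt s) (act (rt Dn) (b i))) = 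
       act (rt s) (act G (b i)) \<ominus>\<^bsub>M\<^esub> act (rt Dn) (act G' (b i))"
    proof -
      have cc: "act (rt s) (act G (b i)) \<in> carrier M" "act (rt Dn) (act G' (b i)) \<in> carrier M"
        "act (rt s) (act (rt Dn) (b i)) \<in> carrier M" using s G bi DnS by auto
      have "(act (rt s) (act G (b i)) \<ominus>\<^bsub>M\<^esub> act (rt s) (act (rt Dn) (b i))) \<ominus>\<^bsub>M\<^esub>
         (act (rt Dn) (act G' (b i)) \<ominus>\<^bsub>M\<^esub> act (rt s) (act (rt Dn) (b i))) =
         (act (rt s) (act G (b i)) \<oplus>\<^bsub>M\<^esub> \<ominus>\<^bsub>M\<^esub> act (rt s) (act (rt Dn) (b i))) \<ominus>\<^bsub>M\<^esub>
         (act (rt Dn) (act G' (b i)) \<oplus>\<^bsub>M\<^esub> \<ominus>\<^bsub>M\<^esub> act (rt s) (act (rt Dn) (b i)))"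
        by (simp only: a_minus_def)
      also have "\<dots> = (act (rt s) (act G (b i)) \<ominus>\<^bsub>M\<^esub> act (rt Dn) (act G' (b i))) \<oplus>\<^bsub>M\<^esub>
         (\<ominus>\<^bsub>M\<^esub> act (rt s) (act (rt Dn) (b i)) \<ominus>\<^bsub>M\<^esub> \<ominus>\<^bsub>M\<^esub> act (rt s) (act (rt Dn) (b i)))"
        by (rule SSM.add_diff_add) (use cc in auto)
      also have "\<dots> = act (rt s) (act G (b i)) \<ominus>\<^bsub>M\<^esub> act (rt Dn) (act G' (b i))"
        using cc by (simp add: minus_zero_iff[of "\<ominus>\<^bsub>M\<^esub> act (rt s) (act (rt Dn) (b i))", THEN iffD2])
      finally show ?thesis .
    qed
    finally have "lc J1 e b = act (rt s) (act G (b i)) \<ominus>\<^bsub>M\<^esub> act (rt Dn) (act G' (b i))" .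
    moreover have "act (rt s) (act G (b i)) \<ominus>\<^bsub>M\<^esub> act (rt Dn) (act G' (b i)) \<in> sec D"
      by (intro sec_minus sec_act rt_SS GD s G DnS)
    ultimately have "lc J1 e b \<in> sec D" by simp
    then have "lc J1 e b \<ominus>\<^bsub>M\<^esub> lc JD e b \<in> sec D" using sec_minus lcD[OF cs(3)] by blast
    then have eB: "lc JB e b \<in> sec D" using add_diff_cancel cl[OF cs(3)] split[OF cs(3)] by simp
    have "e k = (\<lambda>_. 0)"
    proof (rule tri_independent[OF t cs(3) B(1) _ kJ])
      show "lc {j \<in> J. lab j \<in> B} e b \<in> sec (- B)"
        unfolding JB[symmetric] by (rule sec_mono[OF _ eB]) (auto simp: B_def)
    qed
    then have "(\<lambda>v. s v * c k v) = (\<lambda>v. Dn v * c' k v)" by (simp add: e_def fun_eq_iff)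
    moreover have "c' k \<in> S" using c'(1) kJ by auto
    ultimately show "\<exists>s \<in> S. \<not> Sdvd lam s \<and> Sdvd Dn (\<lambda>v. s v * c k v)"
      using s(1,2) unfolding Sdvd_def by blast
  qed
  then have "\<forall>k \<in> JB. \<exists>h. h \<in> S \<and> c k = (\<lambda>v. Dn v * h v)" unfolding Sdvd_def by blast
  then obtain h where h: "\<And>k. k \<in> JB \<Longrightarrow> h k \<in> S" "\<And>k. k \<in> JB \<Longrightarrow> c k = (\<lambda>v. Dn v * h k v)" by metis
  have hJ: "h \<in> JB \<rightarrow> S" using h(1) by auto
  \<comment> \<open>Dn times this element is G b i minus its part with labels in D, hence lies in
    \<open>sec D\<close>; torsion freeness of the quotient brings \<beta> itself into
    \<open>sec D\<close>.\<close>
  define \<beta> where "\<beta> = b i \<oplus>\<^bsub>M\<^esub> lc JB h b"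
  have hc: "lc JB h b \<in> carrier M" using lc_closed'[OF fin(3) hJ bc(3)] .
  have hlow: "lc JB h b \<in> sec {y. r y < n}"
  proof (rule lc_sec[OF fin(3) hJ])
    fix j assume j: "j \<in> JB"
    then have jJ: "j \<in> J" "r (lab j) < n" by (auto simp: JB_def J1_def)
    show "b j \<in> sec {y. r y < n}" by (rule sec_mono[OF _ tD(4)[OF jJ(1)]]) (use jJ in auto)
  qed
  have \<beta>: "\<beta> \<in> carrier M" "\<beta> \<ominus>\<^bsub>M\<^esub> b i \<in> sec {y. r y < n}"
    using bi hc hlow add_diff_cancel[OF bi(1) hc] by (auto simp: \<beta>_def)
  have "act (rt Dn) (lc JB h b) = lc JB (\<lambda>j v. Dn v * h j v) b"
    by (rule act_lc[symmetric, OF fin(3) hJ bc(3) DnS(1)])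
  also have "\<dots> = lc JB c b"
    by (rule N.finsum_cong') (use h c bc(3) in \<open>auto simp: Pi_iff JB_def J1_def\<close>)
  finally have Dh: "act (rt Dn) (lc JB h b) = lc JB c b" .
  have "act G (b i) = lc J1 c b \<oplus>\<^bsub>M\<^esub> act (rt Dn) (b i)"
    using SSM.diff_add_cancel[of "act G (b i)" "act (rt Dn) (b i)"] c(2) G(2) DnS bi by simp
  also have "\<dots> = lc JD c b \<oplus>\<^bsub>M\<^esub> (lc JB c b \<oplus>\<^bsub>M\<^esub> act (rt Dn) (b i))"
    unfolding split[OF c(1)] by (rule SSM.M.a_assoc) (use cl[OF c(1)] bi DnS in auto)
  also have "lc JB c b \<oplus>\<^bsub>M\<^esub> act (rt Dn) (b i) = act (rt Dn) (b i) \<oplus>\<^bsub>M\<^esub> lc JB c b"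
    by (rule SSM.M.a_comm) (use cl[OF c(1)] bi DnS in auto)
  also have "\<dots> = act (rt Dn) \<beta>"
    unfolding \<beta>_def Dh[symmetric] by (rule act_plus[symmetric]) (use bi hc DnS in auto)
  finally have "act G (b i) \<ominus>\<^bsub>M\<^esub> lc JD c b = act (rt Dn) \<beta>"
    using add_diff_cancel[OF cl(1)[OF c(1)], of "act (rt Dn) \<beta>"] \<beta>(1) DnS(1) by simp
  moreover have "act G (b i) \<ominus>\<^bsub>M\<^esub> lc JD c b \<in> sec D" using sec_minus[OF GD[OF G(2,4)] lcD[OF c(1)]] .
  ultimately have "act (rt Dn) \<beta> \<in> sec D" by simp
  then have \<beta>D: "\<beta> \<in> sec D" using sec_rt_cancel[OF DnS \<beta>(1)] by blast
  \<comment> \<open>\<beta> need not be homogeneous. Its component of degree d i keeps both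
    properties, because sections form graded submodules and b i has that degree.\<close>
  define \<gamma> where "\<gamma> = N.hc (d i) \<beta>"
  have "\<gamma> \<in> part M (d i)" unfolding \<gamma>_def using N.hc_props(1)[of \<beta> "d i"] \<beta>(1) by simp
  moreover have "\<gamma> \<in> sec D" unfolding \<gamma>_def using sec_gsubmodule \<beta>D by (simp add: N.gsubmodule_def)
  moreover have "\<gamma> \<ominus>\<^bsub>M\<^esub> b i \<in> sec {y. r y < n}"
  proof -
    have "N.hc (d i) (\<beta> \<ominus>\<^bsub>M\<^esub> b i) \<in> sec {y. r y < n}" using sec_gsubmodule \<beta>(2) by (simp add: N.gsubmodule_def)
    moreover have "N.hc (d i) (\<beta> \<ominus>\<^bsub>M\<^esub> b i) = \<gamma> \<ominus>\<^bsub>M\<^esub> N.hc (d i) (b i)"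
      using SSM.hc_diff[OF \<beta>(1) bi(1)] unfolding \<gamma>_def hc_N .
    moreover have "N.hc (d i) (b i) = b i" using N.hc_part[of "b i" "d i" "d i"] tD(3)[OF i(1)] by simp
    ultimately show ?thesis by simp
  qed
  ultimately show ?thesis by blast
qed

text \<open>Elements are moved in the order of increasing rank: moving one of rank n relies on those
  of smaller rank with label in D lying in \<open>sec D\<close> already. Each move adds only terms
  of smaller rank, so the basis stays triangular.\<close>

lemma tri_move:
  assumes t: "tri r J b d lab"
    and D: "\<And>x t. x \<in> D \<Longrightarrow> x \<in> A \<Longrightarrow> t \<in> T \<Longrightarrow> t \<otimes>\<^bsub>W\<^esub> x \<in> A \<Longrightarrow> r (t \<otimes>\<^bsub>W\<^esub> x) < r x \<Longrightarrow> t \<otimes>\<^bsub>W\<^esub> x \<in> D"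
  shows "\<exists>b'. tri r J b' d lab \<and> (\<forall>j \<in> J. lab j \<in> D \<longrightarrow> b' j \<in> sec D) \<and>
    (\<forall>j \<in> J. b' j \<ominus>\<^bsub>M\<^esub> b j \<in> sec {y. r y < r (lab j)})"
proof -
  note tD = triD[OF t]
  have "\<exists>b'. (\<forall>j \<in> J. b' j \<in> part M (d j) \<and> b' j \<ominus>\<^bsub>M\<^esub> b j \<in> sec {y. r y < r (lab j)}) \<and>
     (\<forall>j \<in> J. lab j \<in> D \<longrightarrow> r (lab j) < n \<longrightarrow> b' j \<in> sec D)" for n
  proof (induction n)
    case 0
    have "b j \<ominus>\<^bsub>M\<^esub> b j = \<zero>\<^bsub>M\<^esub>" if "j \<in> J" for j using minus_zero_iff tD(5)[OF that] by blast
    then show ?case using tD(3) by (intro exI[of _ b]) simp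
  next
    case (Suc n)
    then obtain b' where b': "\<And>j. j \<in> J \<Longrightarrow> b' j \<in> part M (d j)" "\<And>j. j \<in> J \<Longrightarrow> b' j \<ominus>\<^bsub>M\<^esub> b j \<in> sec {y. r y < r (lab j)}"
      "\<And>j. j \<in> J \<Longrightarrow> lab j \<in> D \<Longrightarrow> r (lab j) < n \<Longrightarrow> b' j \<in> sec D" by blast
    have t': "tri r J b' d lab" by (rule tri_change[OF t b'(1,2)])
    have b'c: "\<And>j. j \<in> J \<Longrightarrow> b' j \<in> carrier M" using triD(5)[OF t'] .
    have "\<forall>j \<in> J. \<exists>\<beta>. \<beta> \<in> part M (d j) \<and> \<beta> \<ominus>\<^bsub>M\<^esub> b' j \<in> sec {y. r y < r (lab j)} \<and>
       (lab j \<in> D \<longrightarrow> r (lab j) < Suc n \<longrightarrow> \<beta> \<in> sec D)"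
    proof
      fix j assume j: "j \<in> J"
      show "\<exists>\<beta>. \<beta> \<in> part M (d j) \<and> \<beta> \<ominus>\<^bsub>M\<^esub> b' j \<in> sec {y. r y < r (lab j)} \<and>
       (lab j \<in> D \<longrightarrow> r (lab j) < Suc n \<longrightarrow> \<beta> \<in> sec D)"
      proof (cases "lab j \<in> D \<and> r (lab j) = n")
        case True
        then show ?thesis using tri_move_one[OF t' D b'(3) j] by blast
      next
        case False
        have "b' j \<ominus>\<^bsub>M\<^esub> b' j = \<zero>\<^bsub>M\<^esub>" using minus_zero_iff b'c[OF j] by blast
        then show ?thesis using b'(1,3)[OF j] False by (intro exI[of _ "b' j"]) auto
      qed
    qed
    then obtain b2 where b2: "\<And>j. j \<in> J \<Longrightarrow> b2 j \<in> part M (d j)"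
      "\<And>j. j \<in> J \<Longrightarrow> b2 j \<ominus>\<^bsub>M\<^esub> b' j \<in> sec {y. r y < r (lab j)}"
      "\<And>j. j \<in> J \<Longrightarrow> lab j \<in> D \<Longrightarrow> r (lab j) < Suc n \<Longrightarrow> b2 j \<in> sec D" by metis
    have "b2 j \<ominus>\<^bsub>M\<^esub> b j \<in> sec {y. r y < r (lab j)}" if j: "j \<in> J" for j
    proof -
      have c: "b2 j \<in> carrier M" "b' j \<in> carrier M" "b j \<in> carrier M"
        using b2(1)[OF j] b'c[OF j] tD(5)[OF j] SSM.part_carrier by auto
      have "(b2 j \<ominus>\<^bsub>M\<^esub> b' j) \<oplus>\<^bsub>M\<^esub> (b' j \<ominus>\<^bsub>M\<^esub> b j) = (b2 j \<oplus>\<^bsub>M\<^esub> b' j) \<ominus>\<^bsub>M\<^esub> (b' j \<oplus>\<^bsub>M\<^esub> b j)"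
        using SSM.add_diff_add[OF c(1,2,2,3)] by simp
      also have "\<dots> = (b2 j \<oplus>\<^bsub>M\<^esub> b' j) \<ominus>\<^bsub>M\<^esub> (b j \<oplus>\<^bsub>M\<^esub> b' j)" using SSM.M.a_comm c by simp
      also have "\<dots> = (b2 j \<ominus>\<^bsub>M\<^esub> b j) \<oplus>\<^bsub>M\<^esub> (b' j \<ominus>\<^bsub>M\<^esub> b' j)" using SSM.add_diff_add[OF c(1,2,3,2)] .
      also have "\<dots> = b2 j \<ominus>\<^bsub>M\<^esub> b j" using c minus_zero_iff[OF c(2,2)] by simp
      finally show ?thesis using sec_add[OF b2(2)[OF j] b'(2)[OF j]] by simp
    qed
    then show ?case using b2 by blast
  qed
  moreover obtain n where n: "\<And>j. j \<in> J \<Longrightarrow> r (lab j) < n"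
  proof -
    have "\<forall>j \<in> J. r (lab j) < Suc (Max ((\<lambda>j. r (lab j)) ` J))" using tD(1) by (auto simp: less_Suc_eq_le)
    then show ?thesis using that by blast
  qed
  ultimately obtain b' where b': "\<And>j. j \<in> J \<Longrightarrow> b' j \<in> part M (d j)" "\<And>j. j \<in> J \<Longrightarrow> b' j \<ominus>\<^bsub>M\<^esub> b j \<in> sec {y. r y < r (lab j)}"
      "\<And>j. j \<in> J \<Longrightarrow> lab j \<in> D \<Longrightarrow> b' j \<in> sec D"
  proof -
    assume *: "\<And>n. \<exists>b'. (\<forall>j \<in> J. b' j \<in> part M (d j) \<and> b' j \<ominus>\<^bsub>M\<^esub> b j \<in> sec {y. r y < r (lab j)}) \<and>
     (\<forall>j \<in> J. lab j \<in> D \<longrightarrow> r (lab j) < n \<longrightarrow> b' j \<in> sec D)"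
      and n: "\<And>j. j \<in> J \<Longrightarrow> r (lab j) < n"
    from *[of n] obtain b' where b': "\<forall>j \<in> J. b' j \<in> part M (d j) \<and> b' j \<ominus>\<^bsub>M\<^esub> b j \<in> sec {y. r y < r (lab j)}"
      "\<forall>j \<in> J. lab j \<in> D \<longrightarrow> r (lab j) < n \<longrightarrow> b' j \<in> sec D" by blast
    show ?thesis by (rule that[of b']) (use b' n in auto)
  qed
  have "tri r J b' d lab" by (rule tri_change[OF t b'(1,2)])
  then show ?thesis using b' by blast
qed

text \<open>Locally at every hyperplane \<open>z\<close> is the restriction of a polynomial, so the possible denominators of its
  action are coprime, and coordinates with respect to a triangular basis cancel them.\<close>

lemma congruence_action:
  assumes t: "tri r J b d lab" and z: "\<And>x. x \<in> A \<Longrightarrow> z x \<in> S"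
    "\<And>x t. x \<in> A \<Longrightarrow> t \<in> T \<Longrightarrow> t \<otimes>\<^bsub>W\<^esub> x \<in> A \<Longrightarrow> Sdvd (\<alpha> t) (\<lambda>v. z x v - z (t \<otimes>\<^bsub>W\<^esub> x) v)"
    and m: "m \<in> carrier M"
  shows "\<exists>m' \<in> carrier M. \<forall>F \<in> SS. \<forall>s \<in> S. (\<forall>x \<in> A. res x F = (\<lambda>v. s v * z x v)) \<longrightarrow> act (rt s) m' = act F m"
proof -
  note tD = triD[OF t]
  obtain D e G where G: "linprod D" "G \<in> SS" "\<forall>x \<in> A. res x G = (\<lambda>v. D v * z x v)"
    using interpolation[OF A, of z] z(1) by blast
  have DS: "D \<in> S" "D \<noteq> (\<lambda>_. 0)" using linprod_S linprod_nonzero G(1) by auto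
  \<comment> \<open>Two fractions F/s and F'/s' representing z are compatible, since s F' and s' F
    have the same restrictions to the graphs over A.\<close>
  have cross: "act (rt s) (act F' m) = act (rt s') (act F m)"
    if "F \<in> SS" "F' \<in> SS" "s \<in> S" "s' \<in> S" "\<forall>x \<in> A. res x F = (\<lambda>v. s v * z x v)" "\<forall>x \<in> A. res x F' = (\<lambda>v. s' v * z x v)"
    for F F' s s'
  proof -
    have "act (\<lambda>p. rt s p * F' p) m = act (\<lambda>p. rt s' p * F p) m"
      by (rule act_cong) (use that m in \<open>auto simp: mult.left_commute\<close>)
    then show ?thesis using that m by (simp add: act_mult)
  qed
  have all: "- A \<inter> A = {}" by auto
  have full: "lc {j \<in> J. lab j \<in> A} c b = lc J c b" for c
  proof -
    have "{j \<in> J. lab j \<in> A} = J" using tD(2) by auto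
    then show ?thesis by simp
  qed
  obtain c where c: "c \<in> J \<rightarrow> S" "act G m = lc J c b" using tD(6)[of "act G m"] G m by auto
  have "Sdvd D (c k)" if k: "k \<in> J" for k
  proof (rule linprod_dvd[OF G(1)])
    show "c k \<in> S" using c(1) k by auto
    fix lam assume lam: "lam \<in> dual" "lam \<noteq> (\<lambda>_. 0)"
    obtain s G' where s: "s \<in> S" "\<not> Sdvd lam s" "G' \<in> SS" "\<forall>x \<in> A. res x G' = (\<lambda>v. s v * z x v)"
      using interpolation_mod[OF A z(1) lam z(2)] by blast
    obtain c' where c': "c' \<in> J \<rightarrow> S" "act G' m = lc J c' b" using tD(6)[of "act G' m"] s m by auto
    \<comment> \<open>The fraction G'/s that is good at \<open>lam\<close> satisfies s (G m) = D (G'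
      m). Comparing coordinates gives s c = D c', the input of \<open>linprod_dvd\<close>.\<close>
    define e where "e j = (\<lambda>v. s v * c j v - D v * c' j v)" for j
    have cs: "(\<lambda>j v. s v * c j v) \<in> J \<rightarrow> S" "(\<lambda>j v. D v * c' j v) \<in> J \<rightarrow> S" "e \<in> J \<rightarrow> S"
      using c(1) c'(1) s(1) DS(1) by (auto simp: Pi_iff e_def)
    have "lc J e b = lc J (\<lambda>j v. s v * c j v) b \<ominus>\<^bsub>M\<^esub> lc J (\<lambda>j v. D v * c' j v) b"
      unfolding e_def by (rule lc_minus'[OF tD(1) cs(1,2) tD(5)])
    also have "lc J (\<lambda>j v. s v * c j v) b = act (rt s) (act G m)"
      unfolding c(2) by (rule act_lc[OF tD(1) c(1) tD(5) s(1)])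
    also have "lc J (\<lambda>j v. D v * c' j v) b = act (rt D) (act G' m)"
      unfolding c'(2) by (rule act_lc[OF tD(1) c'(1) tD(5) DS(1)])
    also have "act (rt s) (act G m) = act (rt D) (act G' m)"
      by (rule cross) (use s G DS in auto)
    also have "act (rt D) (act G' m) \<ominus>\<^bsub>M\<^esub> act (rt D) (act G' m) = \<zero>\<^bsub>M\<^esub>"
      using minus_zero_iff s m DS by simp
    finally have "lc J e b = \<zero>\<^bsub>M\<^esub>" .
    then have "lc {j \<in> J. lab j \<in> A} e b \<in> sec (- A)" unfolding full by simp
    then have "e k = (\<lambda>_. 0)" using tri_independent[OF t cs(3) subset_refl _ k tD(2)[OF k]] by blast
    then have "(\<lambda>v. s v * c k v) = (\<lambda>v. D v * c' k v)" by (simp add: e_def fun_eq_iff)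
    moreover have "c' k \<in> S" using c'(1) k by auto
    ultimately show "\<exists>s \<in> S. \<not> Sdvd lam s \<and> Sdvd D (\<lambda>v. s v * c k v)"
      using s(1,2) unfolding Sdvd_def by blast
  qed
  then have "\<forall>k \<in> J. \<exists>h. h \<in> S \<and> c k = (\<lambda>v. D v * h v)" unfolding Sdvd_def by blast
  then obtain h where h: "\<And>k. k \<in> J \<Longrightarrow> h k \<in> S" "\<And>k. k \<in> J \<Longrightarrow> c k = (\<lambda>v. D v * h k v)" by metis
  have hJ: "h \<in> J \<rightarrow> S" using h(1) by auto
  \<comment> \<open>G m divided by D coordinate by coordinate; this will be z m.\<close>
  define m' where "m' = lc J h b"
  have m'c: "m' \<in> carrier M" unfolding m'_def by (rule lc_closed'[OF tD(1) hJ tD(5)])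
  have "act (rt D) m' = lc J (\<lambda>j v. D v * h j v) b"
    unfolding m'_def by (rule act_lc[symmetric, OF tD(1) hJ tD(5) DS(1)])
  also have "\<dots> = lc J c b"
    by (rule N.finsum_cong') (use h c tD(5) in \<open>auto simp: Pi_iff\<close>)
  finally have Dm: "act (rt D) m' = act G m" using c(2) by simp
  have "act (rt s) m' = act F m" if F: "F \<in> SS" "s \<in> S" "\<forall>x \<in> A. res x F = (\<lambda>v. s v * z x v)" for F s
  proof (rule act_rt_cancel[OF DS])
    have "act (rt D) (act (rt s) m') = act (rt s) (act (rt D) m')" using DS F m'c by (intro act_comm) auto
    also have "\<dots> = act (rt D) (act F m)" unfolding Dm using cross[OF F(1) G(2) F(2) DS(1) F(3) G(3)] .
    finally show "act (rt D) (act (rt s) m') = act (rt D) (act F m)" .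
  qed (use F m m'c in auto)
  then show ?thesis using m'c by blast
qed

end

section \<open>The category \<open>\<F>\<^sub>\<nabla>\<close>\<close>

context graded_mod
begin

section \<open>Quotients of graded modules by submodules\<close>

lemma coset_eq:
  assumes N0: "submodule N0 R M" and "x \<in> carrier M" "y \<in> carrier M"
  shows "(\<lambda>h. h \<oplus>\<^bsub>M\<^esub> x) ` N0 = (\<lambda>h. h \<oplus>\<^bsub>M\<^esub> y) ` N0 \<longleftrightarrow> x \<ominus>\<^bsub>M\<^esub> y \<in> N0"
proof
  note f = submodule_facts[OF N0]
  assume eq: "(\<lambda>h. h \<oplus>\<^bsub>M\<^esub> x) ` N0 = (\<lambda>h. h \<oplus>\<^bsub>M\<^esub> y) ` N0"
  have "\<zero>\<^bsub>M\<^esub> \<oplus>\<^bsub>M\<^esub> x \<in> (\<lambda>h. h \<oplus>\<^bsub>M\<^esub> y) ` N0" unfolding eq[symmetric] using f(2) by blast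
  then obtain h where h: "h \<in> N0" "x = h \<oplus>\<^bsub>M\<^esub> y" using assms by auto
  have "x \<ominus>\<^bsub>M\<^esub> y = h" using h f(1) assms by (auto simp: a_minus_def M.add.m_assoc M.r_neg)
  then show "x \<ominus>\<^bsub>M\<^esub> y \<in> N0" using h by simp
next
  note f = submodule_facts[OF N0]
  have sub: "(\<lambda>h. h \<oplus>\<^bsub>M\<^esub> x) ` N0 \<subseteq> (\<lambda>h. h \<oplus>\<^bsub>M\<^esub> y) ` N0"
    if xy: "x \<ominus>\<^bsub>M\<^esub> y \<in> N0" "x \<in> carrier M" "y \<in> carrier M" for x y
  proof
    fix u assume "u \<in> (\<lambda>h. h \<oplus>\<^bsub>M\<^esub> x) ` N0"
    then obtain h where h: "h \<in> N0" "u = h \<oplus>\<^bsub>M\<^esub> x" by auto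
    have "u = h \<oplus>\<^bsub>M\<^esub> ((x \<ominus>\<^bsub>M\<^esub> y) \<oplus>\<^bsub>M\<^esub> y)" using h diff_add_cancel[OF xy(2,3)] by simp
    also have "\<dots> = (h \<oplus>\<^bsub>M\<^esub> (x \<ominus>\<^bsub>M\<^esub> y)) \<oplus>\<^bsub>M\<^esub> y"
      by (rule M.a_assoc[symmetric]) (use h xy f(1) in auto)
    finally show "u \<in> (\<lambda>h. h \<oplus>\<^bsub>M\<^esub> y) ` N0" using f(4)[OF h(1) xy(1)] by blast
  qed
  assume xy: "x \<ominus>\<^bsub>M\<^esub> y \<in> N0"
  have "y \<ominus>\<^bsub>M\<^esub> x = \<ominus>\<^bsub>M\<^esub> (x \<ominus>\<^bsub>M\<^esub> y)" using assms by (simp add: a_minus_def M.minus_add M.a_comm)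
  then have yx: "y \<ominus>\<^bsub>M\<^esub> x \<in> N0" using f(3)[OF xy] by simp
  show "(\<lambda>h. h \<oplus>\<^bsub>M\<^esub> x) ` N0 = (\<lambda>h. h \<oplus>\<^bsub>M\<^esub> y) ` N0"
    using sub[OF xy assms(2,3)] sub[OF yx assms(3,2)] by blast
qed

text \<open>Scalar multiplication of a coset is a union over its elements. All members of the union
  coincide, so the quotient satisfies the conditions imposed on \<open>\<pi>\<close> in
  \<open>gmod_iso_cyclic\<close>.\<close>

lemma gquot_iso_cyclic:
  fixes C :: "nat \<Rightarrow> ('a, 'q) gmodule"
  assumes N0: "submodule N0 R M" and M1: "submodule M1 R M" and sub: "N0 \<subseteq> M1"
    and one: "\<one>\<^bsub>R\<^esub> \<in> rpart R 0" and zero: "\<And>i. \<zero>\<^bsub>R\<^esub> \<in> rpart R i"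
    and C: "\<And>j. j < n \<Longrightarrow> carrier (C j) = q j ` carrier R"
      "\<And>j r s. j < n \<Longrightarrow> r \<in> carrier R \<Longrightarrow> s \<in> carrier R \<Longrightarrow> q j r \<oplus>\<^bsub>C j\<^esub> q j s = q j (r \<oplus>\<^bsub>R\<^esub> s)"
      "\<And>j r s. j < n \<Longrightarrow> r \<in> carrier R \<Longrightarrow> s \<in> carrier R \<Longrightarrow> r \<odot>\<^bsub>C j\<^esub> q j s = q j (r \<otimes>\<^bsub>R\<^esub> s)"
      "\<And>j i. j < n \<Longrightarrow> part (C j) i = q j ` rpart R i"
  shows "gmod_iso R (gquot (gsub M M1) N0) (gdirect_sum {..<n} (\<lambda>j. gshift (C j) (k j))) \<longleftrightarrow>
    (\<exists>b. presentation N0 M1 n b k q)"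
proof -
  note f0 = submodule_facts[OF N0] and f1 = submodule_facts[OF M1]
  define \<pi> where "\<pi> x = (\<lambda>h. h \<oplus>\<^bsub>M\<^esub> x) ` N0" for x
  have coset: "a_r_coset (gsub M M1) N0 x = \<pi> x" for x
    by (auto simp: a_r_coset_def r_coset_def gsub_def \<pi>_def)
  have eq: "\<pi> m = \<pi> m' \<longleftrightarrow> m \<ominus>\<^bsub>M\<^esub> m' \<in> N0" if "m \<in> M1" "m' \<in> M1" for m m'
    unfolding \<pi>_def using that f1(1) by (intro coset_eq[OF N0]) auto
  have mem: "m' \<in> \<pi> m \<longleftrightarrow> m' \<in> carrier M \<and> m' \<ominus>\<^bsub>M\<^esub> m \<in> N0" if m: "m \<in> M1" for m m'
  proof
    assume "m' \<in> \<pi> m"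
    then obtain h where h: "h \<in> N0" "m' = h \<oplus>\<^bsub>M\<^esub> m" by (auto simp: \<pi>_def)
    have c: "h \<in> carrier M" "m \<in> carrier M" using h(1) m f0(1) f1(1) by auto
    have "m' \<ominus>\<^bsub>M\<^esub> m = h" unfolding h(2) using c by (simp add: a_minus_def M.add.m_assoc M.r_neg)
    then show "m' \<in> carrier M \<and> m' \<ominus>\<^bsub>M\<^esub> m \<in> N0" using h c by simp
  next
    assume a: "m' \<in> carrier M \<and> m' \<ominus>\<^bsub>M\<^esub> m \<in> N0"
    then have "m' = (m' \<ominus>\<^bsub>M\<^esub> m) \<oplus>\<^bsub>M\<^esub> m" using diff_add_cancel m f1(1) by auto
    then show "m' \<in> \<pi> m" unfolding \<pi>_def using a by blast
  qed
  have self: "m \<in> \<pi> m" if "m \<in> M1" for m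
    using mem[OF that] f0(2) that f1(1) by (auto simp: a_minus_def M.r_neg)
  have in1: "m' \<in> M1" if "m' \<in> \<pi> m" "m \<in> M1" for m m'
    using that f1(4) sub by (auto simp: \<pi>_def)
  show ?thesis
  proof (rule gmod_iso_cyclic[where \<pi> = \<pi>, OF N0 M1 sub one zero _ eq _ _ _ C])
    show "carrier (gquot (gsub M M1) N0) = \<pi> ` M1"
      unfolding gquot_def by (auto simp: A_RCOSETS_def RCOSETS_def \<pi>_def r_coset_def gsub_def)
    show "part (gquot (gsub M M1) N0) i = \<pi> ` (part M i \<inter> M1)" for i
      unfolding gquot_def using coset by (auto simp: gsub_def)
    fix m assume m: "m \<in> M1"
    { fix m' assume m': "m' \<in> M1"
      have c: "m \<in> carrier M" "m' \<in> carrier M" using m m' f1(1) by auto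
      have "set_add (gsub M M1) (\<pi> m) (\<pi> m') = \<pi> (m \<oplus>\<^bsub>M\<^esub> m')"
      proof
        show "set_add (gsub M M1) (\<pi> m) (\<pi> m') \<subseteq> \<pi> (m \<oplus>\<^bsub>M\<^esub> m')"
        proof
          fix u assume "u \<in> set_add (gsub M M1) (\<pi> m) (\<pi> m')"
          then obtain a b where u: "a \<in> \<pi> m" "b \<in> \<pi> m'" "u = a \<oplus>\<^bsub>M\<^esub> b"
            by (auto simp: set_add_def set_mult_def gsub_def)
          have ab: "a \<in> carrier M" "b \<in> carrier M" "a \<ominus>\<^bsub>M\<^esub> m \<in> N0" "b \<ominus>\<^bsub>M\<^esub> m' \<in> N0"
            using u mem m m' by auto
          have "u \<ominus>\<^bsub>M\<^esub> (m \<oplus>\<^bsub>M\<^esub> m') \<in> N0" unfolding u(3) add_diff_add[OF ab(1,2) c] using f0(4) ab by blast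
          then show "u \<in> \<pi> (m \<oplus>\<^bsub>M\<^esub> m')" using mem[OF f1(4)[OF m m']] u(3) ab by simp
        qed
        show "\<pi> (m \<oplus>\<^bsub>M\<^esub> m') \<subseteq> set_add (gsub M M1) (\<pi> m) (\<pi> m')"
        proof
          fix u assume "u \<in> \<pi> (m \<oplus>\<^bsub>M\<^esub> m')"
          then obtain h where h: "h \<in> N0" "u = h \<oplus>\<^bsub>M\<^esub> (m \<oplus>\<^bsub>M\<^esub> m')" by (auto simp: \<pi>_def)
          then have "u = (h \<oplus>\<^bsub>M\<^esub> m) \<oplus>\<^bsub>M\<^esub> m'" using f0(1) c by (auto simp: M.a_assoc)
          moreover have "h \<oplus>\<^bsub>M\<^esub> m \<in> \<pi> m" using h by (auto simp: \<pi>_def)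
          ultimately show "u \<in> set_add (gsub M M1) (\<pi> m) (\<pi> m')"
            using self[OF m'] by (auto simp: set_add_def set_mult_def gsub_def)
        qed
      qed
      then show "\<pi> m \<oplus>\<^bsub>gquot (gsub M M1) N0\<^esub> \<pi> m' = \<pi> (m \<oplus>\<^bsub>M\<^esub> m')" by (simp add: gquot_def) }
    { fix r assume r: "r \<in> carrier R"
      have "\<pi> (r \<odot>\<^bsub>M\<^esub> x) = \<pi> (r \<odot>\<^bsub>M\<^esub> m)" if x: "x \<in> \<pi> m" for x
      proof -
        have xm: "x \<in> carrier M" "x \<ominus>\<^bsub>M\<^esub> m \<in> N0" "m \<in> carrier M" using mem[OF m] x m f1(1) by auto
        have "r \<odot>\<^bsub>M\<^esub> x \<ominus>\<^bsub>M\<^esub> r \<odot>\<^bsub>M\<^esub> m \<in> N0" using smult_diff[OF r xm(1,3)] f0(6)[OF r xm(2)] by simp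
        then show ?thesis using eq f1(6)[OF r] in1[OF x m] m by simp
      qed
      then have "(\<Union>x \<in> \<pi> m. \<pi> (r \<odot>\<^bsub>M\<^esub> x)) = \<pi> (r \<odot>\<^bsub>M\<^esub> m)" using self[OF m] by blast
      then show "r \<odot>\<^bsub>gquot (gsub M M1) N0\<^esub> \<pi> m = \<pi> (r \<odot>\<^bsub>M\<^esub> m)"
        by (simp add: gquot_def coset) (simp add: gsub_def) }
  qed
qed

end

context coxeter_representation
begin

definition gr where "gr x F = restrict F (graph W \<rho> x)"

section \<open>Supports in the prime spectrum\<close>

lemma gr_eq_iff: "gr x F = gr x G \<longleftrightarrow> res x F = res x G"
  by (auto simp: gr_def graph_def res_def restrict_def fun_eq_iff split: if_splits)

lemma vanishing_ideal_graph: "vanishing_ideal scale (graph W \<rho> x) = {F \<in> SS. res x F = (\<lambda>_. 0)}"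
  by (auto simp: vanishing_ideal_def graph_def res_def fun_eq_iff)

text \<open>It is the kernel of \<open>res x\<close>, a ring homomorphism into the domain S.\<close>

lemma vanishing_ideal_prime:
  assumes x: "x \<in> carrier W"
  shows "primeideal (vanishing_ideal scale (graph W \<rho> x)) (SS_ring scale)"
proof -
  interpret SS: cring "SS_ring scale" by (rule SS_cring)
  have inv: "\<ominus>\<^bsub>SS_ring scale\<^esub> F = (\<lambda>p. - F p)" if "F \<in> SS" for F
    by (rule SS.minus_equality) (use that in auto)
  show ?thesis
    unfolding vanishing_ideal_graph
  proof (rule primeidealI)
    show "ideal {F \<in> SS. res x F = (\<lambda>_. 0)} (SS_ring scale)"
    proof (rule idealI[OF SS.ring_axioms])
      show "subgroup {F \<in> SS. res x F = (\<lambda>_. 0)} (add_monoid (SS_ring scale))"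
        by (rule SS.add.subgroupI) (auto simp: a_inv_def[symmetric] inv intro!: exI[of _ "\<lambda>_. 0"])
    qed auto
    show "cring (SS_ring scale)" by (rule SS_cring)
    have "(\<lambda>_. 1) \<notin> {F \<in> SS. res x F = (\<lambda>_. 0)}" by (auto simp: fun_eq_iff)
    then show "SS \<noteq> {F \<in> SS. res x F = (\<lambda>_. 0)}" by (metis const_SS)
    fix F G assume "F \<in> SS" "G \<in> SS" "F \<otimes>\<^bsub>SS_ring scale\<^esub> G \<in> {F \<in> SS. res x F = (\<lambda>_. 0)}"
    then show "F \<in> {F \<in> SS. res x F = (\<lambda>_. 0)} \<or> G \<in> {F \<in> SS. res x F = (\<lambda>_. 0)}"
      using S_domain[of "res x F" "res x G"] res_S[OF _ x] by auto
  qed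
qed

text \<open>Proved for arbitrary modules because the layers of an object of F_nabla are handled
  before torsion freeness is known. For sums: if the annihilators of m and m' both leave the prime
  P, a product of elements outside P kills the sum.\<close>

lemma supported_sections_submodule:
  assumes "Module.module (SS_ring scale) M"
  shows "submodule (supported_sections scale W \<rho> M B) (SS_ring scale) M"
proof -
  interpret M: Module.module "SS_ring scale" M by fact
  let ?R = "SS_ring scale"
  have P1: "F \<otimes>\<^bsub>?R\<^esub> G \<notin> P" if "primeideal P ?R" "F \<in> SS - P" "G \<in> SS - P" for P F G
    using primeideal.I_prime[OF that(1), of F G] that(2,3) by blast
  show ?thesis
  proof (rule M.submoduleI)
    show "supported_sections scale W \<rho> M B \<subseteq> carrier M" by (auto simp: supported_sections_def)
    have "P \<notin> section_support ?R M \<zero>\<^bsub>M\<^esub>" for P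
    proof
      assume P: "P \<in> section_support ?R M \<zero>\<^bsub>M\<^esub>"
      then have pr: "primeideal P ?R" "SS \<subseteq> P" by (auto simp: section_support_def)
      have "P \<subseteq> SS" using pr(1) by (simp add: primeideal_def additive_subgroup.a_subset ideal.axioms(1))
      then show False using primeideal.I_notcarr[OF pr(1)] pr(2) by blast
    qed
    then show "\<zero>\<^bsub>M\<^esub> \<in> supported_sections scale W \<rho> M B" by (auto simp: supported_sections_def)
  next
    fix m assume m: "m \<in> supported_sections scale W \<rho> M B"
    have mc: "m \<in> carrier M" using m by (simp add: supported_sections_def)
    have "section_support ?R M (\<ominus>\<^bsub>M\<^esub> m) \<subseteq> section_support ?R M m"
      using mc M.smult_r_minus[of _ m] by (auto simp: section_support_def)
    then show "\<ominus>\<^bsub>M\<^esub> m \<in> supported_sections scale W \<rho> M B" using m mc by (auto simp: supported_sections_def)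
    { fix m' assume m': "m' \<in> supported_sections scale W \<rho> M B"
      have mc': "m' \<in> carrier M" using m' by (simp add: supported_sections_def)
      have "section_support ?R M (m \<oplus>\<^bsub>M\<^esub> m') \<subseteq> section_support ?R M m \<union> section_support ?R M m'"
      proof
        fix P assume P: "P \<in> section_support ?R M (m \<oplus>\<^bsub>M\<^esub> m')"
        then have pr: "primeideal P ?R" by (simp add: section_support_def)
        show "P \<in> section_support ?R M m \<union> section_support ?R M m'"
        proof (rule ccontr)
          assume "\<not> ?thesis"
          then obtain F G where F: "F \<in> SS - P" "F \<odot>\<^bsub>M\<^esub> m = \<zero>\<^bsub>M\<^esub>" and G: "G \<in> SS - P" "G \<odot>\<^bsub>M\<^esub> m' = \<zero>\<^bsub>M\<^esub>"
            using pr by (auto simp: section_support_def)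
          have FG: "F \<in> SS" "G \<in> SS" using F G by auto
          have "(F \<otimes>\<^bsub>?R\<^esub> G) \<odot>\<^bsub>M\<^esub> m = (G \<otimes>\<^bsub>?R\<^esub> F) \<odot>\<^bsub>M\<^esub> m" using M.R.m_comm[OF FG] by simp
          also have "\<dots> = \<zero>\<^bsub>M\<^esub>" using M.smult_assoc1[OF FG(2,1) mc] F(2) FG by simp
          finally have "(F \<otimes>\<^bsub>?R\<^esub> G) \<odot>\<^bsub>M\<^esub> (m \<oplus>\<^bsub>M\<^esub> m') = \<zero>\<^bsub>M\<^esub>"
            using M.smult_assoc1[OF FG mc'] G(2) FG mc mc' M.smult_r_distr[OF M.R.m_closed[OF FG] mc mc'] by simp
          then have "F \<otimes>\<^bsub>?R\<^esub> G \<in> P" using P M.R.m_closed[OF FG] by (auto simp: section_support_def)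
          then show False using P1[OF pr F(1) G(1)] by blast
        qed
      qed
      then show "m \<oplus>\<^bsub>M\<^esub> m' \<in> supported_sections scale W \<rho> M B"
        using m m' mc mc' by (auto simp: supported_sections_def) }
    { fix F assume F: "F \<in> SS"
      have "G \<odot>\<^bsub>M\<^esub> (F \<odot>\<^bsub>M\<^esub> m) = \<zero>\<^bsub>M\<^esub>" if G: "G \<in> SS" "G \<odot>\<^bsub>M\<^esub> m = \<zero>\<^bsub>M\<^esub>" for G
      proof -
        have "G \<odot>\<^bsub>M\<^esub> (F \<odot>\<^bsub>M\<^esub> m) = (F \<otimes>\<^bsub>?R\<^esub> G) \<odot>\<^bsub>M\<^esub> m" using M.smult_assoc1[OF G(1) F mc] M.R.m_comm[OF F G(1)] by simp
        then show ?thesis using M.smult_assoc1[OF F G(1) mc] G F by simp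
      qed
      then have "section_support ?R M (F \<odot>\<^bsub>M\<^esub> m) \<subseteq> section_support ?R M m" by (auto simp: section_support_def)
      then show "F \<odot>\<^bsub>M\<^esub> m \<in> supported_sections scale W \<rho> M B" using m mc F by (auto simp: supported_sections_def) }
  qed
qed

lemma supported_sections_mono: "B \<subseteq> C \<Longrightarrow> supported_sections scale W \<rho> M B \<subseteq> supported_sections scale W \<rho> M C"
  unfolding supported_sections_def graph_primes_def by blast

text \<open>Restriction \<open>gr (xs j)\<close> presents S(xs j) as a cyclic quotient of S tensor
  S.\<close>

lemma layer_iso_iff:
  assumes M: "graded_module (SS_ring scale) M" and N0: "submodule N0 (SS_ring scale) M" and M1: "submodule M1 (SS_ring scale) M"
    and sub: "N0 \<subseteq> M1"
  shows "gmod_iso (SS_ring scale) (gquot (gsub M M1) N0)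
      (gdirect_sum {..<n} (\<lambda>j. gshift (graph_bimodule scale W \<rho> (xs j)) (k j))) \<longleftrightarrow>
    (\<exists>b. graded_mod.presentation (SS_ring scale) M N0 M1 n b k (\<lambda>j. gr (xs j)))"
proof -
  interpret M: graded_mod "SS_ring scale" M using M SSp_SS by unfold_locales auto
  show ?thesis
    by (rule M.gquot_iso_cyclic[OF N0 M1 sub])
      (auto simp: one_SSp graph_bimodule_def gr_def restrict_def fun_eq_iff)
qed

end

context supported_module
begin

text \<open>If a prime contains the ideal of no graph over B, a product of functions outside it
  vanishes on the relevant graphs and kills m. Conversely, if \<open>E x\<close> does not kill m,
  the annihilator of m lies in the ideal of Gr(x), which contains the ideal of no other
  graph.\<close>

lemma supported_sections_eq_sec: "B \<subseteq> carrier W \<Longrightarrow> supported_sections scale W \<rho> M B = sec B"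
proof
  assume BW: "B \<subseteq> carrier W"
  show "sec B \<subseteq> supported_sections scale W \<rho> M B"
  proof
    fix m assume m: "m \<in> sec B"
    have mc: "m \<in> carrier M" using m sec_carrier by blast
    have "P \<in> graph_primes scale W \<rho> B" if P: "P \<in> section_support (SS_ring scale) M m" for P
    proof (rule ccontr)
      assume nP: "P \<notin> graph_primes scale W \<rho> B"
      have pr: "primeideal P (SS_ring scale)" and ann: "\<And>F. F \<in> SS \<Longrightarrow> act F m = \<zero>\<^bsub>M\<^esub> \<Longrightarrow> F \<in> P"
        using P by (auto simp: section_support_def act_def)
      interpret P: primeideal P "SS_ring scale" by (rule pr)
      have ne: "\<And>x. x \<in> B \<Longrightarrow> \<exists>F \<in> SS. res x F = (\<lambda>_. 0) \<and> F \<notin> P"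
        using nP pr unfolding graph_primes_def vanishing_ideal_graph by blast
      have "finite C \<Longrightarrow> C \<subseteq> A \<inter> B \<Longrightarrow> \<exists>F \<in> SS. (\<forall>x \<in> C. res x F = (\<lambda>_. 0)) \<and> F \<notin> P" for C
      proof (induction C rule: finite_induct)
        case empty
        have "(\<lambda>_. 1) \<notin> P" using P.one_imp_carrier P.I_notcarr by auto
        then show ?case by (intro bexI[of _ "\<lambda>_. 1"]) auto
      next
        case (insert x C)
        then obtain F where F: "F \<in> SS" "\<forall>x \<in> C. res x F = (\<lambda>_. 0)" "F \<notin> P" by auto
        obtain G where G: "G \<in> SS" "res x G = (\<lambda>_. 0)" "G \<notin> P" using ne[of x] insert.prems by auto
        have "(\<lambda>p. F p * G p) \<notin> P" using P.I_prime[OF F(1) G(1)] F(3) G(3) by auto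
        then show ?case using F G by (intro bexI[of _ "\<lambda>p. F p * G p"]) auto
      qed
      from this[of "A \<inter> B"] obtain F where "F \<in> SS" "\<forall>x \<in> A \<inter> B. res x F = (\<lambda>_. 0)" "F \<notin> P"
        using A(1) by auto
      then show False using ann[of F] sec_vanish[OF m, of F] by auto
    qed
    then show "m \<in> supported_sections scale W \<rho> M B" using mc by (auto simp: supported_sections_def)
  qed
  show "supported_sections scale W \<rho> M B \<subseteq> sec B"
  proof
    fix m assume m: "m \<in> supported_sections scale W \<rho> M B"
    then have mc: "m \<in> carrier M" and supp: "section_support (SS_ring scale) M m \<subseteq> graph_primes scale W \<rho> B"
      by (auto simp: supported_sections_def)
    have "act (E x) m = \<zero>\<^bsub>M\<^esub>" if x: "x \<in> A - B" for x
    proof (rule ccontr)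
      assume ne: "act (E x) m \<noteq> \<zero>\<^bsub>M\<^esub>"
      have xA: "x \<in> A" "x \<in> carrier W" using x A by auto
      note Ex = E_props[OF xA(1)]
      have "F \<in> vanishing_ideal scale (graph W \<rho> x)" if F: "F \<in> SS" "act F m = \<zero>\<^bsub>M\<^esub>" for F
      proof -
        \<comment> \<open>A function killing m also kills \<open>act (E x) m\<close>, on which it
          acts as its restriction to Gr(x); so that restriction is zero.\<close>
        have "act (rt (res x F)) (act (E x) m) = act (\<lambda>p. rt (res x F) p * E x p) m"
          using act_mult Ex(4) F(1) res_S[OF F(1) xA(2)] mc by simp
        also have "\<dots> = act (\<lambda>p. E x p * F p) m"
        proof (rule act_cong)
          fix y assume "y \<in> A"
          then show "res y (\<lambda>p. rt (res x F) p * E x p) = res y (\<lambda>p. E x p * F p)"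
            using Ex(3)[of y] by (cases "y = x") (auto simp: mult.commute)
        qed (use Ex F res_S[OF F(1) xA(2)] mc in auto)
        also have "\<dots> = \<zero>\<^bsub>M\<^esub>" using act_mult[OF Ex(4) F(1) mc] F(2) Ex(4) by simp
        finally have "res x F = (\<lambda>_. 0)"
          using ne act_rt_zero[OF res_S[OF F(1) xA(2)]] Ex(4) mc by blast
        then show ?thesis using F(1) by (simp add: vanishing_ideal_graph)
      qed
      then have "vanishing_ideal scale (graph W \<rho> x) \<in> section_support (SS_ring scale) M m"
        using vanishing_ideal_prime[OF xA(2)] by (auto simp: section_support_def act_def)
      then obtain y where y: "y \<in> B" "vanishing_ideal scale (graph W \<rho> y) \<subseteq> vanishing_ideal scale (graph W \<rho> x)"
        using supp unfolding graph_primes_def by blast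
      have yW: "y \<in> carrier W" "x \<noteq> y" using y x BW by auto
      obtain f where f: "f \<in> dual" "res x (sep y f) \<noteq> (\<lambda>_. 0)" using sep_nonzero[OF xA(2) yW] by blast
      have "sep y f \<in> SS" using sep_SSp[OF f(1) yW(1)] SSp_SS by blast
      then have "sep y f \<in> vanishing_ideal scale (graph W \<rho> y)" by (simp add: vanishing_ideal_graph)
      then show False using y(2) f(2) by (auto simp: vanishing_ideal_graph)
    qed
    then show "m \<in> sec B" using mc by (simp add: sec_def)
  qed
qed

text \<open>On S(x) a function F acts as the scalar \<open>res x F\<close>, so a sum of such
  bimodules is a free right module whose basis elements each live on one graph modulo shorter ones.
  The bimodule isomorphism in F_nabla is thereby replaced by a basis over S together with
  supports.\<close>

lemma presentation_iff_rel_basis: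
  assumes len: "\<And>j. j < n \<Longrightarrow> xs j \<in> A \<and> len (xs j) = i"
  shows "SSM.presentation (sec {y. len y < i}) (sec {y. len y < Suc i}) n b k (\<lambda>j. gr (xs j)) \<longleftrightarrow>
    N.rel_basis (sec {y. len y < i}) (sec {y. len y < Suc i}) {..<n} b (\<lambda>j. - k j) \<and>
    (\<forall>j < n. b j \<in> sec (insert (xs j) {y. len y < i}))"
    (is "SSM.presentation ?N0 ?N1 n b k ?q \<longleftrightarrow> _")
proof
  assume pr: "SSM.presentation ?N0 ?N1 n b k ?q"
  note N0 = sec_submodule_SS[of "{y. len y < i}"]
  have b: "\<And>j. j < n \<Longrightarrow> b j \<in> ?N1" "\<And>j. j < n \<Longrightarrow> b j \<in> part M (- k j)"
    and span: "\<And>m. m \<in> ?N1 \<Longrightarrow> \<exists>F \<in> {..<n} \<rightarrow> SS. m \<ominus>\<^bsub>M\<^esub> (\<Oplus>\<^bsub>M\<^esub>j \<in> {..<n}. F j \<odot>\<^bsub>M\<^esub> b j) \<in> ?N0"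
    and indep: "\<And>F. F \<in> {..<n} \<rightarrow> SS \<Longrightarrow> (\<Oplus>\<^bsub>M\<^esub>j \<in> {..<n}. F j \<odot>\<^bsub>M\<^esub> b j) \<in> ?N0 \<longleftrightarrow> (\<forall>j < n. res (xs j) (F j) = (\<lambda>_. 0))"
    using pr unfolding SSM.presentation_def gr_eq_iff by auto
  have bc: "b \<in> {..<n} \<rightarrow> carrier M" using b(1) sec_carrier by blast
  have xW: "\<And>j. j < n \<Longrightarrow> xs j \<in> carrier W" using len A by auto
  have "N.rel_basis ?N0 ?N1 {..<n} b (\<lambda>j. - k j)"
    unfolding N.rel_basis_def
  proof (intro conjI ballI impI)
    fix m assume m: "m \<in> ?N1"
    obtain F where F: "F \<in> {..<n} \<rightarrow> SS" "m \<ominus>\<^bsub>M\<^esub> (\<Oplus>\<^bsub>M\<^esub>j \<in> {..<n}. F j \<odot>\<^bsub>M\<^esub> b j) \<in> ?N0" using span[OF m] by blast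
    \<comment> \<open>On the j-th generator F j may be replaced by \<open>rt (c j)\<close>: their
      difference restricts to 0 on Gr(xs j), so the relations send it to smaller length.\<close>
    define c where "c j = res (xs j) (F j)" for j
    have c: "c \<in> {..<n} \<rightarrow> S" using F(1) res_S xW by (auto simp: c_def Pi_iff)
    have rc: "(\<lambda>j. rt (c j)) \<in> {..<n} \<rightarrow> SS" using c by auto
    have "(\<lambda>j. F j \<ominus>\<^bsub>SS_ring scale\<^esub> rt (c j)) \<in> {..<n} \<rightarrow> SS" using F(1) rc SSM.R.minus_closed by (simp add: Pi_iff del: S_ring_simps)
    moreover have "res (xs j) (F j \<ominus>\<^bsub>SS_ring scale\<^esub> rt (c j)) = (\<lambda>_. 0)" if "j < n" for j
    proof -
      have FS: "F j \<in> SS" "rt (c j) \<in> SS" using F(1) rc that by auto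
      have "\<ominus>\<^bsub>SS_ring scale\<^esub> rt (c j) = (\<lambda>p. - rt (c j) p)" by (rule SSM.R.minus_equality) (use FS in auto)
      then show ?thesis by (simp add: a_minus_def c_def)
    qed
    ultimately have d: "(\<Oplus>\<^bsub>M\<^esub>j \<in> {..<n}. (F j \<ominus>\<^bsub>SS_ring scale\<^esub> rt (c j)) \<odot>\<^bsub>M\<^esub> b j) \<in> ?N0" using indep by blast
    have cl: "m \<in> carrier M" "(\<Oplus>\<^bsub>M\<^esub>j \<in> {..<n}. F j \<odot>\<^bsub>M\<^esub> b j) \<in> carrier M" "(\<Oplus>\<^bsub>M\<^esub>j \<in> {..<n}. rt (c j) \<odot>\<^bsub>M\<^esub> b j) \<in> carrier M"
      using sec_carrier[OF m] SSM.lc_closed[OF _ F(1) bc] SSM.lc_closed[OF _ rc bc] by auto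
    have "m \<ominus>\<^bsub>M\<^esub> (\<Oplus>\<^bsub>M\<^esub>j \<in> {..<n}. rt (c j) \<odot>\<^bsub>M\<^esub> b j) =
      (m \<ominus>\<^bsub>M\<^esub> (\<Oplus>\<^bsub>M\<^esub>j \<in> {..<n}. F j \<odot>\<^bsub>M\<^esub> b j)) \<oplus>\<^bsub>M\<^esub> (\<Oplus>\<^bsub>M\<^esub>j \<in> {..<n}. (F j \<ominus>\<^bsub>SS_ring scale\<^esub> rt (c j)) \<odot>\<^bsub>M\<^esub> b j)"
      unfolding SSM.lc_diff[OF finite_lessThan F(1) rc bc]
      using cl by (simp add: a_minus_def SSM.M.a_assoc SSM.M.r_neg1)
    then show "\<exists>c \<in> {..<n} \<rightarrow> S. m \<ominus>\<^bsub>N\<^esub> (\<Oplus>\<^bsub>N\<^esub>j \<in> {..<n}. c j \<odot>\<^bsub>N\<^esub> b j) \<in> ?N0"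
      using sec_add[OF F(2) d] c by (intro bexI[of _ c]) (simp_all add: minus_N)
  next
    fix c j assume c: "c \<in> {..<n} \<rightarrow> S" "(\<Oplus>\<^bsub>N\<^esub>j \<in> {..<n}. c j \<odot>\<^bsub>N\<^esub> b j) \<in> ?N0" and j: "j \<in> {..<n}"
    have "(\<lambda>j. rt (c j)) \<in> {..<n} \<rightarrow> SS" using c by auto
    from indep[OF this] show "c j = \<zero>\<^bsub>S_ring scale\<^esub>" using c(2) j by (simp add: minus_N)
  qed (use b in auto)
  moreover have "b j \<in> sec (insert (xs j) {y. len y < i})" if j: "j < n" for j
  proof -
    have "act (E y) (b j) = \<zero>\<^bsub>M\<^esub>" if y: "y \<in> A - insert (xs j) {y. len y < i}" for y
    proof (cases "len y = i")
      case False
      then show ?thesis using b(1)[OF j] y by (auto simp: sec_def)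
    next
      case True
      have yA: "y \<in> A" using y by simp
      note Ey = E_props[OF yA]
      have bj: "b j \<in> carrier M" using bc j by auto
      \<comment> \<open>For y of the same length as the label, \<open>E y\<close> restricts to 0 on
        the graph of the label, so it sends b j to smaller length, where a second application gives
        0. But on \<open>act (E y) (b j)\<close> the function \<open>E y\<close> acts as a nonzero
        scalar.\<close>
      have xy: "res (xs j) (E y) = (\<lambda>_. 0)" using Ey(3)[of "xs j"] len[OF j] y by auto
      have "(\<Oplus>\<^bsub>M\<^esub>l \<in> {..<n}. (if l = j then E y else \<zero>\<^bsub>SS_ring scale\<^esub>) \<odot>\<^bsub>M\<^esub> b l) = E y \<odot>\<^bsub>M\<^esub> b j"
        by (rule SSM.lc_single) (use j bc Ey in auto)
      moreover have "(\<Oplus>\<^bsub>M\<^esub>l \<in> {..<n}. (if l = j then E y else \<zero>\<^bsub>SS_ring scale\<^esub>) \<odot>\<^bsub>M\<^esub> b l) \<in> ?N0"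
        by (subst indep) (use xy Ey in auto)
      ultimately have "act (E y) (b j) \<in> ?N0" by (simp add: act_def)
      then have z: "act (E y) (act (E y) (b j)) = \<zero>\<^bsub>M\<^esub>" using True yA by (auto simp: sec_def)
      have "act (rt (res y (E y))) (act (E y) (b j)) = act (\<lambda>p. rt (res y (E y)) p * E y p) (b j)"
        using act_mult Ey bj by simp
      also have "\<dots> = act (\<lambda>p. E y p * E y p) (b j)"
      proof (rule act_cong)
        fix w assume "w \<in> A"
        then show "res w (\<lambda>p. rt (res y (E y)) p * E y p) = res w (\<lambda>p. E y p * E y p)"
          using Ey(3)[of w] by (cases "w = y") auto
      qed (use Ey bj in auto)
      also have "\<dots> = \<zero>\<^bsub>M\<^esub>" using act_mult[OF Ey(4,4) bj] z by simp
      finally show ?thesis using act_rt_zero[OF Ey(5,2)] Ey(4) bj by blast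
    qed
    then show ?thesis using b(1)[OF j] by (simp add: sec_def)
  qed
  ultimately show "N.rel_basis ?N0 ?N1 {..<n} b (\<lambda>j. - k j) \<and> (\<forall>j < n. b j \<in> sec (insert (xs j) {y. len y < i}))"
    by blast
next
  assume asm: "N.rel_basis ?N0 ?N1 {..<n} b (\<lambda>j. - k j) \<and> (\<forall>j < n. b j \<in> sec (insert (xs j) {y. len y < i}))"
  then have B: "N.rel_basis ?N0 ?N1 {..<n} b (\<lambda>j. - k j)" and bs: "\<And>j. j < n \<Longrightarrow> b j \<in> sec (insert (xs j) {y. len y < i})" by auto
  note BD = N.rel_basisD[OF B]
  note N0 = sec_submodule_SS[of "{y. len y < i}"]
  have bc: "b \<in> {..<n} \<rightarrow> carrier M" using BD(4) by simp
  have xW: "\<And>j. j < n \<Longrightarrow> xs j \<in> carrier W" using len A by auto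
  show "SSM.presentation ?N0 ?N1 n b k ?q"
    unfolding SSM.presentation_def gr_eq_iff
  proof (intro conjI allI ballI impI)
    fix j assume j: "j < n"
    show "b j \<in> ?N1" "b j \<in> part M (- k j)" using BD(2,3) j by auto
  next
    fix m assume m: "m \<in> ?N1"
    obtain c where c: "c \<in> {..<n} \<rightarrow> S" "m \<ominus>\<^bsub>N\<^esub> (\<Oplus>\<^bsub>N\<^esub>j \<in> {..<n}. c j \<odot>\<^bsub>N\<^esub> b j) \<in> ?N0" using BD(5)[OF m] by blast
    then show "\<exists>F \<in> {..<n} \<rightarrow> SS. m \<ominus>\<^bsub>M\<^esub> (\<Oplus>\<^bsub>M\<^esub>j \<in> {..<n}. F j \<odot>\<^bsub>M\<^esub> b j) \<in> ?N0"
      by (intro bexI[of _ "\<lambda>j. rt (c j)"]) (auto simp: minus_N)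
  next
    fix i' m assume m: "m \<in> ?N1" "m \<in> part M i'"
    obtain c where c: "c \<in> {..<n} \<rightarrow> S" "m \<ominus>\<^bsub>N\<^esub> (\<Oplus>\<^bsub>N\<^esub>j \<in> {..<n}. c j \<odot>\<^bsub>N\<^esub> b j) \<in> ?N0" using BD(5)[OF m(1)] by blast
    have mN: "m \<in> part N i'" using m(2) by simp
    obtain c' where c': "\<forall>j \<in> {..<n}. c' j \<in> Sp (i' - - k j)" "m \<ominus>\<^bsub>N\<^esub> (\<Oplus>\<^bsub>N\<^esub>j \<in> {..<n}. c' j \<odot>\<^bsub>N\<^esub> b j) \<in> ?N0"
      using N.homogeneous_coefficients[where b = b and d = "\<lambda>j. - k j", OF sec_gsubmodule BD(1,3) c(1) mN c(2)] by auto
    then show "\<exists>F. (\<forall>j<n. F j \<in> SSp (i' + k j)) \<and> m \<ominus>\<^bsub>M\<^esub> (\<Oplus>\<^bsub>M\<^esub>j \<in> {..<n}. F j \<odot>\<^bsub>M\<^esub> b j) \<in> ?N0"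
      by (intro exI[of _ "\<lambda>j. rt (c' j)"]) (auto simp: minus_N intro!: rt_SSp)
  next
    fix F assume F: "F \<in> {..<n} \<rightarrow> SS"
    define c where "c j = res (xs j) (F j)" for j
    have c: "c \<in> {..<n} \<rightarrow> S" using F res_S xW by (auto simp: c_def Pi_iff)
    have rc: "(\<lambda>j. rt (c j)) \<in> {..<n} \<rightarrow> SS" using c by auto
    have "(\<Oplus>\<^bsub>M\<^esub>j \<in> {..<n}. (F j \<ominus>\<^bsub>SS_ring scale\<^esub> rt (c j)) \<odot>\<^bsub>M\<^esub> b j) \<in> ?N0"
    proof (rule SSM.finsum_submodule[OF N0])
      fix j assume "j \<in> {..<n}"
      then have j: "j < n" by simp
      have FS: "F j \<in> SS" "rt (c j) \<in> SS" using F rc j by auto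
      have mi: "\<ominus>\<^bsub>SS_ring scale\<^esub> rt (c j) = (\<lambda>p. - rt (c j) p)" by (rule SSM.R.minus_equality) (use FS in auto)
      have diff: "F j \<ominus>\<^bsub>SS_ring scale\<^esub> rt (c j) = (\<lambda>p. F j p - rt (c j) p)" unfolding a_minus_def mi by simp
      have "act (\<lambda>p. F j p - rt (c j) p) (b j) \<in> ?N0"
        unfolding sec_iff
      proof (intro conjI ballI impI)
        show "act (\<lambda>p. F j p - rt (c j) p) (b j) \<in> carrier M" using FS sec_carrier[OF bs[OF j]] by auto
        fix G assume G: "G \<in> SS" "\<forall>x \<in> A \<inter> {y. len y < i}. res x G = (\<lambda>_. 0)"
        have "act (\<lambda>p. G p * (F j p - rt (c j) p)) (b j) = \<zero>\<^bsub>M\<^esub>"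
          by (rule sec_vanish[OF bs[OF j]]) (use G FS in \<open>auto simp: c_def\<close>)
        then show "act G (act (\<lambda>p. F j p - rt (c j) p) (b j)) = \<zero>\<^bsub>M\<^esub>"
          using act_mult[of G "\<lambda>p. F j p - rt (c j) p" "b j"] G FS sec_carrier[OF bs[OF j]] by auto
      qed
      then show "(F j \<ominus>\<^bsub>SS_ring scale\<^esub> rt (c j)) \<odot>\<^bsub>M\<^esub> b j \<in> ?N0" unfolding diff act_def .
    qed simp
    then have d: "(\<Oplus>\<^bsub>M\<^esub>j \<in> {..<n}. F j \<odot>\<^bsub>M\<^esub> b j) \<ominus>\<^bsub>M\<^esub> (\<Oplus>\<^bsub>M\<^esub>j \<in> {..<n}. rt (c j) \<odot>\<^bsub>M\<^esub> b j) \<in> ?N0"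
      unfolding SSM.lc_diff[OF finite_lessThan F rc bc] .
    have "(\<Oplus>\<^bsub>M\<^esub>j \<in> {..<n}. F j \<odot>\<^bsub>M\<^esub> b j) \<in> ?N0 \<longleftrightarrow> (\<Oplus>\<^bsub>M\<^esub>j \<in> {..<n}. rt (c j) \<odot>\<^bsub>M\<^esub> b j) \<in> ?N0"
      by (rule SSM.mem_cancel[OF N0 _ _ d]) (use SSM.lc_closed[OF _ F bc] SSM.lc_closed[OF _ rc bc] in auto)
    also have "(\<Oplus>\<^bsub>M\<^esub>j \<in> {..<n}. rt (c j) \<odot>\<^bsub>M\<^esub> b j) = lc {..<n} c b" by (simp add: minus_N)
    also have "lc {..<n} c b \<in> ?N0 \<longleftrightarrow> (\<forall>j < n. c j = (\<lambda>_. 0))"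
    proof
      assume "lc {..<n} c b \<in> ?N0"
      then show "\<forall>j < n. c j = (\<lambda>_. 0)" using BD(6)[OF c] by auto
    next
      assume "\<forall>j < n. c j = (\<lambda>_. 0)"
      then have "lc {..<n} c b = \<zero>\<^bsub>M\<^esub>" using bc by (intro lc_zero) auto
      then show "lc {..<n} c b \<in> ?N0" by simp
    qed
    finally show "(\<Oplus>\<^bsub>M\<^esub>j \<in> {..<n}. F j \<odot>\<^bsub>M\<^esub> b j) \<in> ?N0 \<longleftrightarrow> (\<forall>j<n. res (xs j) (F j) = res (xs j) \<zero>\<^bsub>SS_ring scale\<^esub>)"
      by (simp add: c_def)
  qed
qed

text \<open>Representatives of bases of the successive subquotients together form a basis of M. An
  index is a pair of a rank and a position within that layer.\<close>

lemma tri_from_layers: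
  assumes B: "\<And>i. i < n \<Longrightarrow> N.rel_basis (sec {y. r y < i}) (sec {y. r y < Suc i}) (K i) (b i) (d i)"
    and lab: "\<And>i j. i < n \<Longrightarrow> j \<in> K i \<Longrightarrow> lab i j \<in> A \<and> r (lab i j) = i \<and> b i j \<in> sec (insert (lab i j) {y. r y < i})"
    and n: "\<And>x. x \<in> A \<Longrightarrow> r x < n"
  shows "tri r (Sigma {..<n} K) (\<lambda>(i, j). b i j) (\<lambda>(i, j). d i j) (\<lambda>(i, j). lab i j)"
proof -
  define J where "J = Sigma {..<n} K"
  define bb where "bb = (\<lambda>(i, j). b i j)"
  have fK: "finite (K i)" if "i < n" for i using N.rel_basisD(1)[OF B[OF that]] .
  have fJ: "finite J" unfolding J_def using fK by auto
  have bc: "bb p \<in> carrier M" if "p \<in> J" for p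
    using that lab sec_carrier by (auto simp: J_def bb_def)
  have sub: "lc J c' bb = lc (K i) c (b i)"
    if i: "i < n" and c': "c' \<in> J \<rightarrow> S" "\<And>p. p \<in> J \<Longrightarrow> p \<notin> Pair i ` K i \<Longrightarrow> c' p = (\<lambda>_. 0)" "\<And>j. j \<in> K i \<Longrightarrow> c' (i, j) = c j" for i c c'
  proof -
    have z: "lc {p \<in> J. \<not> p \<in> Pair i ` K i} c' bb = \<zero>\<^bsub>M\<^esub>" by (rule lc_zero) (use c' bc in auto)
    have e: "{p \<in> J. p \<in> Pair i ` K i} = Pair i ` K i" using i by (auto simp: J_def)
    have KJ: "Pair i ` K i \<subseteq> J" using i by (auto simp: J_def)
    have cl: "lc (Pair i ` K i) c' bb \<in> carrier M"
      by (rule lc_closed') (use fK[OF i] c'(1) KJ bc in auto)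
    have "lc J c' bb = lc {p \<in> J. p \<in> Pair i ` K i} c' bb \<oplus>\<^bsub>M\<^esub> lc {p \<in> J. \<not> p \<in> Pair i ` K i} c' bb"
      by (rule lc_split[OF fJ c'(1) bc])
    then have "lc J c' bb = lc (Pair i ` K i) c' bb" unfolding z e using cl by simp
    also have "\<dots> = (\<Oplus>\<^bsub>N\<^esub>j \<in> K i. c' (i, j) \<odot>\<^bsub>N\<^esub> bb (i, j))"
    proof (rule N.finsum_reindex)
      have "c' p \<odot>\<^bsub>N\<^esub> bb p \<in> carrier N" if "p \<in> Pair i ` K i" for p
      proof (rule N.smult_closed)
        have "p \<in> J" using that KJ by blast
        then show "c' p \<in> S" "bb p \<in> carrier N" using c'(1) bc[of p] by auto
      qed
      then show "(\<lambda>p. c' p \<odot>\<^bsub>N\<^esub> bb p) \<in> Pair i ` K i \<rightarrow> carrier N" by blast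
    qed (auto simp: inj_on_def)
    also have "\<dots> = lc (K i) c (b i)"
    proof (rule N.finsum_cong'[OF refl])
      have "c j \<odot>\<^bsub>N\<^esub> b i j \<in> carrier N" if j: "j \<in> K i" for j
      proof -
        have "(i, j) \<in> J" using j i by (auto simp: J_def)
        then have "c' (i, j) \<in> S" "b i j \<in> carrier N" using c'(1) bc[of "(i, j)"] by (blast, simp add: bb_def)
        then show ?thesis using N.smult_closed[of "c j" "b i j"] c'(3)[OF j] by metis
      qed
      then show "(\<lambda>j. c j \<odot>\<^bsub>N\<^esub> b i j) \<in> K i \<rightarrow> carrier N" by blast
    qed (use c' in \<open>auto simp: bb_def\<close>)
    finally show ?thesis .
  qed
  have span: "i \<le> n \<Longrightarrow> m \<in> sec {y. r y < i} \<Longrightarrow> \<exists>c \<in> J \<rightarrow> S. m = lc J c bb" for i m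
  proof (induction i arbitrary: m)
    case 0
    then have "m = \<zero>\<^bsub>M\<^esub>" using sec_none[of "{y. r y < 0}"] by auto
    then show ?case using lc_zero[of J "\<lambda>_ _. 0" bb] bc by (intro bexI[of _ "\<lambda>_ _. 0"]) auto
  next
    case (Suc i)
    have i: "i < n" using Suc.prems by simp
    obtain c where c: "c \<in> K i \<rightarrow> S" "m \<ominus>\<^bsub>N\<^esub> lc (K i) c (b i) \<in> sec {y. r y < i}"
      using N.rel_basisD(5)[OF B[OF i] Suc.prems(2)] by blast
    define c' where "c' p = (if p \<in> Pair i ` K i then c (snd p) else (\<lambda>_. 0))" for p
    have c': "c' \<in> J \<rightarrow> S" using c(1) by (auto simp: c'_def)
    have e: "lc J c' bb = lc (K i) c (b i)" by (rule sub[OF i c']) (auto simp: c'_def)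
    have "m \<ominus>\<^bsub>M\<^esub> lc J c' bb \<in> sec {y. r y < i}" using c(2) by (simp only: minus_N(1) e)
    from Suc.IH[OF _ this] i obtain c2 where c2: "c2 \<in> J \<rightarrow> S" "m \<ominus>\<^bsub>M\<^esub> lc J c' bb = lc J c2 bb" by auto
    have mc: "m \<in> carrier M" "lc J c' bb \<in> carrier M" using Suc.prems sec_carrier lc_closed'[OF fJ c' bc] by auto
    have "m = lc J c2 bb \<oplus>\<^bsub>N\<^esub> lc J c' bb" using SSM.diff_add_cancel[OF mc] c2(2) by simp
    also have "\<dots> = (\<Oplus>\<^bsub>N\<^esub>j \<in> J. (c2 j \<oplus>\<^bsub>S_ring scale\<^esub> c' j) \<odot>\<^bsub>N\<^esub> bb j)"
      by (rule N.lc_add[symmetric, OF fJ c2(1) c']) (use bc in auto)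
    finally show ?case using c2(1) c' by (intro bexI[of _ "\<lambda>j. c2 j \<oplus>\<^bsub>S_ring scale\<^esub> c' j"]) auto
  qed
  show ?thesis
    unfolding tri_def J_def[symmetric] bb_def[symmetric]
  proof (intro conjI ballI impI)
    show "finite J" by fact
    fix p assume p: "p \<in> J"
    then obtain i j where ij: "p = (i, j)" "i < n" "j \<in> K i" by (auto simp: J_def)
    show "(case p of (i, j) \<Rightarrow> lab i j) \<in> A" using lab[OF ij(2,3)] ij(1) by simp
    show "bb p \<in> part M (case p of (i, j) \<Rightarrow> d i j)"
      using N.rel_basisD(3)[OF B[OF ij(2)] ij(3)] by (simp add: bb_def ij(1))
    show "bb p \<in> sec (insert (case p of (i, j) \<Rightarrow> lab i j) {y. r y < r (case p of (i, j) \<Rightarrow> lab i j)})"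
      using lab[OF ij(2,3)] by (simp add: bb_def ij(1))
  next
    fix m assume "m \<in> carrier M"
    then have "m \<in> sec {y. r y < n}" using sec_all[of "{y. r y < n}"] n by auto
    then show "\<exists>c \<in> J \<rightarrow> S. m = lc J c bb" using span by blast
  next
    fix x c p assume x: "x \<in> A" and c: "c \<in> J \<rightarrow> S"
      and s: "lc {p \<in> J. (case p of (i, j) \<Rightarrow> lab i j) = x} c bb \<in> sec {y. r y < r x}"
      and p: "p \<in> J" "(case p of (i, j) \<Rightarrow> lab i j) = x"
    define i where "i = r x"
    have i: "i < n" using n x by (simp add: i_def)
    define L where "L = {p \<in> J. (case p of (i, j) \<Rightarrow> lab i j) = x}"
    have L: "\<exists>j. p = (i, j) \<and> j \<in> K i" if "p \<in> L" for p
      using that lab by (auto simp: L_def J_def i_def)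
    define c' where "c' p = (if p \<in> L then c p else (\<lambda>_. 0))" for p
    have c': "c' \<in> J \<rightarrow> S" using c by (auto simp: c'_def)
    have z: "lc {p \<in> J. \<not> p \<in> L} c' bb = \<zero>\<^bsub>M\<^esub>" by (rule lc_zero) (use bc in \<open>auto simp: c'_def\<close>)
    have e: "{p \<in> J. p \<in> L} = L" by (auto simp: L_def)
    have LJ: "L \<subseteq> J" "finite L" using fJ by (auto simp: L_def)
    have ec: "lc L c' bb = lc L c bb" by (rule N.finsum_cong') (use c bc LJ in \<open>auto simp: c'_def Pi_iff subset_iff\<close>)
    have cl: "lc L c bb \<in> carrier M" by (rule lc_closed'[OF LJ(2)]) (use c bc LJ in auto)
    have "lc J c' bb = lc {p \<in> J. p \<in> L} c' bb \<oplus>\<^bsub>M\<^esub> lc {p \<in> J. \<not> p \<in> L} c' bb"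
      by (rule lc_split[OF fJ c' bc])
    then have "lc J c' bb = lc L c bb" unfolding z e ec using cl by simp
    moreover have "lc J c' bb = lc (K i) (\<lambda>j. c' (i, j)) (b i)"
      by (rule sub[OF i c']) (use L in \<open>auto simp: c'_def\<close>)
    ultimately have "lc (K i) (\<lambda>j. c' (i, j)) (b i) \<in> sec {y. r y < i}" using s by (simp add: L_def i_def)
    moreover have "(\<lambda>j. c' (i, j)) \<in> K i \<rightarrow> S" using c' i by (auto simp: J_def)
    ultimately have "\<And>j. j \<in> K i \<Longrightarrow> c' (i, j) = (\<lambda>_. 0)" using N.rel_basisD(6)[OF B[OF i]] by blast
    moreover obtain j where j: "p = (i, j)" "j \<in> K i" using L[of p] p by (auto simp: L_def)
    ultimately have "c' p = (\<lambda>_. 0)" by blast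
    then show "c p = (\<lambda>_. 0)" using p by (simp add: c'_def L_def)
  qed
qed

end

text \<open>Where the two categories meet: a basis triangular for the length. The indices are pairs,
  as produced by \<open>tri_from_layers\<close>; fixing their type permits quantifying over such
  bases.\<close>

locale triangular_module = supported_module scale W I \<rho> \<alpha> M A
  for scale :: "'k::field \<Rightarrow> 'v::ab_group_add \<Rightarrow> 'v" and W :: "'w monoid" and I \<rho> \<alpha>
    and M :: "('v \<times> 'v \<Rightarrow> 'k, 'm) gmodule" and A +
  fixes J :: "(nat \<times> nat) set" and b d lab
  assumes triangular: "tri (cox_length W I) J b d lab"
begin

text \<open>Elements with shorter labels vanish modulo the smaller layer. Independence across all
  labels of length i is \<open>tri_independent\<close> for the set of points of that length.\<close>

lemma layer_rel_basis:
  "N.rel_basis (sec {y. len y < i}) (sec {y. len y < Suc i}) {j \<in> J. len (lab j) = i} b d"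
proof -
  note tD = triD[OF triangular]
  let ?K = "{j \<in> J. len (lab j) = i}"
  have fK: "finite ?K" using tD(1) by simp
  have bc: "\<And>j. j \<in> ?K \<Longrightarrow> b j \<in> carrier M" using tD(5) by simp
  show ?thesis
    unfolding N.rel_basis_def
  proof (intro conjI ballI impI)
    show "finite ?K" by fact
    fix j assume j: "j \<in> ?K"
    show "b j \<in> part N (d j)" using tD(3) j by simp
    have "b j \<in> sec (insert (lab j) {y. len y < len (lab j)})" using tD(4)[of j] j by simp
    then show "b j \<in> sec {y. len y < Suc i}" by (rule sec_mono[rotated]) (use j in auto)
  next
    fix m assume m: "m \<in> sec {y. len y < Suc i}"
    obtain c where c: "c \<in> J \<rightarrow> S" "m = lc {j \<in> J. lab j \<in> {y. len y < Suc i}} c b"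
      using tri_span_sec[OF triangular _ m] by auto
    define L where "L = {j \<in> J. lab j \<in> {y. len y < Suc i}}"
    have L: "finite L" "c \<in> L \<rightarrow> S" "\<And>j. j \<in> L \<Longrightarrow> b j \<in> carrier M" using tD(1,5) c(1) by (auto simp: L_def)
    define L' where "L' = {j \<in> L. \<not> len (lab j) = i}"
    have e: "{j \<in> L. len (lab j) = i} = ?K" by (auto simp: L_def)
    have "lc L c b = lc {j \<in> L. len (lab j) = i} c b \<oplus>\<^bsub>M\<^esub> lc L' c b"
      unfolding L'_def by (rule lc_split[OF L])
    then have ms: "m = lc ?K c b \<oplus>\<^bsub>M\<^esub> lc L' c b" unfolding e using c(2) by (simp add: L_def)
    have L'f: "finite L'" "c \<in> L' \<rightarrow> S" "\<And>j. j \<in> L' \<Longrightarrow> b j \<in> carrier M" using L by (auto simp: L'_def)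
    have cK: "c \<in> ?K \<rightarrow> S" using c(1) by auto
    have "lc L' c b \<in> sec {y. len y < i}"
    proof (rule lc_sec[OF L'f(1,2)])
      fix j assume "j \<in> L'"
      then have j: "j \<in> J" "len (lab j) < i" by (auto simp: L'_def L_def)
      show "b j \<in> sec {y. len y < i}" by (rule sec_mono[OF _ tD(4)[OF j(1)]]) (use j in auto)
    qed
    moreover have "m \<ominus>\<^bsub>M\<^esub> lc ?K c b = lc L' c b"
      unfolding ms by (rule add_diff_cancel[OF lc_closed'[OF fK cK bc] lc_closed'[OF L'f]])
    ultimately show "\<exists>c \<in> ?K \<rightarrow> S. m \<ominus>\<^bsub>N\<^esub> lc ?K c b \<in> sec {y. len y < i}"
      using cK unfolding minus_N by (intro bexI[of _ c]) simp_all
  next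
    fix c j assume c: "c \<in> ?K \<rightarrow> S" "lc ?K c b \<in> sec {y. len y < i}" and j: "j \<in> ?K"
    define c' where "c' j = (if j \<in> ?K then c j else (\<lambda>_. 0))" for j
    have c': "c' \<in> J \<rightarrow> S" using c(1) by (auto simp: c'_def)
    define Om where "Om = {x \<in> A. len x = i}"
    have e: "{j \<in> J. lab j \<in> Om} = ?K" using tD(2) by (auto simp: Om_def)
    have "lc ?K c' b = lc ?K c b" by (rule N.finsum_cong') (use c bc in \<open>auto simp: c'_def Pi_iff\<close>)
    then have "lc {j \<in> J. lab j \<in> Om} c' b \<in> sec {y. len y < i}" unfolding e using c(2) by metis
    then have "lc {j \<in> J. lab j \<in> Om} c' b \<in> sec (- Om)"
      by (rule sec_mono[rotated]) (auto simp: Om_def)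
    then have "c' j = (\<lambda>_. 0)"
      using tri_independent[OF triangular c', of Om j] j tD(2) by (auto simp: Om_def)
    then show "c j = \<zero>\<^bsub>S_ring scale\<^esub>" using j by (simp add: c'_def)
  qed
qed

lemma F_nabla_object: "M \<in> F_nabla_objects scale W I \<rho>"
  unfolding F_nabla_objects_def
proof (intro CollectI conjI allI)
  note tD = triD[OF triangular]
  show "graded_module (SS_ring scale) M" by (rule SS_graded)
  have "supported_sections scale W \<rho> M A = carrier M"
    using supported_sections_eq_sec[OF A(2)] sec_all[of A] by simp
  then show "\<exists>A. finite A \<and> A \<subseteq> carrier W \<and> supported_sections scale W \<rho> M A = carrier M"
    using A by blast
  fix i
  have L: "sections_le scale W I \<rho> M i = sec {y. len y < Suc i}" for i
  proof -
    have "sections_le scale W I \<rho> M i = sec {x \<in> carrier W. len x \<le> i}"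
      unfolding sections_le_def by (rule supported_sections_eq_sec) auto
    also have "\<dots> = sec {y. len y < Suc i}"
      by (rule subset_antisym; rule subsetI; erule sec_mono[rotated]; use A(2) in auto)
    finally show ?thesis .
  qed
  \<comment> \<open>For i = 0 no length is smaller, and both sides are the zero submodule.\<close>
  have Q: "(case i of 0 \<Rightarrow> {\<zero>\<^bsub>M\<^esub>} | Suc j \<Rightarrow> sections_le scale W I \<rho> M j) = sec {y. len y < i}"
    using sec_none[of "{y. len y < 0}"] L by (cases i) auto
  have fK: "finite {j \<in> J. len (lab j) = i}" using tD(1) by simp
  define n where "n = card {j \<in> J. len (lab j) = i}"
  obtain h where h: "bij_betw h {..<n} {j \<in> J. len (lab j) = i}"
    using ex_bij_betw_nat_finite[OF fK] unfolding n_def atLeast0LessThan by blast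
  have hJ: "h j \<in> J" "len (lab (h j)) = i" if "j < n" for j
    using h that unfolding bij_betw_def by auto
  have "N.rel_basis (sec {y. len y < i}) (sec {y. len y < Suc i}) {..<n} (\<lambda>j. b (h j)) (\<lambda>j. d (h j))"
    by (rule N.rel_basis_reindex[OF layer_rel_basis h])
  moreover have "b (h j) \<in> sec (insert (lab (h j)) {y. len y < i})" if "j < n" for j
    using tD(4)[OF hJ(1)[OF that]] hJ(2)[OF that] by simp
  ultimately have "SSM.presentation (sec {y. len y < i}) (sec {y. len y < Suc i}) n (\<lambda>j. b (h j)) (\<lambda>j. - d (h j)) (\<lambda>j. gr (lab (h j)))"
    using presentation_iff_rel_basis[of n "\<lambda>j. lab (h j)" i "\<lambda>j. b (h j)" "\<lambda>j. - d (h j)"] hJ tD(2) by simp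
  moreover have sub: "sec {y. len y < i} \<subseteq> sec {y. len y < Suc i}"
    by (rule subsetI, erule sec_mono[rotated]) auto
  ultimately have "gmod_iso (SS_ring scale) (layer scale W I \<rho> M i)
          (gdirect_sum {..<n} (\<lambda>j. gshift (graph_bimodule scale W \<rho> (lab (h j))) (- d (h j))))"
    unfolding layer_def Q unfolding L layer_iso_iff[OF SS_graded sec_submodule_SS sec_submodule_SS sub] by blast
  moreover have "\<forall>j<n. lab (h j) \<in> carrier W \<and> len (lab (h j)) = i"
    using tD(2)[OF hJ(1)] A(2) hJ(2) by (auto 0 3)
  ultimately show "\<exists>(n::nat) xs ks. (\<forall>j < n. xs j \<in> carrier W \<and> len (xs j) = i) \<and>
        gmod_iso (SS_ring scale) (layer scale W I \<rho> M i)
          (gdirect_sum {..<n} (\<lambda>j. gshift (graph_bimodule scale W \<rho> (xs j)) (ks j)))"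
    by (intro exI[of _ n] exI[of _ "\<lambda>j. lab (h j)"] exI[of _ "\<lambda>j. - d (h j)"] conjI)
qed

end

context coxeter_representation
begin

text \<open>The definition of F_nabla speaks only of supports and layers. Torsion freeness and
  annihilation by functions vanishing on the graphs are carried up through the layers; then
  \<open>sec\<close> is available and the layers become a triangular basis.\<close>

lemma F_nabla_object_triangular:
  fixes M :: "('v \<times> 'v \<Rightarrow> 'k, 'm) gmodule"
  assumes M: "M \<in> F_nabla_objects scale W I \<rho>"
  shows "\<exists>A J b d lab. triangular_module scale W I \<rho> \<alpha> M A J b d lab"
proof -
  have gM: "graded_module (SS_ring scale) M" using M by (simp add: F_nabla_objects_def)
  interpret M: graded_mod "SS_ring scale" M using gM SSp_SS by unfold_locales auto
  obtain A0 where A0: "finite A0" "A0 \<subseteq> carrier W" "supported_sections scale W \<rho> M A0 = carrier M"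
    using M by (auto simp: F_nabla_objects_def)
  define L where "L i = sections_le scale W I \<rho> M i" for i
  define Q where "Q i = (case i of 0 \<Rightarrow> {\<zero>\<^bsub>M\<^esub>} | Suc j \<Rightarrow> L j)" for i
  have QS [simp]: "Q 0 = {\<zero>\<^bsub>M\<^esub>}" "Q (Suc i) = L i" for i by (simp_all add: Q_def)
  have Lsub: "submodule (L i) (SS_ring scale) M" for i
    unfolding L_def sections_le_def by (rule supported_sections_submodule[OF M.module_axioms])
  have Qsub: "submodule (Q i) (SS_ring scale) M" for i
  proof (cases i)
    case 0
    show ?thesis unfolding 0 QS by (rule M.submoduleI) auto
  qed (simp add: Lsub)
  have QL: "Q i \<subseteq> L i" for i
  proof (cases i)
    case 0
    then show ?thesis using M.submodule_facts(2)[OF Lsub] by simp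
  next
    case (Suc j)
    then show ?thesis unfolding QS Suc L_def sections_le_def by (simp add: supported_sections_mono Collect_mono_iff)
  qed
  have "\<exists>n xs k b. (\<forall>j < n. xs j \<in> carrier W \<and> len (xs j) = i) \<and> M.presentation (Q i) (L i) n b k (\<lambda>j. gr (xs j))" for i
  proof -
    obtain n xs k where x: "\<forall>j < (n::nat). xs j \<in> carrier W \<and> len (xs j) = i"
      "gmod_iso (SS_ring scale) (layer scale W I \<rho> M i)
          (gdirect_sum {..<n} (\<lambda>j. gshift (graph_bimodule scale W \<rho> (xs j)) (k j)))"
      using M unfolding F_nabla_objects_def by blast
    have "layer scale W I \<rho> M i = gquot (gsub M (L i)) (Q i)" by (cases i) (simp_all add: layer_def L_def Q_def)
    then have "\<exists>b. M.presentation (Q i) (L i) n b k (\<lambda>j. gr (xs j))"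
      using x(2) layer_iso_iff[OF gM Qsub Lsub QL] by simp
    then show ?thesis using x(1) by blast
  qed
  then obtain n xs k b where xs: "\<And>i j. j < n i \<Longrightarrow> xs i j \<in> carrier W \<and> len (xs i j) = i"
    and pr: "\<And>i. M.presentation (Q i) (L i) (n i) (b i) (k i) (\<lambda>j. gr (xs i j))" by metis
  have pb: "\<And>i j. j < n i \<Longrightarrow> b i j \<in> L i"
    and pspan: "\<And>i m. m \<in> L i \<Longrightarrow> \<exists>F \<in> {..<n i} \<rightarrow> SS. m \<ominus>\<^bsub>M\<^esub> (\<Oplus>\<^bsub>M\<^esub>j \<in> {..<n i}. F j \<odot>\<^bsub>M\<^esub> b i j) \<in> Q i"
    and pind: "\<And>i F. F \<in> {..<n i} \<rightarrow> SS \<Longrightarrow> (\<Oplus>\<^bsub>M\<^esub>j \<in> {..<n i}. F j \<odot>\<^bsub>M\<^esub> b i j) \<in> Q i \<longleftrightarrow> (\<forall>j < n i. res (xs i j) (F j) = (\<lambda>_. 0))"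
    using pr unfolding M.presentation_def gr_eq_iff by auto
  have bc: "b i \<in> {..<n i} \<rightarrow> carrier M" for i using pb M.submodule_facts(1)[OF Lsub] by auto
  have LM: "m \<in> carrier M" if "m \<in> L i" for m i using that M.submodule_facts(1)[OF Lsub] by blast
  have QM: "m \<in> carrier M" if "m \<in> Q i" for m i using that M.submodule_facts(1)[OF Qsub] by blast
  \<comment> \<open>The points occurring in layer i. Their union up to the maximal length in the
    given support will serve as the set A.\<close>
  define X where "X i = xs i ` {..<n i}" for i
  have X: "finite (X i)" "X i \<subseteq> carrier W" "\<And>x. x \<in> X i \<Longrightarrow> len x = i" for i using xs by (auto simp: X_def)
  \<comment> \<open>Modulo the previous layer, the coefficients in layer i are seen only on the
    graphs over \<open>X i\<close>, where H vanishes.\<close>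
  have step: "H \<odot>\<^bsub>M\<^esub> m \<in> Q i" if H: "H \<in> SS" "\<And>x. x \<in> X i \<Longrightarrow> res x H = (\<lambda>_. 0)" and m: "m \<in> L i" for H m i
  proof -
    obtain F where F: "F \<in> {..<n i} \<rightarrow> SS" "m \<ominus>\<^bsub>M\<^esub> (\<Oplus>\<^bsub>M\<^esub>j \<in> {..<n i}. F j \<odot>\<^bsub>M\<^esub> b i j) \<in> Q i" using pspan[OF m] by blast
    let ?l = "\<Oplus>\<^bsub>M\<^esub>j \<in> {..<n i}. F j \<odot>\<^bsub>M\<^esub> b i j"
    have l: "?l \<in> carrier M" by (rule M.lc_closed[OF _ F(1) bc]) simp
    have HF: "(\<lambda>j. H \<otimes>\<^bsub>SS_ring scale\<^esub> F j) \<in> {..<n i} \<rightarrow> SS" using H(1) F(1) by (auto simp: Pi_iff)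
    have "(\<Oplus>\<^bsub>M\<^esub>j \<in> {..<n i}. (H \<otimes>\<^bsub>SS_ring scale\<^esub> F j) \<odot>\<^bsub>M\<^esub> b i j) \<in> Q i"
      unfolding pind[OF HF] using H(2) by (auto simp: X_def)
    moreover have "(\<Oplus>\<^bsub>M\<^esub>j \<in> {..<n i}. (H \<otimes>\<^bsub>SS_ring scale\<^esub> F j) \<odot>\<^bsub>M\<^esub> b i j) = H \<odot>\<^bsub>M\<^esub> ?l"
      by (rule M.lc_smult[OF _ F(1) H(1) bc]) simp
    ultimately have "H \<odot>\<^bsub>M\<^esub> ?l \<in> Q i" by (simp only:)
    moreover have "H \<odot>\<^bsub>M\<^esub> m \<ominus>\<^bsub>M\<^esub> H \<odot>\<^bsub>M\<^esub> ?l \<in> Q i"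
      using M.submodule_facts(6)[OF Qsub H(1) F(2)] M.smult_diff[OF H(1) LM[OF m] l] by simp
    ultimately show ?thesis
      using M.mem_cancel[OF Qsub M.smult_closed[OF H(1) LM[OF m]] M.smult_closed[OF H(1) l]] by blast
  qed
  \<comment> \<open>Each layer is a sum of copies of the domain S, so a nonzero scalar killing m
    forces m one layer down.\<close>
  have tf: "\<And>m. m \<in> Q i \<Longrightarrow> rt s \<odot>\<^bsub>M\<^esub> m = \<zero>\<^bsub>M\<^esub> \<Longrightarrow> m = \<zero>\<^bsub>M\<^esub>" if s: "s \<in> S" "s \<noteq> (\<lambda>_. 0)" for s i
  proof (induction i)
    case (Suc i m)
    have m: "m \<in> L i" using Suc.prems by simp
    have rs: "rt s \<in> SS" using s by simp
    obtain F where F: "F \<in> {..<n i} \<rightarrow> SS" "m \<ominus>\<^bsub>M\<^esub> (\<Oplus>\<^bsub>M\<^esub>j \<in> {..<n i}. F j \<odot>\<^bsub>M\<^esub> b i j) \<in> Q i" using pspan[OF m] by blast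
    let ?l = "\<Oplus>\<^bsub>M\<^esub>j \<in> {..<n i}. F j \<odot>\<^bsub>M\<^esub> b i j"
    have l: "?l \<in> carrier M" by (rule M.lc_closed[OF _ F(1) bc]) simp
    have HF: "(\<lambda>j. rt s \<otimes>\<^bsub>SS_ring scale\<^esub> F j) \<in> {..<n i} \<rightarrow> SS" using rs F(1) by (auto simp: Pi_iff)
    have "rt s \<odot>\<^bsub>M\<^esub> m \<ominus>\<^bsub>M\<^esub> rt s \<odot>\<^bsub>M\<^esub> ?l \<in> Q i"
      using M.submodule_facts(6)[OF Qsub rs F(2)] M.smult_diff[OF rs LM[OF m] l] by simp
    then have "rt s \<odot>\<^bsub>M\<^esub> ?l \<in> Q i"
      using M.mem_cancel[OF Qsub M.smult_closed[OF rs LM[OF m]] M.smult_closed[OF rs l]] Suc.prems(2)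
        M.submodule_facts(2)[OF Qsub] by simp
    moreover have "(\<Oplus>\<^bsub>M\<^esub>j \<in> {..<n i}. (rt s \<otimes>\<^bsub>SS_ring scale\<^esub> F j) \<odot>\<^bsub>M\<^esub> b i j) = rt s \<odot>\<^bsub>M\<^esub> ?l"
      by (rule M.lc_smult[OF _ F(1) rs bc]) simp
    ultimately have "(\<Oplus>\<^bsub>M\<^esub>j \<in> {..<n i}. (rt s \<otimes>\<^bsub>SS_ring scale\<^esub> F j) \<odot>\<^bsub>M\<^esub> b i j) \<in> Q i" by (simp only:)
    then have z: "\<forall>j < n i. (\<lambda>v. s v * res (xs i j) (F j) v) = (\<lambda>_. 0)" unfolding pind[OF HF] by simp
    have "\<forall>j < n i. res (xs i j) (F j) = (\<lambda>_. 0)"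
    proof (intro allI impI)
      fix j assume j: "j < n i"
      have "res (xs i j) (F j) \<in> S" using F(1) xs[OF j] j by (intro res_S) auto
      then show "res (xs i j) (F j) = (\<lambda>_. 0)" using S_domain[OF s(1)] z j s(2) by blast
    qed
    then have "?l \<in> Q i" unfolding pind[OF F(1)] .
    then have "m \<in> Q i" using M.mem_cancel[OF Qsub LM[OF m] l F(2)] by blast
    then show ?case using Suc.IH Suc.prems(2) by blast
  qed simp
  have kill: "\<And>F m. F \<in> SS \<Longrightarrow> (\<And>x. x \<in> (\<Union>i' < i. X i') \<Longrightarrow> res x F = (\<lambda>_. 0)) \<Longrightarrow> m \<in> Q i \<Longrightarrow> F \<odot>\<^bsub>M\<^esub> m = \<zero>\<^bsub>M\<^esub>" for i
  proof (induction i)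
    case (Suc i F m)
    have m: "m \<in> L i" "m \<in> carrier M" using Suc.prems(3) LM by auto
    define Y where "Y = (\<Union>i' < Suc i. X i')"
    have Y: "finite Y" "Y \<subseteq> carrier W" using X by (auto simp: Y_def)
    \<comment> \<open>Going down the layers would only show that F acts nilpotently. The function G,
      equal to D on the graphs of length i and 0 on the shorter ones, separates the layers: G - D
      lowers m, so F kills (G - D) m, and F lowers m, so G kills F m. Together D F m = 0.\<close>
    define z where "z x = (if len x = i then (\<lambda>_. 1) else (\<lambda>_. 0) :: 'v \<Rightarrow> 'k)" for x
    have zS: "z x \<in> S" for x by (simp add: z_def)
    obtain D e G where G: "linprod D" "G \<in> SS" "\<forall>x \<in> Y. res x G = (\<lambda>v. D v * z x v)"
      using interpolation[OF Y, of z] zS by blast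
    have DS: "D \<in> S" "D \<noteq> (\<lambda>_. 0)" using linprod_S linprod_nonzero G(1) by auto
    have Gi: "res x G = D" if "x \<in> X i" for x
    proof -
      have "x \<in> Y" using that by (auto simp: Y_def)
      then have "res x G = (\<lambda>v. D v * z x v)" using G(3) by blast
      then show ?thesis using X(3)[OF that] by (simp add: z_def)
    qed
    have Gl: "res x G = (\<lambda>_. 0)" if "x \<in> (\<Union>i' < i. X i')" for x
    proof -
      from that obtain i' where i': "i' < i" "x \<in> X i'" by blast
      then have "x \<in> Y" by (auto simp: Y_def)
      then have "res x G = (\<lambda>v. D v * z x v)" using G(3) by blast
      then show ?thesis using X(3)[OF i'(2)] i'(1) by (simp add: z_def)
    qed
    define H where "H = (\<lambda>p. G p - rt D p)"
    have H: "H \<in> SS" unfolding H_def using G DS by auto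
    have Fl: "res x F = (\<lambda>_. 0)" if "x \<in> (\<Union>i' < i. X i')" for x
    proof (rule Suc.prems(2))
      show "x \<in> (\<Union>i' < Suc i. X i')" using that by (meson UN_iff lessThan_iff less_SucI)
    qed
    have FH: "F \<odot>\<^bsub>M\<^esub> (H \<odot>\<^bsub>M\<^esub> m) = \<zero>\<^bsub>M\<^esub>"
    proof (rule Suc.IH[OF Suc.prems(1) Fl])
      show "H \<odot>\<^bsub>M\<^esub> m \<in> Q i" by (rule step[OF H _ m(1)]) (simp add: H_def Gi)
    qed
    have GF: "G \<odot>\<^bsub>M\<^esub> (F \<odot>\<^bsub>M\<^esub> m) = \<zero>\<^bsub>M\<^esub>"
    proof (rule Suc.IH[OF G(2) Gl])
      show "F \<odot>\<^bsub>M\<^esub> m \<in> Q i" by (rule step[OF Suc.prems(1) _ m(1)]) (use Suc.prems(2) in auto)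
    qed
    have rD: "rt D \<in> SS" using DS by simp
    have comm: "F' \<odot>\<^bsub>M\<^esub> (G' \<odot>\<^bsub>M\<^esub> m) = G' \<odot>\<^bsub>M\<^esub> (F' \<odot>\<^bsub>M\<^esub> m)" if "F' \<in> SS" "G' \<in> SS" for F' G'
      using M.smult_assoc1[OF that m(2)] M.smult_assoc1[OF that(2,1) m(2)] M.R.m_comm[OF that] by simp
    have "G = (\<lambda>p. H p + rt D p)" by (simp add: H_def)
    then have "G \<odot>\<^bsub>M\<^esub> m = H \<odot>\<^bsub>M\<^esub> m \<oplus>\<^bsub>M\<^esub> rt D \<odot>\<^bsub>M\<^esub> m" using M.smult_l_distr[OF H rD m(2)] by simp
    then have "F \<odot>\<^bsub>M\<^esub> (G \<odot>\<^bsub>M\<^esub> m) = F \<odot>\<^bsub>M\<^esub> (H \<odot>\<^bsub>M\<^esub> m) \<oplus>\<^bsub>M\<^esub> F \<odot>\<^bsub>M\<^esub> (rt D \<odot>\<^bsub>M\<^esub> m)"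
      using M.smult_r_distr[OF Suc.prems(1) M.smult_closed[OF H m(2)] M.smult_closed[OF rD m(2)]] by simp
    then have "F \<odot>\<^bsub>M\<^esub> (rt D \<odot>\<^bsub>M\<^esub> m) = \<zero>\<^bsub>M\<^esub>"
      using FH GF comm[OF Suc.prems(1) G(2)] M.smult_closed[OF Suc.prems(1) M.smult_closed[OF rD m(2)]] by simp
    then have "rt D \<odot>\<^bsub>M\<^esub> (F \<odot>\<^bsub>M\<^esub> m) = \<zero>\<^bsub>M\<^esub>" using comm[OF Suc.prems(1) rD] by simp
    moreover have "F \<odot>\<^bsub>M\<^esub> m \<in> Q (Suc i)" using M.submodule_facts(6)[OF Qsub Suc.prems(1,3)] .
    ultimately show ?case using tf[OF DS] by blast
  qed simp
  obtain n0 where n0: "\<And>x. x \<in> A0 \<Longrightarrow> len x \<le> n0"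
  proof -
    have "\<forall>x \<in> A0. len x \<le> Max (len ` A0)" using A0(1) by simp
    then show ?thesis using that by blast
  qed
  have full: "Q (Suc n0) = carrier M"
  proof -
    have "A0 \<subseteq> {x \<in> carrier W. len x \<le> n0}" using A0(2) n0 by auto
    then have "carrier M \<subseteq> L n0" unfolding L_def sections_le_def A0(3)[symmetric] by (rule supported_sections_mono)
    then show ?thesis using M.submodule_facts(1)[OF Lsub] by auto
  qed
  define A where "A = (\<Union>i < Suc n0. X i)"
  have "supported_module scale W I \<rho> \<alpha> M A"
  proof unfold_locales
    show "graded_module (SS_ring scale) M" by fact
    show "finite A" "A \<subseteq> carrier W" using X by (auto simp: A_def)
    show "s = (\<lambda>_. 0) \<or> m = \<zero>\<^bsub>M\<^esub>" if "s \<in> S" "m \<in> carrier M" "rt s \<odot>\<^bsub>M\<^esub> m = \<zero>\<^bsub>M\<^esub>" for s m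
      using tf[OF that(1), of m "Suc n0"] that full by blast
    show "F \<odot>\<^bsub>M\<^esub> m = \<zero>\<^bsub>M\<^esub>" if "F \<in> SS" "\<And>x. x \<in> A \<Longrightarrow> res x F = (\<lambda>_. 0)" "m \<in> carrier M" for F m
      by (rule kill[of F "Suc n0"]) (use that full in \<open>auto simp: A_def\<close>)
  qed
  then interpret SM: supported_module scale W I \<rho> \<alpha> M A .
  have Ls: "L i = SM.sec {y. len y < Suc i}" for i
  proof -
    have "L i = SM.sec {x \<in> carrier W. len x \<le> i}"
      unfolding L_def sections_le_def by (rule SM.supported_sections_eq_sec) auto
    also have "\<dots> = SM.sec {y. len y < Suc i}"
      by (rule subset_antisym; rule subsetI; erule SM.sec_mono[rotated]; use SM.A(2) in auto)
    finally show ?thesis .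
  qed
  have Qs: "Q i = SM.sec {y. len y < i}" for i
    using SM.sec_none[of "{y. len y < 0}"] Ls by (cases i) auto
  have rb: "SM.N.rel_basis (SM.sec {y. len y < i}) (SM.sec {y. len y < Suc i}) {..<n i} (b i) (\<lambda>j. - k i j) \<and>
    (\<forall>j < n i. b i j \<in> SM.sec (insert (xs i j) {y. len y < i}))" if i: "i < Suc n0" for i
  proof -
    have "\<And>j. j < n i \<Longrightarrow> xs i j \<in> A \<and> len (xs i j) = i" using xs i by (auto simp: A_def X_def)
    then show ?thesis using SM.presentation_iff_rel_basis[of "n i" "xs i" i "b i" "k i"] pr[of i] unfolding Ls Qs by blast
  qed
  have "SM.tri len (Sigma {..<Suc n0} (\<lambda>i. {..<n i})) (\<lambda>(i, j). b i j) (\<lambda>(i, j). - k i j) (\<lambda>(i, j). xs i j)"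
  proof (rule SM.tri_from_layers)
    show "SM.N.rel_basis (SM.sec {y. len y < i}) (SM.sec {y. len y < Suc i}) {..<n i} (b i) (\<lambda>j. - k i j)"
      if "i < Suc n0" for i using rb[OF that] by blast
    show "xs i j \<in> A \<and> len (xs i j) = i \<and> b i j \<in> SM.sec (insert (xs i j) {y. len y < i})"
      if "i < Suc n0" "j \<in> {..<n i}" for i j
      using rb[OF that(1)] xs[of j i] that by (auto simp: A_def X_def)
    show "len x < Suc n0" if "x \<in> A" for x using that X(3) by (auto simp: A_def)
  qed
  then have "triangular_module scale W I \<rho> \<alpha> M A (Sigma {..<Suc n0} (\<lambda>i. {..<n i})) (\<lambda>(i, j). b i j) (\<lambda>(i, j). - k i j) (\<lambda>(i, j). xs i j)"
    by unfold_locales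
  then show ?thesis by blast
qed

end

section \<open>The algebra \<open>Z\<close> and the category \<open>\<V>(\<Lambda>)\<close>\<close>

lemma restrict_eq_iff: "restrict f B = restrict g B \<longleftrightarrow> (\<forall>x \<in> B. f x = g x)"
  by (auto simp: restrict_def fun_eq_iff)

text \<open>Sums of fractions are defined as unions over all representatives; the union collapses
  once every member is the same class.\<close>

lemma UN_pairs_const:
  assumes "X \<noteq> {}" "Y \<noteq> {}" "\<And>a b c d. (a, b) \<in> X \<Longrightarrow> (c, d) \<in> Y \<Longrightarrow> f a b c d = C"
  shows "(\<Union>(a, b) \<in> X. \<Union>(c, d) \<in> Y. f a b c d) = C"
proof -
  have "(\<Union>(c, d) \<in> Y. f a b c d) = C" if "(a, b) \<in> X" for a b
  proof -
    have "\<forall>p \<in> Y. (case p of (c, d) \<Rightarrow> f a b c d) = C" using assms(3) that by auto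
    then show ?thesis using assms(2) by simp
  qed
  then have "(case p of (a, b) \<Rightarrow> \<Union>(c, d) \<in> Y. f a b c d) = C" if "p \<in> X" for p
    using that by (cases p) simp
  then show ?thesis using assms(1) by simp
qed

context coxeter_representation
begin

abbreviation Zr where "Zr \<equiv> Z_ring scale W I \<alpha>"
abbreviation Zc where "Zc \<equiv> carrier (Z_ring scale W I \<alpha>)"
abbreviation cf where "cf \<equiv> const_family W"

section \<open>The ring Z and its map from S tensor S\<close>

lemma Sdvd_add: "Sdvd l f \<Longrightarrow> Sdvd l g \<Longrightarrow> Sdvd l (\<lambda>v. f v + g v)"
proof -
  assume "Sdvd l f" "Sdvd l g"
  then obtain h k where "h \<in> S" "k \<in> S" "f = (\<lambda>v. l v * h v)" "g = (\<lambda>v. l v * k v)" by (auto simp: Sdvd_def)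
  then show ?thesis unfolding Sdvd_def by (intro bexI[of _ "\<lambda>v. h v + k v"]) (auto simp: algebra_simps)
qed

lemma Sdvd_mult: "Sdvd l f \<Longrightarrow> g \<in> S \<Longrightarrow> Sdvd l (\<lambda>v. g v * f v)"
proof -
  assume "Sdvd l f" and g: "g \<in> S"
  then obtain h where "h \<in> S" "f = (\<lambda>v. l v * h v)" by (auto simp: Sdvd_def)
  then show ?thesis using g unfolding Sdvd_def by (intro bexI[of _ "\<lambda>v. g v * h v"]) (auto simp: algebra_simps)
qed

lemma Z_simps:
  "carrier Zr = {z \<in> carrier W \<rightarrow>\<^sub>E S. \<forall>w \<in> carrier W. \<forall>t \<in> T. \<exists>h \<in> S. z w = (\<lambda>v. z (t \<otimes>\<^bsub>W\<^esub> w) v + \<alpha> t v * h v)}"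
  "monoid.mult Zr = (\<lambda>y z. \<lambda>w \<in> carrier W. \<lambda>v. y w v * z w v)" "monoid.one Zr = cf (\<lambda>_. 1)"
  "ring.zero Zr = cf (\<lambda>_. 0)" "ring.add Zr = (\<lambda>y z. \<lambda>w \<in> carrier W. \<lambda>v. y w v + z w v)"
  "rpart Zr = (\<lambda>n. {z \<in> carrier Zr. \<forall>w \<in> carrier W. z w \<in> Sp n})"
  by (simp_all add: Z_ring_def Let_def const_family_def)

lemma Z_iff: "z \<in> Zc \<longleftrightarrow> z \<in> extensional (carrier W) \<and> (\<forall>w \<in> carrier W. z w \<in> S) \<and>
    (\<forall>w \<in> carrier W. \<forall>t \<in> T. Sdvd (\<alpha> t) (\<lambda>v. z w v - z (t \<otimes>\<^bsub>W\<^esub> w) v))"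
proof -
  have "(\<exists>h \<in> S. z w = (\<lambda>v. z (t \<otimes>\<^bsub>W\<^esub> w) v + \<alpha> t v * h v)) \<longleftrightarrow> Sdvd (\<alpha> t) (\<lambda>v. z w v - z (t \<otimes>\<^bsub>W\<^esub> w) v)" for w t
    unfolding Sdvd_def fun_eq_iff by (simp add: diff_eq_eq add.commute)
  then show ?thesis unfolding Z_simps by (auto simp: PiE_iff)
qed

lemma Z_S: "z \<in> Zc \<Longrightarrow> w \<in> carrier W \<Longrightarrow> z w \<in> S"
  and Z_dvd: "z \<in> Zc \<Longrightarrow> w \<in> carrier W \<Longrightarrow> t \<in> T \<Longrightarrow> Sdvd (\<alpha> t) (\<lambda>v. z w v - z (t \<otimes>\<^bsub>W\<^esub> w) v)"
  by (simp_all add: Z_iff)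

lemma Z_eqI: "y \<in> Zc \<Longrightarrow> z \<in> Zc \<Longrightarrow> (\<And>w. w \<in> carrier W \<Longrightarrow> y w = z w) \<Longrightarrow> y = z"
  unfolding Z_iff by (meson extensionalityI)

lemma cf_Z [simp, intro]: "s \<in> S \<Longrightarrow> cf s \<in> Zc"
  using W.m_closed T_carrier by (auto simp: Z_iff const_family_def Sdvd_zero)

lemma cf_app [simp]: "w \<in> carrier W \<Longrightarrow> cf s w = s"
  by (simp add: const_family_def)

lemma Z_add_closed: "y \<in> Zc \<Longrightarrow> z \<in> Zc \<Longrightarrow> y \<oplus>\<^bsub>Zr\<^esub> z \<in> Zc"
proof -
  assume y: "y \<in> Zc" and z: "z \<in> Zc"
  have "Sdvd (\<alpha> t) (\<lambda>v. (y w v + z w v) - (y (t \<otimes>\<^bsub>W\<^esub> w) v + z (t \<otimes>\<^bsub>W\<^esub> w) v))" if "w \<in> carrier W" "t \<in> T" for w t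
    using Sdvd_add[OF Z_dvd[OF y that] Z_dvd[OF z that]] by (simp add: algebra_simps)
  then show ?thesis using Z_S[OF y] Z_S[OF z] T_carrier by (simp add: Z_iff Z_simps(5))
qed

lemma Z_mult_closed: "y \<in> Zc \<Longrightarrow> z \<in> Zc \<Longrightarrow> y \<otimes>\<^bsub>Zr\<^esub> z \<in> Zc"
proof -
  assume y: "y \<in> Zc" and z: "z \<in> Zc"
  have "Sdvd (\<alpha> t) (\<lambda>v. (y w v * z w v) - (y (t \<otimes>\<^bsub>W\<^esub> w) v * z (t \<otimes>\<^bsub>W\<^esub> w) v))" if w: "w \<in> carrier W" "t \<in> T" for w t
  proof -
    have tw: "t \<otimes>\<^bsub>W\<^esub> w \<in> carrier W" using w T_carrier by simp
    \<comment> \<open>Leibniz rule for the difference of the two products.\<close>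
    have "Sdvd (\<alpha> t) (\<lambda>v. y w v * (z w v - z (t \<otimes>\<^bsub>W\<^esub> w) v) + z (t \<otimes>\<^bsub>W\<^esub> w) v * (y w v - y (t \<otimes>\<^bsub>W\<^esub> w) v))"
      by (intro Sdvd_add Sdvd_mult[OF Z_dvd[OF z w]] Sdvd_mult[OF Z_dvd[OF y w]] Z_S[OF y w(1)] Z_S[OF z tw])
    then show ?thesis by (simp add: algebra_simps)
  qed
  then show ?thesis using Z_S[OF y] Z_S[OF z] T_carrier by (simp add: Z_iff Z_simps(2))
qed

lemma Z_cring: "cring Zr"
proof -
  have one: "\<one>\<^bsub>Zr\<^esub> \<in> Zc" and zero: "\<zero>\<^bsub>Zr\<^esub> \<in> Zc" by (simp_all add: Z_simps(3,4))
  have app: "(y \<oplus>\<^bsub>Zr\<^esub> z) w = (\<lambda>v. y w v + z w v)" "(y \<otimes>\<^bsub>Zr\<^esub> z) w = (\<lambda>v. y w v * z w v)"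
    "\<one>\<^bsub>Zr\<^esub> w = (\<lambda>_. 1)" "\<zero>\<^bsub>Zr\<^esub> w = (\<lambda>_. 0)" if "w \<in> carrier W" for y z w
    using that by (simp_all add: Z_simps(2-5))
  note cl = Z_add_closed Z_mult_closed one zero
  show ?thesis
  proof (rule cringI)
    show "abelian_group Zr"
    proof (rule abelian_groupI)
      fix x assume x: "x \<in> Zc"
      have "cf (\<lambda>_. - 1) \<otimes>\<^bsub>Zr\<^esub> x \<in> Zc" using Z_mult_closed x by blast
      moreover have "(cf (\<lambda>_. - 1) \<otimes>\<^bsub>Zr\<^esub> x) \<oplus>\<^bsub>Zr\<^esub> x = \<zero>\<^bsub>Zr\<^esub>"
        by (rule Z_eqI) (use x cl in \<open>auto simp: app\<close>)
      ultimately show "\<exists>y\<in>Zc. y \<oplus>\<^bsub>Zr\<^esub> x = \<zero>\<^bsub>Zr\<^esub>" by blast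
    qed (auto simp: cl intro!: Z_eqI simp: app algebra_simps)
    show "Group.comm_monoid Zr"
      by (rule comm_monoidI) (auto simp: cl intro!: Z_eqI simp: app algebra_simps)
  qed (auto simp: cl intro!: Z_eqI simp: app algebra_simps)
qed

definition im :: "('v \<times> 'v \<Rightarrow> 'k) \<Rightarrow> 'w \<Rightarrow> 'v \<Rightarrow> 'k" where
  "im F = (\<lambda>w \<in> carrier W. res w F)"

lemma im_app [simp]: "w \<in> carrier W \<Longrightarrow> im F w = res w F"
  by (simp add: im_def)

lemma im_Z [simp, intro]: "F \<in> SS \<Longrightarrow> im F \<in> Zc"
  using res_S res_reflect_dvd T_carrier by (auto simp: Z_iff im_def)

lemma im_rt: "im (rt s) = cf s"
  by (simp add: im_def const_family_def)

lemma im_hom: "im (\<lambda>p. F p + G p) = im F \<oplus>\<^bsub>Zr\<^esub> im G" "im (\<lambda>p. F p * G p) = im F \<otimes>\<^bsub>Zr\<^esub> im G"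
  "im (\<lambda>_. 1) = \<one>\<^bsub>Zr\<^esub>" "im (\<lambda>_. 0) = \<zero>\<^bsub>Zr\<^esub>"
  by (auto simp: im_def Z_simps(2-5) const_family_def fun_eq_iff restrict_def)

lemma im_part: "F \<in> SSp n \<Longrightarrow> im F \<in> rpart Zr n"
  using res_Sp SSp_SS by (auto simp: Z_simps(6))

lemma cf_mult: "cf s \<otimes>\<^bsub>Zr\<^esub> cf t = cf (\<lambda>v. s v * t v)"
  by (auto simp: Z_simps(2) const_family_def restrict_def fun_eq_iff)

definition SS_restriction :: "('w \<Rightarrow> 'v \<Rightarrow> 'k, 'm) gmodule \<Rightarrow> ('v \<times> 'v \<Rightarrow> 'k, 'm) gmodule" where
  "SS_restriction M = \<lparr>carrier = carrier M, monoid.mult = monoid.mult M, one = monoid.one M, zero = ring.zero M,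
     add = ring.add M, module.smult = (\<lambda>F m. im F \<odot>\<^bsub>M\<^esub> m), part = part M\<rparr>"

lemma SS_restriction_simps [simp]:
  "carrier (SS_restriction M) = carrier M" "ring.add (SS_restriction M) = ring.add M" "ring.zero (SS_restriction M) = ring.zero M"
  "part (SS_restriction M) = part M" "Module.module.smult (SS_restriction M) F m = im F \<odot>\<^bsub>M\<^esub> m"
  by (simp_all add: SS_restriction_def)

lemma SS_restriction_graded:
  assumes "graded_module Zr M"
  shows "graded_module (SS_ring scale) (SS_restriction M)"
proof -
  interpret M: Module.module Zr M using assms by (simp add: graded_module_def)
  show ?thesis
  proof (rule graded_module_transfer[OF assms SS_cring])
    fix a b x assume a: "a \<in> SS" and b: "b \<in> SS" and x: "x \<in> carrier M"
    show "(a \<oplus>\<^bsub>SS_ring scale\<^esub> b) \<odot>\<^bsub>SS_restriction M\<^esub> x = a \<odot>\<^bsub>SS_restriction M\<^esub> x \<oplus>\<^bsub>M\<^esub> b \<odot>\<^bsub>SS_restriction M\<^esub> x"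
      using M.smult_l_distr[OF im_Z[OF a] im_Z[OF b] x] by (simp add: im_hom)
    show "(a \<otimes>\<^bsub>SS_ring scale\<^esub> b) \<odot>\<^bsub>SS_restriction M\<^esub> x = a \<odot>\<^bsub>SS_restriction M\<^esub> (b \<odot>\<^bsub>SS_restriction M\<^esub> x)"
      using M.smult_assoc1[OF im_Z[OF a] im_Z[OF b] x] by (simp add: im_hom)
  next
    fix x assume "x \<in> carrier M"
    then show "\<one>\<^bsub>SS_ring scale\<^esub> \<odot>\<^bsub>SS_restriction M\<^esub> x = x" using M.smult_one[of x] by (simp add: im_hom)
  next
    fix i j r m assume "r \<in> SSp i" "m \<in> part M j"
    then show "r \<odot>\<^bsub>SS_restriction M\<^esub> m \<in> part M (i + j)" using assms im_part by (simp add: graded_module_def)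
  qed (simp_all add: M.smult_r_distr)
qed

end

text \<open>A bimodule and a Z-module on the same graded group with compatible actions. Both
  functors of the equivalence yield such a pair, so the quotients M^Omega of \<open>Mz\<close> can
  be computed with the sections of \<open>M\<close>.\<close>

locale Z_lattice = supported_module scale W I \<rho> \<alpha> M A
  for scale :: "'k::field \<Rightarrow> 'v::ab_group_add \<Rightarrow> 'v" and W :: "'w monoid" and I \<rho> \<alpha>
    and M :: "('v \<times> 'v \<Rightarrow> 'k, 'm) gmodule" and A +
  fixes Mz :: "('w \<Rightarrow> 'v \<Rightarrow> 'k, 'm) gmodule"
  assumes Z_graded: "graded_module (Z_ring scale W I \<alpha>) Mz"
    and same: "carrier Mz = carrier M" "ring.add Mz = ring.add M" "ring.zero Mz = ring.zero M" "part Mz = part M"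
    and smult_im: "\<And>F m. F \<in> carrier (SS_ring scale) \<Longrightarrow> m \<in> carrier M \<Longrightarrow> im F \<odot>\<^bsub>Mz\<^esub> m = F \<odot>\<^bsub>M\<^esub> m"
    and through: "acts_through scale W I \<alpha> Mz A"
begin

sublocale Z: Module.module "Z_ring scale W I \<alpha>" Mz
  using Z_graded by (simp add: graded_module_def)

abbreviation Dn where "Dn \<equiv> denominators scale W"

definition zs where "zs z m = z \<odot>\<^bsub>Mz\<^esub> m"

lemma zs_closed [simp]: "z \<in> Zc \<Longrightarrow> m \<in> carrier M \<Longrightarrow> zs z m \<in> carrier M"
  using Z.smult_closed[of z m] by (simp add: zs_def same)

lemma zs_im: "F \<in> SS \<Longrightarrow> m \<in> carrier M \<Longrightarrow> zs (im F) m = act F m"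
  by (simp add: zs_def act_def smult_im)

lemma zs_cf: "s \<in> S \<Longrightarrow> m \<in> carrier M \<Longrightarrow> zs (cf s) m = act (rt s) m"
  using zs_im[of "rt s" m] by (simp add: im_rt)

lemma zs_mult: "y \<in> Zc \<Longrightarrow> z \<in> Zc \<Longrightarrow> m \<in> carrier M \<Longrightarrow> zs (y \<otimes>\<^bsub>Zr\<^esub> z) m = zs y (zs z m)"
  using Z.smult_assoc1[of y z m] by (simp add: zs_def same)

lemma zs_comm: "y \<in> Zc \<Longrightarrow> z \<in> Zc \<Longrightarrow> m \<in> carrier M \<Longrightarrow> zs y (zs z m) = zs z (zs y m)"
  using zs_mult[of y z m] zs_mult[of z y m] Z.R.m_comm[of y z] by simp

lemma zs_rt: "z \<in> Zc \<Longrightarrow> s \<in> S \<Longrightarrow> m \<in> carrier M \<Longrightarrow> zs z (act (rt s) m) = act (rt s) (zs z m)"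
  using zs_comm[of z "cf s" m] by (simp add: zs_cf)

lemma zs_through:
  "acts_through scale W I \<alpha> Mz B \<Longrightarrow> y \<in> Zc \<Longrightarrow> z \<in> Zc \<Longrightarrow> (\<And>w. w \<in> B \<Longrightarrow> y w = z w) \<Longrightarrow> m \<in> carrier M \<Longrightarrow> zs y m = zs z m"
  unfolding acts_through_def zs_def same by (metis restrict_ext)

section \<open>Fractions and the projections to single points\<close>

lemma Dn_iff: "u \<in> Dn \<longleftrightarrow> (\<exists>s \<in> S. s \<noteq> (\<lambda>_. 0) \<and> u = cf s)"
  by (auto simp: denominators_def)

text \<open>Torsion freeness removes the auxiliary multiplier from the equality of
  fractions.\<close>

lemma frac_rel_iff:
  assumes "s \<in> S" "s \<noteq> (\<lambda>_. 0)" "t \<in> S" "t \<noteq> (\<lambda>_. 0)"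
  shows "((m, cf s), (n, cf t)) \<in> frac_rel Mz Dn \<longleftrightarrow> m \<in> carrier M \<and> n \<in> carrier M \<and> act (rt t) m = act (rt s) n"
proof
  assume "((m, cf s), (n, cf t)) \<in> frac_rel Mz Dn"
  then obtain u where u: "m \<in> carrier M" "n \<in> carrier M" "u \<in> Dn" "zs u (zs (cf t) m) = zs u (zs (cf s) n)"
    by (auto simp: frac_rel_def zs_def same)
  obtain r where r: "r \<in> S" "r \<noteq> (\<lambda>_. 0)" "u = cf r" using u(3) Dn_iff by blast
  have "act (rt r) (act (rt t) m) = act (rt r) (act (rt s) n)" using u r assms by (simp add: zs_cf)
  then show "m \<in> carrier M \<and> n \<in> carrier M \<and> act (rt t) m = act (rt s) n"
    using act_rt_cancel[OF r(1,2)] u assms by simp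
next
  assume a: "m \<in> carrier M \<and> n \<in> carrier M \<and> act (rt t) m = act (rt s) n"
  have "cf (\<lambda>_. 1) \<in> Dn" unfolding Dn_iff by (intro bexI[of _ "\<lambda>_. 1"]) (auto simp: fun_eq_iff)
  moreover have "zs (cf (\<lambda>_. 1)) (zs (cf t) m) = zs (cf (\<lambda>_. 1)) (zs (cf s) n)" using a assms by (simp add: zs_cf)
  moreover have "cf s \<in> Dn" "cf t \<in> Dn" unfolding Dn_iff using assms by blast+
  ultimately show "((m, cf s), (n, cf t)) \<in> frac_rel Mz Dn"
    using a unfolding frac_rel_def zs_def same by blast
qed

lemma frac_mem:
  assumes "s \<in> S" "s \<noteq> (\<lambda>_. 0)"
  shows "p \<in> frac Mz Dn m (cf s) \<longleftrightarrow>
    (\<exists>n t. p = (n, cf t) \<and> t \<in> S \<and> t \<noteq> (\<lambda>_. 0) \<and> m \<in> carrier M \<and> n \<in> carrier M \<and> act (rt t) m = act (rt s) n)"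
proof
  assume p: "p \<in> frac Mz Dn m (cf s)"
  then have "snd p \<in> Dn" by (auto simp: frac_def frac_rel_def)
  then obtain t where t: "t \<in> S" "t \<noteq> (\<lambda>_. 0)" "snd p = cf t" unfolding Dn_iff by blast
  then have pe: "p = (fst p, cf t)" by (metis prod.collapse)
  have "((m, cf s), (fst p, cf t)) \<in> frac_rel Mz Dn" using p pe unfolding frac_def by (metis Image_singleton_iff)
  then show "\<exists>n t. p = (n, cf t) \<and> t \<in> S \<and> t \<noteq> (\<lambda>_. 0) \<and> m \<in> carrier M \<and> n \<in> carrier M \<and> act (rt t) m = act (rt s) n"
    unfolding frac_rel_iff[OF assms t(1,2)] using pe t by blast
next
  assume "\<exists>n t. p = (n, cf t) \<and> t \<in> S \<and> t \<noteq> (\<lambda>_. 0) \<and> m \<in> carrier M \<and> n \<in> carrier M \<and> act (rt t) m = act (rt s) n"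
  then obtain n t where nt: "p = (n, cf t)" "t \<in> S" "t \<noteq> (\<lambda>_. 0)" "m \<in> carrier M \<and> n \<in> carrier M \<and> act (rt t) m = act (rt s) n" by blast
  have "((m, cf s), (n, cf t)) \<in> frac_rel Mz Dn" unfolding frac_rel_iff[OF assms nt(2,3)] by (rule nt(4))
  then show "p \<in> frac Mz Dn m (cf s)" unfolding frac_def nt(1) by blast
qed

lemma frac_eq:
  assumes s: "s \<in> S" "s \<noteq> (\<lambda>_. 0)" and t: "t \<in> S" "t \<noteq> (\<lambda>_. 0)" and mn: "m \<in> carrier M" "n \<in> carrier M"
  shows "frac Mz Dn m (cf s) = frac Mz Dn n (cf t) \<longleftrightarrow> act (rt t) m = act (rt s) n"
proof
  assume eq: "frac Mz Dn m (cf s) = frac Mz Dn n (cf t)"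
  have "(m, cf s) \<in> frac Mz Dn m (cf s)" unfolding frac_mem[OF s] using s mn by blast
  then have "(m, cf s) \<in> frac Mz Dn n (cf t)" using eq by simp
  then have "((n, cf t), (m, cf s)) \<in> frac_rel Mz Dn" unfolding frac_def by blast
  then show "act (rt t) m = act (rt s) n" unfolding frac_rel_iff[OF t s] by simp
next
  have sub: "frac Mz Dn m (cf s) \<subseteq> frac Mz Dn n (cf t)"
    if eq: "act (rt t) m = act (rt s) n" and s: "s \<in> S" "s \<noteq> (\<lambda>_. 0)" and t: "t \<in> S" "t \<noteq> (\<lambda>_. 0)"
      and mn: "m \<in> carrier M" "n \<in> carrier M" for m n s t
  proof
    fix p assume "p \<in> frac Mz Dn m (cf s)"
    then obtain k r where k: "p = (k, cf r)" "r \<in> S" "r \<noteq> (\<lambda>_. 0)" "k \<in> carrier M" "act (rt r) m = act (rt s) k"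
      unfolding frac_mem[OF s] by blast
    have "act (rt r) n = act (rt t) k"
    proof (rule act_rt_cancel[OF s])
      have "act (rt s) (act (rt r) n) = act (rt r) (act (rt t) m)"
        unfolding eq using act_comm s k mn by simp
      also have "\<dots> = act (rt t) (act (rt s) k)"
        unfolding k(5)[symmetric] by (rule act_comm) (use t k mn in auto)
      also have "\<dots> = act (rt s) (act (rt t) k)" using act_comm s t k by simp
      finally show "act (rt s) (act (rt r) n) = act (rt s) (act (rt t) k)" .
    qed (use k t mn in auto)
    then show "p \<in> frac Mz Dn n (cf t)" unfolding frac_mem[OF t] using k mn by blast
  qed
  assume eq: "act (rt t) m = act (rt s) n"
  show "frac Mz Dn m (cf s) = frac Mz Dn n (cf t)"
    using sub[OF eq s t mn] sub[OF eq[symmetric] t s mn(2,1)] by blast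
qed

lemma frac_act_frac:
  assumes z: "z \<in> Zc" and s: "s \<in> S" "s \<noteq> (\<lambda>_. 0)" and t: "t \<in> S" "t \<noteq> (\<lambda>_. 0)" and m: "m \<in> carrier M"
  shows "frac_act Zr Mz Dn z (cf s) (frac Mz Dn m (cf t)) = frac Mz Dn (zs z m) (cf (\<lambda>v. s v * t v))"
proof -
  have st: "(\<lambda>v. s v * t v) \<in> S" "(\<lambda>v. s v * t v) \<noteq> (\<lambda>_. 0)" using S_mult_nonzero s t by auto
  have *: "(case p of (n, u) \<Rightarrow> frac Mz Dn (z \<odot>\<^bsub>Mz\<^esub> n) (cf s \<otimes>\<^bsub>Zr\<^esub> u)) = frac Mz Dn (zs z m) (cf (\<lambda>v. s v * t v))"
    if p: "p \<in> frac Mz Dn m (cf t)" for p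
  proof -
    obtain n r where n: "p = (n, cf r)" "r \<in> S" "r \<noteq> (\<lambda>_. 0)" "n \<in> carrier M" "act (rt r) m = act (rt t) n"
      using p unfolding frac_mem[OF t] by blast
    have sr: "(\<lambda>v. s v * r v) \<in> S" "(\<lambda>v. s v * r v) \<noteq> (\<lambda>_. 0)" using S_mult_nonzero s n by auto
    have "act (rt (\<lambda>v. s v * t v)) (zs z n) = act (rt s) (zs z (act (rt t) n))"
      using act_mult[of "rt s" "rt t" "zs z n"] s t z n zs_rt by (simp add: rt_simps)
    also have "\<dots> = act (rt (\<lambda>v. s v * r v)) (zs z m)"
      unfolding n(5)[symmetric] using act_mult[of "rt s" "rt r" "zs z m"] s z m n(2) zs_rt[OF z n(2) m] by (simp add: rt_simps)
    finally have "frac Mz Dn (zs z n) (cf (\<lambda>v. s v * r v)) = frac Mz Dn (zs z m) (cf (\<lambda>v. s v * t v))"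
      using frac_eq[OF sr st, of "zs z n" "zs z m"] z m n by simp
    then show ?thesis by (simp add: n(1) cf_mult zs_def)
  qed
  have "(m, cf t) \<in> frac Mz Dn m (cf t)" unfolding frac_mem[OF t] using m t by blast
  then show ?thesis unfolding frac_act_def using * by blast
qed

lemma frac_add_frac:
  assumes s: "s \<in> S" "s \<noteq> (\<lambda>_. 0)" and mn: "m \<in> carrier M" "n \<in> carrier M"
  shows "frac Mz Dn m (cf s) \<oplus>\<^bsub>M_Q scale W I \<alpha> Mz\<^esub> frac Mz Dn n (cf s) = frac Mz Dn (m \<oplus>\<^bsub>M\<^esub> n) (cf s)"
proof -
  have *: "frac Mz Dn (u' \<odot>\<^bsub>Mz\<^esub> m' \<oplus>\<^bsub>Mz\<^esub> u \<odot>\<^bsub>Mz\<^esub> n') (u \<otimes>\<^bsub>Zr\<^esub> u') = frac Mz Dn (m \<oplus>\<^bsub>M\<^esub> n) (cf s)"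
    if mu: "(m', u) \<in> frac Mz Dn m (cf s)" and nu: "(n', u') \<in> frac Mz Dn n (cf s)" for m' u n' u'
  proof -
    obtain t where t: "u = cf t" "t \<in> S" "t \<noteq> (\<lambda>_. 0)" "m' \<in> carrier M" "act (rt t) m = act (rt s) m'"
      using mu unfolding frac_mem[OF s] by blast
    obtain t' where t': "u' = cf t'" "t' \<in> S" "t' \<noteq> (\<lambda>_. 0)" "n' \<in> carrier M" "act (rt t') n = act (rt s) n'"
      using nu unfolding frac_mem[OF s] by blast
    have tt: "(\<lambda>v. t v * t' v) \<in> S" "(\<lambda>v. t v * t' v) \<noteq> (\<lambda>_. 0)" using S_mult_nonzero t t' by auto
    have "act (rt s) (act (rt t') m' \<oplus>\<^bsub>M\<^esub> act (rt t) n') = act (rt t') (act (rt s) m') \<oplus>\<^bsub>M\<^esub> act (rt t) (act (rt s) n')"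
      using s t t' act_plus act_comm by simp
    also have "act (rt t') (act (rt s) m') = act (rt (\<lambda>v. t v * t' v)) m"
      unfolding t(5)[symmetric] using act_mult[of "rt t" "rt t'" m] act_comm[of "rt t" "rt t'" m] t t' mn by (simp add: rt_simps)
    also have "act (rt t) (act (rt s) n') = act (rt (\<lambda>v. t v * t' v)) n"
      unfolding t'(5)[symmetric] using act_mult[of "rt t" "rt t'" n] t t' mn by (simp add: rt_simps)
    also have "act (rt (\<lambda>v. t v * t' v)) m \<oplus>\<^bsub>M\<^esub> act (rt (\<lambda>v. t v * t' v)) n = act (rt (\<lambda>v. t v * t' v)) (m \<oplus>\<^bsub>M\<^esub> n)"
      using act_plus[of "rt (\<lambda>v. t v * t' v)" m n] tt mn by simp
    finally have "frac Mz Dn (act (rt t') m' \<oplus>\<^bsub>M\<^esub> act (rt t) n') (cf (\<lambda>v. t v * t' v)) = frac Mz Dn (m \<oplus>\<^bsub>M\<^esub> n) (cf s)"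
      using frac_eq[OF tt s, of "act (rt t') m' \<oplus>\<^bsub>M\<^esub> act (rt t) n'" "m \<oplus>\<^bsub>M\<^esub> n"] t t' mn by simp
    then show ?thesis
      using t t' zs_cf[OF t'(2) t(4)] zs_cf[OF t(2) t'(4)] by (simp add: cf_mult same zs_def)
  qed
  have "(m, cf s) \<in> frac Mz Dn m (cf s)" "(n, cf s) \<in> frac Mz Dn n (cf s)" unfolding frac_mem[OF s] using mn s by blast+
  then have ne: "frac Mz Dn m (cf s) \<noteq> {}" "frac Mz Dn n (cf s) \<noteq> {}" by blast+
  have "(\<Union>(m', u) \<in> frac Mz Dn m (cf s). \<Union>(n', u') \<in> frac Mz Dn n (cf s).
      frac Mz Dn (u' \<odot>\<^bsub>Mz\<^esub> m' \<oplus>\<^bsub>Mz\<^esub> u \<odot>\<^bsub>Mz\<^esub> n') (u \<otimes>\<^bsub>Zr\<^esub> u')) = frac Mz Dn (m \<oplus>\<^bsub>M\<^esub> n) (cf s)"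
    by (rule UN_pairs_const[OF ne *])
  then show ?thesis by (simp add: M_Q_def frac_module_def)
qed

text \<open>\<open>proj_Q\<close> ranges over all finite sets through which Z acts, so two of them
  have to be compared. Let G be D on B and 0 on C - B: it acts as D because Z acts through B, and
  after multiplication by it y and z agree on all of C.\<close>

lemma acts_through_Int:
  assumes B: "finite B" "B \<subseteq> carrier W" "acts_through scale W I \<alpha> Mz B"
    and C: "finite C" "C \<subseteq> carrier W" "acts_through scale W I \<alpha> Mz C"
    and yz: "y \<in> Zc" "z \<in> Zc" "\<And>w. w \<in> B \<inter> C \<Longrightarrow> y w = z w" and m: "m \<in> carrier M"
  shows "zs y m = zs z m"
proof -
  define \<delta> where "\<delta> x = (if x \<in> B then (\<lambda>_. 1) else (\<lambda>_. 0) :: 'v \<Rightarrow> 'k)" for x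
  have \<delta>S: "\<delta> x \<in> S" for x by (simp add: \<delta>_def)
  have BC: "finite (B \<union> C)" "B \<union> C \<subseteq> carrier W" using B C by auto
  obtain D e G where G: "linprod D" "G \<in> SS" "\<forall>x \<in> B \<union> C. res x G = (\<lambda>v. D v * \<delta> x v)"
    using interpolation[OF BC, of \<delta>] \<delta>S by blast
  have DS: "D \<in> S" "D \<noteq> (\<lambda>_. 0)" using linprod_S linprod_nonzero G(1) by auto
  have GB: "zs (im G) m' = act (rt D) m'" if "m' \<in> carrier M" for m'
  proof -
    have "zs (im G) m' = zs (cf D) m'"
      by (rule zs_through[OF B(3)]) (use G B DS that in \<open>auto simp: \<delta>_def subset_iff\<close>)
    then show ?thesis using zs_cf DS that by simp
  qed
  have "zs (y \<otimes>\<^bsub>Zr\<^esub> im G) m = zs (z \<otimes>\<^bsub>Zr\<^esub> im G) m"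
  proof (rule zs_through[OF C(3)])
    fix w assume w: "w \<in> C"
    have wW: "w \<in> carrier W" using w C by auto
    have "res w G = (\<lambda>v. D v * \<delta> w v)" using G(3) w by blast
    then have rw: "res w G = (\<lambda>_. 0)" if "w \<notin> B" using that by (simp add: \<delta>_def)
    show "(y \<otimes>\<^bsub>Zr\<^esub> im G) w = (z \<otimes>\<^bsub>Zr\<^esub> im G) w"
      using yz(3)[of w] w wW rw by (cases "w \<in> B") (auto simp: Z_simps(2))
  qed (use yz G m Z_mult_closed in auto)
  then have "zs (im G) (zs y m) = zs (im G) (zs z m)"
    using zs_mult zs_comm yz G m by simp
  then have "act (rt D) (zs y m) = act (rt D) (zs z m)" using GB yz m by simp
  then show ?thesis using act_rt_cancel[OF DS] yz m by simp
qed

text \<open>Evaluates the definite description in \<open>proj_Q\<close> by an idempotent that comes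
  from S tensor S.\<close>

lemma proj_Q_eq:
  assumes w: "w \<in> carrier W" and Om: "finite \<Omega>" "\<Omega> \<subseteq> carrier W" "w \<in> \<Omega>" "acts_through scale W I \<alpha> Mz \<Omega>"
    and F: "F \<in> SS" "res w F = s" "s \<noteq> (\<lambda>_. 0)" "\<And>y. y \<in> \<Omega> - {w} \<Longrightarrow> res y F = (\<lambda>_. 0)" and m: "m \<in> carrier M"
  shows "proj_Q scale W I \<alpha> Mz w (frac Mz Dn m \<one>\<^bsub>Zr\<^esub>) = frac Mz Dn (act F m) (cf s)"
proof -
  have sS: "s \<in> S" using res_S F w by blast
  have one: "(\<lambda>_. 1) \<in> S" "(\<lambda>_. 1 :: 'k) \<noteq> (\<lambda>_. 0)" by (auto simp: fun_eq_iff)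
  have rep: "represents_idempotent scale W I \<alpha> \<Omega> w (im F) (cf s)"
    unfolding represents_idempotent_def Dn_iff using F sS w Om by (auto simp: subset_iff)
  have val: "frac_act Zr Mz Dn z (cf u) (frac Mz Dn m \<one>\<^bsub>Zr\<^esub>) = frac Mz Dn (zs z m) (cf u)"
    if "z \<in> Zc" "u \<in> S" "u \<noteq> (\<lambda>_. 0)" for z u
    using frac_act_frac[OF that one m] by (simp add: Z_simps(3))
  show ?thesis
    unfolding proj_Q_def
  proof (rule the_equality)
    have "frac Mz Dn (act F m) (cf s) = frac_act Zr Mz Dn (im F) (cf s) (frac Mz Dn m \<one>\<^bsub>Zr\<^esub>)"
      using val[OF im_Z[OF F(1)] sS F(3)] zs_im[OF F(1) m] by simp
    then show "\<exists>\<Omega> z s'. finite \<Omega> \<and> \<Omega> \<subseteq> carrier W \<and> w \<in> \<Omega> \<and> acts_through scale W I \<alpha> Mz \<Omega> \<and>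
      represents_idempotent scale W I \<alpha> \<Omega> w z s' \<and>
      frac Mz Dn (act F m) (cf s) = frac_act Zr Mz Dn z s' (frac Mz Dn m \<one>\<^bsub>Zr\<^esub>)"
      using Om rep by blast
    fix Y assume "\<exists>\<Omega> z s'. finite \<Omega> \<and> \<Omega> \<subseteq> carrier W \<and> w \<in> \<Omega> \<and> acts_through scale W I \<alpha> Mz \<Omega> \<and>
      represents_idempotent scale W I \<alpha> \<Omega> w z s' \<and> Y = frac_act Zr Mz Dn z s' (frac Mz Dn m \<one>\<^bsub>Zr\<^esub>)"
    then obtain B z s' where B: "finite B" "B \<subseteq> carrier W" "w \<in> B" "acts_through scale W I \<alpha> Mz B"
      "represents_idempotent scale W I \<alpha> B w z s'" "Y = frac_act Zr Mz Dn z s' (frac Mz Dn m \<one>\<^bsub>Zr\<^esub>)" by blast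
    obtain u where u: "z \<in> Zc" "s' = cf u" "u \<in> S" "u \<noteq> (\<lambda>_. 0)" "z w = u" "\<And>y. y \<in> B - {w} \<Longrightarrow> z y = (\<lambda>_. 0)"
      using B(5) w unfolding represents_idempotent_def Dn_iff by auto
    \<comment> \<open>Uniqueness: after cross multiplication the two fractions agree on the
      intersection of \<open>\<Omega>\<close> and B, since both numerators vanish there away from
      w.\<close>
    have "zs (cf s \<otimes>\<^bsub>Zr\<^esub> z) m = zs (cf u \<otimes>\<^bsub>Zr\<^esub> im F) m"
    proof (rule acts_through_Int[OF Om(1,2,4) B(1,2,4)])
      fix y assume y: "y \<in> \<Omega> \<inter> B"
      have yW: "y \<in> carrier W" using y Om by auto
      show "(cf s \<otimes>\<^bsub>Zr\<^esub> z) y = (cf u \<otimes>\<^bsub>Zr\<^esub> im F) y"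
        using y yW u(5) u(6)[of y] F(2) F(4)[of y] by (cases "y = w") (auto simp: Z_simps(2) mult.commute)
    qed (use sS u F m Z_mult_closed in auto)
    then have "act (rt s) (zs z m) = act (rt u) (act F m)"
      using zs_mult zs_cf zs_im sS u F m by simp
    then have "frac Mz Dn (zs z m) (cf u) = frac Mz Dn (act F m) (cf s)"
      using frac_eq[OF u(3,4) sS F(3), of "zs z m" "act F m"] u F m by simp
    then show "Y = frac Mz Dn (act F m) (cf s)" using B(6) u(2) val[OF u(1,3,4)] by simp
  qed
qed

text \<open>With \<open>q w\<close>, the numerator and denominator of the idempotent at w as it acts
  on M. At w outside A the component is zero, written as 0/1.\<close>

definition P where "P w = (if w \<in> A then E w else (\<lambda>_. 0))"
definition q where "q w = (if w \<in> A then res w (E w) else (\<lambda>_. 1))"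

lemma Pq: "P w \<in> SS" "q w \<in> S" "q w \<noteq> (\<lambda>_. 0)"
  using E_props by (auto simp: P_def q_def fun_eq_iff)

lemma proj_Q_frac:
  assumes w: "w \<in> carrier W" and m: "m \<in> carrier M"
  shows "proj_Q scale W I \<alpha> Mz w (frac Mz Dn m \<one>\<^bsub>Zr\<^esub>) = frac Mz Dn (act (P w) m) (cf (q w))"
proof (cases "w \<in> A")
  case True
  then show ?thesis
    using proj_Q_eq[OF w A _ through E_props(4)[OF True] refl E_props(2)[OF True] _ m] E_props(3)[OF True]
    by (simp add: P_def q_def)
next
  case False
  \<comment> \<open>The set in \<open>proj_Q\<close> has to contain w, so A is enlarged by w. A
    numerator of the idempotent then vanishes on all graphs over A and kills m.\<close>
  define \<delta> where "\<delta> x = (if x = w then (\<lambda>_. 1) else (\<lambda>_. 0) :: 'v \<Rightarrow> 'k)" for x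
  have \<delta>S: "\<delta> x \<in> S" for x by (simp add: \<delta>_def)
  have fin: "finite (insert w A)" "insert w A \<subseteq> carrier W" using A w by auto
  obtain D e G where G: "linprod D" "G \<in> SS" "\<forall>x \<in> insert w A. res x G = (\<lambda>v. D v * \<delta> x v)"
    using interpolation[OF fin, of \<delta>] \<delta>S by blast
  have DS: "D \<in> S" "D \<noteq> (\<lambda>_. 0)" using linprod_S linprod_nonzero G(1) by auto
  have Gw: "res w G = D" using G(3) by (simp add: \<delta>_def)
  have Gy: "res y G = (\<lambda>_. 0)" if "y \<in> insert w A - {w}" for y using G(3) that by (simp add: \<delta>_def)
  have th: "acts_through scale W I \<alpha> Mz (insert w A)"
    unfolding acts_through_def
  proof (intro ballI impI)
    fix y z m assume a: "y \<in> Zc" "z \<in> Zc" "restrict y (insert w A) = restrict z (insert w A)" "m \<in> carrier Mz"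
    have "\<And>x. x \<in> A \<Longrightarrow> y x = z x" using a(3) by (metis insertCI restrict_apply')
    then show "y \<odot>\<^bsub>Mz\<^esub> m = z \<odot>\<^bsub>Mz\<^esub> m" using zs_through[OF through a(1,2)] a(4) by (simp add: same zs_def)
  qed
  have "act G m = \<zero>\<^bsub>M\<^esub>"
    by (rule act_vanish[OF G(2) m]) (use Gy False in auto)
  then have "proj_Q scale W I \<alpha> Mz w (frac Mz Dn m \<one>\<^bsub>Zr\<^esub>) = frac Mz Dn \<zero>\<^bsub>M\<^esub> (cf D)"
    using proj_Q_eq[OF w fin _ th G(2) Gw DS(2) Gy m] by simp
  also have "\<dots> = frac Mz Dn \<zero>\<^bsub>M\<^esub> (cf (q w))"
    using frac_eq[OF DS Pq(2)[of w] Pq(3)[of w], of "\<zero>\<^bsub>M\<^esub>" "\<zero>\<^bsub>M\<^esub>"] DS Pq(2) by simp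
  also have "\<zero>\<^bsub>M\<^esub> = act (P w) m"
    using False m act_vanish[of "\<lambda>_. 0" m] by (simp add: P_def)
  finally show ?thesis .
qed

text \<open>The elements with zero component at every point of \<open>\<Omega>\<close> are the
  sections over the complement, so M^Omega is the quotient of M by
  \<open>sec (- \<Omega>)\<close>.\<close>

lemma M_restr_free_iff:
  assumes Om: "\<Omega> \<subseteq> carrier W"
  shows "graded_free (S_ring scale) (M_restr scale W I \<alpha> Mz \<Omega>) \<longleftrightarrow>
    (\<exists>(n::nat) b d. N.rel_basis (sec (- \<Omega>)) (carrier M) {..<n} b d)"
proof -
  define \<pi> where "\<pi> = proj_family scale W I \<alpha> Mz \<Omega>"
  have pi: "\<pi> m = (\<lambda>w \<in> \<Omega>. frac Mz Dn (act (P w) m) (cf (q w)))" if "m \<in> carrier M" for m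
    unfolding \<pi>_def proj_family_def using proj_Q_frac that Om by (auto simp: restrict_def fun_eq_iff)
  have "graded_free (S_ring scale) (M_restr scale W I \<alpha> Mz \<Omega>) \<longleftrightarrow>
    (\<exists>(n::nat) b d. N.rel_basis (sec (- \<Omega>)) (carrier N) {..<n} b d)"
  proof (rule N.graded_free_iff_rel_basis[OF sec_gsubmodule, where \<pi> = \<pi>])
    show "carrier (M_restr scale W I \<alpha> Mz \<Omega>) = \<pi> ` carrier N" by (simp add: M_restr_def \<pi>_def same)
    show "part (M_restr scale W I \<alpha> Mz \<Omega>) i = \<pi> ` part N i" for i by (simp add: M_restr_def \<pi>_def same)
    fix m assume "m \<in> carrier N"
    then have m: "m \<in> carrier M" by simp
    { fix m' assume "m' \<in> carrier N"
      then have m': "m' \<in> carrier M" by simp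
      have "\<pi> m = \<pi> m' \<longleftrightarrow> (\<forall>w \<in> \<Omega>. frac Mz Dn (act (P w) m) (cf (q w)) = frac Mz Dn (act (P w) m') (cf (q w)))"
        unfolding pi[OF m] pi[OF m'] by (rule restrict_eq_iff)
      also have "\<dots> \<longleftrightarrow> (\<forall>w \<in> \<Omega>. act (P w) m = act (P w) m')"
      proof -
        have "frac Mz Dn (act (P w) m) (cf (q w)) = frac Mz Dn (act (P w) m') (cf (q w)) \<longleftrightarrow> act (P w) m = act (P w) m'" for w
        proof -
          have c: "act (P w) m \<in> carrier M" "act (P w) m' \<in> carrier M" using act_closed[OF Pq(1)] m m' by auto
          show ?thesis unfolding frac_eq[OF Pq(2,3) Pq(2,3) c] using act_rt_cancel[OF Pq(2,3) c] by auto
        qed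
        then show ?thesis by simp
      qed
      also have "\<dots> \<longleftrightarrow> (\<forall>w \<in> \<Omega> \<inter> A. act (E w) (m \<ominus>\<^bsub>M\<^esub> m') = \<zero>\<^bsub>M\<^esub>)"
      proof -
        have "act (P w) m = act (P w) m' \<longleftrightarrow> (w \<in> A \<longrightarrow> act (E w) (m \<ominus>\<^bsub>M\<^esub> m') = \<zero>\<^bsub>M\<^esub>)" for w
        proof (cases "w \<in> A")
          case True
          then show ?thesis using E_props(4)[OF True] m m' minus_zero_iff[of "act (E w) m" "act (E w) m'"]
            by (simp add: P_def act_minus)
        next
          case False
          then show ?thesis using m m' act_vanish[of "\<lambda>_. 0"] by (simp add: P_def)
        qed
        then show ?thesis by blast
      qed
      also have "\<dots> \<longleftrightarrow> m \<ominus>\<^bsub>M\<^esub> m' \<in> sec (- \<Omega>)" using m m' by (auto simp: sec_def)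
      finally show "\<pi> m = \<pi> m' \<longleftrightarrow> m \<ominus>\<^bsub>N\<^esub> m' \<in> sec (- \<Omega>)" unfolding minus_N .
      show "\<pi> m \<oplus>\<^bsub>M_restr scale W I \<alpha> Mz \<Omega>\<^esub> \<pi> m' = \<pi> (m \<oplus>\<^bsub>N\<^esub> m')"
      proof -
        have mm: "m \<oplus>\<^bsub>M\<^esub> m' \<in> carrier M" using m m' by simp
        show ?thesis
          unfolding right_module_simps pi[OF m] pi[OF m'] pi[OF mm] M_restr_def
          using frac_add_frac[OF Pq(2,3), of "act (P w) m" "act (P w) m'" w for w] Pq(1) m m'
          by (auto simp: restrict_def fun_eq_iff act_plus)
      qed }
    { fix r assume r: "r \<in> S"
      have one: "(\<lambda>_. 1) \<in> S" "(\<lambda>_. 1 :: 'k) \<noteq> (\<lambda>_. 0)" by (auto simp: fun_eq_iff)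
      have rm: "act (rt r) m \<in> carrier M" using r m by simp
      have "cf r \<odot>\<^bsub>M_Q scale W I \<alpha> Mz\<^esub> frac Mz Dn (act (P w) m) (cf (q w)) = frac Mz Dn (act (P w) (act (rt r) m)) (cf (q w))" for w
        using frac_act_frac[OF cf_Z[OF r] one Pq(2,3)[of w], of "act (P w) m"] Pq(1)[of w] m zs_cf[OF r, of "act (P w) m"]
          act_comm[of "P w" "rt r" m] r
        by (simp add: M_Q_def frac_module_def Z_simps(3))
      then show "r \<odot>\<^bsub>M_restr scale W I \<alpha> Mz \<Omega>\<^esub> \<pi> m = \<pi> (r \<odot>\<^bsub>N\<^esub> m)"
        unfolding smult_N pi[OF m] pi[OF rm] M_restr_def by (auto simp: restrict_def fun_eq_iff) }
  qed
  then show ?thesis by simp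
qed

end

section \<open>The equivalence\<close>

context triangular_module
begin

text \<open>A reflection that lowers the length goes down in the Bruhat order, so the complement of
  \<open>\<Omega>\<close> is closed in the sense of \<open>tri_move\<close>. After the move,
  elements with labels outside \<open>\<Omega>\<close> lie in \<open>sec (- \<Omega>)\<close> and
  the others give a basis of the quotient.\<close>

lemma upward_rel_basis:
  assumes "upwardly_closed W I \<Omega>"
  shows "\<exists>(n::nat) b d. N.rel_basis (sec (- \<Omega>)) (carrier M) {..<n} b d"
proof -
  have closed: "t \<otimes>\<^bsub>W\<^esub> x \<in> - \<Omega>"
    if "x \<in> - \<Omega>" "x \<in> A" "t \<in> T" "t \<otimes>\<^bsub>W\<^esub> x \<in> A" "len (t \<otimes>\<^bsub>W\<^esub> x) < len x" for x t
  proof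
    assume tx: "t \<otimes>\<^bsub>W\<^esub> x \<in> \<Omega>"
    have xW: "x \<in> carrier W" "t \<otimes>\<^bsub>W\<^esub> x \<in> carrier W" using that A(2) by auto
    have "bruhat_step W I (t \<otimes>\<^bsub>W\<^esub> x) x"
      unfolding bruhat_step_def using T_mult_self[OF that(3) xW(1)] that(3,5) xW(2)
      by (intro conjI bexI[of _ t]) simp_all
    then have "bruhat_le W I (t \<otimes>\<^bsub>W\<^esub> x) x" unfolding bruhat_le_def by (rule r_into_rtranclp)
    then have "x \<in> \<Omega>" using assms tx xW(1) unfolding upwardly_closed_def by blast
    then show False using that(1) by simp
  qed
  obtain b' where t': "tri len J b' d lab" and b': "\<And>j. j \<in> J \<Longrightarrow> lab j \<in> - \<Omega> \<Longrightarrow> b' j \<in> sec (- \<Omega>)"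
    using tri_move[OF triangular closed] by blast
  note tD = triD[OF t']
  let ?K = "{j \<in> J. lab j \<in> \<Omega>}"
  have fK: "finite ?K" using tD(1) by simp
  have bc: "\<And>j. j \<in> ?K \<Longrightarrow> b' j \<in> carrier M" using tD(5) by simp
  have "N.rel_basis (sec (- \<Omega>)) (carrier M) ?K b' d"
    unfolding N.rel_basis_def
  proof (intro conjI ballI impI)
    show "finite ?K" by fact
    fix m assume m: "m \<in> carrier M"
    obtain c where c: "c \<in> J \<rightarrow> S" "m = lc J c b'" using tD(6)[OF m] by blast
    let ?L = "{j \<in> J. \<not> lab j \<in> \<Omega>}"
    have L: "finite ?L" "c \<in> ?L \<rightarrow> S" "\<And>j. j \<in> ?L \<Longrightarrow> b' j \<in> carrier M" using tD(1,5) c(1) by auto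
    have cK: "c \<in> ?K \<rightarrow> S" using c(1) by auto
    have ms: "m = lc ?K c b' \<oplus>\<^bsub>M\<^esub> lc ?L c b'" unfolding c(2) by (rule lc_split[OF tD(1) c(1) tD(5)])
    have "lc ?L c b' \<in> sec (- \<Omega>)" by (rule lc_sec[OF L(1,2)]) (use b' in auto)
    moreover have "m \<ominus>\<^bsub>M\<^esub> lc ?K c b' = lc ?L c b'"
      unfolding ms by (rule add_diff_cancel[OF lc_closed'[OF fK cK bc] lc_closed'[OF L]])
    ultimately show "\<exists>c \<in> ?K \<rightarrow> S. m \<ominus>\<^bsub>N\<^esub> lc ?K c b' \<in> sec (- \<Omega>)"
      using cK unfolding minus_N by (intro bexI[of _ c]) simp_all
  next
    fix c j assume c: "c \<in> ?K \<rightarrow> S" "lc ?K c b' \<in> sec (- \<Omega>)" and j: "j \<in> ?K"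
    define c' where "c' j = (if j \<in> ?K then c j else (\<lambda>_. 0))" for j
    have c': "c' \<in> J \<rightarrow> S" using c(1) by (auto simp: c'_def)
    have e: "{j \<in> J. lab j \<in> \<Omega> \<inter> A} = ?K" using tD(2) by auto
    have "lc ?K c' b' = lc ?K c b'" by (rule N.finsum_cong') (use c bc in \<open>auto simp: c'_def Pi_iff\<close>)
    then have "lc {j \<in> J. lab j \<in> \<Omega> \<inter> A} c' b' \<in> sec (- \<Omega>)" unfolding e using c(2) by metis
    then have "lc {j \<in> J. lab j \<in> \<Omega> \<inter> A} c' b' \<in> sec (- (\<Omega> \<inter> A))"
      by (rule sec_mono[rotated]) auto
    then have "c' j = (\<lambda>_. 0)"
      using tri_independent[OF t' c', of "\<Omega> \<inter> A" j] j tD(2) by auto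
    then show "c j = \<zero>\<^bsub>S_ring scale\<^esub>" using j by (simp add: c'_def)
  qed (use tD(3) bc in auto)
  moreover obtain h where "bij_betw h {..<card ?K} ?K"
    using ex_bij_betw_nat_finite[OF fK] unfolding atLeast0LessThan by blast
  ultimately have "N.rel_basis (sec (- \<Omega>)) (carrier M) {..<card ?K} (\<lambda>j. b' (h j)) (\<lambda>j. d (h j))"
    by (rule N.rel_basis_reindex)
  then show ?thesis by blast
qed

end

context coxeter_representation
begin

section \<open>From free quotients to a triangular basis\<close>

lemma bruhat_le_len: "bruhat_le W I x w \<Longrightarrow> x = w \<or> len x < len w"
  unfolding bruhat_le_def
  by (induction rule: rtranclp_induct) (auto simp: bruhat_step_def)

lemma upward_closure_closed:
  assumes "B \<subseteq> carrier W"
  shows "upwardly_closed W I {w \<in> carrier W. \<exists>x \<in> B. bruhat_le W I x w}"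
  unfolding upwardly_closed_def bruhat_le_def by (auto intro: rtranclp_trans)

end

context Z_lattice
begin

text \<open>Upward closures give a filtration that meets one point of A at a time, and kernels
  between consecutive quotients are free. The resulting basis is triangular for a rank finer than
  the length and is then improved to one for the length.\<close>

lemma free_imp_triangular:
  assumes free: "\<And>\<Omega>. upwardly_closed W I \<Omega> \<Longrightarrow> graded_free (S_ring scale) (M_restr scale W I \<alpha> Mz \<Omega>)"
  shows "\<exists>J b d lab. triangular_module scale W I \<rho> \<alpha> M A J b d lab"
proof -
  obtain f and n :: nat where f: "f ` A = {i. i < n}" "inj_on f A" using finite_imp_inj_to_nat_seg[OF A(1)] by blast
  \<comment> \<open>Length first, with an arbitrary numbering f of A as tie-breaker. On A the values
    of f stay below n, so the factor \<open>Suc n\<close> keeps the length dominant.\<close>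
  define r where "r x = len x * Suc n + f x" for x
  have r_less: "r x < r y" if "len x < len y" "x \<in> A" for x y
  proof -
    have "f x < n" using f(1) that(2) by auto
    then have "r x < Suc (len x) * Suc n" by (simp add: r_def)
    also have "\<dots> \<le> len y * Suc n" using that(1) by (intro mult_le_mono1) simp
    finally show ?thesis by (simp add: r_def)
  qed
  have r_inj: "x = y" if "x \<in> A" "y \<in> A" "r x = r y" for x y
  proof -
    have "len x = len y" using r_less[of x y] r_less[of y x] that by (cases "len x" "len y" rule: linorder_cases) auto
    then show ?thesis using that f(2) by (auto simp: r_def inj_on_def)
  qed
  \<comment> \<open>The upward closure of the points of rank at least i. It meets A in exactly these
    points, since going strictly up in the Bruhat order raises the length and thus the rank.\<close>
  define Om where "Om i = {w \<in> carrier W. \<exists>x \<in> {x \<in> A. i \<le> r x}. bruhat_le W I x w}" for i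
  have Om_sec: "sec (- Om i) = sec {y. r y < i}" for i
  proof -
    have 1: "A \<inter> - Om i \<subseteq> {y. r y < i}"
    proof
      fix y assume y: "y \<in> A \<inter> - Om i"
      have "bruhat_le W I y y" by (simp add: bruhat_le_def)
      then show "y \<in> {y. r y < i}" using y A(2) by (auto simp: Om_def not_le[symmetric])
    qed
    have 2: "A \<inter> {y. r y < i} \<subseteq> - Om i"
    proof
      fix y assume y: "y \<in> A \<inter> {y. r y < i}"
      show "y \<in> - Om i"
      proof
        assume "y \<in> Om i"
        then obtain x where x: "x \<in> A" "i \<le> r x" "bruhat_le W I x y" by (auto simp: Om_def)
        have "x = y \<or> r x < r y" using bruhat_le_len[OF x(3)] r_less x(1) by blast
        then show False using x y by auto
      qed
    qed
    show ?thesis using sec_mono[OF 1] sec_mono[OF 2] by blast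
  qed
  have free': "\<exists>(n::nat) b d. N.rel_basis (sec {y. r y < i}) (carrier M) {..<n} b d" for i
  proof -
    have "upwardly_closed W I (Om i)" unfolding Om_def by (rule upward_closure_closed) (use A in auto)
    moreover have "Om i \<subseteq> carrier W" by (auto simp: Om_def)
    ultimately show ?thesis using free M_restr_free_iff[of "Om i"] unfolding Om_sec by blast
  qed
  define P where "P i K b d lab \<longleftrightarrow> N.rel_basis (sec {y. r y < i}) (sec {y. r y < Suc i}) K b d \<and>
      (\<forall>j \<in> K. lab j \<in> A \<and> r (lab j) = i \<and> b j \<in> sec (insert (lab j) {y. r y < i}))"
    for i and K :: "nat set" and b d lab
  have layer: "\<exists>K b d lab. P i K b d lab" for i
  proof (cases "\<exists>x \<in> A. r x = i")
    case True
    then obtain x where x: "x \<in> A" "r x = i" by blast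
    obtain n0 :: nat and b0 d0 where B0: "N.rel_basis (sec {y. r y < i}) (carrier M) {..<n0} b0 d0" using free' by blast
    obtain n1 :: nat and b1 d1 where B1: "N.rel_basis (sec {y. r y < Suc i}) (carrier M) {..<n1} b1 d1" using free' by blast
    have sub: "sec {y. r y < i} \<subseteq> sec {y. r y < Suc i}" by (rule subsetI, erule sec_mono[rotated]) auto
    have sub': "sec {y. r y < Suc i} \<subseteq> carrier M" using sec_carrier by blast
    have cs: "submodule (carrier M) (S_ring scale) N" using N.carrier_is_submodule by simp
    obtain K b where K: "N.rel_basis (sec {y. r y < i}) (sec {y. r y < Suc i}) K b d0" "K \<subseteq> {..<n0}"
      using N.rel_basis_kernel[OF B0 B1 sec_gsubmodule sec_gsubmodule cs sub sub'] by blast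
    have "b j \<in> sec (insert x {y. r y < i})" if "j \<in> K" for j
    proof (rule sec_mono[OF _ N.rel_basisD(2)[OF K(1) that]])
      show "A \<inter> {y. r y < Suc i} \<subseteq> insert x {y. r y < i}"
        using r_inj x by (auto simp: less_Suc_eq)
    qed
    then show ?thesis using K(1) x unfolding P_def
      by (intro exI[of _ K] exI[of _ b] exI[of _ d0] exI[of _ "\<lambda>_. x"]) blast
  next
    case False
    \<comment> \<open>No point of A has rank i: the layer is zero and gets the empty basis.\<close>
    have "sec {y. r y < Suc i} \<subseteq> sec {y. r y < i}"
      by (rule subsetI, erule sec_mono[rotated]) (use False in \<open>auto simp: less_Suc_eq\<close>)
    then have "N.rel_basis (sec {y. r y < i}) (sec {y. r y < Suc i}) {} (\<lambda>_. \<zero>\<^bsub>M\<^esub>) (\<lambda>_. 0)"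
      using SSM.diff_zero sec_carrier by (auto simp: N.rel_basis_def minus_N subset_iff)
    then show ?thesis unfolding P_def by (intro exI[of _ "{}"] exI[of _ "\<lambda>_. \<zero>\<^bsub>M\<^esub>"] exI[of _ "\<lambda>_. 0"]) auto
  qed
  have "\<exists>K b d lab. \<forall>i. P i (K i) (b i) (d i) (lab i)" using layer by metis
  then obtain K :: "nat \<Rightarrow> nat set" and b d lab where
    L: "\<And>i. N.rel_basis (sec {y. r y < i}) (sec {y. r y < Suc i}) (K i) (b i) (d i)"
      "\<And>i j. j \<in> K i \<Longrightarrow> lab i j \<in> A \<and> r (lab i j) = i \<and> b i j \<in> sec (insert (lab i j) {y. r y < i})"
    unfolding P_def by blast
  obtain m where m: "\<And>x. x \<in> A \<Longrightarrow> r x < m"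
  proof -
    have "\<forall>x \<in> A. r x < Suc (Max (r ` A))" using A(1) by (simp add: less_Suc_eq_le)
    then show ?thesis using that by blast
  qed
  define J where "J = Sigma {..<m} K"
  define b1 where "b1 = (\<lambda>(i, j). b i j)"
  define d1 where "d1 = (\<lambda>(i, j). d i j)"
  define l1 where "l1 = (\<lambda>(i, j). lab i j)"
  have t: "tri r J b1 d1 l1"
    unfolding J_def b1_def d1_def l1_def by (rule tri_from_layers[OF L m])
  note tD = triD[OF t]
  have "\<exists>b'. \<forall>j \<in> J. b' j \<in> part M (d1 j) \<and> (l1 j = x \<longrightarrow> b' j \<in> sec (insert x {y. len y < len x})) \<and>
      b' j \<ominus>\<^bsub>M\<^esub> b1 j \<in> sec {y. r y < r (l1 j)}" for x
  proof -
    \<comment> \<open>The points of smaller rank to be avoided are those of the same length as x. A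
      reflection that lowers the rank cannot raise the length, and by parity it lowers it, so it
      does not leave D.\<close>
    define D where "D = insert x {y. len y < len x}"
    have "t \<otimes>\<^bsub>W\<^esub> u \<in> D" if u: "u \<in> D" "u \<in> A" "t \<in> T" "t \<otimes>\<^bsub>W\<^esub> u \<in> A" "r (t \<otimes>\<^bsub>W\<^esub> u) < r u" for u t
    proof -
      have "\<not> len u < len (t \<otimes>\<^bsub>W\<^esub> u)" using r_less[OF _ u(2), of "t \<otimes>\<^bsub>W\<^esub> u"] u(5) by auto
      moreover have "len (t \<otimes>\<^bsub>W\<^esub> u) \<noteq> len u" using even_len_reflect[OF u(3), of u] u(2) A(2) by auto
      ultimately show ?thesis using u(1) by (auto simp: D_def)
    qed
    from tri_move[OF t this] obtain b' where b': "tri r J b' d1 l1" "\<forall>j \<in> J. l1 j \<in> D \<longrightarrow> b' j \<in> sec D"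
      "\<forall>j \<in> J. b' j \<ominus>\<^bsub>M\<^esub> b1 j \<in> sec {y. r y < r (l1 j)}" by blast
    then show ?thesis using triD(3)[OF b'(1)] unfolding D_def by (intro exI[of _ b']) auto
  qed
  then obtain bb where bb: "\<And>x j. j \<in> J \<Longrightarrow> bb x j \<in> part M (d1 j)"
    "\<And>x j. j \<in> J \<Longrightarrow> l1 j = x \<Longrightarrow> bb x j \<in> sec (insert x {y. len y < len x})"
    "\<And>x j. j \<in> J \<Longrightarrow> bb x j \<ominus>\<^bsub>M\<^esub> b1 j \<in> sec {y. r y < r (l1 j)}" by metis
  \<comment> \<open>The set D differs with x, so the basis is moved once for each x and only the
    elements labelled x are kept. All of them differ from \<open>b1\<close> by terms of smaller
    rank, so they still form a triangular basis.\<close>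
  define b2 where "b2 j = bb (l1 j) j" for j
  have t2: "tri r J b2 d1 l1"
    unfolding b2_def by (rule tri_change[OF t bb(1,3)])
  note t2D = triD[OF t2]
  have "tri len J b2 d1 l1"
    unfolding tri_def
  proof (intro conjI ballI impI)
    show "finite J" by (rule t2D(1))
    show "l1 j \<in> A" "b2 j \<in> part M (d1 j)" if "j \<in> J" for j using t2D(2,3) that by auto
    show "b2 j \<in> sec (insert (l1 j) {y. len y < len (l1 j)})" if "j \<in> J" for j
      unfolding b2_def using bb(2)[OF that refl] .
    show "\<exists>c \<in> J \<rightarrow> S. u = lc J c b2" if "u \<in> carrier M" for u using t2D(6)[OF that] .
    fix x c j assume x: "x \<in> A" and c: "c \<in> J \<rightarrow> S" and s: "lc {j \<in> J. l1 j = x} c b2 \<in> sec {y. len y < len x}"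
      and j: "j \<in> J" "l1 j = x"
    \<comment> \<open>Independence transfers because sections over shorter points are sections over
      points of smaller rank.\<close>
    have "lc {j \<in> J. l1 j = x} c b2 \<in> sec {y. r y < r x}"
      by (rule sec_mono[OF _ s]) (use r_less in auto)
    then show "c j = (\<lambda>_. 0)" using t2D(7)[OF x c _ j] by blast
  qed
  then have "triangular_module scale W I \<rho> \<alpha> M A J b2 d1 l1" by unfold_locales
  then show ?thesis by blast
qed

end

context coxeter_representation
begin

text \<open>By \<open>F_nabla_object_triangular\<close> an object of \<open>\<F>\<^sub>\<nabla>\<close> is supported on the graphs of some finite set;
  the extension of the action to \<open>Z\<close> does not depend on which one is chosen.\<close>

definition supp_set :: "('v \<times> 'v \<Rightarrow> 'k, 'm) gmodule \<Rightarrow> 'w set" where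
  "supp_set M = (SOME A. \<exists>J b d lab. triangular_module scale W I \<rho> \<alpha> M A J b d lab)"

section \<open>Extension of the action to Z\<close>

lemma supp_set:
  assumes "M \<in> F_nabla_objects scale W I \<rho>"
  obtains J b d lab where "triangular_module scale W I \<rho> \<alpha> M (supp_set M) J b d lab"
  using someI_ex[OF F_nabla_object_triangular[OF assms]] unfolding supp_set_def[symmetric] by blast

text \<open>z m is characterized by s (z m) = F m for every fraction F/s representing z on the
  graphs. A fraction with nonzero s exists by interpolation, so torsion freeness makes the choice
  unique.\<close>

definition Z_act :: "('v \<times> 'v \<Rightarrow> 'k, 'm) gmodule \<Rightarrow> ('w \<Rightarrow> 'v \<Rightarrow> 'k) \<Rightarrow> 'm \<Rightarrow> 'm" where
  "Z_act M z m = (SOME m'. m' \<in> carrier M \<and> (\<forall>F \<in> SS. \<forall>s \<in> S.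
     (\<forall>x \<in> supp_set M. res x F = (\<lambda>v. s v * z x v)) \<longrightarrow> rt s \<odot>\<^bsub>M\<^esub> m' = F \<odot>\<^bsub>M\<^esub> m))"

definition Z_extension :: "('v \<times> 'v \<Rightarrow> 'k, 'm) gmodule \<Rightarrow> ('w \<Rightarrow> 'v \<Rightarrow> 'k, 'm) gmodule" where
  "Z_extension M = \<lparr>carrier = carrier M, monoid.mult = monoid.mult M, one = monoid.one M, zero = ring.zero M,
     add = ring.add M, module.smult = Z_act M, part = part M\<rparr>"

lemma Z_extension_simps [simp]:
  "carrier (Z_extension M) = carrier M" "ring.add (Z_extension M) = ring.add M" "ring.zero (Z_extension M) = ring.zero M"
  "part (Z_extension M) = part M" "Module.module.smult (Z_extension M) z m = Z_act M z m"
  by (simp_all add: Z_extension_def)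

lemma Z_act_props:
  assumes M: "M \<in> F_nabla_objects scale W I \<rho>" and z: "z \<in> Zc" and m: "m \<in> carrier M"
  shows "Z_act M z m \<in> carrier M"
    and "\<And>F s. F \<in> SS \<Longrightarrow> s \<in> S \<Longrightarrow> (\<And>x. x \<in> supp_set M \<Longrightarrow> res x F = (\<lambda>v. s v * z x v)) \<Longrightarrow>
      rt s \<odot>\<^bsub>M\<^esub> Z_act M z m = F \<odot>\<^bsub>M\<^esub> m"
proof -
  obtain J b d lab where "triangular_module scale W I \<rho> \<alpha> M (supp_set M) J b d lab" using supp_set[OF M] .
  then interpret T: triangular_module scale W I \<rho> \<alpha> M "supp_set M" J b d lab .
  have "\<exists>m'. m' \<in> carrier M \<and> (\<forall>F \<in> SS. \<forall>s \<in> S.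
     (\<forall>x \<in> supp_set M. res x F = (\<lambda>v. s v * z x v)) \<longrightarrow> rt s \<odot>\<^bsub>M\<^esub> m' = F \<odot>\<^bsub>M\<^esub> m)"
    using T.congruence_action[OF T.triangular, of z m] Z_S[OF z] Z_dvd[OF z] T.A(2) m
    unfolding T.act_def by blast
  from someI_ex[OF this] show "Z_act M z m \<in> carrier M"
    "\<And>F s. F \<in> SS \<Longrightarrow> s \<in> S \<Longrightarrow> (\<And>x. x \<in> supp_set M \<Longrightarrow> res x F = (\<lambda>v. s v * z x v)) \<Longrightarrow>
      rt s \<odot>\<^bsub>M\<^esub> Z_act M z m = F \<odot>\<^bsub>M\<^esub> m"
    unfolding Z_act_def[symmetric] by blast+
qed

lemma Z_interpolation:
  assumes "z \<in> Zc" "finite B" "B \<subseteq> carrier W"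
  shows "\<exists>D e G. D \<in> S \<and> D \<noteq> (\<lambda>_. 0) \<and> D \<in> Sp e \<and> G \<in> SS \<and>
    (\<forall>x \<in> B. res x G = (\<lambda>v. D v * z x v)) \<and> (\<forall>d. z \<in> rpart Zr d \<longrightarrow> G \<in> SSp (d + e))"
proof -
  obtain D e G where G: "linprod D" "D \<in> Sp e" "G \<in> SS" "\<forall>x \<in> B. res x G = (\<lambda>v. D v * z x v)"
    "\<forall>d. (\<forall>x \<in> B. z x \<in> Sp d) \<longrightarrow> G \<in> SSp (d + e)"
    using interpolation[OF assms(2,3), of z] Z_S[OF assms(1)] assms(3) by blast
  show ?thesis
    by (rule exI[of _ D], rule exI[of _ e], rule exI[of _ G]) (use G linprod_S linprod_nonzero assms(3) in \<open>fastforce simp: Z_simps(6)\<close>)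
qed

text \<open>Each module law is checked after multiplying by a common denominator of the elements of
  Z involved, where it becomes a law for functions on V x V.\<close>

lemma Z_extension_lattice:
  assumes M: "M \<in> F_nabla_objects scale W I \<rho>"
  shows "Z_lattice scale W I \<rho> \<alpha> M (supp_set M) (Z_extension M)"
proof -
  obtain J b d lab where "triangular_module scale W I \<rho> \<alpha> M (supp_set M) J b d lab" using supp_set[OF M] .
  then interpret T: triangular_module scale W I \<rho> \<alpha> M "supp_set M" J b d lab .
  note cl = Z_act_props(1)[OF M]
  have eq: "T.act (rt s) (Z_act M z m) = T.act F m"
    if "z \<in> Zc" "m \<in> carrier M" "F \<in> SS" "s \<in> S" "\<And>x. x \<in> supp_set M \<Longrightarrow> res x F = (\<lambda>v. s v * z x v)" for F s z m
    unfolding T.act_def by (rule Z_act_props(2)[OF M that])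
  have im: "Z_act M (im F) m = T.act F m" if "F \<in> SS" "m \<in> carrier M" for F m
  proof -
    have "T.act (rt (\<lambda>_. 1)) (Z_act M (im F) m) = T.act F m"
      by (rule eq) (use that T.A(2) in \<open>auto simp: subset_iff\<close>)
    then show ?thesis using cl[OF im_Z[OF that(1)] that(2)] by (simp add: rt_simps)
  qed
  note int = Z_interpolation[OF _ T.A]
  show ?thesis
  proof (unfold_locales)
    show "graded_module Zr (Z_extension M)"
    proof (rule graded_module_transfer[OF T.SS_graded Z_cring])
      fix y z m assume y: "y \<in> Zc" and z: "z \<in> Zc" and m: "m \<in> carrier M"
      obtain D e G where G: "D \<in> S" "D \<noteq> (\<lambda>_. 0)" "G \<in> SS" "\<And>x. x \<in> supp_set M \<Longrightarrow> res x G = (\<lambda>v. D v * y x v)"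
        using int[OF y] by blast
      obtain D' e' G' where G': "D' \<in> S" "D' \<noteq> (\<lambda>_. 0)" "G' \<in> SS" "\<And>x. x \<in> supp_set M \<Longrightarrow> res x G' = (\<lambda>v. D' v * z x v)"
        using int[OF z] by blast
      define DD where "DD = (\<lambda>v. D v * D' v)"
      have DD: "DD \<in> S" "DD \<noteq> (\<lambda>_. 0)" using S_mult_nonzero G G' by (auto simp: DD_def)
      have xW: "x \<in> carrier W" if "x \<in> supp_set M" for x using that T.A(2) by blast
      have DDm: "T.act (rt DD) u = T.act (rt D) (T.act (rt D') u)" if "u \<in> carrier M" for u
        using T.act_mult[of "rt D" "rt D'" u] G G' that by (simp add: DD_def rt_simps)
      have "Z_act M (y \<oplus>\<^bsub>Zr\<^esub> z) m = Z_act M y m \<oplus>\<^bsub>M\<^esub> Z_act M z m"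
      proof (rule T.act_rt_cancel[OF DD])
        have yz: "y \<oplus>\<^bsub>Zr\<^esub> z \<in> Zc" using Z_add_closed y z .
        have F: "(\<lambda>p. rt D' p * G p) \<in> SS" "(\<lambda>p. rt D p * G' p) \<in> SS" using G G' by auto
        have "T.act (rt DD) (Z_act M (y \<oplus>\<^bsub>Zr\<^esub> z) m) = T.act (\<lambda>p. rt D' p * G p + rt D p * G' p) m"
          by (rule eq[OF yz m]) (use F DD(1) G(4) G'(4) xW in \<open>auto simp: Z_simps(5) DD_def algebra_simps\<close>)
        also have "\<dots> = T.act (rt D') (T.act G m) \<oplus>\<^bsub>M\<^esub> T.act (rt D) (T.act G' m)"
          using T.act_add[OF F m] T.act_mult G G' m by simp
        also have "T.act G m = T.act (rt D) (Z_act M y m)" using eq[OF y m G(3,1,4)] by simp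
        also have "T.act G' m = T.act (rt D') (Z_act M z m)" using eq[OF z m G'(3,1,4)] by simp
        also have "T.act (rt D') (T.act (rt D) (Z_act M y m)) = T.act (rt DD) (Z_act M y m)"
          using DDm[OF cl[OF y m]] T.act_comm G G' cl[OF y m] by simp
        also have "T.act (rt D) (T.act (rt D') (Z_act M z m)) = T.act (rt DD) (Z_act M z m)"
          using DDm[OF cl[OF z m]] by simp
        also have "T.act (rt DD) (Z_act M y m) \<oplus>\<^bsub>M\<^esub> T.act (rt DD) (Z_act M z m) =
          T.act (rt DD) (Z_act M y m \<oplus>\<^bsub>M\<^esub> Z_act M z m)"
          using T.act_plus[of "rt DD"] DD cl[OF y m] cl[OF z m] by simp
        finally show "T.act (rt DD) (Z_act M (y \<oplus>\<^bsub>Zr\<^esub> z) m) = T.act (rt DD) (Z_act M y m \<oplus>\<^bsub>M\<^esub> Z_act M z m)" .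
      qed (use cl y z m Z_add_closed in auto)
      then show "(y \<oplus>\<^bsub>Zr\<^esub> z) \<odot>\<^bsub>Z_extension M\<^esub> m = y \<odot>\<^bsub>Z_extension M\<^esub> m \<oplus>\<^bsub>M\<^esub> z \<odot>\<^bsub>Z_extension M\<^esub> m" by simp
      have "Z_act M (y \<otimes>\<^bsub>Zr\<^esub> z) m = Z_act M y (Z_act M z m)"
      proof (rule T.act_rt_cancel[OF DD])
        have yz: "y \<otimes>\<^bsub>Zr\<^esub> z \<in> Zc" using Z_mult_closed y z .
        have "T.act (rt DD) (Z_act M (y \<otimes>\<^bsub>Zr\<^esub> z) m) = T.act (\<lambda>p. G p * G' p) m"
          by (rule eq[OF yz m]) (use DD(1) G(3,4) G'(3,4) xW in \<open>auto simp: Z_simps(2) DD_def algebra_simps\<close>)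
        also have "\<dots> = T.act G (T.act G' m)" using T.act_mult G G' m by simp
        also have "T.act G' m = T.act (rt D') (Z_act M z m)" using eq[OF z m G'(3,1,4)] by simp
        also have "T.act G (T.act (rt D') (Z_act M z m)) = T.act (rt D') (T.act G (Z_act M z m))"
          using T.act_comm G G' cl[OF z m] by simp
        also have "T.act G (Z_act M z m) = T.act (rt D) (Z_act M y (Z_act M z m))"
          using eq[OF y cl[OF z m] G(3,1,4)] by simp
        also have "T.act (rt D') (T.act (rt D) (Z_act M y (Z_act M z m))) = T.act (rt DD) (Z_act M y (Z_act M z m))"
          using DDm[OF cl[OF y cl[OF z m]]] T.act_comm G G' cl[OF y cl[OF z m]] by simp
        finally show "T.act (rt DD) (Z_act M (y \<otimes>\<^bsub>Zr\<^esub> z) m) = T.act (rt DD) (Z_act M y (Z_act M z m))" .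
      qed (use cl y z m Z_mult_closed in auto)
      then show "(y \<otimes>\<^bsub>Zr\<^esub> z) \<odot>\<^bsub>Z_extension M\<^esub> m = y \<odot>\<^bsub>Z_extension M\<^esub> (z \<odot>\<^bsub>Z_extension M\<^esub> m)" by simp
    next
      fix z m m' assume z: "z \<in> Zc" and m: "m \<in> carrier M" "m' \<in> carrier M"
      obtain D e G where G: "D \<in> S" "D \<noteq> (\<lambda>_. 0)" "G \<in> SS" "\<And>x. x \<in> supp_set M \<Longrightarrow> res x G = (\<lambda>v. D v * z x v)"
        using int[OF z] by blast
      have mm: "m \<oplus>\<^bsub>M\<^esub> m' \<in> carrier M" using m by simp
      have "Z_act M z (m \<oplus>\<^bsub>M\<^esub> m') = Z_act M z m \<oplus>\<^bsub>M\<^esub> Z_act M z m'"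
      proof (rule T.act_rt_cancel[OF G(1,2)])
        have "T.act (rt D) (Z_act M z (m \<oplus>\<^bsub>M\<^esub> m')) = T.act G m \<oplus>\<^bsub>M\<^esub> T.act G m'"
          using eq[OF z mm G(3,1,4)] T.act_plus[OF G(3) m] by simp
        also have "\<dots> = T.act (rt D) (Z_act M z m \<oplus>\<^bsub>M\<^esub> Z_act M z m')"
          using eq[OF z m(1) G(3,1,4)] eq[OF z m(2) G(3,1,4)] T.act_plus[of "rt D"] G cl[OF z m(1)] cl[OF z m(2)] by simp
        finally show "T.act (rt D) (Z_act M z (m \<oplus>\<^bsub>M\<^esub> m')) = T.act (rt D) (Z_act M z m \<oplus>\<^bsub>M\<^esub> Z_act M z m')" .
      qed (use cl z m mm in auto)
      then show "z \<odot>\<^bsub>Z_extension M\<^esub> (m \<oplus>\<^bsub>M\<^esub> m') = z \<odot>\<^bsub>Z_extension M\<^esub> m \<oplus>\<^bsub>M\<^esub> z \<odot>\<^bsub>Z_extension M\<^esub> m'" by simp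
    next
      fix m assume m: "m \<in> carrier M"
      show "\<one>\<^bsub>Zr\<^esub> \<odot>\<^bsub>Z_extension M\<^esub> m = m" using im[OF const_SS m, of 1] m by (simp add: im_hom)
    next
      fix i j z m assume zp: "z \<in> rpart Zr i" and mp: "m \<in> part M j"
      have z: "z \<in> Zc" using zp by (simp add: Z_simps(6))
      have m: "m \<in> carrier M" using mp T.SSM.part_carrier by blast
      obtain D e G where G: "D \<in> S" "D \<noteq> (\<lambda>_. 0)" "D \<in> Sp e" "G \<in> SS" "\<And>x. x \<in> supp_set M \<Longrightarrow> res x G = (\<lambda>v. D v * z x v)"
        "\<And>d. z \<in> rpart Zr d \<Longrightarrow> G \<in> SSp (d + e)" using int[OF z] by blast
      note zm = cl[OF z m]
      have "T.act G m \<in> part M (i + e + j)" unfolding T.act_def using T.SSM.part_smult[OF G(6)[OF zp] mp] .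
      then have Dz: "T.act (rt D) (Z_act M z m) \<in> part M (i + e + j)" using eq[OF z m G(4,1,5)] by simp
      \<comment> \<open>D is homogeneous of degree e, so it embeds the component of degree n of z m
        into the component of degree e + n of D z m, which is zero unless n = i + j.\<close>
      have "T.SSM.hc n (Z_act M z m) = \<zero>\<^bsub>M\<^esub>" if n: "n \<noteq> i + j" for n
      proof -
        have "T.act (rt D) (T.SSM.hc n (Z_act M z m)) = T.SSM.hc (e + n) (T.act (rt D) (Z_act M z m))"
          unfolding T.act_def using T.SSM.hc_smult[OF rt_SSp[OF G(3)] zm] by simp
        also have "\<dots> = \<zero>\<^bsub>M\<^esub>" using T.SSM.hc_part[OF Dz, of "e + n"] n by simp
        finally show ?thesis using T.act_rt_zero[OF G(1,2)] zm by blast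
      qed
      then show "z \<odot>\<^bsub>Z_extension M\<^esub> m \<in> part M (i + j)" using T.SSM.part_iff_hc[OF zm] by simp
    qed (use cl in auto)
    show "im F \<odot>\<^bsub>Z_extension M\<^esub> m = F \<odot>\<^bsub>M\<^esub> m" if "F \<in> SS" "m \<in> carrier M" for F m
      using im[OF that] by (simp add: T.act_def)
    show "acts_through scale W I \<alpha> (Z_extension M) (supp_set M)"
      unfolding acts_through_def
    proof (intro ballI impI)
      fix y z :: "'w \<Rightarrow> 'v \<Rightarrow> 'k" and m assume "restrict y (supp_set M) = restrict z (supp_set M)"
      then have "\<And>x. x \<in> supp_set M \<Longrightarrow> y x = z x" unfolding restrict_eq_iff by blast
      then have "Z_act M y m = Z_act M z m" unfolding Z_act_def by (simp cong: ball_cong)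
      then show "y \<odot>\<^bsub>Z_extension M\<^esub> m = z \<odot>\<^bsub>Z_extension M\<^esub> m" by simp
    qed
  qed simp_all
qed

lemma Z_extension_object:
  assumes M: "M \<in> F_nabla_objects scale W I \<rho>"
  shows "Z_extension M \<in> V_objects scale W I \<alpha>"
proof -
  obtain J b d lab where "triangular_module scale W I \<rho> \<alpha> M (supp_set M) J b d lab" using supp_set[OF M] .
  then interpret T: triangular_module scale W I \<rho> \<alpha> M "supp_set M" J b d lab .
  interpret L: Z_lattice scale W I \<rho> \<alpha> M "supp_set M" "Z_extension M" by (rule Z_extension_lattice[OF M])
  note tD = T.triD[OF T.triangular]
  let ?N = "restrict_scalars W (Z_extension M)"
  have rs: "carrier ?N = carrier M" "ring.zero ?N = ring.zero M" "ring.add ?N = ring.add M"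
    by (simp_all add: restrict_scalars_def)
  have sm: "s \<odot>\<^bsub>?N\<^esub> m = s \<odot>\<^bsub>T.N\<^esub> m" if "s \<in> S" "m \<in> carrier M" for s m
    using L.zs_cf[OF that] by (simp add: restrict_scalars_def L.zs_def T.act_def)
  have fe: "finsum ?N = finsum T.N" by (rule finsum_transfer(1)) (simp_all add: rs)
  \<comment> \<open>\<open>fin_gen\<close> indexes coefficients by the generators themselves, so
    distinct indices must give distinct generators before coefficients can be carried over.\<close>
  have inj: "inj_on b J"
  proof (rule inj_onI, rule ccontr)
    fix i j assume ij: "i \<in> J" "j \<in> J" "b i = b j" "i \<noteq> j"
    define c where "c k = (if k = i then \<one>\<^bsub>S_ring scale\<^esub> else \<zero>\<^bsub>S_ring scale\<^esub>)" for k
    define c' where "c' k = (if k = j then \<one>\<^bsub>S_ring scale\<^esub> else \<zero>\<^bsub>S_ring scale\<^esub>)" for k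
    have bN: "b \<in> J \<rightarrow> carrier T.N" using tD(5) by auto
    have cS: "c \<in> J \<rightarrow> S" "c' \<in> J \<rightarrow> S" "(\<lambda>k v. c k v - c' k v) \<in> J \<rightarrow> S" by (auto simp: c_def c'_def)
    have "T.lc J c b = \<one>\<^bsub>S_ring scale\<^esub> \<odot>\<^bsub>T.N\<^esub> b i" unfolding c_def
      by (rule T.N.lc_single[OF tD(1) ij(1) bN]) simp
    moreover have "T.lc J c' b = \<one>\<^bsub>S_ring scale\<^esub> \<odot>\<^bsub>T.N\<^esub> b j" unfolding c'_def
      by (rule T.N.lc_single[OF tD(1) ij(2) bN]) simp
    ultimately have "T.lc J c b = T.lc J c' b" using ij(3) by simp
    then have "T.lc J (\<lambda>k v. c k v - c' k v) b = \<zero>\<^bsub>M\<^esub>"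
      using T.lc_minus'[OF tD(1) cS(1,2) tD(5)] T.minus_zero_iff T.lc_closed'[OF tD(1) cS(1) tD(5)]
        T.lc_closed'[OF tD(1) cS(2) tD(5)] by simp
    moreover have "{j \<in> J. lab j \<in> supp_set M} = J" using tD(2) by auto
    ultimately have "T.lc {j \<in> J. lab j \<in> supp_set M} (\<lambda>k v. c k v - c' k v) b \<in> T.sec (- supp_set M)" by simp
    then have "(\<lambda>v. c i v - c' i v) = (\<lambda>_. 0)"
      using T.tri_independent[OF T.triangular cS(3) subset_refl _ ij(1) tD(2)[OF ij(1)]] by blast
    then show False using ij(4) by (simp add: c_def c'_def fun_eq_iff)
  qed
  have "fin_gen (S_ring scale) ?N"
    unfolding fin_gen_def
  proof (intro exI[of _ "b ` J"] conjI ballI)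
    show "finite (b ` J)" using tD(1) by simp
    show "b ` J \<subseteq> carrier ?N" using tD(5) by (auto simp: rs)
    fix m assume "m \<in> carrier ?N"
    then have m: "m \<in> carrier M" by (simp add: rs)
    obtain c where c: "c \<in> J \<rightarrow> S" "m = T.lc J c b" using tD(6)[OF m] by blast
    define c' where "c' u = c (the_inv_into J b u)" for u
    have c'b: "c' (b j) = c j" if "j \<in> J" for j using the_inv_into_f_f[OF inj that] by (simp add: c'_def)
    have c': "c' \<in> b ` J \<rightarrow> S" using c'b c(1) by auto
    have cl: "c' u \<in> S" "u \<in> carrier M" if "u \<in> b ` J" for u using that c' tD(5) by auto
    have fN: "(\<lambda>u. c' u \<odot>\<^bsub>T.N\<^esub> u) \<in> b ` J \<rightarrow> carrier T.N"
    proof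
      fix u assume "u \<in> b ` J"
      then have "c' u \<in> S" "u \<in> carrier T.N" using cl by auto
      then show "c' u \<odot>\<^bsub>T.N\<^esub> u \<in> carrier T.N" by (rule T.N.smult_closed)
    qed
    have "(\<Oplus>\<^bsub>?N\<^esub>u \<in> b ` J. c' u \<odot>\<^bsub>?N\<^esub> u) = (\<Oplus>\<^bsub>T.N\<^esub>u \<in> b ` J. c' u \<odot>\<^bsub>?N\<^esub> u)"
      by (simp only: fe)
    also have "\<dots> = (\<Oplus>\<^bsub>T.N\<^esub>u \<in> b ` J. c' u \<odot>\<^bsub>T.N\<^esub> u)"
      by (rule T.N.finsum_cong'[OF refl fN]) (use sm cl in auto)
    also have "\<dots> = (\<Oplus>\<^bsub>T.N\<^esub>j \<in> J. c' (b j) \<odot>\<^bsub>T.N\<^esub> b j)"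
      by (rule T.N.finsum_reindex[OF fN inj])
    also have "\<dots> = T.lc J c b"
    proof (rule T.N.finsum_cong'[OF refl])
      show "(\<lambda>j. c j \<odot>\<^bsub>T.N\<^esub> b j) \<in> J \<rightarrow> carrier T.N"
      proof
        fix j assume j: "j \<in> J"
        then have "c j \<in> S" "b j \<in> carrier T.N" using c(1) tD(5) by auto
        then show "c j \<odot>\<^bsub>T.N\<^esub> b j \<in> carrier T.N" by (rule T.N.smult_closed)
      qed
    qed (simp add: c'b)
    finally show "\<exists>c \<in> b ` J \<rightarrow> S. m = (\<Oplus>\<^bsub>?N\<^esub>u \<in> b ` J. c u \<odot>\<^bsub>?N\<^esub> u)" using c(2) c' by (intro bexI[of _ c']) simp_all
  qed
  moreover have "torsion_free (S_ring scale) ?N"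
    unfolding torsion_free_def rs using sm T.torsion_free by simp
  ultimately have "Z_extension M \<in> Z_mod_f_objects scale W I \<alpha>"
    unfolding Z_mod_f_objects_def using L.Z_graded L.through T.A by blast
  moreover have "graded_free (S_ring scale) (M_restr scale W I \<alpha> (Z_extension M) \<Omega>)" if "upwardly_closed W I \<Omega>" for \<Omega>
    using L.M_restr_free_iff[of \<Omega>] T.upward_rel_basis[OF that] that by (simp add: upwardly_closed_def)
  ultimately show ?thesis by (simp add: V_objects_def)
qed

text \<open>If Z acts through A, then a function vanishing on the graphs over A acts like the zero
  of Z.\<close>

lemma V_object_lattice:
  assumes M: "M \<in> V_objects scale W I \<alpha>"
  shows "\<exists>A. Z_lattice scale W I \<rho> \<alpha> (SS_restriction M) A M"
proof -
  have gM: "graded_module Zr M" and tf: "torsion_free (S_ring scale) (restrict_scalars W M)"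
    using M by (auto simp: V_objects_def Z_mod_f_objects_def)
  obtain A where A: "finite A" "A \<subseteq> carrier W" "acts_through scale W I \<alpha> M A"
    using M by (auto simp: V_objects_def Z_mod_f_objects_def)
  interpret Z: Module.module Zr M using gM by (simp add: graded_module_def)
  have "Z_lattice scale W I \<rho> \<alpha> (SS_restriction M) A M"
  proof unfold_locales
    show "graded_module (SS_ring scale) (SS_restriction M)" by (rule SS_restriction_graded[OF gM])
    show "s = (\<lambda>_. 0) \<or> m = \<zero>\<^bsub>SS_restriction M\<^esub>"
      if "s \<in> S" "m \<in> carrier (SS_restriction M)" "rt s \<odot>\<^bsub>SS_restriction M\<^esub> m = \<zero>\<^bsub>SS_restriction M\<^esub>" for s m
      using tf that by (simp add: torsion_free_def restrict_scalars_def im_rt)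
    show "F \<odot>\<^bsub>SS_restriction M\<^esub> m = \<zero>\<^bsub>SS_restriction M\<^esub>"
      if "F \<in> SS" "\<And>x. x \<in> A \<Longrightarrow> res x F = (\<lambda>_. 0)" "m \<in> carrier (SS_restriction M)" for F m
    proof -
      have m: "m \<in> carrier M" using that by simp
      have "restrict (im F) A = restrict \<zero>\<^bsub>Zr\<^esub> A"
        unfolding restrict_eq_iff using that(2) A(2) by (auto simp: Z_simps(4))
      then have "im F \<odot>\<^bsub>M\<^esub> m = \<zero>\<^bsub>Zr\<^esub> \<odot>\<^bsub>M\<^esub> m"
        using A(3) im_Z[OF that(1)] Z.R.zero_closed m unfolding acts_through_def by blast
      then show ?thesis using Z.smult_l_null[OF m] by simp
    qed
  qed (use A gM in auto)
  then show ?thesis by blast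
qed

lemma SS_restriction_object:
  assumes M: "M \<in> V_objects scale W I \<alpha>"
  shows "SS_restriction M \<in> F_nabla_objects scale W I \<rho>"
proof -
  obtain A where "Z_lattice scale W I \<rho> \<alpha> (SS_restriction M) A M" using V_object_lattice[OF M] by blast
  then interpret L: Z_lattice scale W I \<rho> \<alpha> "SS_restriction M" A M .
  have "\<And>\<Omega>. upwardly_closed W I \<Omega> \<Longrightarrow> graded_free (S_ring scale) (M_restr scale W I \<alpha> M \<Omega>)"
    using M by (simp add: V_objects_def)
  from L.free_imp_triangular[OF this] obtain J b d lab
    where "triangular_module scale W I \<rho> \<alpha> (SS_restriction M) A J b d lab" by blast
  then show ?thesis by (rule triangular_module.F_nabla_object)
qed

lemma Z_act_im:
  assumes M: "M \<in> F_nabla_objects scale W I \<rho>" and F: "F \<in> SS" and m: "m \<in> carrier M"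
  shows "Z_act M (im F) m = F \<odot>\<^bsub>M\<^esub> m"
proof -
  interpret L: Z_lattice scale W I \<rho> \<alpha> M "supp_set M" "Z_extension M" by (rule Z_extension_lattice[OF M])
  show ?thesis using L.smult_im[OF F m] by simp
qed

text \<open>The set chosen for the restricted module may differ from the set A through which Z acts,
  so z is interpolated on the union. Then D times either side equals G m.\<close>

lemma Z_act_SS_restriction:
  assumes M: "M \<in> V_objects scale W I \<alpha>" and z: "z \<in> Zc" and m: "m \<in> carrier M"
  shows "Z_act (SS_restriction M) z m = z \<odot>\<^bsub>M\<^esub> m"
proof -
  obtain A where "Z_lattice scale W I \<rho> \<alpha> (SS_restriction M) A M" using V_object_lattice[OF M] by blast
  then interpret L: Z_lattice scale W I \<rho> \<alpha> "SS_restriction M" A M .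
  have F: "SS_restriction M \<in> F_nabla_objects scale W I \<rho>" by (rule SS_restriction_object[OF M])
  obtain J b d lab where "triangular_module scale W I \<rho> \<alpha> (SS_restriction M) (supp_set (SS_restriction M)) J b d lab" using supp_set[OF F] .
  then interpret T: triangular_module scale W I \<rho> \<alpha> "SS_restriction M" "supp_set (SS_restriction M)" J b d lab .
  have fin: "finite (A \<union> supp_set (SS_restriction M))" "A \<union> supp_set (SS_restriction M) \<subseteq> carrier W"
    using L.A T.A by auto
  obtain D e G where G: "D \<in> S" "D \<noteq> (\<lambda>_. 0)" "G \<in> SS" "\<And>x. x \<in> A \<union> supp_set (SS_restriction M) \<Longrightarrow> res x G = (\<lambda>v. D v * z x v)"
    using Z_interpolation[OF z fin] by blast
  have m': "m \<in> carrier (SS_restriction M)" using m by simp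
  have zm: "Z_act (SS_restriction M) z m \<in> carrier (SS_restriction M)" using Z_act_props(1)[OF F z m'] .
  have "L.act (rt D) (Z_act (SS_restriction M) z m) = L.act G m"
    unfolding L.act_def by (rule Z_act_props(2)[OF F z m' G(3,1)]) (use G(4) in auto)
  also have "\<dots> = L.zs (im G) m" using L.zs_im[OF G(3) m'] by simp
  also have "\<dots> = L.zs (cf D \<otimes>\<^bsub>Zr\<^esub> z) m"
  proof (rule L.zs_through[OF L.through])
    fix w assume "w \<in> A"
    then show "im G w = (cf D \<otimes>\<^bsub>Zr\<^esub> z) w" using G(4)[of w] L.A(2) by (auto simp: Z_simps(2))
  qed (use G z m' Z_mult_closed in auto)
  also have "\<dots> = L.act (rt D) (L.zs z m)"
    using L.zs_mult[OF _ z m', of "cf D"] L.zs_cf[OF G(1) L.zs_closed[OF z m']] G(1) by simp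
  finally have "Z_act (SS_restriction M) z m = L.zs z m"
    by (rule L.act_rt_cancel[OF G(1,2) zm L.zs_closed[OF z m']])
  then show ?thesis by (simp add: L.zs_def)
qed

text \<open>Clear denominators by one fraction G/D that represents z on the supports of both
  modules: f commutes with G and with D, and Y is torsion free.\<close>

lemma SS_hom_imp_Z_hom:
  assumes X: "X \<in> F_nabla_objects scale W I \<rho>" and Y: "Y \<in> F_nabla_objects scale W I \<rho>"
    and f: "f \<in> gmod_hom (SS_ring scale) X Y"
  shows "f \<in> gmod_hom Zr (Z_extension X) (Z_extension Y)"
proof -
  obtain J b d lab where "triangular_module scale W I \<rho> \<alpha> X (supp_set X) J b d lab" using supp_set[OF X] .
  then interpret TX: triangular_module scale W I \<rho> \<alpha> X "supp_set X" J b d lab .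
  obtain J' b' d' lab' where "triangular_module scale W I \<rho> \<alpha> Y (supp_set Y) J' b' d' lab'" using supp_set[OF Y] .
  then interpret TY: triangular_module scale W I \<rho> \<alpha> Y "supp_set Y" J' b' d' lab' .
  have fin: "finite (supp_set X \<union> supp_set Y)" "supp_set X \<union> supp_set Y \<subseteq> carrier W" using TX.A TY.A by auto
  have fc: "f x \<in> carrier Y" if "x \<in> carrier X" for x using f that by (auto simp: gmod_hom_def)
  have fs: "f (F \<odot>\<^bsub>X\<^esub> x) = F \<odot>\<^bsub>Y\<^esub> f x" if "F \<in> SS" "x \<in> carrier X" for F x
    using f that unfolding gmod_hom_def by blast
  have "f (Z_act X z m) = Z_act Y z (f m)" if z: "z \<in> Zc" and m: "m \<in> carrier X" for z m
  proof -
    obtain D e G where G: "D \<in> S" "D \<noteq> (\<lambda>_. 0)" "G \<in> SS" "\<And>x. x \<in> supp_set X \<union> supp_set Y \<Longrightarrow> res x G = (\<lambda>v. D v * z x v)"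
      using Z_interpolation[OF z fin] by blast
    have rD: "rt D \<in> SS" using G by simp
    note zX = Z_act_props[OF X z m] and zY = Z_act_props[OF Y z fc[OF m]]
    have "rt D \<odot>\<^bsub>Y\<^esub> f (Z_act X z m) = f (rt D \<odot>\<^bsub>X\<^esub> Z_act X z m)" using fs[OF rD zX(1)] by simp
    also have "rt D \<odot>\<^bsub>X\<^esub> Z_act X z m = G \<odot>\<^bsub>X\<^esub> m" by (rule zX(2)[OF G(3,1)]) (use G(4) in auto)
    also have "f (G \<odot>\<^bsub>X\<^esub> m) = G \<odot>\<^bsub>Y\<^esub> f m" using fs[OF G(3) m] .
    also have "\<dots> = rt D \<odot>\<^bsub>Y\<^esub> Z_act Y z (f m)" by (rule zY(2)[OF G(3,1), symmetric]) (use G(4) in auto)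
    finally show ?thesis using TY.act_rt_cancel[OF G(1,2) fc[OF zX(1)] zY(1)] by (simp add: TY.act_def)
  qed
  then show ?thesis using f unfolding gmod_hom_def by simp
qed

lemma Z_hom_imp_SS_hom:
  "f \<in> gmod_hom Zr X Y \<Longrightarrow> f \<in> gmod_hom (SS_ring scale) (SS_restriction X) (SS_restriction Y)"
  unfolding gmod_hom_def by simp

end

section \<open>Categories of graded modules and the natural isomorphisms\<close>

lemma gmod_category_category:
  assumes "\<And>M. M \<in> Os \<Longrightarrow> graded_module R M"
  shows "category (gmod_category R Os)"
proof
  have mod: "Module.module R M" "\<And>n. part M n \<subseteq> carrier M" if "M \<in> Os" for M
    using assms[OF that] by (auto simp: graded_module_def dest!: additive_subgroup.a_subset)
  show "Ide (gmod_category R Os) X \<in> Arr (gmod_category R Os) X X" if "X \<in> Obj (gmod_category R Os)" for X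
  proof -
    have X: "X \<in> Os" using that by (simp add: gmod_category_def)
    interpret Module.module R X using mod(1)[OF X] .
    show ?thesis using mod(2)[OF X] by (auto simp: gmod_category_def gmod_hom_def)
  qed
  show "Cmp (gmod_category R Os) X Y Z g f \<in> Arr (gmod_category R Os) X Z"
    if "X \<in> Obj (gmod_category R Os)" "Y \<in> Obj (gmod_category R Os)" "Z \<in> Obj (gmod_category R Os)"
      "f \<in> Arr (gmod_category R Os) X Y" "g \<in> Arr (gmod_category R Os) Y Z" for X Y Z f g
  proof -
    have X: "X \<in> Os" using that by (simp add: gmod_category_def)
    interpret Module.module R X using mod(1)[OF X] .
    have f: "f \<in> gmod_hom R X Y" and g: "g \<in> gmod_hom R Y Z" using that by (simp_all add: gmod_category_def)
    have fc: "\<And>x. x \<in> carrier X \<Longrightarrow> f x \<in> carrier Y" using f by (auto simp: gmod_hom_def)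
    have gc: "\<And>x. x \<in> carrier Y \<Longrightarrow> g x \<in> carrier Z" using g by (auto simp: gmod_hom_def)
    have "compose (carrier X) g f \<in> gmod_hom R X Z"
      unfolding gmod_hom_def
    proof (intro CollectI conjI ballI allI)
      show "compose (carrier X) g f \<in> carrier X \<rightarrow>\<^sub>E carrier Z" using fc gc by (auto simp: compose_def)
      show "compose (carrier X) g f (x \<oplus>\<^bsub>X\<^esub> y) = compose (carrier X) g f x \<oplus>\<^bsub>Z\<^esub> compose (carrier X) g f y"
        if "x \<in> carrier X" "y \<in> carrier X" for x y
        using f g that fc by (simp add: gmod_hom_def compose_def)
      show "compose (carrier X) g f (r \<odot>\<^bsub>X\<^esub> x) = r \<odot>\<^bsub>Z\<^esub> compose (carrier X) g f x"
        if "r \<in> carrier R" "x \<in> carrier X" for r x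
        using f g that fc by (simp add: gmod_hom_def compose_def)
      show "compose (carrier X) g f ` part X n \<subseteq> part Z n" for n
      proof -
        have "f ` part X n \<subseteq> part Y n" "g ` part Y n \<subseteq> part Z n" using f g by (simp_all add: gmod_hom_def)
        then show ?thesis using mod(2)[OF X, of n] by (auto simp: compose_def)
      qed
    qed
    then show ?thesis by (simp add: gmod_category_def)
  qed
  show "Cmp (gmod_category R Os) X X Y f (Ide (gmod_category R Os) X) = f"
    if "f \<in> Arr (gmod_category R Os) X Y" for X Y f
    using that by (auto simp: gmod_category_def gmod_hom_def compose_def restrict_def PiE_def extensional_def fun_eq_iff)
  show "Cmp (gmod_category R Os) X Y Y (Ide (gmod_category R Os) Y) f = f"
    if "f \<in> Arr (gmod_category R Os) X Y" for X Y f
    using that by (auto simp: gmod_category_def gmod_hom_def compose_def restrict_def PiE_def extensional_def fun_eq_iff Pi_iff)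
  show "Cmp (gmod_category R Os) X Y U (Cmp (gmod_category R Os) Y Z U h g) f =
      Cmp (gmod_category R Os) X Z U h (Cmp (gmod_category R Os) X Y Z g f)"
    if "f \<in> Arr (gmod_category R Os) X Y" for X Y Z U f g h
    using that by (auto simp: gmod_category_def gmod_hom_def compose_def restrict_def PiE_def Pi_iff fun_eq_iff)
qed

lemma identity_gmod_hom:
  assumes "Module.module R M" "\<And>n. part M n \<subseteq> carrier M"
    and "carrier N = carrier M" "ring.add N = ring.add M" "part N = part M"
    and "\<And>r m. r \<in> carrier R \<Longrightarrow> m \<in> carrier M \<Longrightarrow> r \<odot>\<^bsub>N\<^esub> m = r \<odot>\<^bsub>M\<^esub> m"
  shows "(\<lambda>x \<in> carrier M. x) \<in> gmod_hom R M N" "(\<lambda>x \<in> carrier M. x) \<in> gmod_hom R N M"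
proof -
  interpret Module.module R M by fact
  show "(\<lambda>x \<in> carrier M. x) \<in> gmod_hom R M N" "(\<lambda>x \<in> carrier M. x) \<in> gmod_hom R N M"
    using assms(2-6) by (auto simp: gmod_hom_def)
qed

theorem theorem4p3:
  fixes scale :: "'k::field \<Rightarrow> 'v::ab_group_add \<Rightarrow> 'v"
    and W :: "'w monoid" and I :: "'w set" and \<rho> :: "'w \<Rightarrow> 'v \<Rightarrow> 'v"
    and \<alpha> :: "'w \<Rightarrow> 'v \<Rightarrow> 'k" and v :: 'v
  assumes "infinite (UNIV :: 'k set)" and "(2::'k) \<noteq> 0"
    and "coxeter_system W I"
    and "reflection_faithful_rep scale W I \<rho>"
    and "\<forall>t \<in> reflections W I. \<alpha> t \<in> dual_space scale \<and> \<alpha> t \<noteq> (\<lambda>_. 0) \<and>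
           (\<forall>u \<in> fixed_space \<rho> t. \<alpha> t u = 0)"
    and "\<forall>x \<in> carrier W. \<rho> x v = v \<longrightarrow> x = \<one>\<^bsub>W\<^esub>"
  shows "equivalent_categories
           (F_nabla scale W I \<rho> :: (('v \<times> 'v \<Rightarrow> 'k, 'm) gmodule, 'm \<Rightarrow> 'm) cat)
           (V_category scale W I \<alpha> :: (('w \<Rightarrow> 'v \<Rightarrow> 'k, 'm) gmodule, 'm \<Rightarrow> 'm) cat)"
proof -
  have vs: "vector_space scale" using assms(4) by (simp add: reflection_faithful_rep_def)
  interpret coxeter_representation scale W I \<rho> \<alpha>
    using vs assms(1,3-5)
    by (simp add: coxeter_representation_def coxeter_representation_axioms_def polynomial_functions_def
        polynomial_functions_axioms_def)
  let ?F = "F_nabla scale W I \<rho> :: (('v \<times> 'v \<Rightarrow> 'k, 'm) gmodule, 'm \<Rightarrow> 'm) cat"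
  let ?V = "V_category scale W I \<alpha> :: (('w \<Rightarrow> 'v \<Rightarrow> 'k, 'm) gmodule, 'm \<Rightarrow> 'm) cat"
  have gF: "graded_module (SS_ring scale) M" if "M \<in> F_nabla_objects scale W I \<rho>" for M :: "('v \<times> 'v \<Rightarrow> 'k, 'm) gmodule"
    using that by (simp add: F_nabla_objects_def)
  have gV: "graded_module Zr M" if "M \<in> V_objects scale W I \<alpha>" for M :: "('w \<Rightarrow> 'v \<Rightarrow> 'k, 'm) gmodule"
    using that by (simp add: V_objects_def Z_mod_f_objects_def)
  have catF: "category ?F" unfolding F_nabla_def by (rule gmod_category_category[OF gF])
  have catV: "category ?V" unfolding V_category_def by (rule gmod_category_category[OF gV])
  have F [simp]: "Obj ?F = F_nabla_objects scale W I \<rho>" "Arr ?F = gmod_hom (SS_ring scale)"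
    "Ide ?F = (\<lambda>M. \<lambda>x \<in> carrier M. x)" "Cmp ?F = (\<lambda>L M N g f. compose (carrier L) g f)"
    by (simp_all add: F_nabla_def gmod_category_def)
  have V [simp]: "Obj ?V = V_objects scale W I \<alpha>" "Arr ?V = gmod_hom Zr"
    "Ide ?V = (\<lambda>M. \<lambda>x \<in> carrier M. x)" "Cmp ?V = (\<lambda>L M N g f. compose (carrier L) g f)"
    by (simp_all add: V_category_def gmod_category_def)
  have pc: "part M n \<subseteq> carrier M" if "graded_module R M" for R :: "'r gring" and M :: "('r, 'm) gmodule" and n
    using that by (auto simp: graded_module_def dest!: additive_subgroup.a_subset)
  have comp_id: "compose (carrier M) (\<lambda>x \<in> carrier M. x) (\<lambda>x \<in> carrier M. x) = (\<lambda>x \<in> carrier M. x)" for M :: "('r, 'm) gmodule"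
    by (auto simp: compose_def restrict_def fun_eq_iff)
  have nat: "compose (carrier X) (\<lambda>x \<in> carrier Y. x) f = compose (carrier X) f (\<lambda>x \<in> carrier X. x)"
    if "f \<in> gmod_hom R X Y" for R :: "'r gring" and X Y :: "('r, 'm) gmodule" and f
    using that by (auto simp: gmod_hom_def compose_def restrict_def fun_eq_iff Pi_iff)
  have FV: "cat_functor ?F ?V Z_extension (\<lambda>X Y f. f)"
    by (intro cat_functor.intro catF catV cat_functor_axioms.intro)
      (auto intro: Z_extension_object SS_hom_imp_Z_hom)
  have VF: "cat_functor ?V ?F SS_restriction (\<lambda>X Y f. f)"
    by (intro cat_functor.intro catF catV cat_functor_axioms.intro)
      (auto intro: SS_restriction_object Z_hom_imp_SS_hom)
  \<comment> \<open>The round trip reproduces the scalar multiplication on the ring and the carrier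
    but possibly not beyond them, so the result is isomorphic to X and perhaps not equal to it. The
    identity of the carrier serves as the isomorphism.\<close>
  have eta: "natural_iso ?F ?F (\<lambda>X. X) (\<lambda>X Y f. f) (\<lambda>X. SS_restriction (Z_extension X)) (\<lambda>X Y f. f) (\<lambda>X. \<lambda>x \<in> carrier X. x)"
    unfolding natural_iso_def iso_arr_def F
  proof (intro conjI ballI)
    fix X :: "('v \<times> 'v \<Rightarrow> 'k, 'm) gmodule" assume X: "X \<in> F_nabla_objects scale W I \<rho>"
    have "Module.module (SS_ring scale) X" using gF[OF X] by (simp add: graded_module_def)
    note id = identity_gmod_hom[OF this pc[OF gF[OF X]], of "SS_restriction (Z_extension X)"]
    show h: "(\<lambda>x \<in> carrier X. x) \<in> gmod_hom (SS_ring scale) X (SS_restriction (Z_extension X))"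
      by (rule id(1)) (auto simp: Z_act_im[OF X])
    have h': "(\<lambda>x \<in> carrier X. x) \<in> gmod_hom (SS_ring scale) (SS_restriction (Z_extension X)) X"
      by (rule id(2)) (auto simp: Z_act_im[OF X])
    show "\<exists>g \<in> gmod_hom (SS_ring scale) (SS_restriction (Z_extension X)) X.
        compose (carrier X) g (\<lambda>x \<in> carrier X. x) = (\<lambda>x \<in> carrier X. x) \<and>
        compose (carrier (SS_restriction (Z_extension X))) (\<lambda>x \<in> carrier X. x) g =
        (\<lambda>x \<in> carrier (SS_restriction (Z_extension X)). x)"
      using comp_id[of X] by (intro bexI[OF _ h']) simp
    fix Y :: "('v \<times> 'v \<Rightarrow> 'k, 'm) gmodule" and f assume "f \<in> gmod_hom (SS_ring scale) X Y"
    then show "compose (carrier X) (\<lambda>x \<in> carrier Y. x) f = compose (carrier X) f (\<lambda>x \<in> carrier X. x)" by (rule nat)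
  qed
  \<comment> \<open>Here the action of z is recovered by \<open>Z_act_SS_restriction\<close>,
    whichever finite set the extension has chosen.\<close>
  have eps: "natural_iso ?V ?V (\<lambda>X. Z_extension (SS_restriction X)) (\<lambda>X Y f. f) (\<lambda>X. X) (\<lambda>X Y f. f) (\<lambda>X. \<lambda>x \<in> carrier X. x)"
    unfolding natural_iso_def iso_arr_def V
  proof (intro conjI ballI)
    fix X :: "('w \<Rightarrow> 'v \<Rightarrow> 'k, 'm) gmodule" assume X: "X \<in> V_objects scale W I \<alpha>"
    have "Module.module Zr X" using gV[OF X] by (simp add: graded_module_def)
    note id = identity_gmod_hom[OF this pc[OF gV[OF X]], of "Z_extension (SS_restriction X)"]
    show "(\<lambda>x \<in> carrier X. x) \<in> gmod_hom Zr (Z_extension (SS_restriction X)) X"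
      by (rule id(2)) (auto simp: Z_act_SS_restriction[OF X])
    have h': "(\<lambda>x \<in> carrier X. x) \<in> gmod_hom Zr X (Z_extension (SS_restriction X))"
      by (rule id(1)) (auto simp: Z_act_SS_restriction[OF X])
    show "\<exists>g \<in> gmod_hom Zr X (Z_extension (SS_restriction X)).
        compose (carrier (Z_extension (SS_restriction X))) g (\<lambda>x \<in> carrier X. x) =
        (\<lambda>x \<in> carrier (Z_extension (SS_restriction X)). x) \<and>
        compose (carrier X) (\<lambda>x \<in> carrier X. x) g = (\<lambda>x \<in> carrier X. x)"
      using comp_id[of X] by (intro bexI[OF _ h']) simp
    fix Y :: "('w \<Rightarrow> 'v \<Rightarrow> 'k, 'm) gmodule" and f assume "f \<in> gmod_hom Zr X Y"
    then show "compose (carrier (Z_extension (SS_restriction X))) (\<lambda>x \<in> carrier Y. x) f =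
        compose (carrier (Z_extension (SS_restriction X))) f (\<lambda>x \<in> carrier X. x)"
      using nat by simp
  qed
  show ?thesis
    unfolding equivalent_categories_def using FV VF eta eps by blast
qed

end
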